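(* Let $0<p,q<1$ with $p+q=1$; $0<p'<p$, $q'=1-p'$, $0<r\le\frac{1-\alpha q'}{\alpha q'}$; $0\le\widehat q<q$, $\widehat p=1-\widehat q$, $0<\widehat r\le\frac{1-\alpha}{\alpha}$. Suppose $\varphi\in D(L^{\beta(p+\widehat q)})$, $k\in C[0,T]$, $F(t,\cdot,\mathbf 0)=\mathbf 0$ and $\|F(t_1,\cdot,v_1)-F(t_2,\cdot,v_2)\|\le\Upsilon^*(|t_1-t_2|+\|v_1-v_2\|)$ for all $v_1,v_2\in L_2(\Omega)$ and $t,t_1,t_2\in(0,T)$, with a constant $\Upsilon^*>0$, and $\Theta(T)<1$. Then the nonlocal problem $$\partial_t^\alpha u+L^\beta u+k(t)u=F(t,x,u)\ \text{in }(0,T)\times\Omega,\quad \mathbf Bu=0\ \text{on }(0,T)\times\partial\Omega,\quad u(T,x)=\kappa u(0,x)+\varphi(x),\ x\in\Omega,$$ has a unique (mild) solution $u$, and it satisfies $\partial_t^\alpha u\in L^{\frac1\alpha-\widehat r}\bigl(0,T;D(L^{-\beta(q-\widehat q)})\bigr)$. Moreover, there exists a constant $C_7>0$ such that $$\|\partial_t^\alpha u\|_{L^{\frac1\alpha-\widehat r}(0,T;D(L^{-\beta(q-\widehat q)}))}\le C_7\,\|t^{-\alpha}\|_{L^{\frac1\alpha-\widehat r}(0,T)}\,\|\varphi\|_{D(L^{\beta(p+\widehat q)})}.$$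
   Context: Setting. $0<\alpha<1$, $0<\beta\le1$, $T>0$, $\kappa$ a real number; $\Omega\subset\mathbb R^N$ ($N\ge1$) is open and bounded with boundary $\partial\Omega$; $\|\cdot\|$, $(\cdot,\cdot)$ are the norm and inner product of $L_2(\Omega)$. The Caputo derivative is $\partial_t^\alpha u=\frac1{\Gamma(1-\alpha)}\int_0^t(t-\tau)^{-\alpha}u_\tau(\tau)\,d\tau$. $Lu=-\sum_i\partial_{x_i}\bigl(\sum_jA_{ij}\partial_{x_j}u\bigr)+bu$ with $A_{ij}=A_{ji}\in C^1(\bar\Omega)$, $b\in C(\bar\Omega)$, $b\ge0$, and $\xi^T[A_{ij}(x)]\xi\ge L_0|\xi|^2$ for some $L_0>0$. The boundary operator is $\mathbf Bv=v$ or $\mathbf Bv=([A_{ij}]\nabla v)\cdot\vec n$. $L$ has eigenvalues $0<\lambda_1\le\lambda_2\le\dots\to\infty$ and eigenfunctions $e_j\in\{v\in H^2(\Omega):\mathbf Bv=0\}$ forming an orthonormal basis of $L_2(\Omega)$. For $\gamma\ge0$, $L^\gamma v=\sum_j\lambda_j^\gamma(v,e_j)e_j$, $D(L^\gamma)=\{v\in L_2(\Omega):\|L^\gamma v\|<\infty\}$, $\|v\|_{D(L^\gamma)}=\|L^\gamma v\|$; $D(L^{-\gamma})$ is the dual of $D(L^\gamma)$ (with $L_2(\Omega)$ identified with its dual), with norm $\|v\|_{D(L^{-\gamma})}=\bigl(\sum_j(v,e_j)_{-\gamma,\gamma}^2\lambda_j^{-2\gamma}\bigr)^{1/2}$, $(\cdot,\cdot)_{-\gamma,\gamma}$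 being the duality pairing. $E_{\alpha,\sigma}(z)=\sum_{k\ge0}z^k/\Gamma(\alpha k+\sigma)$; $B(\cdot,\cdot)$ with two numerical arguments is Euler's Beta function. $M_2>0$ is a constant with $|E_{\alpha,\sigma}(-z)|\le M_2/(1+z)$ for $z\ge0$, $\sigma\in\{\alpha-1,\alpha,1\}$. $\Psi_j(T)=\bigl(E_{\alpha,1}(-\lambda_j^\beta T^\alpha)-\kappa\bigr)^{-1}$. Standing assumption: $\kappa\notin(0,1)$, or $\kappa\in(0,1)$ and $\lambda_j\ne\lambda_0$ for all $j$, where $\lambda_0>0$ is the unique number with $E_{\alpha,1}(-\lambda_0^\beta T^\alpha)=\kappa$. $C_\kappa>0$ is a constant with $|\Psi_j(T)|\le C_\kappa$ for all $j$ (for $\kappa=0$ the paper's bound is $|\Psi_j(T)|\le C_\kappa\lambda_j^\beta T^\alpha$). Operators. With $h_j=(h,e_j)$: $\mathcal G_1(t)h=\sum_j\int_0^th_j(\tau)(t-\tau)^{\alpha-1}E_{\alpha,\alpha}(-\lambda_j^\beta(t-\tau)^\alpha)\,d\tau\,e_j$ for $h=h(t,x)$; $\mathcal G_2(t)v=\sum_jv_j\Psi_j(T)E_{\alpha,1}(-\lambda_j^\beta t^\alpha)e_j$ for $v=v(x)$; $\mathcal G_3(t)h=-\mathcal G_2(t)[\mathcal G_1(T)h]$. Mild solution: a function $u\in L^{m}(0,T;L^{l}(\Omega))$ for some $m,l\ge1$ satisfying $u=\mathcal G_2\varphi+\mathcal G_1F(\cdot,u)+\mathcal G_3F(\cdot,u)-\mathcal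 G_3(ku)-\mathcal G_1(ku)$. (C2): $F(t,\cdot,\mathbf 0)=\mathbf 0$ and there is $\Upsilon^*>0$ with $\|F(t_1,\cdot,v_1)-F(t_2,\cdot,v_2)\|\le\Upsilon^*(|t_1-t_2|+\|v_1-v_2\|)$ for all $v_1,v_2\in L_2(\Omega)$, $t_1,t_2\in(0,T)$. Constant, with $\Upsilon=\Upsilon^*$: $$\Theta(T)=\frac{M_2}{\lambda_1^{\beta p}}\Bigl(T^{\alpha q}\Upsilon+C_\kappa+C_\kappa M_2\Upsilon T^{\alpha q}+T^{\alpha q}\|k\|_{C[0,T]}+M_2C_\kappa T^{\alpha q}\|k\|_{C[0,T]}\Bigr)B(\alpha q,1-\alpha q).$$ *)

theory Defs
  imports "HOL-Analysis.Analysis"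
begin

section \<open>Lebesgue spaces\<close>

text \<open>Elements of the spaces below are represented by functions; equality in a space is equality
  almost everywhere.\<close>

definition Lp :: "'a measure \<Rightarrow> real \<Rightarrow> ('a \<Rightarrow> real) set" where
  "Lp M l = {f \<in> borel_measurable M. integrable M (\<lambda>x. \<bar>f x\<bar> powr l)}"

definition Lp_norm :: "'a measure \<Rightarrow> real \<Rightarrow> ('a \<Rightarrow> real) \<Rightarrow> real" where
  "Lp_norm M l f = (\<integral>x. \<bar>f x\<bar> powr l \<partial>M) powr (1 / l)"

abbreviation L2 :: "(real^'n) set \<Rightarrow> (real^'n \<Rightarrow> real) set" where
  "L2 \<Omega> \<equiv> Lp (lebesgue_on \<Omega>) 2"

abbreviation L2_norm :: "(real^'n) set \<Rightarrow> (real^'n \<Rightarrow> real) \<Rightarrow> real" where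
  "L2_norm \<Omega> \<equiv> Lp_norm (lebesgue_on \<Omega>) 2"

definition L2_inner :: "(real^'n) set \<Rightarrow> (real^'n \<Rightarrow> real) \<Rightarrow> (real^'n \<Rightarrow> real) \<Rightarrow> real" where
  "L2_inner \<Omega> f g = (\<integral>x. f x * g x \<partial>lebesgue_on \<Omega>)"

definition L2_sums :: "(real^'n) set \<Rightarrow> (nat \<Rightarrow> real^'n \<Rightarrow> real) \<Rightarrow> (real^'n \<Rightarrow> real) \<Rightarrow> bool" where
  "L2_sums \<Omega> f w \<longleftrightarrow> (\<forall>j. f j \<in> L2 \<Omega>) \<and> w \<in> L2 \<Omega> \<and>
     (\<lambda>n. L2_norm \<Omega> (\<lambda>x. w x - (\<Sum>j<n. f j x))) \<longlonglongrightarrow> 0"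

definition L2_summable :: "(real^'n) set \<Rightarrow> (nat \<Rightarrow> real^'n \<Rightarrow> real) \<Rightarrow> bool" where
  "L2_summable \<Omega> f \<longleftrightarrow> (\<exists>w. L2_sums \<Omega> f w)"

definition L2_suminf :: "(real^'n) set \<Rightarrow> (nat \<Rightarrow> real^'n \<Rightarrow> real) \<Rightarrow> real^'n \<Rightarrow> real" where
  "L2_suminf \<Omega> f = (SOME w. L2_sums \<Omega> f w)"

definition orthonormal_basis :: "(real^'n) set \<Rightarrow> (nat \<Rightarrow> real^'n \<Rightarrow> real) \<Rightarrow> bool" where
  "orthonormal_basis \<Omega> e \<longleftrightarrow>
     (\<forall>j. e j \<in> L2 \<Omega>) \<and>
     (\<forall>i j. L2_inner \<Omega> (e i) (e j) = (if i = j then 1 else 0)) \<and>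
     (\<forall>v\<in>L2 \<Omega>. L2_sums \<Omega> (\<lambda>j x. L2_inner \<Omega> v (e j) * e j x) v)"

section \<open>Bochner spaces\<close>

text \<open>The space \<open>L\<^sup>m(0,T;X)\<close> for a space \<open>X\<close> of real-valued functions (ordinary functions on a domain,
  or functionals) with seminorm \<open>N\<close>: strong measurability means approximation by simple functions
  almost everywhere in \<open>(0,T)\<close>.\<close>

definition strongly_measurable ::
  "real \<Rightarrow> ('b \<Rightarrow> real) set \<Rightarrow> (('b \<Rightarrow> real) \<Rightarrow> real) \<Rightarrow> (real \<Rightarrow> 'b \<Rightarrow> real) \<Rightarrow> bool" where
  "strongly_measurable T X N u \<longleftrightarrow>
     (\<exists>s :: nat \<Rightarrow> real \<Rightarrow> 'b \<Rightarrow> real.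
        (\<forall>n. finite (s n ` {0<..<T}) \<and> s n ` {0<..<T} \<subseteq> X \<and>
             (\<forall>v. {t \<in> {0<..<T}. s n t = v} \<in> sets lebesgue)) \<and>
        (AE t in lebesgue_on {0<..<T}. (\<lambda>n. N (\<lambda>y. s n t y - u t y)) \<longlonglongrightarrow> 0))"

definition Bochner_Lp ::
  "real \<Rightarrow> real \<Rightarrow> ('b \<Rightarrow> real) set \<Rightarrow> (('b \<Rightarrow> real) \<Rightarrow> real) \<Rightarrow> (real \<Rightarrow> 'b \<Rightarrow> real) set" where
  "Bochner_Lp m T X N =
     {u. (AE t in lebesgue_on {0<..<T}. u t \<in> X) \<and> strongly_measurable T X N u \<and>
         integrable (lebesgue_on {0<..<T}) (\<lambda>t. N (u t) powr m)}"

definition Bochner_Lp_norm ::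
  "real \<Rightarrow> real \<Rightarrow> (('b \<Rightarrow> real) \<Rightarrow> real) \<Rightarrow> (real \<Rightarrow> 'b \<Rightarrow> real) \<Rightarrow> real" where
  "Bochner_Lp_norm m T N u = (\<integral>t. N (u t) powr m \<partial>lebesgue_on {0<..<T}) powr (1 / m)"

section \<open>Weak derivatives, Sobolev spaces and the elliptic operator\<close>

definition pderiv_at :: "'n \<Rightarrow> (real^'n \<Rightarrow> real) \<Rightarrow> real^'n \<Rightarrow> real" where
  "pderiv_at i f x = frechet_derivative f (at x) (axis i 1)"

primrec Ck :: "nat \<Rightarrow> (real^'n \<Rightarrow> real) \<Rightarrow> bool" where
  "Ck 0 f \<longleftrightarrow> continuous_on UNIV f"
| "Ck (Suc k) f \<longleftrightarrow> (\<forall>x. f differentiable (at x)) \<and> (\<forall>i. Ck k (pderiv_at i f))"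

definition test_fun :: "(real^'n) set \<Rightarrow> (real^'n \<Rightarrow> real) \<Rightarrow> bool" where
  "test_fun \<Omega> \<psi> \<longleftrightarrow> (\<forall>k. Ck k \<psi>) \<and> compact (closure {x. \<psi> x \<noteq> 0}) \<and> closure {x. \<psi> x \<noteq> 0} \<subseteq> \<Omega>"

definition loc_integrable :: "(real^'n) set \<Rightarrow> (real^'n \<Rightarrow> real) \<Rightarrow> bool" where
  "loc_integrable \<Omega> f \<longleftrightarrow> (\<forall>K. compact K \<and> K \<subseteq> \<Omega> \<longrightarrow> integrable (lebesgue_on K) f)"

definition has_weak_pderiv ::
  "(real^'n) set \<Rightarrow> 'n \<Rightarrow> (real^'n \<Rightarrow> real) \<Rightarrow> (real^'n \<Rightarrow> real) \<Rightarrow> bool" where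
  "has_weak_pderiv \<Omega> i f g \<longleftrightarrow> loc_integrable \<Omega> f \<and> loc_integrable \<Omega> g \<and>
     (\<forall>\<psi>. test_fun \<Omega> \<psi> \<longrightarrow>
        (\<integral>x. f x * pderiv_at i \<psi> x \<partial>lebesgue_on \<Omega>) = - (\<integral>x. g x * \<psi> x \<partial>lebesgue_on \<Omega>))"

definition weak_pderiv :: "(real^'n) set \<Rightarrow> 'n \<Rightarrow> (real^'n \<Rightarrow> real) \<Rightarrow> real^'n \<Rightarrow> real" where
  "weak_pderiv \<Omega> i f = (SOME g. has_weak_pderiv \<Omega> i f g)"

definition H1 :: "(real^'n) set \<Rightarrow> (real^'n \<Rightarrow> real) set" where
  "H1 \<Omega> = {v \<in> L2 \<Omega>. \<forall>i. \<exists>g\<in>L2 \<Omega>. has_weak_pderiv \<Omega> i v g}"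

definition H2 :: "(real^'n) set \<Rightarrow> (real^'n \<Rightarrow> real) set" where
  "H2 \<Omega> = {v \<in> L2 \<Omega>. \<forall>i. \<exists>g\<in>H1 \<Omega>. has_weak_pderiv \<Omega> i v g}"

definition C1_closure :: "(real^'n) set \<Rightarrow> (real^'n \<Rightarrow> real) \<Rightarrow> bool" where
  "C1_closure \<Omega> f \<longleftrightarrow> continuous_on (closure \<Omega>) f \<and>
     (\<exists>G. continuous_on (closure \<Omega>) G \<and> (\<forall>x\<in>\<Omega>. (f has_derivative (\<lambda>h. G x \<bullet> h)) (at x)))"

definition flux ::
  "(real^'n) set \<Rightarrow> (real^'n \<Rightarrow> real^'n^'n) \<Rightarrow> (real^'n \<Rightarrow> real) \<Rightarrow> 'n \<Rightarrow> real^'n \<Rightarrow> real" where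
  "flux \<Omega> A v i x = (\<Sum>j\<in>UNIV. A x $ i $ j * weak_pderiv \<Omega> j v x)"

definition elliptic_op ::
  "(real^'n) set \<Rightarrow> (real^'n \<Rightarrow> real^'n^'n) \<Rightarrow> (real^'n \<Rightarrow> real) \<Rightarrow> (real^'n \<Rightarrow> real) \<Rightarrow> real^'n \<Rightarrow> real" where
  "elliptic_op \<Omega> A b v x = - (\<Sum>i\<in>UNIV. weak_pderiv \<Omega> i (flux \<Omega> A v i) x) + b x * v x"

text \<open>No regularity of the boundary is assumed, so the two homogeneous boundary conditions are
  taken in their variational sense: membership in \<open>H\<^sup>1\<^sub>0(\<Omega>)\<close> (closure of the test functions in
  \<open>H\<^sup>1(\<Omega>)\<close>), and vanishing of the boundary term in Green's formula. For a regular boundary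
  these are the usual trace conditions.\<close>

datatype boundary_operator = Dirichlet | Conormal

fun boundary_zero ::
  "boundary_operator \<Rightarrow> (real^'n) set \<Rightarrow> (real^'n \<Rightarrow> real^'n^'n) \<Rightarrow> (real^'n \<Rightarrow> real) \<Rightarrow> bool" where
  "boundary_zero Dirichlet \<Omega> A v \<longleftrightarrow> v \<in> H1 \<Omega> \<and>
     (\<exists>\<psi> :: nat \<Rightarrow> real^'n \<Rightarrow> real. (\<forall>n. test_fun \<Omega> (\<psi> n)) \<and>
        (\<lambda>n. L2_norm \<Omega> (\<lambda>x. \<psi> n x - v x)) \<longlonglongrightarrow> 0 \<and>
        (\<forall>i. (\<lambda>n. L2_norm \<Omega> (\<lambda>x. pderiv_at i (\<psi> n) x - weak_pderiv \<Omega> i v x)) \<longlonglongrightarrow> 0))"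
| "boundary_zero Conormal \<Omega> A v \<longleftrightarrow>
     (\<forall>w\<in>H1 \<Omega>. (\<Sum>i\<in>UNIV. L2_inner \<Omega> (flux \<Omega> A v i) (weak_pderiv \<Omega> i w)) =
        - (\<Sum>i\<in>UNIV. L2_inner \<Omega> (weak_pderiv \<Omega> i (flux \<Omega> A v i)) w))"

section \<open>Fractional powers and their domains\<close>

text \<open>\<open>lam\<close> and \<open>e\<close> enumerate eigenvalues and eigenfunctions from index \<open>0\<close>.\<close>

definition frac_pow_terms ::
  "(real^'n) set \<Rightarrow> (nat \<Rightarrow> real) \<Rightarrow> (nat \<Rightarrow> real^'n \<Rightarrow> real) \<Rightarrow> real \<Rightarrow> (real^'n \<Rightarrow> real) \<Rightarrow> nat \<Rightarrow> real^'n \<Rightarrow> real" where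
  "frac_pow_terms \<Omega> lam e \<gamma> v j x = lam j powr \<gamma> * L2_inner \<Omega> v (e j) * e j x"

definition frac_pow ::
  "(real^'n) set \<Rightarrow> (nat \<Rightarrow> real) \<Rightarrow> (nat \<Rightarrow> real^'n \<Rightarrow> real) \<Rightarrow> real \<Rightarrow> (real^'n \<Rightarrow> real) \<Rightarrow> real^'n \<Rightarrow> real" where
  "frac_pow \<Omega> lam e \<gamma> v = L2_suminf \<Omega> (frac_pow_terms \<Omega> lam e \<gamma> v)"

definition dom_pow ::
  "(real^'n) set \<Rightarrow> (nat \<Rightarrow> real) \<Rightarrow> (nat \<Rightarrow> real^'n \<Rightarrow> real) \<Rightarrow> real \<Rightarrow> (real^'n \<Rightarrow> real) set" where
  "dom_pow \<Omega> lam e \<gamma> = {v \<in> L2 \<Omega>. L2_summable \<Omega> (frac_pow_terms \<Omega> lam e \<gamma> v)}"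

definition dom_pow_norm ::
  "(real^'n) set \<Rightarrow> (nat \<Rightarrow> real) \<Rightarrow> (nat \<Rightarrow> real^'n \<Rightarrow> real) \<Rightarrow> real \<Rightarrow> (real^'n \<Rightarrow> real) \<Rightarrow> real" where
  "dom_pow_norm \<Omega> lam e \<gamma> v = L2_norm \<Omega> (frac_pow \<Omega> lam e \<gamma> v)"

text \<open>\<open>D(L\<^sup>-\<^sup>\<gamma>)\<close> consists of the bounded linear functionals on \<open>D(L\<^sup>\<gamma>)\<close>; the duality pairing is
  application, and \<open>v \<in> L\<^sub>2(\<Omega>)\<close> is identified with \<open>L2_inner \<Omega> v\<close>.\<close>

definition dual_pow ::
  "(real^'n) set \<Rightarrow> (nat \<Rightarrow> real) \<Rightarrow> (nat \<Rightarrow> real^'n \<Rightarrow> real) \<Rightarrow> real \<Rightarrow> ((real^'n \<Rightarrow> real) \<Rightarrow> real) set" where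
  "dual_pow \<Omega> lam e \<gamma> =
     {v. (\<forall>f\<in>dom_pow \<Omega> lam e \<gamma>. \<forall>g\<in>dom_pow \<Omega> lam e \<gamma>. \<forall>a b.
            v (\<lambda>x. a * f x + b * g x) = a * v f + b * v g) \<and>
         (\<exists>C. \<forall>f\<in>dom_pow \<Omega> lam e \<gamma>. \<bar>v f\<bar> \<le> C * dom_pow_norm \<Omega> lam e \<gamma> f)}"

definition dual_pow_norm ::
  "(nat \<Rightarrow> real) \<Rightarrow> (nat \<Rightarrow> real^'n \<Rightarrow> real) \<Rightarrow> real \<Rightarrow> ((real^'n \<Rightarrow> real) \<Rightarrow> real) \<Rightarrow> real" where
  "dual_pow_norm lam e \<gamma> v = sqrt (\<Sum>j. (v (e j))\<^sup>2 * lam j powr (- 2 * \<gamma>))"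

section \<open>The Caputo derivative\<close>

definition RL_integral :: "real \<Rightarrow> (real \<Rightarrow> real) \<Rightarrow> real \<Rightarrow> real" where
  "RL_integral \<sigma> f t = (\<integral>\<tau>. (t - \<tau>) powr (\<sigma> - 1) * f \<tau> \<partial>lebesgue_on {0<..<t}) / Gamma \<sigma>"

text \<open>The Caputo derivative of \<open>f\<close> is \<open>RL_integral (1 - \<alpha>) f'\<close>. A mild solution need not be
  differentiable in time, so \<open>f'\<close> is a distributional derivative; integrating the formula once
  over \<open>(0,t)\<close> removes it, because
  \<open>\<integral>\<^sub>0\<^sup>t RL_integral (1 - \<alpha>) f' = RL_integral (1 - \<alpha>) (f - f 0) t\<close>. The lemma
  \<open>has_caputo_deriv_classical\<close> confirms that the definition extends the classical formula.\<close>

definition has_caputo_deriv :: "real \<Rightarrow> real \<Rightarrow> (real \<Rightarrow> real) \<Rightarrow> (real \<Rightarrow> real) \<Rightarrow> bool" where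
  "has_caputo_deriv \<alpha> T f g \<longleftrightarrow>
     integrable (lebesgue_on {0<..<T}) g \<and>
     (\<forall>t\<in>{0<..<T}. RL_integral (1 - \<alpha>) (\<lambda>\<tau>. f \<tau> - f 0) t = (\<integral>s. g s \<partial>lebesgue_on {0<..<t}))"

lemma powr_kernel_aux:
  fixes \<sigma> c :: real
  assumes "0 < \<sigma>" "0 \<le> c"
  shows "has_bochner_integral lborel (\<lambda>x. indicator {0<..<c} x * x powr (\<sigma> - 1)) (c powr \<sigma> / \<sigma>)"
proof -
  have "((\<lambda>x. x powr (\<sigma> - 1)) has_integral (c powr \<sigma> / \<sigma>)) {0..c}"
    using has_integral_powr_from_0[of "\<sigma> - 1" c] assms by simp
  then have "((\<lambda>x. x powr (\<sigma> - 1)) has_integral (c powr \<sigma> / \<sigma>)) {0<..<c}"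
    using has_integral_Icc_iff_Ioo by blast
  then have "((\<lambda>x. if x \<in> {0<..<c} then x powr (\<sigma> - 1) else 0) has_integral (c powr \<sigma> / \<sigma>)) UNIV"
    by (simp only: has_integral_restrict_UNIV)
  then have "((\<lambda>x. indicator {0<..<c} x * x powr (\<sigma> - 1)) has_integral (c powr \<sigma> / \<sigma>)) UNIV"
    by (rule has_integral_eq[rotated]) (auto simp: indicator_def)
  then have "(\<integral>\<^sup>+ x. ennreal (indicator {0<..<c} x * x powr (\<sigma> - 1)) \<partial>lborel) = ennreal (c powr \<sigma> / \<sigma>)"
    by (intro nn_integral_has_integral_lborel) auto
  then show ?thesis
    by (intro has_bochner_integral_nn_integral) (use assms in auto)
qed

lemma powr_kernel:
  fixes \<sigma> t \<tau> :: real
  assumes "0 < \<sigma>" "\<tau> \<le> t"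
  shows "has_bochner_integral lborel (\<lambda>s. indicator {\<tau><..<t} s * (s - \<tau>) powr (\<sigma> - 1)) ((t - \<tau>) powr \<sigma> / \<sigma>)"
    and "has_bochner_integral lborel (\<lambda>s. indicator {\<tau><..<t} s * (t - s) powr (\<sigma> - 1)) ((t - \<tau>) powr \<sigma> / \<sigma>)"
proof -
  note * = powr_kernel_aux[OF assms(1), of "t - \<tau>"]
  have "has_bochner_integral lborel (\<lambda>s. indicator {0<..<t-\<tau>} (-\<tau> + 1 * s) * (-\<tau> + 1 * s) powr (\<sigma> - 1))
     ((t - \<tau>) powr \<sigma> / \<sigma> /\<^sub>R \<bar>1\<bar>)"
    using * assms by (subst lborel_has_bochner_integral_real_affine_iff[symmetric]) auto
  then show "has_bochner_integral lborel (\<lambda>s. indicator {\<tau><..<t} s * (s - \<tau>) powr (\<sigma> - 1)) ((t - \<tau>) powr \<sigma> / \<sigma>)"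
    by (elim has_bochner_integral_cong[THEN iffD1, rotated -1]) (auto simp: indicator_def)
  have "has_bochner_integral lborel (\<lambda>s. indicator {0<..<t-\<tau>} (t + (-1) * s) * (t + (-1) * s) powr (\<sigma> - 1))
     ((t - \<tau>) powr \<sigma> / \<sigma> /\<^sub>R \<bar>-1\<bar>)"
    using * assms by (subst lborel_has_bochner_integral_real_affine_iff[symmetric]) auto
  then show "has_bochner_integral lborel (\<lambda>s. indicator {\<tau><..<t} s * (t - s) powr (\<sigma> - 1)) ((t - \<tau>) powr \<sigma> / \<sigma>)"
    by (elim has_bochner_integral_cong[THEN iffD1, rotated -1]) (auto simp: indicator_def)
qed

lemma triangle_fubini:
  fixes a :: "real \<Rightarrow> real \<Rightarrow> real" and g W :: "real \<Rightarrow> real"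
  assumes a[measurable]: "(\<lambda>(\<tau>, s). a \<tau> s) \<in> borel_measurable (borel \<Otimes>\<^sub>M borel)"
    and nonneg: "\<And>\<tau> s. 0 \<le> a \<tau> s"
    and g[measurable]: "g \<in> borel_measurable borel" and bound: "\<And>\<tau>. \<bar>g \<tau>\<bar> \<le> C"
    and W: "\<And>\<tau>. 0 < \<tau> \<Longrightarrow> \<tau> < t \<Longrightarrow> has_bochner_integral lborel (\<lambda>s. indicator {\<tau><..<t} s * a \<tau> s) (W \<tau>)"
    and W_bound: "\<And>\<tau>. 0 < \<tau> \<Longrightarrow> \<tau> < t \<Longrightarrow> W \<tau> \<le> B"
  shows "integrable lborel (\<lambda>s. indicator {0<..<t} s * (\<integral>\<tau>. indicator {0<..<s} \<tau> * (a \<tau> s * g \<tau>) \<partial>lborel))"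
    and "(\<integral>s. indicator {0<..<t} s * (\<integral>\<tau>. indicator {0<..<s} \<tau> * (a \<tau> s * g \<tau>) \<partial>lborel) \<partial>lborel)
         = (\<integral>\<tau>. indicator {0<..<t} \<tau> * (g \<tau> * W \<tau>) \<partial>lborel)"
proof -
  define H where "H \<tau> s = (if 0 < \<tau> \<and> \<tau> < s \<and> s < t then a \<tau> s * g \<tau> else 0)" for \<tau> s
  have H_meas[measurable]: "(\<lambda>(\<tau>, s). H \<tau> s) \<in> borel_measurable (borel \<Otimes>\<^sub>M borel)"
    unfolding H_def by measurable
  have H_eq: "H \<tau> = (\<lambda>s. indicator {0<..<t} \<tau> * g \<tau> * (indicator {\<tau><..<t} s * a \<tau> s))" for \<tau>
    by (auto simp: H_def indicator_def)
  have hbi: "has_bochner_integral lborel (H \<tau>) (indicator {0<..<t} \<tau> * (g \<tau> * W \<tau>))" for \<tau>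
  proof (cases "0 < \<tau> \<and> \<tau> < t")
    case True
    from has_bochner_integral_mult_right[of "indicator {0<..<t} \<tau> * g \<tau>", OF W[of \<tau>]] True
    show ?thesis unfolding H_eq by (simp add: mult_ac)
  next
    case False
    then have "indicator {0<..<t} \<tau> = (0::real)" by (simp add: indicator_def)
    then show ?thesis unfolding H_eq by (simp add: has_bochner_integral_zero)
  qed
  have "has_bochner_integral lborel (\<lambda>s. norm (H \<tau> s)) (indicator {0<..<t} \<tau> * (\<bar>g \<tau>\<bar> * W \<tau>))" for \<tau>
  proof (cases "0 < \<tau> \<and> \<tau> < t")
    case True
    from has_bochner_integral_mult_right[of "indicator {0<..<t} \<tau> * \<bar>g \<tau>\<bar>", OF W[of \<tau>]] True
    show ?thesis unfolding H_eq using nonneg by (simp add: mult_ac abs_mult)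
  next
    case False
    then have "indicator {0<..<t} \<tau> = (0::real)" by (simp add: indicator_def)
    then show ?thesis unfolding H_eq by (simp add: has_bochner_integral_zero)
  qed
  then have norm_int: "(\<integral>s. norm (H \<tau> s) \<partial>lborel) = indicator {0<..<t} \<tau> * (\<bar>g \<tau>\<bar> * W \<tau>)" for \<tau>
    by (rule has_bochner_integral_integral_eq)
  have W_nonneg: "0 \<le> W \<tau>" if "0 < \<tau>" "\<tau> < t" for \<tau>
    using has_bochner_integral_integral_eq[OF W[OF that]] nonneg
    by (metis (no_types, lifting) Bochner_Integration.integral_nonneg indicator_pos_le mult_nonneg_nonneg)
  have C: "0 \<le> C" using bound[of 0] by linarith
  have norm_integrable: "integrable lborel (\<lambda>\<tau>. \<integral>s. norm (H \<tau> s) \<partial>lborel)"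
  proof (rule Bochner_Integration.integrable_bound)
    show "integrable lborel (\<lambda>\<tau>::real. indicator {0<..<t} \<tau> * (C * B))"
      by (intro integrable_mult_left) (auto intro!: integrable_real_indicator emeasure_bounded_finite)
    show "(\<lambda>\<tau>. \<integral>s. norm (H \<tau> s) \<partial>lborel) \<in> borel_measurable lborel"
      by measurable
    show "AE \<tau> in lborel. norm (\<integral>s. norm (H \<tau> s) \<partial>lborel) \<le> norm (indicator {0<..<t} \<tau> * (C * B))"
    proof (rule AE_I2)
      fix \<tau> :: real
      show "norm (\<integral>s. norm (H \<tau> s) \<partial>lborel) \<le> norm (indicator {0<..<t} \<tau> * (C * B))"
      proof (cases "0 < \<tau> \<and> \<tau> < t")
        case True
        then have "\<bar>g \<tau>\<bar> * W \<tau> \<le> C * B"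
          using bound W_bound W_nonneg C by (intro mult_mono) auto
        moreover have "0 \<le> \<bar>g \<tau>\<bar> * W \<tau>" using True W_nonneg by auto
        ultimately show ?thesis using True unfolding norm_int by simp
      next
        case False
        then have "indicator {0<..<t} \<tau> = (0::real)" by (simp add: indicator_def)
          then show ?thesis unfolding norm_int by simp
      qed
    qed
  qed
  have int: "integrable (lborel \<Otimes>\<^sub>M lborel) (\<lambda>(\<tau>, s). H \<tau> s)"
  proof (rule lborel_pair.Fubini_integrable)
    show "(\<lambda>(\<tau>, s). H \<tau> s) \<in> borel_measurable (lborel \<Otimes>\<^sub>M lborel)" by measurable
    show "integrable lborel (\<lambda>\<tau>. \<integral>s. norm (case (\<tau>, s) of (\<tau>, s) \<Rightarrow> H \<tau> s) \<partial>lborel)"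
      using norm_integrable by simp
    show "AE \<tau> in lborel. integrable lborel (\<lambda>s. case (\<tau>, s) of (\<tau>, s) \<Rightarrow> H \<tau> s)"
      using hbi by (auto simp: has_bochner_integral_iff)
  qed
  have inner: "(\<integral>\<tau>. H \<tau> s \<partial>lborel)
      = indicator {0<..<t} s * (\<integral>\<tau>. indicator {0<..<s} \<tau> * (a \<tau> s * g \<tau>) \<partial>lborel)" for s
  proof (cases "0 < s \<and> s < t")
    case True
    then show ?thesis by (auto simp: H_def indicator_def intro!: Bochner_Integration.integral_cong)
  next
    case False
    then have "H \<tau> s = 0" for \<tau> by (auto simp: H_def)
    with False show ?thesis by (auto simp: indicator_def)
  qed
  show "integrable lborel (\<lambda>s. indicator {0<..<t} s * (\<integral>\<tau>. indicator {0<..<s} \<tau> * (a \<tau> s * g \<tau>) \<partial>lborel))"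
    using lborel_pair.integrable_snd[OF int] by (simp add: inner)
  show "(\<integral>s. indicator {0<..<t} s * (\<integral>\<tau>. indicator {0<..<s} \<tau> * (a \<tau> s * g \<tau>) \<partial>lborel) \<partial>lborel)
         = (\<integral>\<tau>. indicator {0<..<t} \<tau> * (g \<tau> * W \<tau>) \<partial>lborel)"
    using lborel_pair.Fubini_integral[OF int]
    by (simp add: inner has_bochner_integral_integral_eq[OF hbi])
qed

lemma integral_lebesgue_on_lborel:
  fixes h :: "real \<Rightarrow> real"
  assumes "(\<lambda>x. indicator {0<..<t} x * h x) \<in> borel_measurable borel"
  shows "(\<integral>x. h x \<partial>lebesgue_on {0<..<t}) = (\<integral>x. indicator {0<..<t} x * h x \<partial>lborel)"
    and "integrable (lebesgue_on {0<..<t}) h \<longleftrightarrow> integrable lborel (\<lambda>x. indicator {0<..<t} x * h x)"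
  using assms by (simp_all add: integral_restrict_space integrable_restrict_space integral_completion integrable_completion)

lemma has_caputo_deriv_classical:
  fixes f f' :: "real \<Rightarrow> real"
  assumes \<alpha>: "0 < \<alpha>" "\<alpha> < 1"
    and f: "\<And>t. t \<in> {0..T} \<Longrightarrow> (f has_real_derivative f' t) (at t within {0..T})"
    and f': "continuous_on {0..T} f'"
  shows "has_caputo_deriv \<alpha> T f (RL_integral (1 - \<alpha>) f')"
proof -
  define \<sigma> where "\<sigma> = 1 - \<alpha>"
  have \<sigma>: "0 < \<sigma>" "1 - \<alpha> = \<sigma>" "- \<alpha> = \<sigma> - 1" using \<alpha> by (auto simp: \<sigma>_def)
  define g where "g x = indicator {0..T} x * f' x" for x
  have g[measurable]: "g \<in> borel_measurable borel"
    using borel_measurable_continuous_on_indicator[OF _ f'] by (simp add: g_def[abs_def])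
  obtain C where C: "\<And>x. \<bar>g x\<bar> \<le> C"
  proof -
    have "bounded (f' ` {0..T})" using f' compact_continuous_image compact_imp_bounded by blast
    then obtain C where C: "\<forall>x\<in>{0..T}. \<bar>f' x\<bar> \<le> C" by (auto simp: bounded_iff)
    have "\<bar>g x\<bar> \<le> max C 0" for x using C by (force simp: g_def indicator_def)
    then show ?thesis using that by blast
  qed
  have B: "(t - \<tau>) powr \<sigma> / \<sigma> \<le> t powr \<sigma> / \<sigma>" if "0 < \<tau>" "\<tau> < t" for t \<tau> :: real
    using that \<sigma> by (intro divide_right_mono powr_mono2) auto
  define k1 where "k1 \<tau> s = (s - \<tau>) powr (\<sigma> - 1)" for \<tau> s :: real
  have RL: "RL_integral \<sigma> f' s
      = (\<integral>\<tau>. indicator {0<..<s} \<tau> * (k1 \<tau> s * g \<tau>) \<partial>lborel) / Gamma \<sigma>" if "s \<le> T" for s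
  proof -
    have eq: "indicator {0<..<s} \<tau> * ((s - \<tau>) powr (\<sigma> - 1) * f' \<tau>)
       = indicator {0<..<s} \<tau> * (k1 \<tau> s * g \<tau>)" for \<tau>
      using that by (auto simp: indicator_def g_def k1_def)
    show ?thesis
      unfolding RL_integral_def by (subst integral_lebesgue_on_lborel) (simp_all add: eq k1_def)
  qed
  have main: "integrable (lebesgue_on {0<..<t}) (RL_integral \<sigma> f') \<and>
     (\<integral>s. RL_integral \<sigma> f' s \<partial>lebesgue_on {0<..<t})
       = (\<integral>\<tau>. indicator {0<..<t} \<tau> * (g \<tau> * ((t - \<tau>) powr \<sigma> / \<sigma>)) \<partial>lborel) / Gamma \<sigma>" if t: "t \<le> T" for t
  proof -
    have eq: "(\<lambda>s. indicator {0<..<t} s * RL_integral \<sigma> f' s)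
      = (\<lambda>s. indicator {0<..<t} s * (\<integral>\<tau>. indicator {0<..<s} \<tau> * (k1 \<tau> s * g \<tau>) \<partial>lborel) / Gamma \<sigma>)"
      using t by (auto simp: indicator_def RL fun_eq_iff)
    note tri = triangle_fubini[of k1 g C t "\<lambda>\<tau>. (t - \<tau>) powr \<sigma> / \<sigma>" "t powr \<sigma> / \<sigma>"]
    have i: "integrable lborel (\<lambda>s. indicator {0<..<t} s * (\<integral>\<tau>. indicator {0<..<s} \<tau> * (k1 \<tau> s * g \<tau>) \<partial>lborel))"
      and e: "(\<integral>s. indicator {0<..<t} s * (\<integral>\<tau>. indicator {0<..<s} \<tau> * (k1 \<tau> s * g \<tau>) \<partial>lborel) \<partial>lborel)
         = (\<integral>\<tau>. indicator {0<..<t} \<tau> * (g \<tau> * ((t - \<tau>) powr \<sigma> / \<sigma>)) \<partial>lborel)"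
      using C B powr_kernel(1)[OF \<sigma>(1)] by (intro tri; auto simp: k1_def)+
    have m: "(\<lambda>s. indicator {0<..<t} s * RL_integral \<sigma> f' s) \<in> borel_measurable borel"
      unfolding eq using borel_measurable_integrable[OF i] by simp
    show ?thesis
      using i e integral_lebesgue_on_lborel[OF m] by (simp add: eq)
  qed
  have "RL_integral \<sigma> (\<lambda>\<tau>. f \<tau> - f 0) t
      = (\<integral>\<tau>. indicator {0<..<t} \<tau> * (g \<tau> * ((t - \<tau>) powr \<sigma> / \<sigma>)) \<partial>lborel) / Gamma \<sigma>" if t: "t \<in> {0<..<T}" for t
  proof -
    define k2 where "k2 \<tau> s = (t - s) powr (\<sigma> - 1)" for \<tau> s :: real
    have ftc: "f s - f 0 = (\<integral>\<tau>. indicator {0<..<s} \<tau> * g \<tau> \<partial>lborel)" if "s \<in> {0<..<t}" for s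
    proof -
      have "(f' has_integral (f s - f 0)) {0..s}"
      proof (intro fundamental_theorem_of_calculus)
        fix x assume "x \<in> {0..s}"
        then have "(f has_vector_derivative f' x) (at x within {0..T})"
          using f[of x] that t by (auto simp: has_real_derivative_iff_has_vector_derivative)
        then show "(f has_vector_derivative f' x) (at x within {0..s})"
          by (rule has_vector_derivative_within_subset) (use that t in auto)
      qed (use that in auto)
      then have "(f' has_integral (f s - f 0)) {0<..<s}"
        using has_integral_Icc_iff_Ioo by blast
      then have "integral {0<..<s} f' = f s - f 0" by blast
      moreover have "integrable lborel (\<lambda>\<tau>. indicator {0<..<s} \<tau> * g \<tau>)"
      proof (rule Bochner_Integration.integrable_bound)
        show "integrable lborel (\<lambda>\<tau>::real. indicator {0<..<s} \<tau> * C)"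
          by (intro integrable_mult_left) (auto intro!: integrable_real_indicator emeasure_bounded_finite)
        show "AE \<tau> in lborel. norm (indicator {0<..<s} \<tau> * g \<tau>) \<le> norm (indicator {0<..<s} \<tau> * C)"
          using order_trans[OF C abs_ge_self] by (intro AE_I2) (auto simp: indicator_def)
      qed simp
      then have "((\<lambda>\<tau>. indicator {0<..<s} \<tau> * g \<tau>) has_integral (\<integral>\<tau>. indicator {0<..<s} \<tau> * g \<tau> \<partial>lborel)) UNIV"
        by (rule has_integral_integral_lborel)
      then have "((\<lambda>\<tau>. if \<tau> \<in> {0<..<s} then f' \<tau> else 0) has_integral (\<integral>\<tau>. indicator {0<..<s} \<tau> * g \<tau> \<partial>lborel)) UNIV"
        by (rule has_integral_eq[rotated]) (use that t in \<open>auto simp: g_def indicator_def\<close>)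
      then have "(f' has_integral (\<integral>\<tau>. indicator {0<..<s} \<tau> * g \<tau> \<partial>lborel)) {0<..<s}"
        by (simp only: has_integral_restrict_UNIV)
      then have "integral {0<..<s} f' = (\<integral>\<tau>. indicator {0<..<s} \<tau> * g \<tau> \<partial>lborel)" by blast
      ultimately show ?thesis by simp
    qed
    have eq: "indicator {0<..<t} s * ((t - s) powr (\<sigma> - 1) * (f s - f 0))
      = indicator {0<..<t} s * (\<integral>\<tau>. indicator {0<..<s} \<tau> * (k2 \<tau> s * g \<tau>) \<partial>lborel)" for s
    proof (cases "s \<in> {0<..<t}")
      case True
      have "(t - s) powr (\<sigma> - 1) * (f s - f 0)
          = (\<integral>\<tau>. (t - s) powr (\<sigma> - 1) * (indicator {0<..<s} \<tau> * g \<tau>) \<partial>lborel)"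
        unfolding ftc[OF True] by simp
      then show ?thesis by (simp add: k2_def mult_ac)
    qed auto
    note tri = triangle_fubini[of k2 g C t "\<lambda>\<tau>. (t - \<tau>) powr \<sigma> / \<sigma>" "t powr \<sigma> / \<sigma>"]
    have i: "integrable lborel (\<lambda>s. indicator {0<..<t} s * (\<integral>\<tau>. indicator {0<..<s} \<tau> * (k2 \<tau> s * g \<tau>) \<partial>lborel))"
      and e: "(\<integral>s. indicator {0<..<t} s * (\<integral>\<tau>. indicator {0<..<s} \<tau> * (k2 \<tau> s * g \<tau>) \<partial>lborel) \<partial>lborel)
         = (\<integral>\<tau>. indicator {0<..<t} \<tau> * (g \<tau> * ((t - \<tau>) powr \<sigma> / \<sigma>)) \<partial>lborel)"
      using C B powr_kernel(2)[OF \<sigma>(1)] by (intro tri; auto simp: k2_def)+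
    have m: "(\<lambda>s. indicator {0<..<t} s * ((t - s) powr (\<sigma> - 1) * (f s - f 0))) \<in> borel_measurable borel"
      unfolding eq using borel_measurable_integrable[OF i] by simp
    show ?thesis
      unfolding RL_integral_def integral_lebesgue_on_lborel(1)[OF m] eq e ..
  qed
  with main show ?thesis
    unfolding has_caputo_deriv_def \<sigma>(2) by auto
qed

text \<open>\<open>w = \<partial>\<^sub>t\<^sup>\<alpha> u\<close> in \<open>D(L\<^sup>-\<^sup>\<gamma>)\<close>: here \<open>u\<close> is determined only for almost every \<open>t\<close>, and \<open>U\<close> is its
  representative in \<open>C([0,T]; D(L\<^sup>-\<^sup>\<gamma>))\<close>, which fixes the initial value. Time integrals in
  \<open>D(L\<^sup>-\<^sup>\<gamma>)\<close> are tested against \<open>D(L\<^sup>\<gamma>)\<close>.\<close>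

definition has_caputo_deriv_dual ::
  "(real^'n) set \<Rightarrow> (nat \<Rightarrow> real) \<Rightarrow> (nat \<Rightarrow> real^'n \<Rightarrow> real) \<Rightarrow> real \<Rightarrow> real \<Rightarrow> real \<Rightarrow>
   (real \<Rightarrow> real^'n \<Rightarrow> real) \<Rightarrow> (real \<Rightarrow> (real^'n \<Rightarrow> real) \<Rightarrow> real) \<Rightarrow> bool" where
  "has_caputo_deriv_dual \<Omega> lam e \<gamma> \<alpha> T u w \<longleftrightarrow>
     (\<exists>U. (\<forall>t\<in>{0..T}. U t \<in> dual_pow \<Omega> lam e \<gamma>) \<and>
          (\<forall>s\<in>{0..T}. ((\<lambda>t. dual_pow_norm lam e \<gamma> (\<lambda>\<psi>. U t \<psi> - U s \<psi>)) \<longlongrightarrow> 0) (at s within {0..T})) \<and>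
          (AE t in lebesgue_on {0<..<T}. \<forall>\<psi>\<in>dom_pow \<Omega> lam e \<gamma>. U t \<psi> = L2_inner \<Omega> (u t) \<psi>) \<and>
          (\<forall>\<psi>\<in>dom_pow \<Omega> lam e \<gamma>. has_caputo_deriv \<alpha> T (\<lambda>t. U t \<psi>) (\<lambda>t. w t \<psi>)))"

section \<open>Solution operators and mild solutions\<close>

definition mittag_leffler :: "real \<Rightarrow> real \<Rightarrow> real \<Rightarrow> real" where
  "mittag_leffler \<alpha> \<sigma> z = (\<Sum>k. z ^ k / Gamma (\<alpha> * real k + \<sigma>))"

definition Psi :: "(nat \<Rightarrow> real) \<Rightarrow> real \<Rightarrow> real \<Rightarrow> real \<Rightarrow> real \<Rightarrow> nat \<Rightarrow> real" where
  "Psi lam \<alpha> \<beta> \<kappa> T j = inverse (mittag_leffler \<alpha> 1 (- (lam j powr \<beta> * T powr \<alpha>)) - \<kappa>)"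

definition G1_integrand ::
  "(real^'n) set \<Rightarrow> (nat \<Rightarrow> real) \<Rightarrow> (nat \<Rightarrow> real^'n \<Rightarrow> real) \<Rightarrow> real \<Rightarrow> real \<Rightarrow> real \<Rightarrow>
   (real \<Rightarrow> real^'n \<Rightarrow> real) \<Rightarrow> nat \<Rightarrow> real \<Rightarrow> real" where
  "G1_integrand \<Omega> lam e \<alpha> \<beta> t h j \<tau> =
     L2_inner \<Omega> (h \<tau>) (e j) * (t - \<tau>) powr (\<alpha> - 1) *
     mittag_leffler \<alpha> \<alpha> (- (lam j powr \<beta> * (t - \<tau>) powr \<alpha>))"

definition G1_terms ::
  "(real^'n) set \<Rightarrow> (nat \<Rightarrow> real) \<Rightarrow> (nat \<Rightarrow> real^'n \<Rightarrow> real) \<Rightarrow> real \<Rightarrow> real \<Rightarrow> real \<Rightarrow>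
   (real \<Rightarrow> real^'n \<Rightarrow> real) \<Rightarrow> nat \<Rightarrow> real^'n \<Rightarrow> real" where
  "G1_terms \<Omega> lam e \<alpha> \<beta> t h j x =
     (\<integral>\<tau>. G1_integrand \<Omega> lam e \<alpha> \<beta> t h j \<tau> \<partial>lebesgue_on {0<..<t}) * e j x"

definition G1 ::
  "(real^'n) set \<Rightarrow> (nat \<Rightarrow> real) \<Rightarrow> (nat \<Rightarrow> real^'n \<Rightarrow> real) \<Rightarrow> real \<Rightarrow> real \<Rightarrow> real \<Rightarrow>
   (real \<Rightarrow> real^'n \<Rightarrow> real) \<Rightarrow> real^'n \<Rightarrow> real" where
  "G1 \<Omega> lam e \<alpha> \<beta> t h = L2_suminf \<Omega> (G1_terms \<Omega> lam e \<alpha> \<beta> t h)"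

definition G1_converges ::
  "(real^'n) set \<Rightarrow> (nat \<Rightarrow> real) \<Rightarrow> (nat \<Rightarrow> real^'n \<Rightarrow> real) \<Rightarrow> real \<Rightarrow> real \<Rightarrow> real \<Rightarrow>
   (real \<Rightarrow> real^'n \<Rightarrow> real) \<Rightarrow> bool" where
  "G1_converges \<Omega> lam e \<alpha> \<beta> t h \<longleftrightarrow>
     (\<forall>j. integrable (lebesgue_on {0<..<t}) (G1_integrand \<Omega> lam e \<alpha> \<beta> t h j)) \<and>
     L2_summable \<Omega> (G1_terms \<Omega> lam e \<alpha> \<beta> t h)"

definition G2_terms ::
  "(real^'n) set \<Rightarrow> (nat \<Rightarrow> real) \<Rightarrow> (nat \<Rightarrow> real^'n \<Rightarrow> real) \<Rightarrow> real \<Rightarrow> real \<Rightarrow> real \<Rightarrow> real \<Rightarrow> real \<Rightarrow>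
   (real^'n \<Rightarrow> real) \<Rightarrow> nat \<Rightarrow> real^'n \<Rightarrow> real" where
  "G2_terms \<Omega> lam e \<alpha> \<beta> \<kappa> T t v j x =
     L2_inner \<Omega> v (e j) * Psi lam \<alpha> \<beta> \<kappa> T j *
     mittag_leffler \<alpha> 1 (- (lam j powr \<beta> * t powr \<alpha>)) * e j x"

definition G2 ::
  "(real^'n) set \<Rightarrow> (nat \<Rightarrow> real) \<Rightarrow> (nat \<Rightarrow> real^'n \<Rightarrow> real) \<Rightarrow> real \<Rightarrow> real \<Rightarrow> real \<Rightarrow> real \<Rightarrow> real \<Rightarrow>
   (real^'n \<Rightarrow> real) \<Rightarrow> real^'n \<Rightarrow> real" where
  "G2 \<Omega> lam e \<alpha> \<beta> \<kappa> T t v = L2_suminf \<Omega> (G2_terms \<Omega> lam e \<alpha> \<beta> \<kappa> T t v)"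

definition G2_converges ::
  "(real^'n) set \<Rightarrow> (nat \<Rightarrow> real) \<Rightarrow> (nat \<Rightarrow> real^'n \<Rightarrow> real) \<Rightarrow> real \<Rightarrow> real \<Rightarrow> real \<Rightarrow> real \<Rightarrow> real \<Rightarrow>
   (real^'n \<Rightarrow> real) \<Rightarrow> bool" where
  "G2_converges \<Omega> lam e \<alpha> \<beta> \<kappa> T t v \<longleftrightarrow> L2_summable \<Omega> (G2_terms \<Omega> lam e \<alpha> \<beta> \<kappa> T t v)"

definition G3 ::
  "(real^'n) set \<Rightarrow> (nat \<Rightarrow> real) \<Rightarrow> (nat \<Rightarrow> real^'n \<Rightarrow> real) \<Rightarrow> real \<Rightarrow> real \<Rightarrow> real \<Rightarrow> real \<Rightarrow> real \<Rightarrow>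
   (real \<Rightarrow> real^'n \<Rightarrow> real) \<Rightarrow> real^'n \<Rightarrow> real" where
  "G3 \<Omega> lam e \<alpha> \<beta> \<kappa> T t h x = - G2 \<Omega> lam e \<alpha> \<beta> \<kappa> T t (G1 \<Omega> lam e \<alpha> \<beta> T h) x"

definition G3_converges ::
  "(real^'n) set \<Rightarrow> (nat \<Rightarrow> real) \<Rightarrow> (nat \<Rightarrow> real^'n \<Rightarrow> real) \<Rightarrow> real \<Rightarrow> real \<Rightarrow> real \<Rightarrow> real \<Rightarrow> real \<Rightarrow>
   (real \<Rightarrow> real^'n \<Rightarrow> real) \<Rightarrow> bool" where
  "G3_converges \<Omega> lam e \<alpha> \<beta> \<kappa> T t h \<longleftrightarrow>
     G1_converges \<Omega> lam e \<alpha> \<beta> T h \<and> G2_converges \<Omega> lam e \<alpha> \<beta> \<kappa> T t (G1 \<Omega> lam e \<alpha> \<beta> T h)"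

text \<open>The right-hand side of the integral equation only makes sense if \<open>u(t) \<in> L\<^sub>2(\<Omega>)\<close> for almost
  every \<open>t\<close>, if the sources \<open>F(\<cdot>,u)\<close> and \<open>ku\<close> belong to \<open>L\<^sup>1(0,T;L\<^sub>2(\<Omega>))\<close> and if the integrals and
  series that define the operators converge; this is required explicitly, since
  Isabelle's operators are total.\<close>

definition mild_solution ::
  "(real^'n) set \<Rightarrow> (nat \<Rightarrow> real) \<Rightarrow> (nat \<Rightarrow> real^'n \<Rightarrow> real) \<Rightarrow> real \<Rightarrow> real \<Rightarrow> real \<Rightarrow> real \<Rightarrow>
   (real \<Rightarrow> real) \<Rightarrow> (real \<Rightarrow> real^'n \<Rightarrow> (real^'n \<Rightarrow> real) \<Rightarrow> real) \<Rightarrow> (real^'n \<Rightarrow> real) \<Rightarrow>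
   (real \<Rightarrow> real^'n \<Rightarrow> real) \<Rightarrow> bool" where
  "mild_solution \<Omega> lam e \<alpha> \<beta> \<kappa> T k F \<phi> u \<longleftrightarrow>
     (\<exists>m\<ge>1. \<exists>l\<ge>1. u \<in> Bochner_Lp m T (Lp (lebesgue_on \<Omega>) l) (Lp_norm (lebesgue_on \<Omega>) l)) \<and>
     (AE t in lebesgue_on {0<..<T}. u t \<in> L2 \<Omega>) \<and>
     (let Fu = (\<lambda>t x. F t x (u t)); ku = (\<lambda>t x. k t * u t x) in
        Fu \<in> Bochner_Lp 1 T (L2 \<Omega>) (L2_norm \<Omega>) \<and>
        ku \<in> Bochner_Lp 1 T (L2 \<Omega>) (L2_norm \<Omega>) \<and>
        (AE t in lebesgue_on {0<..<T}.
           G2_converges \<Omega> lam e \<alpha> \<beta> \<kappa> T t \<phi> \<and>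
           G1_converges \<Omega> lam e \<alpha> \<beta> t Fu \<and> G1_converges \<Omega> lam e \<alpha> \<beta> t ku \<and>
           G3_converges \<Omega> lam e \<alpha> \<beta> \<kappa> T t Fu \<and> G3_converges \<Omega> lam e \<alpha> \<beta> \<kappa> T t ku \<and>
           (AE x in lebesgue_on \<Omega>.
              u t x = G2 \<Omega> lam e \<alpha> \<beta> \<kappa> T t \<phi> x
                    + G1 \<Omega> lam e \<alpha> \<beta> t Fu x + G3 \<Omega> lam e \<alpha> \<beta> \<kappa> T t Fu x
                    - G3 \<Omega> lam e \<alpha> \<beta> \<kappa> T t ku x - G1 \<Omega> lam e \<alpha> \<beta> t ku x)))"

definition Theta ::
  "real \<Rightarrow> real \<Rightarrow> real \<Rightarrow> real \<Rightarrow> real \<Rightarrow> real \<Rightarrow> real \<Rightarrow> real \<Rightarrow> real \<Rightarrow> (real \<Rightarrow> real) \<Rightarrow> real" where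
  "Theta \<alpha> \<beta> p q lam1 M2 C\<kappa> \<Upsilon> T k =
     (let kn = (SUP t\<in>{0..T}. \<bar>k t\<bar>) in
      M2 / lam1 powr (\<beta> * p) *
      (T powr (\<alpha> * q) * \<Upsilon> + C\<kappa> + C\<kappa> * M2 * \<Upsilon> * T powr (\<alpha> * q)
       + T powr (\<alpha> * q) * kn + M2 * C\<kappa> * T powr (\<alpha> * q) * kn) *
      Beta (\<alpha> * q) (1 - \<alpha> * q))"

end

theory Submission
  imports Defs
begin

text \<open>In coordinates with respect to the eigenfunctions the integral equation is a coupled system of scalar
  Volterra equations whose kernels are Mittag-Leffler functions. The source space is weighted:
  \<open>\<parallel>H(t)\<parallel> \<le> Y t\<^sup>-\<^sup>\<alpha>\<^sup>s\<close>, and \<open>\<Theta>(T) < 1\<close> makes the solution map a contraction for this weight with a suitable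
  \<open>s \<ge> q\<close>. For \<open>\<kappa> = 0\<close>, where \<open>\<Psi>\<^sub>j(T)\<close> is unbounded, this needs the positivity and monotonicity of the kernels
  \<open>t\<^sup>\<alpha>\<^sup>-\<^sup>1 E\<^sub>\<alpha>\<^sub>,\<^sub>\<alpha>(-\<lambda> t\<^sup>\<alpha>)\<close>. Picard iteration gives existence. Conversely a mild solution has
  a source that is merely integrable in time, and a weakly singular Gronwall inequality puts it into the weighted
  space, which gives uniqueness and a bound by the norm of \<open>\<phi>\<close>. Each mode satisfies
  \<open>\<partial>\<^sub>t\<^sup>\<alpha> u\<^sub>j = - \<lambda>\<^sub>j\<^sup>\<beta> u\<^sub>j + H\<^sub>j\<close>, and the spatial weights of the data turn this into
  \<open>\<parallel>\<partial>\<^sub>t\<^sup>\<alpha> u(t)\<parallel> \<le> C t\<^sup>-\<^sup>\<alpha>\<close> in the dual space.\<close>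

section \<open>The Beta kernel and the Mittag-Leffler series\<close>

text \<open>The condition \<Theta>(T) < 1 treats \<Psi>_j(T) as if it were bounded by C_\<kappa>.
  For \<kappa> = 0 it may grow like \<mu>_j T^\<alpha>, where \<mu>_j = \<lambda>_j^\<beta>, so the
  final value of the convolution has to pay for a factor \<mu>_j^(1-s), and the direct estimate
  yields T^\<alpha> where \<Theta>(T) only offers \<mu>_0^(-p) T^(\<alpha> q). Nothing is lost as
  long as \<mu>_0 T^\<alpha> \<le> 1. For larger values an absolute bound on the kernel is too weak.
  What helps is its shape: it is positive, has mass at most 1/\<mu>, and decreases both in time and
  in \<mu>. Chebyshev's integral inequality then bounds its convolution with \<tau>^(-a) by t^(-a) /
  (\<mu> (1 - a)), free of M2, and the remaining power \<mu>^(1-2s) can be replaced by its value at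
  the lowest mode exactly when s \<ge> 1/2; hence s = max p q. Positivity and monotonicity are not
  taken from complete monotonicity: they follow from the fractional relaxation equation of the
  kernel by looking at a first zero.\<close>

lemma beta_kernel:
  fixes x y t :: real
  assumes "0 < x" "0 < y" "0 < t"
  shows "has_bochner_integral lborel
    (\<lambda>\<tau>. indicator {0<..<t} \<tau> * ((t - \<tau>) powr (x - 1) * \<tau> powr (y - 1))) (t powr (x + y - 1) * Beta x y)"
proof -
  have "((\<lambda>u. u powr (y - 1) * (1 - u) powr (x - 1)) has_integral Beta y x) {0..1}"
    using has_integral_Beta_real[of y x] assms by simp
  then have "((\<lambda>u. u powr (y - 1) * (1 - u) powr (x - 1)) has_integral Beta y x) {0<..<1}"
    using has_integral_Icc_iff_Ioo by blast
  then have "((\<lambda>u. if u \<in> {0<..<1} then u powr (y - 1) * (1 - u) powr (x - 1) else 0) has_integral Beta y x) UNIV"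
    by (simp only: has_integral_restrict_UNIV)
  then have "((\<lambda>u. indicator {0<..<1} u * ((1 - u) powr (x - 1) * u powr (y - 1))) has_integral Beta y x) UNIV"
    by (rule has_integral_eq[rotated]) (auto simp: indicator_def)
  then have "(\<integral>\<^sup>+ u. ennreal (indicator {0<..<1} u * ((1 - u) powr (x - 1) * u powr (y - 1))) \<partial>lborel) = ennreal (Beta y x)"
    by (intro nn_integral_has_integral_lborel) auto
  moreover have "0 \<le> Beta y x" using assms by (auto simp: Beta_def intro!: divide_nonneg_nonneg Gamma_real_nonneg)
  ultimately have "has_bochner_integral lborel (\<lambda>u. indicator {0<..<1} u * ((1 - u) powr (x - 1) * u powr (y - 1))) (Beta y x)"
    by (intro has_bochner_integral_nn_integral) auto
  then have "has_bochner_integral lborel (\<lambda>\<tau>. indicator {0<..<1} (0 + (1/t) * \<tau>) * ((1 - (0 + (1/t) * \<tau>)) powr (x - 1) * (0 + (1/t) * \<tau>) powr (y - 1))) (Beta y x /\<^sub>R \<bar>1/t\<bar>)"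
    using assms by (subst lborel_has_bochner_integral_real_affine_iff[symmetric]) auto
  from has_bochner_integral_mult_right[of "t powr (x + y - 2)", OF this]
  have "has_bochner_integral lborel (\<lambda>\<tau>. t powr (x + y - 2) * (indicator {0<..<1} (\<tau> / t) * ((1 - \<tau> / t) powr (x - 1) * (\<tau> / t) powr (y - 1)))) (t powr (x + y - 2) * (t * Beta y x))"
    using assms by simp
  moreover have "t powr (x + y - 2) * (indicator {0<..<1} (\<tau> / t) * ((1 - \<tau> / t) powr (x - 1) * (\<tau> / t) powr (y - 1)))
     = indicator {0<..<t} \<tau> * ((t - \<tau>) powr (x - 1) * \<tau> powr (y - 1))" for \<tau>
  proof (cases "0 < \<tau> \<and> \<tau> < t")
    case True
    have "1 - \<tau> / t = (t - \<tau>) / t" using assms by (simp add: field_simps)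
    then have "t powr (x + y - 2) * ((1 - \<tau> / t) powr (x - 1) * (\<tau> / t) powr (y - 1))
       = t powr (x + y - 2) / (t powr (x - 1) * t powr (y - 1)) * ((t - \<tau>) powr (x - 1) * \<tau> powr (y - 1))"
      using True assms by (simp add: powr_divide)
    also have "t powr (x - 1) * t powr (y - 1) = t powr (x + y - 2)"
      using assms by (simp add: powr_add[symmetric] algebra_simps)
    finally show ?thesis using True assms by (simp add: indicator_def)
  next
    case False
    then show ?thesis using assms by (auto simp: indicator_def zero_less_divide_iff)
  qed
  moreover have "t powr (x + y - 2) * (t * Beta y x) = t powr (x + y - 1) * Beta x y"
    using assms powr_add[of t "x + y - 2" 1] by (simp add: Beta_commute[of x y] algebra_simps)
  ultimately show ?thesis by simp
qed

text \<open>For x < 1 the factor (1 - \<tau>)^(x-1) is at least 1, so the Beta integral dominates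
  the integral of \<tau>^(y-1). This is how the constant 1/(1 - \<alpha> s) of Chebyshev's
  inequality is later absorbed into the Beta factor of \<Theta>(T).\<close>

lemma Beta_ge_inverse:
  fixes x y :: real
  assumes "0 < x" "0 < y" "x < 1"
  shows "1 / y \<le> Beta x y"
proof -
  have 1: "has_bochner_integral lborel (\<lambda>\<tau>. indicator {0<..<1} \<tau> * \<tau> powr (y - 1)) (1 / y)"
    using powr_kernel_aux[of y 1] assms by simp
  have 2: "has_bochner_integral lborel (\<lambda>\<tau>. indicator {0<..<1} \<tau> * ((1 - \<tau>) powr (x - 1) * \<tau> powr (y - 1))) (Beta x y)"
    using beta_kernel[of x y 1] assms by simp
  have le: "indicator {0<..<1} \<tau> * \<tau> powr (y - 1) \<le> indicator {0<..<1} \<tau> * ((1 - \<tau>) powr (x - 1) * \<tau> powr (y - 1))" for \<tau> :: real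
  proof (cases "0 < \<tau> \<and> \<tau> < 1")
    case True
    then have "1 \<le> (1 - \<tau>) powr (x - 1)"
      using assms powr_mono2'[of "x - 1" "1 - \<tau>" 1] by simp
    then show ?thesis using True by (simp add: mult_le_cancel_right1)
  qed (auto simp: indicator_def)
  show ?thesis
    using integral_mono[of lborel "\<lambda>\<tau>. indicator {0<..<1} \<tau> * \<tau> powr (y - 1)"
      "\<lambda>\<tau>. indicator {0<..<1} \<tau> * ((1 - \<tau>) powr (x - 1) * \<tau> powr (y - 1))"] 1 2 le
    by (simp add: has_bochner_integral_iff)
qed

text \<open>Gautschi's inequality: log-convexity of Gamma is applied to x + 1, which lies between x
  + \<alpha> and x + \<alpha> + 1.\<close>

lemma Gamma_ratio_le:
  fixes x \<alpha> :: real
  assumes "0 < x" "0 < \<alpha>" "\<alpha> < 1"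
  shows "Gamma x / Gamma (x + \<alpha>) \<le> (x + \<alpha>) powr (1 - \<alpha>) / x"
proof -
  have pos: "0 < Gamma (x + \<alpha>)" "0 < Gamma x" "0 < Gamma (x + 1)" using assms by (auto intro!: Gamma_real_pos)
  have np: "z \<notin> \<int>\<^sub>\<le>\<^sub>0" if "0 < z" for z :: real using that by (auto elim!: nonpos_Ints_cases)
  have "x + 1 = (1 - (1 - \<alpha>)) * (x + \<alpha>) + (1 - \<alpha>) * (x + \<alpha> + 1)" by (simp add: algebra_simps)
  then have "(ln \<circ> Gamma) (x + 1) \<le> (1 - (1 - \<alpha>)) * (ln \<circ> Gamma) (x + \<alpha>) + (1 - \<alpha>) * (ln \<circ> Gamma) (x + \<alpha> + 1)"
    using convex_onD[OF log_convex_Gamma_real, of "1 - \<alpha>" "x + \<alpha>" "x + \<alpha> + 1"] assms by simp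
  also have "(1 - (1 - \<alpha>)) * (ln \<circ> Gamma) (x + \<alpha>) + (1 - \<alpha>) * (ln \<circ> Gamma) (x + \<alpha> + 1)
     = ln (Gamma (x + \<alpha>) * (x + \<alpha>) powr (1 - \<alpha>))"
  proof -
    have "Gamma (x + \<alpha> + 1) = (x + \<alpha>) * Gamma (x + \<alpha>)"
      using assms np by (intro Gamma_plus1) auto
    then have "(ln \<circ> Gamma) (x + \<alpha> + 1) = ln (x + \<alpha>) + ln (Gamma (x + \<alpha>))"
      using pos assms by (simp add: ln_mult_pos)
    moreover have "ln (Gamma (x + \<alpha>) * (x + \<alpha>) powr (1 - \<alpha>)) = ln (Gamma (x + \<alpha>)) + (1 - \<alpha>) * ln (x + \<alpha>)"
      using pos assms by (subst ln_mult_pos) (auto simp: ln_powr)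
    ultimately show ?thesis by (simp add: algebra_simps)
  qed
  finally have "Gamma (x + 1) \<le> Gamma (x + \<alpha>) * (x + \<alpha>) powr (1 - \<alpha>)"
    using pos assms by (simp only: o_apply) (subst (asm) ln_le_cancel_iff, auto intro: mult_pos_pos)
  moreover have "Gamma (x + 1) = x * Gamma x" using assms np[of x] by (intro Gamma_plus1) auto
  ultimately show ?thesis using pos assms by (simp add: field_simps)
qed

text \<open>Ratio test: with x = \<alpha> k + \<sigma>, \<open>Gamma_ratio_le\<close> bounds the
  quotient of consecutive coefficients by 2 x^(-\<alpha>), which tends to 0. Taking k \<ge> 1
  ensures \<alpha> \<le> x, so that x + \<alpha> \<le> 2 x.\<close>

lemma mittag_leffler_summable:
  fixes \<alpha> \<sigma> z :: real
  assumes \<alpha>: "0 < \<alpha>" "\<alpha> < 1" and \<sigma>: "0 < \<sigma>"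
  shows "summable (\<lambda>k. inverse (Gamma (\<alpha> * real k + \<sigma>)) * z ^ k)"
proof -
  have lim: "((\<lambda>k. 2 * (\<alpha> * real k + \<sigma>) powr (- \<alpha>) * \<bar>z\<bar>) \<longlongrightarrow> 2 * 0 * \<bar>z\<bar>) sequentially"
  proof (intro tendsto_intros tendsto_neg_powr)
    show "filterlim (\<lambda>k. \<alpha> * real k + \<sigma>) at_top sequentially"
    proof (rule filterlim_at_top_mono)
      show "filterlim (\<lambda>k. \<alpha> * real k) at_top sequentially"
        using \<alpha> by (intro filterlim_tendsto_pos_mult_at_top[OF tendsto_const] filterlim_real_sequentially) auto
      show "\<forall>\<^sub>F k in sequentially. \<alpha> * real k \<le> \<alpha> * real k + \<sigma>" using \<sigma> by auto
    qed
  qed (use \<alpha> in auto)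
  have "\<forall>\<^sub>F k in sequentially. 2 * (\<alpha> * real k + \<sigma>) powr (- \<alpha>) * \<bar>z\<bar> < 1/2"
    using order_tendstoD(2)[OF lim, of "1/2"] by simp
  then obtain N where N: "\<And>k. N \<le> k \<Longrightarrow> 2 * (\<alpha> * real k + \<sigma>) powr (- \<alpha>) * \<bar>z\<bar> < 1/2"
    by (auto simp: eventually_at_top_linorder)
  show ?thesis
  proof (rule summable_ratio_test[of "1/2" "max N 1"])
    fix k assume k: "max N 1 \<le> k"
    define x where "x = \<alpha> * real k + \<sigma>"
    have "\<alpha> * 1 \<le> \<alpha> * real k" using k \<alpha> by (intro mult_left_mono) auto
    then have x: "0 < x" "\<alpha> \<le> x" using \<sigma> \<alpha> unfolding x_def by linarith+
    have pos: "0 < Gamma x" "0 < Gamma (x + \<alpha>)" using x \<alpha> by (auto intro!: Gamma_real_pos)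
    have "Gamma x / Gamma (x + \<alpha>) \<le> (x + \<alpha>) powr (1 - \<alpha>) / x" using x(1) \<alpha> by (rule Gamma_ratio_le)
    also have "\<dots> \<le> (2 * x) powr (1 - \<alpha>) / x" using x \<alpha> by (intro divide_right_mono powr_mono2) auto
    also have "\<dots> = 2 powr (1 - \<alpha>) * x powr (- \<alpha>)"
      using x powr_add[of x 1 "-\<alpha>"] by (simp add: powr_mult field_simps)
    also have "\<dots> \<le> 2 * x powr (- \<alpha>)"
      using powr_mono[of "1 - \<alpha>" 1 "2::real"] \<alpha> by (intro mult_right_mono) auto
    finally have "Gamma x / Gamma (x + \<alpha>) * \<bar>z\<bar> \<le> 2 * x powr (- \<alpha>) * \<bar>z\<bar>" by (intro mult_right_mono) auto
    also have "\<dots> \<le> 1/2" using N[of k] k by (simp add: x_def)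
    finally have *: "Gamma x / Gamma (x + \<alpha>) * \<bar>z\<bar> \<le> 1/2" .
    have xs: "\<alpha> * real (Suc k) + \<sigma> = x + \<alpha>" by (simp add: x_def algebra_simps)
    have "norm (inverse (Gamma (\<alpha> * real (Suc k) + \<sigma>)) * z ^ Suc k)
      = (Gamma x / Gamma (x + \<alpha>) * \<bar>z\<bar>) * (inverse (Gamma x) * \<bar>z\<bar> ^ k)"
      unfolding xs using pos by (simp add: abs_mult power_abs field_simps)
    also have "\<dots> \<le> 1/2 * (inverse (Gamma x) * \<bar>z\<bar> ^ k)" using pos * by (intro mult_right_mono) auto
    also have "\<dots> = 1/2 * norm (inverse (Gamma (\<alpha> * real k + \<sigma>)) * z ^ k)"
      unfolding x_def[symmetric] using pos by (simp add: abs_mult power_abs)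
    finally show "norm (inverse (Gamma (\<alpha> * real (Suc k) + \<sigma>)) * z ^ Suc k) \<le> 1/2 * norm (inverse (Gamma (\<alpha> * real k + \<sigma>)) * z ^ k)" .
  qed simp
qed

lemma mittag_leffler_altdef: "mittag_leffler \<alpha> \<sigma> z = (\<Sum>k. inverse (Gamma (\<alpha> * real k + \<sigma>)) * z ^ k)"
  by (simp add: mittag_leffler_def field_simps)

lemma mittag_leffler_0: "mittag_leffler \<alpha> \<sigma> 0 = inverse (Gamma \<sigma>)"
  unfolding mittag_leffler_altdef by (subst powser_zero) simp

lemma mittag_leffler_shift:
  fixes \<alpha> \<sigma> z :: real
  assumes \<alpha>: "0 < \<alpha>" "\<alpha> < 1" and \<sigma>: "0 < \<sigma>"
  shows "mittag_leffler \<alpha> \<sigma> z = inverse (Gamma \<sigma>) + z * mittag_leffler \<alpha> (\<sigma> + \<alpha>) z"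
proof -
  let ?f = "\<lambda>k. inverse (Gamma (\<alpha> * real k + \<sigma>)) * z ^ k"
  have s: "summable ?f" by (rule mittag_leffler_summable[OF assms])
  have s2: "summable (\<lambda>k. inverse (Gamma (\<alpha> * real k + (\<sigma> + \<alpha>))) * z ^ k)"
    using assms by (intro mittag_leffler_summable) auto
  have "(\<Sum>k. ?f (Suc k)) = (\<Sum>k. z * (inverse (Gamma (\<alpha> * real k + (\<sigma> + \<alpha>))) * z ^ k))"
    by (intro suminf_cong) (simp add: algebra_simps)
  also have "\<dots> = z * mittag_leffler \<alpha> (\<sigma> + \<alpha>) z"
    unfolding mittag_leffler_altdef by (rule suminf_mult[OF s2])
  finally show ?thesis
    using suminf_split_head[OF s] by (simp add: mittag_leffler_altdef)
qed

lemma mittag_leffler_differentiable: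
  fixes \<alpha> \<sigma> :: real
  assumes \<alpha>: "0 < \<alpha>" "\<alpha> < 1" and \<sigma>: "0 < \<sigma>"
  obtains D where "\<And>z. (mittag_leffler \<alpha> \<sigma> has_real_derivative D z) (at z)" "continuous_on UNIV D"
    "D 0 = inverse (Gamma (\<alpha> + \<sigma>))"
proof -
  let ?c = "\<lambda>k. inverse (Gamma (\<alpha> * real k + \<sigma>))"
  have s: "summable (\<lambda>k. ?c k * z ^ k)" for z by (rule mittag_leffler_summable[OF assms])
  have s': "summable (\<lambda>k. diffs ?c k * z ^ k)" for z by (rule termdiff_converges_all[OF s])
  have d: "(mittag_leffler \<alpha> \<sigma> has_real_derivative (\<Sum>k. diffs ?c k * z ^ k)) (at z)" for z
    unfolding mittag_leffler_altdef[abs_def] by (rule termdiffs_strong_converges_everywhere[OF s])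
  have "((\<lambda>z. \<Sum>k. diffs ?c k * z ^ k) has_real_derivative (\<Sum>k. diffs (diffs ?c) k * z ^ k)) (at z)" for z
    by (rule termdiffs_strong_converges_everywhere[OF s'])
  then have "continuous_on UNIV (\<lambda>z. \<Sum>k. diffs ?c k * z ^ k)"
    by (meson DERIV_isCont continuous_at_imp_continuous_on)
  moreover have "(\<Sum>k. diffs ?c k * 0 ^ k) = inverse (Gamma (\<alpha> + \<sigma>))"
    by (subst powser_zero) (simp add: diffs_def)
  ultimately show ?thesis by (intro that[OF d])
qed

lemma continuous_mittag_leffler:
  fixes \<alpha> \<sigma> :: real
  assumes \<alpha>: "0 < \<alpha>" "\<alpha> < 1" and \<sigma>: "0 < \<sigma>"
  shows "continuous_on S (mittag_leffler \<alpha> \<sigma>)"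
proof -
  obtain D where "\<And>z. (mittag_leffler \<alpha> \<sigma> has_real_derivative D z) (at z)"
    using mittag_leffler_differentiable[OF assms] by metis
  then show ?thesis by (meson DERIV_isCont continuous_at_imp_continuous_on)
qed

lemma borel_mittag_leffler:
  fixes \<alpha> \<sigma> :: real
  assumes \<alpha>: "0 < \<alpha>" "\<alpha> < 1" and \<sigma>: "0 < \<sigma>"
  shows "mittag_leffler \<alpha> \<sigma> \<in> borel_measurable borel"
  using continuous_mittag_leffler[OF assms] by (rule borel_measurable_continuous_onI)

text \<open>Differentiating term by term, the functional equation of Gamma at x = \<alpha> (k + 1)
  cancels the factor k + 1 and lowers the second index from 1 to \<alpha>.\<close>

lemma DERIV_mittag_leffler_1:
  fixes \<alpha> z :: real
  assumes \<alpha>: "0 < \<alpha>" "\<alpha> < 1"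
  shows "(mittag_leffler \<alpha> 1 has_real_derivative mittag_leffler \<alpha> \<alpha> z / \<alpha>) (at z)"
proof -
  let ?c = "\<lambda>k. inverse (Gamma (\<alpha> * real k + 1))"
  have s: "summable (\<lambda>k. ?c k * z ^ k)" for z using assms by (intro mittag_leffler_summable) auto
  have s2: "summable (\<lambda>k. inverse (Gamma (\<alpha> * real k + \<alpha>)) * z ^ k)" using assms by (intro mittag_leffler_summable) auto
  have "diffs ?c k = inverse (Gamma (\<alpha> * real k + \<alpha>)) / \<alpha>" for k
  proof -
    define x where "x = \<alpha> * real k + \<alpha>"
    have x: "0 < x" "x = \<alpha> * real (Suc k)" using \<alpha> by (auto simp: x_def algebra_simps intro!: add_pos_nonneg)
    have "Gamma (x + 1) = x * Gamma x"
      using x by (intro Gamma_plus1) (auto elim!: nonpos_Ints_cases)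
    moreover have "0 < Gamma x" using x by (intro Gamma_real_pos)
    ultimately have "real (Suc k) * inverse (Gamma (x + 1)) = inverse (Gamma x) / \<alpha>"
      using \<alpha> unfolding x(2) by (simp add: inverse_eq_divide del: of_nat_Suc)
    then show ?thesis using x(2) by (simp add: diffs_def x_def[symmetric] algebra_simps)
  qed
  then have "(\<Sum>k. diffs ?c k * z ^ k) = (\<Sum>k. (inverse (Gamma (\<alpha> * real k + \<alpha>)) * z ^ k) / \<alpha>)" by simp
  also have "\<dots> = mittag_leffler \<alpha> \<alpha> z / \<alpha>"
    unfolding mittag_leffler_altdef by (rule suminf_divide[OF s2])
  finally show ?thesis
    using termdiffs_strong_converges_everywhere[OF s, of z] by (simp add: mittag_leffler_altdef[abs_def])
qed

text \<open>Fractional integration of order \<rho> raises the second index by \<rho>: each power is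
  integrated with \<open>beta_kernel\<close>, whose Gamma factors cancel the coefficient. The
  integrals of the absolute values form the same series at \<bar>l\<bar> t^\<alpha>, which
  converges, so sum and integral may be exchanged. All later kernel identities are special
  cases.\<close>

lemma mittag_leffler_convolution:
  fixes \<alpha> \<sigma> \<rho> l t :: real
  assumes \<alpha>: "0 < \<alpha>" "\<alpha> < 1" and \<sigma>: "0 < \<sigma>" and \<rho>: "0 < \<rho>" and t: "0 < t"
  shows "has_bochner_integral lborel
    (\<lambda>\<tau>. indicator {0<..<t} \<tau> * ((t - \<tau>) powr (\<rho> - 1) * (\<tau> powr (\<sigma> - 1) * mittag_leffler \<alpha> \<sigma> (- (l * \<tau> powr \<alpha>)))))
    (Gamma \<rho> * t powr (\<sigma> + \<rho> - 1) * mittag_leffler \<alpha> (\<sigma> + \<rho>) (- (l * t powr \<alpha>)))"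
proof -
  define c where "c k = inverse (Gamma (\<alpha> * real k + \<sigma>))" for k
  define f where "f k \<tau> = (- l) ^ k * c k * (indicator {0<..<t} \<tau> * ((t - \<tau>) powr (\<rho> - 1) * \<tau> powr (\<alpha> * real k + \<sigma> - 1)))" for k \<tau>
  have cpos: "0 < Gamma (\<alpha> * real k + \<sigma>)" "0 < \<alpha> * real k + \<sigma>" for k
    using \<alpha> \<sigma> by (auto intro!: Gamma_real_pos add_nonneg_pos)
  have pw: "\<tau> powr (\<alpha> * real k) = (\<tau> powr \<alpha>) ^ k" if "0 < \<tau>" for \<tau> k
    using that by (simp add: powr_powr[symmetric] powr_realpow)
  define g where "g k = inverse (Gamma (\<alpha> * real k + (\<sigma> + \<rho>)))" for k
  have base: "has_bochner_integral lborel
     (\<lambda>\<tau>. indicator {0<..<t} \<tau> * ((t - \<tau>) powr (\<rho> - 1) * \<tau> powr (\<alpha> * real k + \<sigma> - 1)))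
     (t powr (\<sigma> + \<rho> - 1) * (t powr \<alpha>) ^ k * (Gamma \<rho> * Gamma (\<alpha> * real k + \<sigma>) * g k))" for k
  proof -
    have "t powr (\<rho> + (\<alpha> * real k + \<sigma>) - 1) = t powr (\<sigma> + \<rho> - 1) * (t powr \<alpha>) ^ k"
      using t by (simp add: pw[symmetric] powr_add[symmetric] algebra_simps)
    moreover have "Beta \<rho> (\<alpha> * real k + \<sigma>) = Gamma \<rho> * Gamma (\<alpha> * real k + \<sigma>) * g k"
      by (simp add: Beta_def g_def field_simps)
    ultimately show ?thesis using beta_kernel[OF \<rho> cpos(2)[of k] t] by simp
  qed
  have f: "has_bochner_integral lborel (f k) (Gamma \<rho> * t powr (\<sigma> + \<rho> - 1) * (g k * (- (l * t powr \<alpha>)) ^ k))" for k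
  proof -
    have "(- l) ^ k * c k * (t powr (\<sigma> + \<rho> - 1) * (t powr \<alpha>) ^ k * (Gamma \<rho> * Gamma (\<alpha> * real k + \<sigma>) * g k))
      = Gamma \<rho> * t powr (\<sigma> + \<rho> - 1) * (g k * ((- l) ^ k * (t powr \<alpha>) ^ k))"
      using cpos(1)[of k] by (simp add: c_def)
    also have "(- l) ^ k * (t powr \<alpha>) ^ k = (- (l * t powr \<alpha>)) ^ k"
      by (simp add: power_mult_distrib[symmetric])
    finally show ?thesis
      unfolding f_def using has_bochner_integral_mult_right[OF base[of k], of "(- l) ^ k * c k"] by (simp only:)
  qed
  have "has_bochner_integral lborel (\<lambda>\<tau>. norm (f k \<tau>)) (Gamma \<rho> * t powr (\<sigma> + \<rho> - 1) * (g k * (\<bar>l\<bar> * t powr \<alpha>) ^ k))" for k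
  proof -
    have "norm (f k \<tau>) = \<bar>l\<bar> ^ k * c k * (indicator {0<..<t} \<tau> * ((t - \<tau>) powr (\<rho> - 1) * \<tau> powr (\<alpha> * real k + \<sigma> - 1)))" for \<tau>
      using cpos(1)[of k] by (simp add: f_def abs_mult power_abs c_def)
    moreover have "\<bar>l\<bar> ^ k * c k * (t powr (\<sigma> + \<rho> - 1) * (t powr \<alpha>) ^ k * (Gamma \<rho> * Gamma (\<alpha> * real k + \<sigma>) * g k))
      = Gamma \<rho> * t powr (\<sigma> + \<rho> - 1) * (g k * (\<bar>l\<bar> * t powr \<alpha>) ^ k)"
      using cpos(1)[of k] by (simp add: c_def power_mult_distrib)
    ultimately show ?thesis
      using has_bochner_integral_mult_right[OF base[of k], of "\<bar>l\<bar> ^ k * c k"] by (simp only:)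
  qed
  then have nf: "(\<integral>\<tau>. norm (f k \<tau>) \<partial>lborel) = Gamma \<rho> * t powr (\<sigma> + \<rho> - 1) * (g k * (\<bar>l\<bar> * t powr \<alpha>) ^ k)" for k
    by (rule has_bochner_integral_integral_eq)
  have sg: "summable (\<lambda>k. g k * z ^ k)" for z
    unfolding g_def using \<alpha> \<sigma> \<rho> by (intro mittag_leffler_summable) auto
  have sn: "summable (\<lambda>k. \<integral>\<tau>. norm (f k \<tau>) \<partial>lborel)"
    unfolding nf by (intro summable_mult sg)
  have f_eq: "f k \<tau> = indicator {0<..<t} \<tau> * ((t - \<tau>) powr (\<rho> - 1) * \<tau> powr (\<sigma> - 1)) * (c k * (- (l * \<tau> powr \<alpha>)) ^ k)" for k \<tau>
  proof (cases "0 < \<tau>")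
    case True
    then have "\<tau> powr (\<alpha> * real k + \<sigma> - 1) = \<tau> powr (\<sigma> - 1) * (\<tau> powr \<alpha>) ^ k"
      by (simp add: pw[symmetric] powr_add[symmetric] algebra_simps)
    moreover have "(- (l * \<tau> powr \<alpha>)) ^ k = (- l) ^ k * (\<tau> powr \<alpha>) ^ k" by (simp add: power_mult_distrib[symmetric])
    ultimately show ?thesis by (simp add: f_def)
  qed (simp add: f_def)
  have sc: "summable (\<lambda>k. c k * z ^ k)" for z
    unfolding c_def using \<alpha> \<sigma> by (intro mittag_leffler_summable) auto
  have sum_f: "(\<Sum>k. f k \<tau>) = indicator {0<..<t} \<tau> * ((t - \<tau>) powr (\<rho> - 1) * (\<tau> powr (\<sigma> - 1) * mittag_leffler \<alpha> \<sigma> (- (l * \<tau> powr \<alpha>))))" for \<tau>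
    unfolding f_eq by (subst suminf_mult[OF sc]) (simp add: mittag_leffler_altdef c_def)
  have ae: "AE \<tau> in lborel. summable (\<lambda>k. norm (f k \<tau>))"
  proof (rule AE_I2)
    fix \<tau> :: real
    have "norm (f k \<tau>) = \<bar>indicator {0<..<t} \<tau> * ((t - \<tau>) powr (\<rho> - 1) * \<tau> powr (\<sigma> - 1))\<bar> * (c k * \<bar>l * \<tau> powr \<alpha>\<bar> ^ k)" for k
      using cpos(1)[of k] unfolding f_eq by (simp add: abs_mult power_abs c_def)
    then show "summable (\<lambda>k. norm (f k \<tau>))" by (simp add: summable_mult sc)
  qed
  have int: "integrable lborel (f k)" for k using f by (auto simp: has_bochner_integral_iff)
  have "(\<lambda>k. integral\<^sup>L lborel (f k)) sums (\<integral>\<tau>. (\<Sum>k. f k \<tau>) \<partial>lborel)"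
    by (rule sums_integral[OF int ae sn])
  moreover have "(\<lambda>k. integral\<^sup>L lborel (f k)) sums (Gamma \<rho> * t powr (\<sigma> + \<rho> - 1) * mittag_leffler \<alpha> (\<sigma> + \<rho>) (- (l * t powr \<alpha>)))"
    unfolding has_bochner_integral_integral_eq[OF f] mittag_leffler_altdef g_def[symmetric]
    by (intro sums_mult summable_sums sg)
  ultimately have "(\<integral>\<tau>. (\<Sum>k. f k \<tau>) \<partial>lborel) = Gamma \<rho> * t powr (\<sigma> + \<rho> - 1) * mittag_leffler \<alpha> (\<sigma> + \<rho>) (- (l * t powr \<alpha>))"
    using sums_unique2 by blast
  moreover have "integrable lborel (\<lambda>\<tau>. \<Sum>k. f k \<tau>)" by (rule integrable_suminf[OF int ae sn])
  ultimately show ?thesis unfolding sum_f by (simp add: has_bochner_integral_iff)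
qed

section \<open>Positivity and monotonicity of the Mittag-Leffler kernel\<close>

lemma has_bochner_integral_reflect:
  fixes f :: "real \<Rightarrow> real"
  assumes "has_bochner_integral lborel (\<lambda>\<tau>. indicator {0<..<t} \<tau> * f \<tau>) I"
  shows "has_bochner_integral lborel (\<lambda>\<tau>. indicator {0<..<t} \<tau> * f (t - \<tau>)) I"
proof -
  have "has_bochner_integral lborel (\<lambda>\<tau>. indicator {0<..<t} (t + (-1) * \<tau>) * f (t + (-1) * \<tau>)) (I /\<^sub>R \<bar>-1\<bar>)"
    using assms by (subst lborel_has_bochner_integral_real_affine_iff[symmetric]) auto
  then show ?thesis
    by (elim has_bochner_integral_cong[THEN iffD1, rotated -1]) (auto simp: indicator_def)
qed

text \<open>The impulse response of the scalar equation \<partial>_t^\<alpha> y + l y = h; up to the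
  factor -l it is the derivative of E_{\<alpha>,1}(-l t^\<alpha>).\<close>

definition ml_kernel :: "real \<Rightarrow> real \<Rightarrow> real \<Rightarrow> real" where
  "ml_kernel \<alpha> l t = t powr (\<alpha> - 1) * mittag_leffler \<alpha> \<alpha> (- (l * t powr \<alpha>))"

lemma borel_ml_kernel [measurable]:
  assumes "0 < \<alpha>" "\<alpha> < 1"
  shows "ml_kernel \<alpha> l \<in> borel_measurable borel"
proof -
  note [measurable] = borel_mittag_leffler[OF assms assms(1)]
  show ?thesis unfolding ml_kernel_def[abs_def] by measurable
qed

text \<open>The case \<sigma> = \<alpha>, \<rho> = 1 - \<alpha>. Since the right-hand side has
  derivative -l Gamma(1 - \<alpha>) times the kernel, this is the relaxation equation of the kernel,
  and it is what the first-zero argument contradicts.\<close>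

lemma ml_kernel_fractional_integral:
  fixes \<alpha> l t :: real
  assumes "0 < \<alpha>" "\<alpha> < 1" "0 < t"
  shows "has_bochner_integral lborel (\<lambda>\<tau>. indicator {0<..<t} \<tau> * ((t - \<tau>) powr (- \<alpha>) * ml_kernel \<alpha> l \<tau>))
     (Gamma (1 - \<alpha>) * mittag_leffler \<alpha> 1 (- (l * t powr \<alpha>)))"
  using mittag_leffler_convolution[of \<alpha> \<alpha> "1 - \<alpha>" t l] assms by (simp add: ml_kernel_def)

lemma ml_kernel_powr_convolution:
  fixes \<alpha> l t :: real
  assumes "0 < \<alpha>" "\<alpha> < 1" "0 < t" "0 < \<rho>"
  shows "has_bochner_integral lborel (\<lambda>\<tau>. indicator {0<..<t} \<tau> * (ml_kernel \<alpha> l (t - \<tau>) * \<tau> powr (\<rho> - 1)))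
     (Gamma \<rho> * t powr (\<alpha> + \<rho> - 1) * mittag_leffler \<alpha> (\<alpha> + \<rho>) (- (l * t powr \<alpha>)))"
proof -
  have "has_bochner_integral lborel (\<lambda>\<tau>. indicator {0<..<t} \<tau> * ((t - \<tau>) powr (\<rho> - 1) * ml_kernel \<alpha> l \<tau>))
     (Gamma \<rho> * t powr (\<alpha> + \<rho> - 1) * mittag_leffler \<alpha> (\<alpha> + \<rho>) (- (l * t powr \<alpha>)))"
    using mittag_leffler_convolution[of \<alpha> \<alpha> \<rho> t l] assms by (simp add: ml_kernel_def)
  from has_bochner_integral_reflect[OF this] show ?thesis by (simp add: mult.commute)
qed

lemma ml_kernel_integral:
  fixes \<alpha> l t :: real
  assumes "0 < \<alpha>" "\<alpha> < 1" "0 < t" "l \<noteq> 0"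
  shows "has_bochner_integral lborel (\<lambda>\<tau>. indicator {0<..<t} \<tau> * ml_kernel \<alpha> l (t - \<tau>))
     ((1 - mittag_leffler \<alpha> 1 (- (l * t powr \<alpha>))) / l)"
proof -
  have "t powr \<alpha> * mittag_leffler \<alpha> (\<alpha> + 1) (- (l * t powr \<alpha>)) = (1 - mittag_leffler \<alpha> 1 (- (l * t powr \<alpha>))) / l"
    using mittag_leffler_shift[of \<alpha> 1 "- (l * t powr \<alpha>)"] assms by (simp add: add.commute field_simps)
  then have "has_bochner_integral lborel (\<lambda>\<tau>. indicator {0<..<t} \<tau> * (ml_kernel \<alpha> l (t - \<tau>) * \<tau> powr (1 - 1)))
     ((1 - mittag_leffler \<alpha> 1 (- (l * t powr \<alpha>))) / l)"
    using ml_kernel_powr_convolution[of \<alpha> t 1 l] assms by simp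
  then show ?thesis
    by (elim has_bochner_integral_cong[THEN iffD1, rotated -1]) (auto simp: indicator_def)
qed

lemma DERIV_mittag_leffler_powr:
  fixes \<alpha> l t :: real
  assumes "0 < \<alpha>" "\<alpha> < 1" "0 < t"
  shows "((\<lambda>t. mittag_leffler \<alpha> 1 (- (l * t powr \<alpha>))) has_real_derivative - l * ml_kernel \<alpha> l t) (at t)"
proof -
  have "((\<lambda>t. - (l * t powr \<alpha>)) has_real_derivative - (l * (\<alpha> * t powr (\<alpha> - 1)))) (at t)"
    using assms by (auto intro!: derivative_eq_intros simp: powr_diff)
  from DERIV_chain2[OF DERIV_mittag_leffler_1[OF assms(1,2)] this] show ?thesis
    using assms by (simp add: ml_kernel_def mult_ac)
qed

lemma DERIV_ml_kernel:
  fixes \<alpha> l t :: real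
  assumes "0 < \<alpha>" "\<alpha> < 1" "0 < t"
  obtains D where "(ml_kernel \<alpha> l has_real_derivative D) (at t)"
proof -
  obtain d where d: "\<And>z. (mittag_leffler \<alpha> \<alpha> has_real_derivative d z) (at z)"
    using mittag_leffler_differentiable[OF assms(1,2,1)] by metis
  have i: "((\<lambda>t. - (l * t powr \<alpha>)) has_real_derivative - (l * (\<alpha> * t powr (\<alpha> - 1)))) (at t)"
    using assms by (auto intro!: derivative_eq_intros simp: powr_diff)
  have j: "((\<lambda>t. t powr (\<alpha> - 1)) has_real_derivative (\<alpha> - 1) * t powr (\<alpha> - 1 - 1)) (at t)"
    using assms by (intro has_real_derivative_powr)
  show ?thesis
    using DERIV_mult[OF j DERIV_chain2[OF d i]] that unfolding ml_kernel_def[abs_def] by blast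
qed

text \<open>At its first zero a function that was positive before pulls its fractional integral of order
  \<open>1 - \<alpha>\<close> strictly down: the past contributes a negative slope, and near the zero the singular kernel
  is compensated by the linear vanishing of the function.\<close>

lemma fractional_integral_first_zero:
  fixes m F :: "real \<Rightarrow> real"
  assumes \<alpha>: "0 < \<alpha>" "\<alpha> < 1" and t0: "0 < t0"
    and m[measurable]: "m \<in> borel_measurable borel"
    and pos: "\<And>\<tau>. 0 < \<tau> \<Longrightarrow> \<tau> < t0 \<Longrightarrow> 0 < m \<tau>" and zero: "m t0 = 0"
    and deriv: "(m has_real_derivative D) (at t0)"
    and F: "\<And>t. 0 < t \<Longrightarrow> has_bochner_integral lborel (\<lambda>\<tau>. indicator {0<..<t} \<tau> * ((t - \<tau>) powr (- \<alpha>) * m \<tau>)) (F t)"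
    and F': "(F has_real_derivative F') (at t0)"
  shows "F' < 0"
proof -
  define I where "I = (\<integral>\<tau>. indicator {0<..<t0} \<tau> * m \<tau> \<partial>lborel)"
  have int_m: "integrable lborel (\<lambda>\<tau>. indicator {0<..<t0} \<tau> * m \<tau>)"
  proof (rule Bochner_Integration.integrable_bound)
    show "integrable lborel (\<lambda>\<tau>. t0 powr \<alpha> * (indicator {0<..<t0} \<tau> * ((t0 - \<tau>) powr (- \<alpha>) * m \<tau>)))"
      using F[OF t0] by (intro integrable_mult_right) (auto simp: has_bochner_integral_iff)
    show "AE \<tau> in lborel. norm (indicator {0<..<t0} \<tau> * m \<tau>)
      \<le> norm (t0 powr \<alpha> * (indicator {0<..<t0} \<tau> * ((t0 - \<tau>) powr (- \<alpha>) * m \<tau>)))"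
    proof (rule AE_I2)
      fix \<tau> :: real
      show "norm (indicator {0<..<t0} \<tau> * m \<tau>)
        \<le> norm (t0 powr \<alpha> * (indicator {0<..<t0} \<tau> * ((t0 - \<tau>) powr (- \<alpha>) * m \<tau>)))"
      proof (cases "0 < \<tau> \<and> \<tau> < t0")
        case True
        then have "t0 powr (- \<alpha>) \<le> (t0 - \<tau>) powr (- \<alpha>)" using \<alpha> by (intro powr_mono2') auto
        then have "t0 powr \<alpha> * t0 powr (- \<alpha>) \<le> t0 powr \<alpha> * (t0 - \<tau>) powr (- \<alpha>)" by (intro mult_left_mono) auto
        moreover have "t0 powr \<alpha> * t0 powr (- \<alpha>) = 1" using t0 by (simp add: powr_add[symmetric])
        ultimately have "1 * m \<tau> \<le> (t0 powr \<alpha> * (t0 - \<tau>) powr (- \<alpha>)) * m \<tau>"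
          using pos[of \<tau>] True by (intro mult_right_mono) auto
        then show ?thesis using True pos[of \<tau>] by (simp add: abs_mult mult_ac)
      qed (auto simp: indicator_def)
    qed
  qed measurable
  have I: "0 < I"
  proof -
    have nn: "AE \<tau> in lborel. 0 \<le> indicator {0<..<t0} \<tau> * m \<tau>"
      using pos by (intro AE_I2) (auto simp: indicator_def less_imp_le)
    have "I \<noteq> 0"
    proof
      assume "I = 0"
      then have "AE \<tau> in lborel. indicator {0<..<t0} \<tau> * m \<tau> = 0"
        using integral_nonneg_eq_0_iff_AE[OF int_m nn] by (simp add: I_def)
      then have "AE \<tau> in lborel. \<tau> \<notin> {0<..<t0}"
        by eventually_elim (use pos in \<open>force simp: indicator_def\<close>)
      then have "emeasure lborel {0<..<t0} = 0"
        by (subst (asm) AE_iff_measurable[of "{0<..<t0}"]) auto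
      then show False using t0 by simp
    qed
    moreover have "0 \<le> I" unfolding I_def using nn by (rule Bochner_Integration.integral_nonneg_AE)
    ultimately show ?thesis by simp
  qed
  \<comment> \<open>The derivative of x^(-\<alpha>) is at most -C for 0 < x < 2 t0, and t - \<tau>
    stays in this range for t < 2 t0.\<close>
  define C where "C = \<alpha> * (2 * t0) powr (- \<alpha> - 1)"
  have C: "0 < C" using \<alpha> t0 by (simp add: C_def)
  define M where "M = \<bar>D\<bar> + 1"
  have "\<forall>\<^sub>F \<tau> in at t0. \<bar>(m \<tau> - m t0) / (\<tau> - t0) - D\<bar> < 1"
    using deriv[unfolded has_field_derivative_iff] by (auto dest!: tendstoD[where e = 1] simp: dist_real_def)
  then obtain d where d: "0 < d" "\<And>\<tau>. \<tau> \<noteq> t0 \<Longrightarrow> \<bar>\<tau> - t0\<bar> < d \<Longrightarrow> \<bar>m \<tau> / (\<tau> - t0) - D\<bar> < 1"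
    unfolding eventually_at by (auto simp: zero dist_real_def)
  have mM: "\<bar>m \<tau>\<bar> \<le> M * (\<tau> - t0)" if "t0 < \<tau>" "\<tau> < t0 + d" for \<tau>
  proof -
    have "\<bar>m \<tau> / (\<tau> - t0)\<bar> \<le> M" using d(2)[of \<tau>] that by (auto simp: M_def)
    then show ?thesis using that by (simp add: abs_divide field_simps)
  qed
  have slope: "(F t - F t0) / (t - t0) \<le> - C * I + M * (t - t0) powr (1 - \<alpha>) / (1 - \<alpha>)"
    if t: "t0 < t" "t < t0 + d" "t < 2 * t0" for t
  proof -
    \<comment> \<open>On (0, t0) the mean value theorem lowers the kernel by at least (t - t0) C. On
      (t0, t) the bound m(\<tau>) \<le> M (\<tau> - t0) \<le> M (t - t0) leaves an integrable
      kernel, whose contribution to the slope is of order (t - t0)^(1-\<alpha>) and vanishes in the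
      limit.\<close>
    define G where "G \<tau> = - (t - t0) * C * (indicator {0<..<t0} \<tau> * m \<tau>)
        + M * (t - t0) * (indicator {t0<..<t} \<tau> * (t - \<tau>) powr ((1 - \<alpha>) - 1))" for \<tau>
    have G: "has_bochner_integral lborel G (- (t - t0) * C * I + M * (t - t0) * ((t - t0) powr (1 - \<alpha>) / (1 - \<alpha>)))"
      unfolding G_def I_def
      using int_m powr_kernel(2)[of "1 - \<alpha>" t0 t] \<alpha> t
      by (intro has_bochner_integral_add has_bochner_integral_mult_right) (auto simp: has_bochner_integral_iff)
    have D: "has_bochner_integral lborel (\<lambda>\<tau>. indicator {0<..<t} \<tau> * ((t - \<tau>) powr (- \<alpha>) * m \<tau>)
        - indicator {0<..<t0} \<tau> * ((t0 - \<tau>) powr (- \<alpha>) * m \<tau>)) (F t - F t0)"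
      using F t t0 by (intro has_bochner_integral_diff) auto
    have le: "indicator {0<..<t} \<tau> * ((t - \<tau>) powr (- \<alpha>) * m \<tau>)
        - indicator {0<..<t0} \<tau> * ((t0 - \<tau>) powr (- \<alpha>) * m \<tau>) \<le> G \<tau>" for \<tau>
    proof -
      consider "\<tau> \<le> 0 \<or> t \<le> \<tau>" | "0 < \<tau>" "\<tau> < t0" | "\<tau> = t0" | "t0 < \<tau>" "\<tau> < t" by linarith
      then show ?thesis
      proof cases
        case 1 then show ?thesis using t t0 by (auto simp: G_def indicator_def)
      next
        case 2
        obtain z where z: "t0 - \<tau> < z" "z < t - \<tau>"
          "(t - \<tau>) powr (- \<alpha>) - (t0 - \<tau>) powr (- \<alpha>) = ((t - \<tau>) - (t0 - \<tau>)) * (- \<alpha> * z powr (- \<alpha> - 1))"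
          using MVT2[of "t0 - \<tau>" "t - \<tau>" "\<lambda>x. x powr (- \<alpha>)" "\<lambda>x. - \<alpha> * x powr (- \<alpha> - 1)"] 2 t
          by (force intro!: derivative_eq_intros simp: powr_diff)
        have "(2 * t0) powr (- \<alpha> - 1) \<le> z powr (- \<alpha> - 1)"
          using z 2 t \<alpha> by (intro powr_mono2') auto
        then have "C \<le> \<alpha> * z powr (- \<alpha> - 1)" unfolding C_def using \<alpha> by (intro mult_left_mono) auto
        then have "(t - t0) * C \<le> (t - t0) * (\<alpha> * z powr (- \<alpha> - 1))" using t by (intro mult_left_mono) auto
        then have "((t - \<tau>) powr (- \<alpha>) - (t0 - \<tau>) powr (- \<alpha>)) * m \<tau> \<le> (- (t - t0) * C) * m \<tau>"
        proof (intro mult_right_mono)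
          have "(t - \<tau>) powr (- \<alpha>) - (t0 - \<tau>) powr (- \<alpha>) = - ((t - t0) * (\<alpha> * z powr (- \<alpha> - 1)))"
            using z(3) by simp
          also have "\<dots> \<le> - ((t - t0) * C)" using \<open>(t - t0) * C \<le> _\<close> by linarith
          finally show "(t - \<tau>) powr (- \<alpha>) - (t0 - \<tau>) powr (- \<alpha>) \<le> - (t - t0) * C" by (simp only: mult_minus_left)
        qed (use pos[OF 2] in auto)
        then show ?thesis using 2 t by (simp add: G_def algebra_simps)
      next
        case 3 then show ?thesis using t t0 zero by (simp add: G_def)
      next
        case 4
        have "m \<tau> \<le> M * (\<tau> - t0)" using mM[of \<tau>] 4 t by auto
        also have "\<dots> \<le> M * (t - t0)" using 4 by (intro mult_left_mono) (auto simp: M_def)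
        finally have "(t - \<tau>) powr (- \<alpha>) * m \<tau> \<le> (t - \<tau>) powr (- \<alpha>) * (M * (t - t0))" by (intro mult_left_mono) auto
        then show ?thesis using 4 t t0 by (simp add: G_def mult_ac)
      qed
    qed
    have "F t - F t0 \<le> - (t - t0) * C * I + M * (t - t0) * ((t - t0) powr (1 - \<alpha>) / (1 - \<alpha>))"
      using integral_mono[of lborel, OF integrable.intros[OF D] integrable.intros[OF G] le]
        has_bochner_integral_integral_eq[OF D] has_bochner_integral_integral_eq[OF G] by simp
    also have "\<dots> = (- C * I + M * (t - t0) powr (1 - \<alpha>) / (1 - \<alpha>)) * (t - t0)" by (simp add: algebra_simps)
    finally show ?thesis using t by (simp add: pos_divide_le_eq)
  qed
  have lim1: "((\<lambda>t. (F t - F t0) / (t - t0)) \<longlongrightarrow> F') (at_right t0)"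
    using F'[unfolded has_field_derivative_iff] by (rule filterlim_mono[OF _ order_refl at_le]) auto
  have lim2: "((\<lambda>t. - C * I + M * (t - t0) powr (1 - \<alpha>) / (1 - \<alpha>)) \<longlongrightarrow> - C * I + M * 0 powr (1 - \<alpha>) / (1 - \<alpha>)) (at_right t0)"
  proof -
    have h: "((\<lambda>t. (t - t0) powr (1 - \<alpha>)) \<longlongrightarrow> 0 powr (1 - \<alpha>)) (at_right t0)"
    proof (rule tendsto_powr2)
      show "((\<lambda>t. t - t0) \<longlongrightarrow> 0) (at_right t0)" by (auto intro!: tendsto_eq_intros)
      show "\<forall>\<^sub>F t in at_right t0. 0 \<le> t - t0" by (auto simp: eventually_at_right_less eventually_at_filter)
    qed (use \<alpha> in auto)
    show ?thesis using \<alpha> by (intro tendsto_add tendsto_mult tendsto_divide tendsto_const h) auto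
  qed
  have "\<forall>\<^sub>F t in at_right t0. (F t - F t0) / (t - t0) \<le> - C * I + M * (t - t0) powr (1 - \<alpha>) / (1 - \<alpha>)"
    unfolding eventually_at_right_field
    by (rule exI[of _ "min (t0 + d) (2 * t0)"]) (use slope d t0 in auto)
  from tendsto_le[OF trivial_limit_at_right_real lim2 lim1 this] have "F' \<le> - C * I" using \<alpha> by simp
  also have "\<dots> < 0" using C I by simp
  finally show ?thesis .
qed

text \<open>The smallest element of the compact zero set in [0, z] works: by the intermediate value
  theorem an earlier nonpositive value would produce an earlier zero.\<close>

lemma first_nonpositive:
  fixes f :: "real \<Rightarrow> real"
  assumes f: "continuous_on {0..} f" and "0 < f 0" "0 \<le> z" "f z \<le> 0"
  obtains z0 where "0 < z0" "f z0 = 0" "\<And>x. 0 \<le> x \<Longrightarrow> x < z0 \<Longrightarrow> 0 < f x"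
proof -
  define Z where "Z = {x\<in>{0..z}. f x = 0}"
  have f': "continuous_on {0..z} f" using f by (rule continuous_on_subset) auto
  have ex: "\<exists>x\<in>{0..y}. f x = 0" if "0 \<le> y" "f y \<le> 0" for y
    using IVT2'[of f y 0 0] assms that continuous_on_subset[OF f, of "{0..y}"] by fastforce
  have "Z \<noteq> {}" using ex[of z] assms by (auto simp: Z_def)
  moreover have "compact Z"
    unfolding Z_def
    by (rule closedin_compact[OF compact_Icc[of 0 z]])
       (use continuous_closedin_preimage_constant[OF f', of 0] in simp)
  ultimately obtain z0 where z0: "z0 \<in> Z" "\<And>x. x \<in> Z \<Longrightarrow> z0 \<le> x"
    using compact_attains_inf[of Z] by metis
  show ?thesis
  proof
    show "f z0 = 0" using z0 by (simp add: Z_def)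
    then show "0 < z0" using z0 assms by (cases "z0 = 0") (auto simp: Z_def)
    fix x assume x: "0 \<le> x" "x < z0"
    show "0 < f x"
    proof (rule ccontr)
      assume "\<not> 0 < f x"
      then obtain y where "y \<in> {0..x}" "f y = 0" using ex[of x] x by auto
      then show False using z0 x by (force simp: Z_def)
    qed
  qed
qed

text \<open>At a first zero t0 of the kernel with l = 1 its fractional integral has derivative
  -Gamma(1 - \<alpha>) times the kernel at t0, hence 0, whereas
  \<open>fractional_integral_first_zero\<close> makes this derivative strictly negative. Taking l =
  1 suffices because the argument z is reached at time z^(1/\<alpha>).\<close>

lemma mittag_leffler_diag_pos:
  fixes \<alpha> z :: real
  assumes \<alpha>: "0 < \<alpha>" "\<alpha> < 1" and z: "0 \<le> z"
  shows "0 < mittag_leffler \<alpha> \<alpha> (- z)"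
proof (rule ccontr)
  assume neg: "\<not> ?thesis"
  have "continuous_on {0..} (\<lambda>z. mittag_leffler \<alpha> \<alpha> (- z))"
    by (rule continuous_on_compose2[OF continuous_mittag_leffler[OF \<alpha> \<alpha>(1), of UNIV]]) (auto intro!: continuous_intros)
  moreover have "0 < mittag_leffler \<alpha> \<alpha> (- 0)"
    using \<alpha> by (simp add: mittag_leffler_0 Gamma_real_pos)
  ultimately obtain z0 where z0: "0 < z0" "mittag_leffler \<alpha> \<alpha> (- z0) = 0"
    "\<And>x. 0 \<le> x \<Longrightarrow> x < z0 \<Longrightarrow> 0 < mittag_leffler \<alpha> \<alpha> (- x)"
    using first_nonpositive[of "\<lambda>z. mittag_leffler \<alpha> \<alpha> (- z)" z] z neg by (metis not_less)
  define t0 where "t0 = z0 powr (1 / \<alpha>)"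
  have t0: "0 < t0" "t0 powr \<alpha> = z0" using z0(1) \<alpha> by (auto simp: t0_def powr_powr)
  have zero: "ml_kernel \<alpha> 1 t0 = 0" using z0(2) t0 by (simp add: ml_kernel_def)
  obtain D where D: "(ml_kernel \<alpha> 1 has_real_derivative D) (at t0)" using DERIV_ml_kernel[OF \<alpha> t0(1)] .
  have "((\<lambda>t. Gamma (1 - \<alpha>) * mittag_leffler \<alpha> 1 (- (1 * t powr \<alpha>))) has_real_derivative
     Gamma (1 - \<alpha>) * (- 1 * ml_kernel \<alpha> 1 t0)) (at t0)"
    by (rule DERIV_cmult[OF DERIV_mittag_leffler_powr[OF \<alpha> t0(1)]])
  then have "Gamma (1 - \<alpha>) * (- 1 * ml_kernel \<alpha> 1 t0) < 0"
  proof (rule fractional_integral_first_zero[OF \<alpha> t0(1) borel_ml_kernel[OF \<alpha>] _ zero D, rotated 2])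
    fix \<tau> assume \<tau>: "0 < \<tau>" "\<tau> < t0"
    then have "\<tau> powr \<alpha> < z0" using \<alpha> t0 powr_less_mono2[of \<alpha> \<tau> t0] by simp
    then show "0 < ml_kernel \<alpha> 1 \<tau>" unfolding ml_kernel_def using \<tau> z0(3)[of "\<tau> powr \<alpha>"] by simp
  next
    fix t :: real assume "0 < t"
    then show "has_bochner_integral lborel (\<lambda>\<tau>. indicator {0<..<t} \<tau> * ((t - \<tau>) powr (- \<alpha>) * ml_kernel \<alpha> 1 \<tau>))
      (Gamma (1 - \<alpha>) * mittag_leffler \<alpha> 1 (- (1 * t powr \<alpha>)))"
      by (rule ml_kernel_fractional_integral[OF \<alpha>])
  qed
  then show False using zero by simp
qed

lemma ml_kernel_pos:
  fixes \<alpha> l t :: real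
  assumes \<alpha>: "0 < \<alpha>" "\<alpha> < 1" and "0 \<le> l" "0 < t"
  shows "0 < ml_kernel \<alpha> l t"
  unfolding ml_kernel_def using assms mittag_leffler_diag_pos[OF \<alpha>, of "l * t powr \<alpha>"] by simp

text \<open>The same argument for the difference of the kernels with rates a < b. At its first zero
  both kernels agree, so the derivative of the fractional integral equals Gamma(1 - \<alpha>) (b -
  a) times a positive kernel value, again contradicting the strict negativity.\<close>

lemma mittag_leffler_diag_antimono:
  fixes \<alpha> a b :: real
  assumes \<alpha>: "0 < \<alpha>" "\<alpha> < 1" and ab: "0 \<le> a" "a < b"
  shows "mittag_leffler \<alpha> \<alpha> (- b) < mittag_leffler \<alpha> \<alpha> (- a)"
proof -
  \<comment> \<open>The difference itself vanishes at x = 0, where no first zero could be sought.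
    Its quotient by x starts at the positive value (b - a) / Gamma(2 \<alpha>).\<close>
  define f where "f x = b * mittag_leffler \<alpha> (\<alpha> + \<alpha>) (- (b * x)) - a * mittag_leffler \<alpha> (\<alpha> + \<alpha>) (- (a * x))" for x
  have diff: "mittag_leffler \<alpha> \<alpha> (- (a * x)) - mittag_leffler \<alpha> \<alpha> (- (b * x)) = x * f x" for x
    unfolding f_def mittag_leffler_shift[OF \<alpha> \<alpha>(1), of "- (a * x)"] mittag_leffler_shift[OF \<alpha> \<alpha>(1), of "- (b * x)"]
    by (simp add: right_diff_distrib)
  have "0 < f 1"
  proof (rule ccontr)
    assume neg: "\<not> 0 < f 1"
    have c: "continuous_on {0..} (\<lambda>x. mittag_leffler \<alpha> (\<alpha> + \<alpha>) (- (c * x)))" for c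
      by (rule continuous_on_compose2[OF continuous_mittag_leffler[of \<alpha> "\<alpha> + \<alpha>" UNIV]])
         (use \<alpha> in \<open>auto intro!: continuous_intros\<close>)
    have "continuous_on {0..} f" unfolding f_def using c by (intro continuous_intros) auto
    moreover have "0 < f 0"
      using \<alpha> ab mult_strict_right_mono[of a b "inverse (Gamma (\<alpha> + \<alpha>))"] Gamma_real_pos[of "\<alpha> + \<alpha>"]
      by (simp add: f_def mittag_leffler_0)
    ultimately obtain z0 where z0: "0 < z0" "f z0 = 0" "\<And>x. 0 \<le> x \<Longrightarrow> x < z0 \<Longrightarrow> 0 < f x"
      using first_nonpositive[of f 1] neg by (metis not_less zero_le_one)
    define t0 where "t0 = z0 powr (1 / \<alpha>)"
    have t0: "0 < t0" "t0 powr \<alpha> = z0" using z0(1) \<alpha> by (auto simp: t0_def powr_powr)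
    let ?m = "\<lambda>t. ml_kernel \<alpha> a t - ml_kernel \<alpha> b t"
    have m_eq: "?m t = t powr (\<alpha> - 1) * (t powr \<alpha> * f (t powr \<alpha>))" for t
      using diff[of "t powr \<alpha>"] by (simp add: ml_kernel_def right_diff_distrib[symmetric])
    have zero: "?m t0 = 0" unfolding m_eq t0(2) z0(2) by simp
    obtain D1 where D1: "(ml_kernel \<alpha> a has_real_derivative D1) (at t0)" using DERIV_ml_kernel[OF \<alpha> t0(1)] .
    obtain D2 where D2: "(ml_kernel \<alpha> b has_real_derivative D2) (at t0)" using DERIV_ml_kernel[OF \<alpha> t0(1)] .
    let ?F = "\<lambda>t. Gamma (1 - \<alpha>) * mittag_leffler \<alpha> 1 (- (a * t powr \<alpha>)) - Gamma (1 - \<alpha>) * mittag_leffler \<alpha> 1 (- (b * t powr \<alpha>))"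
    have "(?F has_real_derivative
       Gamma (1 - \<alpha>) * (- a * ml_kernel \<alpha> a t0) - Gamma (1 - \<alpha>) * (- b * ml_kernel \<alpha> b t0)) (at t0)"
      by (intro DERIV_diff DERIV_cmult DERIV_mittag_leffler_powr[OF \<alpha> t0(1)])
    then have "Gamma (1 - \<alpha>) * (- a * ml_kernel \<alpha> a t0) - Gamma (1 - \<alpha>) * (- b * ml_kernel \<alpha> b t0) < 0"
    proof (rule fractional_integral_first_zero[OF \<alpha> t0(1) _ _ zero DERIV_diff[OF D1 D2], rotated 3])
      show "?m \<in> borel_measurable borel" using borel_ml_kernel[OF \<alpha>] by (intro borel_measurable_diff)
      fix \<tau> assume \<tau>: "0 < \<tau>" "\<tau> < t0"
      then have "\<tau> powr \<alpha> < z0" using \<alpha> t0 powr_less_mono2[of \<alpha> \<tau> t0] by simp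
      then show "0 < ?m \<tau>" unfolding m_eq using \<tau> z0(3)[of "\<tau> powr \<alpha>"] by simp
    next
      fix t :: real assume t: "0 < t"
      show "has_bochner_integral lborel (\<lambda>\<tau>. indicator {0<..<t} \<tau> * ((t - \<tau>) powr (- \<alpha>) * ?m \<tau>)) (?F t)"
        using has_bochner_integral_diff[OF ml_kernel_fractional_integral[OF \<alpha> t, of a] ml_kernel_fractional_integral[OF \<alpha> t, of b]]
        by (simp add: algebra_simps)
    qed
    moreover have "ml_kernel \<alpha> a t0 = ml_kernel \<alpha> b t0" using zero by simp
    moreover have "0 < ml_kernel \<alpha> b t0" using ml_kernel_pos[OF \<alpha> _ t0(1), of b] ab by simp
    moreover have "0 < Gamma (1 - \<alpha>)" using \<alpha> by (intro Gamma_real_pos) simp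
    ultimately have "Gamma (1 - \<alpha>) * ((b - a) * ml_kernel \<alpha> b t0) < 0" "0 < Gamma (1 - \<alpha>) * ((b - a) * ml_kernel \<alpha> b t0)"
      using ab by (simp_all add: algebra_simps)
    then show False by simp
  qed
  then show ?thesis using diff[of 1] by simp
qed

lemma ml_kernel_antimono:
  fixes \<alpha> a b s t :: real
  assumes \<alpha>: "0 < \<alpha>" "\<alpha> < 1" and ab: "0 \<le> a" "a \<le> b" and st: "0 < s" "s \<le> t"
  shows "ml_kernel \<alpha> b t \<le> ml_kernel \<alpha> a s"
proof -
  have "a * s powr \<alpha> \<le> b * t powr \<alpha>" using assms by (intro mult_mono powr_mono2) auto
  then have "mittag_leffler \<alpha> \<alpha> (- (b * t powr \<alpha>)) \<le> mittag_leffler \<alpha> \<alpha> (- (a * s powr \<alpha>))"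
    using mittag_leffler_diag_antimono[OF \<alpha>, of "a * s powr \<alpha>" "b * t powr \<alpha>"] assms
    by (cases "a * s powr \<alpha> = b * t powr \<alpha>") auto
  moreover have "t powr (\<alpha> - 1) \<le> s powr (\<alpha> - 1)" using assms by (intro powr_mono2') auto
  moreover have "0 < mittag_leffler \<alpha> \<alpha> (- (b * t powr \<alpha>))" using assms by (intro mittag_leffler_diag_pos) auto
  ultimately show ?thesis unfolding ml_kernel_def by (intro mult_mono) auto
qed

lemma mittag_leffler_1_nonneg:
  fixes \<alpha> z :: real
  assumes \<alpha>: "0 < \<alpha>" "\<alpha> < 1" and z: "0 \<le> z"
  shows "0 \<le> mittag_leffler \<alpha> 1 (- z)"
proof -
  have "0 \<le> (\<integral>\<tau>. indicator {0<..<1} \<tau> * ((1 - \<tau>) powr (- \<alpha>) * ml_kernel \<alpha> z \<tau>) \<partial>lborel)"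
    using ml_kernel_pos[OF \<alpha> z] by (intro Bochner_Integration.integral_nonneg) (auto simp: indicator_def less_imp_le)
  then have "0 \<le> Gamma (1 - \<alpha>) * mittag_leffler \<alpha> 1 (- z)"
    using has_bochner_integral_integral_eq[OF ml_kernel_fractional_integral[OF \<alpha>, of 1 z]] by simp
  moreover have "0 < Gamma (1 - \<alpha>)" using \<alpha> by (intro Gamma_real_pos) simp
  ultimately show ?thesis by (simp add: zero_le_mult_iff)
qed

text \<open>Chebyshev's inequality for the increasing function \<open>\<tau> \<mapsto> ml_kernel \<alpha> l (t - \<tau>)\<close> and the
  decreasing function \<open>\<tau> \<mapsto> \<tau> powr - a\<close>; \<open>c\<close> is where the latter takes its mean value.\<close>

lemma ml_kernel_singular_bound:
  fixes \<alpha> l t a :: real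
  assumes \<alpha>: "0 < \<alpha>" "\<alpha> < 1" and l: "0 < l" and t: "0 < t" and a: "0 < a" "a < 1"
  shows "(\<integral>\<tau>. indicator {0<..<t} \<tau> * (ml_kernel \<alpha> l (t - \<tau>) * \<tau> powr (- a)) \<partial>lborel) \<le> t powr (- a) / (l * (1 - a))"
proof -
  define g where "g = t powr (- a) / (1 - a)"
  define c where "c = t * (1 - a) powr (1 / a)"
  have c: "0 < c" "c < t" "c powr (- a) = g"
  proof -
    have "(1 - a) powr (1 / a) < 1 powr (1 / a)" using a by (intro powr_less_mono2) auto
    then show "0 < c" "c < t" using t a by (auto simp: c_def)
    show "c powr (- a) = g"
      using t a by (simp add: c_def g_def powr_mult powr_powr powr_minus_divide)
  qed
  let ?k = "\<lambda>\<tau>. ml_kernel \<alpha> l (t - \<tau>)"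
  have i1: "integrable lborel (\<lambda>\<tau>. indicator {0<..<t} \<tau> * (?k \<tau> * \<tau> powr (- a)))"
    using ml_kernel_powr_convolution[OF \<alpha> t, of "1 - a" l] a by (simp add: has_bochner_integral_iff)
  have i2: "has_bochner_integral lborel (\<lambda>\<tau>. indicator {0<..<t} \<tau> * ?k \<tau>) ((1 - mittag_leffler \<alpha> 1 (- (l * t powr \<alpha>))) / l)"
    using ml_kernel_integral[OF \<alpha> t] l by simp
  have i3: "has_bochner_integral lborel (\<lambda>\<tau>. indicator {0<..<t} \<tau> * \<tau> powr (- a)) (t * g)"
    using powr_kernel_aux[of "1 - a" t] a t powr_add[of t 1 "- a"] by (simp add: g_def)
  have i4: "has_bochner_integral lborel (\<lambda>\<tau>. indicator {0<..<t} \<tau> * g) (t * g)"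
  proof -
    have "has_bochner_integral lborel (indicator {0<..<t} :: real \<Rightarrow> real) (measure lborel {0<..<t})"
      using t by (intro has_bochner_integral_real_indicator) auto
    from has_bochner_integral_mult_left[of g, OF this] show ?thesis using t by simp
  qed
  \<comment> \<open>This is the expanded form of (k(\<tau>) - k(c)) (\<tau>^(-a) - g) \<le> 0, where
    both factors change sign at c, in opposite directions. After integration the term with k(c)
    disappears, because g is the mean of \<tau>^(-a) over (0, t).\<close>
  have le: "indicator {0<..<t} \<tau> * (?k \<tau> * \<tau> powr (- a))
     \<le> g * (indicator {0<..<t} \<tau> * ?k \<tau>) + ?k c * (indicator {0<..<t} \<tau> * \<tau> powr (- a) - indicator {0<..<t} \<tau> * g)" for \<tau>
  proof (cases "0 < \<tau> \<and> \<tau> < t")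
    case True
    have "(?k \<tau> - ?k c) * (\<tau> powr (- a) - g) \<le> 0"
    proof (cases "\<tau> \<le> c")
      case le: True
      have "?k \<tau> \<le> ?k c" using True le c l by (intro ml_kernel_antimono[OF \<alpha>]) auto
      moreover have "g \<le> \<tau> powr (- a)" unfolding c(3)[symmetric] using True le a by (intro powr_mono2') auto
      ultimately show ?thesis by (intro mult_nonpos_nonneg) auto
    next
      case False
      have "?k c \<le> ?k \<tau>" using True False c l by (intro ml_kernel_antimono[OF \<alpha>]) auto
      moreover have "\<tau> powr (- a) \<le> g" unfolding c(3)[symmetric] using True False c a by (intro powr_mono2') auto
      ultimately show ?thesis by (intro mult_nonneg_nonpos) auto
    qed
    then show ?thesis using True by (simp add: algebra_simps)
  qed (auto simp: indicator_def)
  have b: "has_bochner_integral lborel (\<lambda>\<tau>. g * (indicator {0<..<t} \<tau> * ?k \<tau>) + ?k c * (indicator {0<..<t} \<tau> * \<tau> powr (- a) - indicator {0<..<t} \<tau> * g))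
     (g * ((1 - mittag_leffler \<alpha> 1 (- (l * t powr \<alpha>))) / l) + ?k c * (t * g - t * g))"
    by (intro has_bochner_integral_add has_bochner_integral_mult_right has_bochner_integral_diff i2 i3 i4)
  have "(\<integral>\<tau>. indicator {0<..<t} \<tau> * (?k \<tau> * \<tau> powr (- a)) \<partial>lborel)
     \<le> g * ((1 - mittag_leffler \<alpha> 1 (- (l * t powr \<alpha>))) / l)"
    using integral_mono[of lborel, OF i1 integrable.intros[OF b] le] has_bochner_integral_integral_eq[OF b] by simp
  also have "\<dots> \<le> g * (1 / l)"
    using mittag_leffler_1_nonneg[OF \<alpha>, of "l * t powr \<alpha>"] l a
    by (intro mult_left_mono divide_right_mono) (auto simp: g_def)
  finally show ?thesis by (simp add: g_def field_simps)
qed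

section \<open>Orthonormal expansions\<close>

lemma L2_iff: "f \<in> L2 \<Omega> \<longleftrightarrow> f \<in> borel_measurable (lebesgue_on \<Omega>) \<and> integrable (lebesgue_on \<Omega>) (\<lambda>x. (f x)\<^sup>2)"
  by (simp add: Lp_def)

lemma L2_norm_eq: "L2_norm \<Omega> f = sqrt (L2_inner \<Omega> f f)"
  by (simp add: Lp_norm_def L2_inner_def power2_eq_square[symmetric] powr_half_sqrt integral_nonneg)

lemma L2_inner_commute: "L2_inner \<Omega> f g = L2_inner \<Omega> g f"
  by (simp add: L2_inner_def mult.commute)

lemma L2_inner_self_nonneg: "0 \<le> L2_inner \<Omega> f f"
  by (simp add: L2_inner_def)

lemma L2_norm_nonneg: "0 \<le> L2_norm \<Omega> f"
  by (simp add: L2_norm_eq L2_inner_self_nonneg)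

lemma L2_norm_square: "(L2_norm \<Omega> f)\<^sup>2 = L2_inner \<Omega> f f"
  by (simp add: L2_norm_eq L2_inner_self_nonneg)

lemma L2_norm_square_integral: "(L2_norm \<Omega> f)\<^sup>2 = (\<integral>x. (f x)\<^sup>2 \<partial>lebesgue_on \<Omega>)"
  unfolding L2_norm_square by (simp add: L2_inner_def power2_eq_square)

lemma L2_measurable: "f \<in> L2 \<Omega> \<Longrightarrow> f \<in> borel_measurable (lebesgue_on \<Omega>)"
  by (simp add: L2_iff)

lemma L2_mult_integrable:
  assumes "f \<in> L2 \<Omega>" "g \<in> L2 \<Omega>"
  shows "integrable (lebesgue_on \<Omega>) (\<lambda>x. f x * g x)"
proof (rule Bochner_Integration.integrable_bound)
  show "integrable (lebesgue_on \<Omega>) (\<lambda>x. (f x)\<^sup>2 + (g x)\<^sup>2)"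
    using assms by (auto simp: L2_iff)
  show "(\<lambda>x. f x * g x) \<in> borel_measurable (lebesgue_on \<Omega>)"
    using assms by (auto simp: L2_iff)
  have "\<bar>a * b\<bar> \<le> a\<^sup>2 + b\<^sup>2" for a b :: real
  proof -
    have "2 * (\<bar>a\<bar> * \<bar>b\<bar>) \<le> a\<^sup>2 + b\<^sup>2"
      using sum_squares_bound[of "\<bar>a\<bar>" "\<bar>b\<bar>"] by (simp add: mult.assoc)
    moreover have "0 \<le> \<bar>a\<bar> * \<bar>b\<bar>" by simp
    ultimately show ?thesis unfolding abs_mult by linarith
  qed
  then show "AE x in lebesgue_on \<Omega>. norm (f x * g x) \<le> norm ((f x)\<^sup>2 + (g x)\<^sup>2)"
    by (auto intro: order_trans[OF _ abs_ge_self])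
qed

lemma L2_lincomb:
  assumes "f \<in> L2 \<Omega>" "g \<in> L2 \<Omega>"
  shows "(\<lambda>x. a * f x + b * g x) \<in> L2 \<Omega>"
proof -
  have "(a * f x + b * g x)\<^sup>2 = a\<^sup>2 * (f x)\<^sup>2 + 2 * a * b * (f x * g x) + b\<^sup>2 * (g x)\<^sup>2" for x
    by (simp add: power2_eq_square algebra_simps)
  then show ?thesis using assms L2_mult_integrable[OF assms] by (auto simp: L2_iff)
qed

lemma L2_zero: "(\<lambda>_. 0) \<in> L2 \<Omega>"
  by (simp add: L2_iff)

lemma L2_scale: "f \<in> L2 \<Omega> \<Longrightarrow> (\<lambda>x. a * f x) \<in> L2 \<Omega>"
  using L2_lincomb[of f \<Omega> f a 0] by simp

lemma L2_add: "f \<in> L2 \<Omega> \<Longrightarrow> g \<in> L2 \<Omega> \<Longrightarrow> (\<lambda>x. f x + g x) \<in> L2 \<Omega>"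
  using L2_lincomb[of f \<Omega> g 1 1] by simp

lemma L2_diff: "f \<in> L2 \<Omega> \<Longrightarrow> g \<in> L2 \<Omega> \<Longrightarrow> (\<lambda>x. f x - g x) \<in> L2 \<Omega>"
  using L2_lincomb[of f \<Omega> g 1 "-1"] by simp

lemma L2_sum: "(\<And>j. j \<in> I \<Longrightarrow> f j \<in> L2 \<Omega>) \<Longrightarrow> (\<lambda>x. \<Sum>j\<in>I. f j x) \<in> L2 \<Omega>"
  by (induction I rule: infinite_finite_induct) (auto simp: L2_zero L2_add)

lemma L2_inner_lincomb_left:
  assumes "f \<in> L2 \<Omega>" "g \<in> L2 \<Omega>" "h \<in> L2 \<Omega>"
  shows "L2_inner \<Omega> (\<lambda>x. a * f x + b * g x) h = a * L2_inner \<Omega> f h + b * L2_inner \<Omega> g h"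
  using L2_mult_integrable[OF assms(1,3)] L2_mult_integrable[OF assms(2,3)]
  by (simp add: L2_inner_def distrib_right mult.assoc)

lemma L2_inner_scale_left: "L2_inner \<Omega> (\<lambda>x. a * f x) h = a * L2_inner \<Omega> f h"
  by (simp add: L2_inner_def mult.assoc)

lemma L2_inner_add_left:
  "f \<in> L2 \<Omega> \<Longrightarrow> g \<in> L2 \<Omega> \<Longrightarrow> h \<in> L2 \<Omega> \<Longrightarrow> L2_inner \<Omega> (\<lambda>x. f x + g x) h = L2_inner \<Omega> f h + L2_inner \<Omega> g h"
  using L2_inner_lincomb_left[of f \<Omega> g h 1 1] by simp

lemma L2_inner_diff_left:
  "f \<in> L2 \<Omega> \<Longrightarrow> g \<in> L2 \<Omega> \<Longrightarrow> h \<in> L2 \<Omega> \<Longrightarrow> L2_inner \<Omega> (\<lambda>x. f x - g x) h = L2_inner \<Omega> f h - L2_inner \<Omega> g h"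
  using L2_inner_lincomb_left[of f \<Omega> g h 1 "-1"] by simp

lemma L2_inner_zero_left: "L2_inner \<Omega> (\<lambda>_. 0) h = 0"
  by (simp add: L2_inner_def)

lemma L2_inner_sum_left:
  assumes "\<And>j. j \<in> I \<Longrightarrow> f j \<in> L2 \<Omega>" "h \<in> L2 \<Omega>"
  shows "L2_inner \<Omega> (\<lambda>x. \<Sum>j\<in>I. f j x) h = (\<Sum>j\<in>I. L2_inner \<Omega> (f j) h)"
  using assms by (induction I rule: infinite_finite_induct) (auto simp: L2_inner_zero_left L2_inner_add_left L2_sum)

lemma L2_inner_square_lincomb:
  assumes "f \<in> L2 \<Omega>" "g \<in> L2 \<Omega>"
  shows "L2_inner \<Omega> (\<lambda>x. a * f x + b * g x) (\<lambda>x. a * f x + b * g x)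
     = a\<^sup>2 * L2_inner \<Omega> f f + 2 * a * b * L2_inner \<Omega> f g + b\<^sup>2 * L2_inner \<Omega> g g"
proof -
  let ?u = "\<lambda>x. a * f x + b * g x"
  have "L2_inner \<Omega> ?u ?u = a * L2_inner \<Omega> f ?u + b * L2_inner \<Omega> g ?u"
    by (rule L2_inner_lincomb_left[OF assms L2_lincomb[OF assms]])
  also have "L2_inner \<Omega> f ?u = a * L2_inner \<Omega> f f + b * L2_inner \<Omega> f g"
    using L2_inner_lincomb_left[OF assms assms(1)] by (simp add: L2_inner_commute)
  also have "L2_inner \<Omega> g ?u = a * L2_inner \<Omega> f g + b * L2_inner \<Omega> g g"
    using L2_inner_lincomb_left[OF assms assms(2)] by (simp add: L2_inner_commute)
  finally show ?thesis by (simp add: power2_eq_square algebra_simps)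
qed

lemma L2_Cauchy_Schwarz:
  assumes f: "f \<in> L2 \<Omega>" and g: "g \<in> L2 \<Omega>"
  shows "\<bar>L2_inner \<Omega> f g\<bar> \<le> L2_norm \<Omega> f * L2_norm \<Omega> g"
proof -
  define A B C where "A = L2_inner \<Omega> f f" "B = L2_inner \<Omega> f g" "C = L2_inner \<Omega> g g"
  have nn: "0 \<le> A" "0 \<le> C" by (simp_all add: A_B_C_def L2_inner_self_nonneg)
  have q: "0 \<le> a\<^sup>2 * A + 2 * a * b * B + b\<^sup>2 * C" for a b
    using L2_inner_square_lincomb[OF f g, of a b] L2_inner_self_nonneg[of \<Omega> "\<lambda>x. a * f x + b * g x"]
    by (simp add: A_B_C_def)
  have "B\<^sup>2 \<le> A * C"
  proof (cases "C = 0")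
    case True
    have "B = 0"
    proof (rule ccontr)
      assume "B \<noteq> 0"
      \<comment> \<open>With C = 0 these arguments make the quadratic form equal to A - (A + 1) =
        -1.\<close>
      then show False using q[of 1 "- (A + 1) / (2 * B)"] True nn by (simp add: field_simps)
    qed
    then show ?thesis using True by simp
  next
    case False
    then have "0 < C" using nn by simp
    have "0 \<le> C\<^sup>2 * A + 2 * C * (- B) * B + (- B)\<^sup>2 * C" by (rule q)
    also have "\<dots> = C * (A * C - B\<^sup>2)" by (simp add: power2_eq_square algebra_simps)
    finally show ?thesis using \<open>0 < C\<close> by (simp add: zero_le_mult_iff)
  qed
  then have "\<bar>B\<bar> \<le> sqrt (A * C)" by (rule real_le_rsqrt[of "\<bar>B\<bar>", simplified])
  then show ?thesis by (simp add: A_B_C_def L2_norm_eq real_sqrt_mult)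
qed

lemma L2_norm_scale: "L2_norm \<Omega> (\<lambda>x. a * f x) = \<bar>a\<bar> * L2_norm \<Omega> f"
proof -
  have "L2_inner \<Omega> (\<lambda>x. a * f x) (\<lambda>x. a * f x) = a\<^sup>2 * L2_inner \<Omega> f f"
    by (simp add: L2_inner_def power2_eq_square mult_ac flip: Bochner_Integration.integral_mult_right_zero)
  then show ?thesis by (simp add: L2_norm_eq real_sqrt_mult)
qed

lemma L2_norm_minus_commute: "L2_norm \<Omega> (\<lambda>x. f x - g x) = L2_norm \<Omega> (\<lambda>x. g x - f x)"
  using L2_norm_scale[of \<Omega> "-1" "\<lambda>x. g x - f x"] by simp

lemma L2_inner_cong_AE:
  assumes "f \<in> L2 \<Omega>" "g \<in> L2 \<Omega>" "h \<in> L2 \<Omega>" "AE x in lebesgue_on \<Omega>. f x = g x"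
  shows "L2_inner \<Omega> f h = L2_inner \<Omega> g h"
  unfolding L2_inner_def using assms(4)
  by (intro integral_cong_AE) (use assms(1-3)[THEN L2_measurable] in auto)

lemma L2_norm_eq_0D:
  assumes "f \<in> L2 \<Omega>" "L2_norm \<Omega> f = 0"
  shows "AE x in lebesgue_on \<Omega>. f x = 0"
proof -
  have "(\<integral>x. (f x)\<^sup>2 \<partial>lebesgue_on \<Omega>) = 0"
    using assms(2) by (simp add: L2_norm_eq L2_inner_def power2_eq_square)
  then have "AE x in lebesgue_on \<Omega>. (f x)\<^sup>2 = 0"
    using assms(1) by (subst (asm) integral_nonneg_eq_0_iff_AE) (auto simp: L2_iff)
  then show ?thesis by simp
qed

lemma finite_measure_lebesgue_on_bounded:
  assumes "open \<Omega>" "bounded (\<Omega> :: (real^'n) set)"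
  shows "finite_measure (lebesgue_on \<Omega>)"
  using assms by (intro finite_measure_lebesgue_on bounded_set_imp_lmeasurable) auto

section \<open>Parseval's identity and the Riesz-Fischer theorem\<close>

locale L2_basis =
  fixes \<Omega> :: "(real^'n) set" and e :: "nat \<Rightarrow> real^'n \<Rightarrow> real"
  assumes finite_\<Omega>: "finite_measure (lebesgue_on \<Omega>)" and basis: "orthonormal_basis \<Omega> e"
begin

definition cf :: "(real^'n \<Rightarrow> real) \<Rightarrow> nat \<Rightarrow> real" where "cf v j = L2_inner \<Omega> v (e j)"

text \<open>The inverse of \<open>cf\<close> on square summable sequences, up to equality almost
  everywhere. The value is a chosen representative, so identities between functions are proved
  through their coordinates.\<close>

definition synth :: "(nat \<Rightarrow> real) \<Rightarrow> real^'n \<Rightarrow> real" where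
  "synth c = L2_suminf \<Omega> (\<lambda>j x. c j * e j x)"

definition psum :: "(nat \<Rightarrow> real) \<Rightarrow> nat \<Rightarrow> real^'n \<Rightarrow> real" where
  "psum c n x = (\<Sum>j<n. c j * e j x)"

lemma e_L2: "e j \<in> L2 \<Omega>"
  using basis by (simp add: orthonormal_basis_def)

lemma inner_e: "L2_inner \<Omega> (e i) (e j) = (if i = j then 1 else 0)"
  using basis by (simp add: orthonormal_basis_def)

lemma cf_e: "cf (e i) j = (if i = j then 1 else 0)"
  by (simp add: cf_def inner_e)

lemma psum_L2: "psum c n \<in> L2 \<Omega>"
  unfolding psum_def[abs_def] by (intro L2_sum L2_scale e_L2)

lemma cf_lincomb: "f \<in> L2 \<Omega> \<Longrightarrow> g \<in> L2 \<Omega> \<Longrightarrow> cf (\<lambda>x. a * f x + b * g x) j = a * cf f j + b * cf g j"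
  unfolding cf_def by (intro L2_inner_lincomb_left e_L2)

lemma cf_diff: "f \<in> L2 \<Omega> \<Longrightarrow> g \<in> L2 \<Omega> \<Longrightarrow> cf (\<lambda>x. f x - g x) j = cf f j - cf g j"
  unfolding cf_def by (intro L2_inner_diff_left e_L2)

lemma cf_scale: "cf (\<lambda>x. a * f x) j = a * cf f j"
  unfolding cf_def by (rule L2_inner_scale_left)

lemma inner_psum: "v \<in> L2 \<Omega> \<Longrightarrow> L2_inner \<Omega> (psum c n) v = (\<Sum>j<n. c j * cf v j)"
  unfolding psum_def[abs_def]
  by (subst L2_inner_sum_left) (auto simp: L2_scale e_L2 L2_inner_scale_left cf_def L2_inner_commute[of \<Omega> v])

lemma cf_psum: "cf (psum c n) i = (if i < n then c i else 0)"
  by (simp add: cf_def inner_psum[OF e_L2] inner_e if_distrib[of "(*) _"] cf_e cong: if_cong)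

lemma norm_psum_square: "(L2_norm \<Omega> (psum c n))\<^sup>2 = (\<Sum>j<n. (c j)\<^sup>2)"
  unfolding L2_norm_square by (simp add: inner_psum[OF psum_L2] cf_psum power2_eq_square)

lemma norm_psum_diff_square: "m \<le> n \<Longrightarrow> (L2_norm \<Omega> (\<lambda>x. psum c n x - psum c m x))\<^sup>2 = (\<Sum>j=m..<n. (c j)\<^sup>2)"
proof -
  assume mn: "m \<le> n"
  have "(\<lambda>x. psum c n x - psum c m x) = psum (\<lambda>j. if j < m then 0 else c j) n"
  proof
    fix x
    have "psum c n x = psum c m x + (\<Sum>j=m..<n. c j * e j x)"
      using mn by (simp add: psum_def sum.atLeastLessThan_concat lessThan_atLeast0)
    moreover have "(\<Sum>j=m..<n. c j * e j x) = psum (\<lambda>j. if j < m then 0 else c j) n x"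
      unfolding psum_def by (rule sum.mono_neutral_cong_left) auto
    ultimately show "psum c n x - psum c m x = psum (\<lambda>j. if j < m then 0 else c j) n x" by simp
  qed
  moreover have "(\<Sum>j<n. (if j < m then 0 else c j)\<^sup>2) = (\<Sum>j=m..<n. (c j)\<^sup>2)"
    by (rule sum.mono_neutral_cong_right) auto
  ultimately show ?thesis by (simp add: norm_psum_square)
qed

lemma norm_remainder_square:
  assumes "v \<in> L2 \<Omega>"
  shows "(L2_norm \<Omega> (\<lambda>x. v x - psum (cf v) n x))\<^sup>2 = (L2_norm \<Omega> v)\<^sup>2 - (\<Sum>j<n. (cf v j)\<^sup>2)"
proof -
  have "L2_inner \<Omega> v (psum (cf v) n) = (\<Sum>j<n. (cf v j)\<^sup>2)"
    by (subst L2_inner_commute) (simp add: inner_psum[OF assms] power2_eq_square)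
  moreover have "L2_inner \<Omega> (psum (cf v) n) (psum (cf v) n) = (\<Sum>j<n. (cf v j)\<^sup>2)"
    using norm_psum_square[of "cf v" n] by (simp add: L2_norm_square)
  ultimately show ?thesis
    using L2_inner_square_lincomb[OF assms psum_L2[of "cf v" n], of 1 "-1"]
    by (simp add: L2_norm_square)
qed

lemma parseval:
  assumes "v \<in> L2 \<Omega>"
  shows "(\<lambda>j. (cf v j)\<^sup>2) sums (L2_norm \<Omega> v)\<^sup>2"
proof -
  have "(\<lambda>n. L2_norm \<Omega> (\<lambda>x. v x - psum (cf v) n x)) \<longlonglongrightarrow> 0"
    using basis assms by (simp add: orthonormal_basis_def L2_sums_def psum_def cf_def)
  then have "(\<lambda>n. (L2_norm \<Omega> v)\<^sup>2 - (L2_norm \<Omega> (\<lambda>x. v x - psum (cf v) n x))\<^sup>2) \<longlonglongrightarrow> (L2_norm \<Omega> v)\<^sup>2 - 0\<^sup>2"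
    by (intro tendsto_intros)
  then show ?thesis by (simp add: norm_remainder_square[OF assms] sums_def)
qed

lemma summable_cf: "v \<in> L2 \<Omega> \<Longrightarrow> summable (\<lambda>j. (cf v j)\<^sup>2)"
  by (rule sums_summable[OF parseval])

lemma parseval_inner:
  assumes v: "v \<in> L2 \<Omega>" and w: "w \<in> L2 \<Omega>"
  shows "(\<lambda>j. cf v j * cf w j) sums L2_inner \<Omega> v w"
proof -
  have "(\<lambda>j. ((cf (\<lambda>x. 1 * v x + 1 * w x) j)\<^sup>2 - (cf v j)\<^sup>2 - (cf w j)\<^sup>2) / 2)
     sums (((L2_norm \<Omega> (\<lambda>x. 1 * v x + 1 * w x))\<^sup>2 - (L2_norm \<Omega> v)\<^sup>2 - (L2_norm \<Omega> w)\<^sup>2) / 2)"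
    by (intro sums_divide sums_diff parseval[OF L2_lincomb[OF v w]] parseval[OF v] parseval[OF w])
  moreover have "((cf (\<lambda>x. 1 * v x + 1 * w x) j)\<^sup>2 - (cf v j)\<^sup>2 - (cf w j)\<^sup>2) / 2 = cf v j * cf w j" for j
    unfolding cf_lincomb[OF v w] by (simp add: power2_eq_square algebra_simps)
  moreover have "((L2_norm \<Omega> (\<lambda>x. 1 * v x + 1 * w x))\<^sup>2 - (L2_norm \<Omega> v)\<^sup>2 - (L2_norm \<Omega> w)\<^sup>2) / 2 = L2_inner \<Omega> v w"
    unfolding L2_norm_square L2_inner_square_lincomb[OF v w] by simp
  ultimately show ?thesis by simp
qed

lemma AE_eq_if_cf_eq:
  assumes v: "v \<in> L2 \<Omega>" and w: "w \<in> L2 \<Omega>" and eq: "\<And>j. cf v j = cf w j"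
  shows "AE x in lebesgue_on \<Omega>. v x = w x"
proof -
  have "(\<lambda>j. (cf (\<lambda>x. v x - w x) j)\<^sup>2) sums (L2_norm \<Omega> (\<lambda>x. v x - w x))\<^sup>2"
    by (rule parseval[OF L2_diff[OF v w]])
  then have "(\<lambda>j. 0) sums (L2_norm \<Omega> (\<lambda>x. v x - w x))\<^sup>2" by (simp add: cf_diff[OF v w] eq)
  from sums_unique2[OF this sums_zero] have "L2_norm \<Omega> (\<lambda>x. v x - w x) = 0" by simp
  from L2_norm_eq_0D[OF L2_diff[OF v w] this] show ?thesis by simp
qed

text \<open>The completeness argument: a subsequence of partial sums with geometrically small
  increments in L2 also has them in L1, because the measure is finite. Hence it converges almost
  everywhere, and Fatou's lemma shows that the pointwise limit is the limit in L2 of all partial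
  sums.\<close>

lemma riesz_fischer:
  assumes c: "summable (\<lambda>j. (c j)\<^sup>2)"
  obtains w where "L2_sums \<Omega> (\<lambda>j x. c j * e j x) w"
proof -
  interpret finite_measure "lebesgue_on \<Omega>" by (rule finite_\<Omega>)
  define tail where "tail n = (\<Sum>j. (c (j + n))\<^sup>2)" for n
  have tail_nn: "0 \<le> tail n" for n unfolding tail_def using c by (intro suminf_nonneg) (auto simp: summable_iff_shift[of "\<lambda>j. (c j)\<^sup>2"])
  have seg: "(\<Sum>j=m..<n. (c j)\<^sup>2) \<le> tail m" for m n
  proof -
    have "(\<Sum>j=m..<n. (c j)\<^sup>2) = (\<Sum>j<n - m. (c (j + m))\<^sup>2)"
      by (rule sum.reindex_bij_witness[of _ "\<lambda>j. j + m" "\<lambda>j. j - m"]) auto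
    also have "\<dots> \<le> tail m"
      unfolding tail_def using c by (intro sum_le_suminf) (auto simp: summable_iff_shift[of "\<lambda>j. (c j)\<^sup>2"])
    finally show ?thesis .
  qed
  have tail_lim: "tail \<longlonglongrightarrow> 0"
    unfolding tail_def using suminf_exist_split2[OF c] by simp
  have diff_le: "(L2_norm \<Omega> (\<lambda>x. psum c n x - psum c m x))\<^sup>2 \<le> tail (min m n)" for m n
  proof (cases "m \<le> n")
    case True
    then show ?thesis using seg by (simp add: norm_psum_diff_square)
  next
    case False
    then show ?thesis using seg norm_psum_diff_square[of n m c] by (subst L2_norm_minus_commute) simp
  qed
  have "\<exists>n. tail n \<le> (1/4) ^ k" for k
  proof -
    have "\<forall>\<^sub>F n in sequentially. tail n < (1/4) ^ k" using tail_lim by (rule order_tendstoD) simp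
    then obtain m where "tail m < (1/4) ^ k" by (auto simp: eventually_sequentially)
    then show ?thesis by (intro exI[of _ m]) simp
  qed
  \<comment> \<open>Tails of size 4^(-k) are squared norms, so the increments \<open>D k\<close>
    have norm at most 2^(-k).\<close>
  then obtain N where N: "\<And>k. tail (N k) \<le> (1/4) ^ k" by metis
  define S where "S k = psum c (N k)" for k
  have S_L2: "S k \<in> L2 \<Omega>" for k by (simp add: S_def psum_L2)
  have [measurable]: "S k \<in> borel_measurable (lebesgue_on \<Omega>)" for k using S_L2 by (rule L2_measurable)
  define D where "D k x = S (Suc k) x - S k x" for k x
  have D_L2: "D k \<in> L2 \<Omega>" for k unfolding D_def by (rule L2_diff[OF S_L2 S_L2])
  have [measurable]: "D k \<in> borel_measurable (lebesgue_on \<Omega>)" for k using D_L2 by (rule L2_measurable)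
  have one_L2: "(\<lambda>x. 1) \<in> L2 \<Omega>" by (simp add: L2_iff)
  define A where "A = L2_norm \<Omega> (\<lambda>x. 1)"
  have D_norm: "L2_norm \<Omega> (D k) \<le> (1/2) ^ k" for k
  proof (rule power2_le_imp_le)
    have "tail (min (N k) (N (Suc k))) \<le> (1/4) ^ k"
    proof -
      have "tail (N (Suc k)) \<le> (1/4) ^ k"
        using N[of "Suc k"] by (rule order_trans) (simp add: power_decreasing)
      then show ?thesis using N[of k] by (simp add: min_def)
    qed
    then show "(L2_norm \<Omega> (D k))\<^sup>2 \<le> ((1/2) ^ k)\<^sup>2"
    proof -
      have "((1/2 :: real) ^ k)\<^sup>2 = (1/4) ^ k" by (simp add: power2_eq_square power_mult_distrib[symmetric])
      then show ?thesis
        using diff_le[of "N (Suc k)" "N k"] \<open>tail (min (N k) (N (Suc k))) \<le> (1/4) ^ k\<close>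
        by (simp add: D_def[abs_def] S_def)
    qed
  qed simp
  have D_int: "(\<integral>\<^sup>+x. ennreal \<bar>D k x\<bar> \<partial>lebesgue_on \<Omega>) \<le> ennreal (A * (1/2) ^ k)" for k
  proof -
    have absD: "(\<lambda>x. \<bar>D k x\<bar>) \<in> L2 \<Omega>" using D_L2[of k] by (simp add: L2_iff)
    have i: "integrable (lebesgue_on \<Omega>) (\<lambda>x. \<bar>D k x\<bar>)" using L2_mult_integrable[OF absD one_L2] by simp
    have "(\<integral>x. \<bar>D k x\<bar> \<partial>lebesgue_on \<Omega>) = L2_inner \<Omega> (\<lambda>x. \<bar>D k x\<bar>) (\<lambda>x. 1)" by (simp add: L2_inner_def)
    also have "\<dots> \<le> L2_norm \<Omega> (\<lambda>x. \<bar>D k x\<bar>) * A"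
      unfolding A_def using L2_Cauchy_Schwarz[OF absD one_L2] by linarith
    also have "L2_norm \<Omega> (\<lambda>x. \<bar>D k x\<bar>) = L2_norm \<Omega> (D k)" by (simp add: Lp_norm_def)
    also have "L2_norm \<Omega> (D k) * A \<le> (1/2) ^ k * A" using D_norm by (intro mult_right_mono) (auto simp: A_def L2_norm_nonneg)
    finally show ?thesis by (subst nn_integral_eq_integral[OF i]) (auto simp: mult.commute intro!: ennreal_leI)
  qed
  have "(\<integral>\<^sup>+x. (\<Sum>k. ennreal \<bar>D k x\<bar>) \<partial>lebesgue_on \<Omega>) = (\<Sum>k. \<integral>\<^sup>+x. ennreal \<bar>D k x\<bar> \<partial>lebesgue_on \<Omega>)"
    by (rule nn_integral_suminf) measurable
  also have "\<dots> \<le> (\<Sum>k. ennreal (A * (1/2) ^ k))" by (intro suminf_le D_int) auto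
  also have "\<dots> = ennreal (\<Sum>k. A * (1/2) ^ k)"
    by (intro suminf_ennreal2 summable_mult summable_geometric) (auto simp: A_def L2_norm_nonneg)
  finally have fin: "(\<integral>\<^sup>+x. (\<Sum>k. ennreal \<bar>D k x\<bar>) \<partial>lebesgue_on \<Omega>) \<noteq> \<infinity>"
    by (auto simp: top_unique)
  have "AE x in lebesgue_on \<Omega>. (\<Sum>k. ennreal \<bar>D k x\<bar>) \<noteq> \<infinity>"
    by (rule nn_integral_noteq_infinite[OF _ fin]) measurable
  then have conv: "AE x in lebesgue_on \<Omega>. convergent (\<lambda>k. S k x)"
  proof eventually_elim
    case (elim x)
    then have "summable (\<lambda>k. \<bar>D k x\<bar>)" by (intro summable_suminf_not_top) auto
    then have "summable (\<lambda>k. D k x)" by (rule summable_rabs_cancel)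
    then have "convergent (\<lambda>n. \<Sum>k<n. D k x)" by (simp add: summable_iff_convergent)
    then have "convergent (\<lambda>n. S n x - S 0 x)"
      using sum_lessThan_telescope[of "\<lambda>k. S k x"] by (simp add: D_def)
    from convergent_add[OF this convergent_const[of "S 0 x"]] show ?case by simp
  qed
  define w where "w x = lim (\<lambda>k. S k x)" for x
  have w_meas[measurable]: "w \<in> borel_measurable (lebesgue_on \<Omega>)"
    unfolding w_def by (rule borel_measurable_lim_metric) measurable
  have [measurable]: "psum c n \<in> borel_measurable (lebesgue_on \<Omega>)" for n using psum_L2 by (rule L2_measurable)
  \<comment> \<open>Fatou along the subsequence, with n fixed: the remainder after n terms is
    compared with the tail of the coefficients.\<close>
  have key: "(\<integral>\<^sup>+x. ennreal ((w x - psum c n x)\<^sup>2) \<partial>lebesgue_on \<Omega>) \<le> ennreal (tail n)" for n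
  proof -
    have "(\<integral>\<^sup>+x. ennreal ((w x - psum c n x)\<^sup>2) \<partial>lebesgue_on \<Omega>)
       = (\<integral>\<^sup>+x. liminf (\<lambda>k. ennreal ((S k x - psum c n x)\<^sup>2)) \<partial>lebesgue_on \<Omega>)"
    proof (rule nn_integral_cong_AE)
      show "AE x in lebesgue_on \<Omega>. ennreal ((w x - psum c n x)\<^sup>2) = liminf (\<lambda>k. ennreal ((S k x - psum c n x)\<^sup>2))"
        using conv
      proof eventually_elim
        case (elim x)
        then have "(\<lambda>k. S k x) \<longlonglongrightarrow> w x" by (simp add: w_def convergent_LIMSEQ_iff)
        then have "(\<lambda>k. ennreal ((S k x - psum c n x)\<^sup>2)) \<longlonglongrightarrow> ennreal ((w x - psum c n x)\<^sup>2)"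
          by (intro tendsto_intros tendsto_ennrealI)
        then show ?case by (intro lim_imp_Liminf[symmetric]) auto
      qed
    qed
    also have "\<dots> \<le> liminf (\<lambda>k. \<integral>\<^sup>+x. ennreal ((S k x - psum c n x)\<^sup>2) \<partial>lebesgue_on \<Omega>)"
      by (rule nn_integral_liminf) measurable
    also have "\<dots> \<le> liminf (\<lambda>k. ennreal (tail n + (1/4) ^ k))"
    proof (intro Liminf_mono always_eventually allI)
      fix k
      have d: "(\<lambda>x. S k x - psum c n x) \<in> L2 \<Omega>" by (rule L2_diff[OF S_L2 psum_L2])
      have "(\<integral>\<^sup>+x. ennreal ((S k x - psum c n x)\<^sup>2) \<partial>lebesgue_on \<Omega>) = ennreal ((L2_norm \<Omega> (\<lambda>x. S k x - psum c n x))\<^sup>2)"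
        using d by (subst nn_integral_eq_integral) (auto simp: L2_iff L2_norm_square_integral)
      also have "\<dots> \<le> ennreal (tail (min n (N k)))" unfolding S_def by (intro ennreal_leI diff_le)
      \<comment> \<open>The minimum is one of the two indices, and the sum dominates the tail at
        either.\<close>
      also have "\<dots> \<le> ennreal (tail n + (1/4) ^ k)"
        using N[of k] tail_nn[of n] by (intro ennreal_leI) (auto simp: min_def)
      finally show "(\<integral>\<^sup>+x. ennreal ((S k x - psum c n x)\<^sup>2) \<partial>lebesgue_on \<Omega>) \<le> ennreal (tail n + (1/4) ^ k)" .
    qed
    also have "\<dots> = ennreal (tail n + 0)"
      by (intro lim_imp_Liminf tendsto_ennrealI tendsto_intros LIMSEQ_power_zero) auto
    finally show ?thesis by simp
  qed
  have r_L2: "(\<lambda>x. w x - psum c n x) \<in> L2 \<Omega>" for n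
  proof -
    have "integrable (lebesgue_on \<Omega>) (\<lambda>x. (w x - psum c n x)\<^sup>2)"
      using key[of n] by (intro integrableI_nonneg) (auto simp: top_unique less_top[symmetric])
    then show ?thesis by (auto simp: L2_iff)
  qed
  have r_norm: "(L2_norm \<Omega> (\<lambda>x. w x - psum c n x))\<^sup>2 \<le> tail n" for n
  proof -
    have "ennreal ((L2_norm \<Omega> (\<lambda>x. w x - psum c n x))\<^sup>2) \<le> ennreal (tail n)"
      using key[of n] r_L2[of n] by (subst (asm) nn_integral_eq_integral) (auto simp: L2_iff L2_norm_square_integral)
    then show ?thesis using tail_nn by (simp add: ennreal_le_iff)
  qed
  have "w \<in> L2 \<Omega>" using L2_add[OF r_L2[of 0] psum_L2[of c 0]] by simp
  moreover have "(\<lambda>n. L2_norm \<Omega> (\<lambda>x. w x - psum c n x)) \<longlonglongrightarrow> 0"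
  proof -
    have "(\<lambda>n. (L2_norm \<Omega> (\<lambda>x. w x - psum c n x))\<^sup>2) \<longlonglongrightarrow> 0"
      using r_norm by (intro tendsto_sandwich[OF _ _ tendsto_const tail_lim] always_eventually) auto
    from tendsto_real_sqrt[OF this] show ?thesis by (simp add: L2_norm_nonneg)
  qed
  ultimately have "L2_sums \<Omega> (\<lambda>j x. c j * e j x) w"
    by (simp add: L2_sums_def psum_def L2_scale e_L2)
  then show ?thesis by (rule that)
qed

lemma cf_L2_sums:
  assumes "L2_sums \<Omega> (\<lambda>j x. c j * e j x) w"
  shows "cf w i = c i"
proof -
  have w: "w \<in> L2 \<Omega>" and lim: "(\<lambda>n. L2_norm \<Omega> (\<lambda>x. w x - psum c n x)) \<longlonglongrightarrow> 0"
    using assms by (auto simp: L2_sums_def psum_def)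
  have "(\<lambda>n. cf w i - cf (psum c n) i) \<longlonglongrightarrow> 0"
  proof (rule tendsto_0_le[OF lim, of _ 1], intro always_eventually allI)
    fix n
    have "\<bar>cf (\<lambda>x. w x - psum c n x) i\<bar> \<le> L2_norm \<Omega> (\<lambda>x. w x - psum c n x) * L2_norm \<Omega> (e i)"
      unfolding cf_def by (rule L2_Cauchy_Schwarz[OF L2_diff[OF w psum_L2] e_L2])
    then show "norm (cf w i - cf (psum c n) i) \<le> norm (L2_norm \<Omega> (\<lambda>x. w x - psum c n x)) * 1"
      by (simp add: cf_diff[OF w psum_L2] L2_norm_eq[of \<Omega> "e i"] inner_e L2_norm_nonneg)
  qed
  moreover have "(\<lambda>n. cf w i - cf (psum c n) i) \<longlonglongrightarrow> cf w i - c i"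
    by (rule tendsto_eventually) (auto simp: cf_psum eventually_sequentially intro!: exI[of _ "Suc i"])
  ultimately show ?thesis using LIMSEQ_unique by fastforce
qed

lemma L2_summable_iff: "L2_summable \<Omega> (\<lambda>j x. c j * e j x) \<longleftrightarrow> summable (\<lambda>j. (c j)\<^sup>2)"
proof
  assume "L2_summable \<Omega> (\<lambda>j x. c j * e j x)"
  then obtain w where w: "L2_sums \<Omega> (\<lambda>j x. c j * e j x) w" by (auto simp: L2_summable_def)
  then have "w \<in> L2 \<Omega>" by (simp add: L2_sums_def)
  from summable_cf[OF this] show "summable (\<lambda>j. (c j)\<^sup>2)" by (simp add: cf_L2_sums[OF w])
next
  assume "summable (\<lambda>j. (c j)\<^sup>2)"
  then show "L2_summable \<Omega> (\<lambda>j x. c j * e j x)" using riesz_fischer unfolding L2_summable_def by metis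
qed

lemma synth:
  assumes "summable (\<lambda>j. (c j)\<^sup>2)"
  shows synth_L2: "synth c \<in> L2 \<Omega>" and cf_synth: "cf (synth c) j = c j"
    and norm_synth: "(L2_norm \<Omega> (synth c))\<^sup>2 = (\<Sum>j. (c j)\<^sup>2)"
proof -
  have s: "L2_sums \<Omega> (\<lambda>j x. c j * e j x) (synth c)"
    unfolding synth_def L2_suminf_def using assms L2_summable_iff[of c] unfolding L2_summable_def by (rule someI_ex[OF iffD2, rotated])
  show L2: "synth c \<in> L2 \<Omega>" using s by (simp add: L2_sums_def)
  show "cf (synth c) j = c j" by (rule cf_L2_sums[OF s])
  show "(L2_norm \<Omega> (synth c))\<^sup>2 = (\<Sum>j. (c j)\<^sup>2)"
    using parseval[OF L2] by (simp add: cf_L2_sums[OF s] sums_iff)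
qed

end

section \<open>The solution operators in coordinates\<close>

text \<open>\<open>l2_bound c B\<close> is the statement \<open>\<parallel>c\<parallel> \<le> B\<close> in the space of square summable sequences.\<close>

definition l2_bound :: "(nat \<Rightarrow> real) \<Rightarrow> real \<Rightarrow> bool" where
  "l2_bound c B \<longleftrightarrow> (\<forall>n. L2_set c {..<n} \<le> B)"

lemma l2_bound_nonneg: "l2_bound c B \<Longrightarrow> 0 \<le> B"
  unfolding l2_bound_def by (metis L2_set_nonneg order_trans)

lemma l2_bound_mono: "l2_bound c A \<Longrightarrow> A \<le> B \<Longrightarrow> l2_bound c B"
  unfolding l2_bound_def by (meson order_trans)

lemma l2_bound_zero: "0 \<le> B \<Longrightarrow> l2_bound (\<lambda>_. 0) B"
  by (simp add: l2_bound_def L2_set_def)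

lemma l2_bound_abs_le:
  assumes "l2_bound b B" "\<And>j. \<bar>a j\<bar> \<le> \<bar>b j\<bar>"
  shows "l2_bound a B"
  unfolding l2_bound_def
proof
  fix n
  have "L2_set a {..<n} = L2_set (\<lambda>j. \<bar>a j\<bar>) {..<n}" by (simp add: L2_set_def)
  also have "\<dots> \<le> L2_set (\<lambda>j. \<bar>b j\<bar>) {..<n}" using assms(2) by (intro L2_set_mono) auto
  also have "\<dots> = L2_set b {..<n}" by (simp add: L2_set_def)
  also have "\<dots> \<le> B" using assms(1) by (simp add: l2_bound_def)
  finally show "L2_set a {..<n} \<le> B" .
qed

lemma l2_bound_scale:
  assumes "l2_bound c B"
  shows "l2_bound (\<lambda>j. a * c j) (\<bar>a\<bar> * B)"
  unfolding l2_bound_def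
proof
  fix n
  have "L2_set (\<lambda>j. a * c j) {..<n} = L2_set (\<lambda>j. \<bar>a\<bar> * c j) {..<n}"
    by (simp add: L2_set_def power_mult_distrib)
  also have "\<dots> = \<bar>a\<bar> * L2_set c {..<n}" by (rule L2_set_right_distrib[symmetric]) simp
  also have "\<dots> \<le> \<bar>a\<bar> * B" using assms by (intro mult_left_mono) (auto simp: l2_bound_def)
  finally show "L2_set (\<lambda>j. a * c j) {..<n} \<le> \<bar>a\<bar> * B" .
qed

lemma l2_bound_mult:
  assumes "l2_bound c B" "\<And>j. \<bar>m j\<bar> \<le> A"
  shows "l2_bound (\<lambda>j. m j * c j) (A * B)"
proof (rule l2_bound_abs_le)
  have "0 \<le> A" using assms(2)[of 0] by linarith
  then show "l2_bound (\<lambda>j. A * c j) (A * B)" using l2_bound_scale[OF assms(1), of A] by simp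
  show "\<bar>m j * c j\<bar> \<le> \<bar>A * c j\<bar>" for j
    using assms(2)[of j] \<open>0 \<le> A\<close> by (simp add: abs_mult mult_right_mono)
qed

lemma l2_bound_add:
  assumes "l2_bound a A" "l2_bound b B"
  shows "l2_bound (\<lambda>j. a j + b j) (A + B)"
  unfolding l2_bound_def
proof
  fix n
  have "L2_set (\<lambda>j. a j + b j) {..<n} \<le> L2_set a {..<n} + L2_set b {..<n}" by (rule L2_set_triangle_ineq)
  also have "\<dots> \<le> A + B" using assms by (intro add_mono) (auto simp: l2_bound_def)
  finally show "L2_set (\<lambda>j. a j + b j) {..<n} \<le> A + B" .
qed

lemma l2_bound_uminus: "l2_bound a A \<Longrightarrow> l2_bound (\<lambda>j. - a j) A"
  by (erule l2_bound_abs_le) simp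

lemma l2_bound_diff: "l2_bound a A \<Longrightarrow> l2_bound b B \<Longrightarrow> l2_bound (\<lambda>j. a j - b j) (A + B)"
  using l2_bound_add[of a A "\<lambda>j. - b j" B] l2_bound_uminus[of b B] by simp

lemma l2_bound_component: "l2_bound c B \<Longrightarrow> \<bar>c j\<bar> \<le> B"
proof -
  assume "l2_bound c B"
  then have "L2_set c {..<Suc j} \<le> B" unfolding l2_bound_def by blast
  moreover have "L2_set (\<lambda>j. \<bar>c j\<bar>) {..<Suc j} = L2_set c {..<Suc j}" by (simp only: L2_set_def power2_abs)
  moreover have "\<bar>c j\<bar> \<le> L2_set (\<lambda>j. \<bar>c j\<bar>) {..<Suc j}" by (rule member_le_L2_set) auto
  ultimately show ?thesis by simp
qed

lemma l2_bound_iff: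
  assumes "0 \<le> B"
  shows "l2_bound c B \<longleftrightarrow> summable (\<lambda>j. (c j)\<^sup>2) \<and> (\<Sum>j. (c j)\<^sup>2) \<le> B\<^sup>2"
proof -
  have "l2_bound c B \<longleftrightarrow> (\<forall>n. (\<Sum>j<n. (c j)\<^sup>2) \<le> B\<^sup>2)"
    unfolding l2_bound_def L2_set_def using assms
    by (metis real_sqrt_le_iff real_sqrt_abs abs_of_nonneg)
  also have "\<dots> \<longleftrightarrow> summable (\<lambda>j. (c j)\<^sup>2) \<and> (\<Sum>j. (c j)\<^sup>2) \<le> B\<^sup>2"
  proof safe
    assume *: "\<forall>n. (\<Sum>j<n. (c j)\<^sup>2) \<le> B\<^sup>2"
    show s: "summable (\<lambda>j. (c j)\<^sup>2)" by (rule summableI_nonneg_bounded) (use * in auto)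
    show "(\<Sum>j. (c j)\<^sup>2) \<le> B\<^sup>2" by (rule suminf_le_const[OF s]) (use * in auto)
  next
    fix n assume "summable (\<lambda>j. (c j)\<^sup>2)" "(\<Sum>j. (c j)\<^sup>2) \<le> B\<^sup>2"
    then show "(\<Sum>j<n. (c j)\<^sup>2) \<le> B\<^sup>2" using sum_le_suminf[of "\<lambda>j. (c j)\<^sup>2" "{..<n}"] by force
  qed
  finally show ?thesis .
qed

lemma l2_bound_sqrt: "summable (\<lambda>j. (c j)\<^sup>2) \<Longrightarrow> l2_bound c (sqrt (\<Sum>j. (c j)\<^sup>2))"
  by (subst l2_bound_iff) (auto simp: suminf_nonneg)

lemma l2_bound_summable: "l2_bound c B \<Longrightarrow> summable (\<lambda>j. (c j)\<^sup>2)"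
  using l2_bound_iff[of B c] l2_bound_nonneg by blast

text \<open>Only finite sections enter \<open>l2_bound\<close>, so coordinatewise convergence is
  enough for this lower semicontinuity of the norm.\<close>

lemma l2_bound_LIMSEQ:
  assumes "\<And>m. l2_bound (c m) (B m)" "\<And>j. (\<lambda>m. c m j) \<longlonglongrightarrow> d j" "B \<longlonglongrightarrow> A"
  shows "l2_bound d A"
  unfolding l2_bound_def
proof
  fix n
  have "(\<lambda>m. L2_set (c m) {..<n}) \<longlonglongrightarrow> L2_set d {..<n}"
    unfolding L2_set_def by (intro tendsto_intros assms(2))
  moreover have "\<forall>m. L2_set (c m) {..<n} \<le> B m" using assms(1) by (simp add: l2_bound_def)
  ultimately show "L2_set d {..<n} \<le> A" using assms(3) LIMSEQ_le by blast
qed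

text \<open>Minkowski's integral inequality; pairing \<open>(\<integral> f\<^sub>j)\<^sub>j\<close> with itself reduces it to Cauchy--Schwarz under the integral.\<close>

lemma l2_bound_integral:
  fixes f :: "nat \<Rightarrow> 'a \<Rightarrow> real"
  assumes f[measurable]: "\<And>j. f j \<in> borel_measurable M"
    and bound: "AE x in M. l2_bound (\<lambda>j. f j x) (g x)" and g: "integrable M g"
  shows "integrable M (f j)" and "l2_bound (\<lambda>j. \<integral>x. f j x \<partial>M) (\<integral>x. g x \<partial>M)"
proof -
  show int: "integrable M (f j)" for j
  proof (rule Bochner_Integration.integrable_bound[OF g])
    show "AE x in M. norm (f j x) \<le> norm (g x)"
      using bound by eventually_elim (auto dest!: l2_bound_component[of _ _ j])
  qed simp
  show "l2_bound (\<lambda>j. \<integral>x. f j x \<partial>M) (\<integral>x. g x \<partial>M)"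
    unfolding l2_bound_def
  proof
    fix n
    define v where "v j = (\<integral>x. f j x \<partial>M)" for j
    define S where "S = L2_set v {..<n}"
    have S: "0 \<le> S" by (simp add: S_def)
    have "S\<^sup>2 = (\<Sum>j<n. v j * v j)" by (simp add: S_def L2_set_def sum_nonneg power2_eq_square)
    also have "\<dots> = (\<integral>x. (\<Sum>j<n. v j * f j x) \<partial>M)"
      using int by (subst Bochner_Integration.integral_sum) (auto simp: v_def)
    also have "\<dots> \<le> (\<integral>x. S * g x \<partial>M)"
    proof (rule integral_mono_AE)
      show "integrable M (\<lambda>x. \<Sum>j<n. v j * f j x)" using int by auto
      show "integrable M (\<lambda>x. S * g x)" using g by auto
      show "AE x in M. (\<Sum>j<n. v j * f j x) \<le> S * g x"
        using bound
      proof eventually_elim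
        case (elim x)
        have "(\<Sum>j<n. v j * f j x) \<le> (\<Sum>j<n. \<bar>v j\<bar> * \<bar>f j x\<bar>)" by (intro sum_mono) (simp add: abs_mult[symmetric])
        also have "\<dots> \<le> S * L2_set (\<lambda>j. f j x) {..<n}" unfolding S_def by (rule L2_set_mult_ineq)
        also have "\<dots> \<le> S * g x" using elim S by (intro mult_left_mono) (auto simp: l2_bound_def)
        finally show ?case .
      qed
    qed
    finally have "S * S \<le> S * (\<integral>x. g x \<partial>M)" by (simp add: power2_eq_square)
    moreover have "0 \<le> (\<integral>x. g x \<partial>M)"
      using bound by (intro integral_nonneg_AE) (auto dest: l2_bound_nonneg)
    ultimately have "S \<le> (\<integral>x. g x \<partial>M)"
      using S by (cases "S = 0") (auto dest: mult_left_le_imp_le)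
    then show "L2_set (\<lambda>j. \<integral>x. f j x \<partial>M) {..<n} \<le> (\<integral>x. g x \<partial>M)"
      unfolding S_def v_def .
  qed
qed

text \<open>Allows the decay 1/(1 + z) to be spent as z^(-\<theta>) for any \<theta> in [0, 1]; this
  is how spatial weights are exchanged for powers of time.\<close>

lemma powr_le_1_plus:
  fixes x \<theta> :: real
  assumes "0 \<le> x" "0 \<le> \<theta>" "\<theta> \<le> 1"
  shows "x powr \<theta> \<le> 1 + x"
proof (cases "x \<le> 1")
  case True
  then have "x powr \<theta> \<le> 1" using assms by (intro powr_le1) auto
  then show ?thesis using assms by simp
next
  case False
  then have "x powr \<theta> \<le> x powr 1" using assms by (intro powr_mono) auto
  then show ?thesis using assms by simp
qed

text \<open>In coordinates \<open>\<mu> j\<close> stands for \<open>\<lambda>\<^sub>j\<^sup>\<beta>\<close>. The growth allowed for \<open>\<Psi>\<close> is the one that occurs for \<open>\<kappa> = 0\<close>.\<close>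

locale ml_modes =
  fixes \<alpha> T M2 C' :: real and \<mu> \<Psi> :: "nat \<Rightarrow> real"
  assumes \<alpha>: "0 < \<alpha>" "\<alpha> < 1" and T: "0 < T" and M2: "0 < M2"
    and E1_bound: "\<And>z. 0 \<le> z \<Longrightarrow> \<bar>mittag_leffler \<alpha> 1 (- z)\<bar> \<le> M2 / (1 + z)"
    and Ea_bound: "\<And>z. 0 \<le> z \<Longrightarrow> \<bar>mittag_leffler \<alpha> \<alpha> (- z)\<bar> \<le> M2 / (1 + z)"
    and \<mu>: "0 < \<mu> 0" "\<And>j. \<mu> 0 \<le> \<mu> j"
    and \<Psi>: "\<And>j. \<bar>\<Psi> j\<bar> \<le> C' * \<mu> j"
begin

section \<open>Weighted kernel bounds for the modes\<close>

lemma \<mu>_pos: "0 < \<mu> j"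
  using \<mu>(1) \<mu>(2)[of j] by simp

lemma C'_nonneg: "0 \<le> C'"
proof -
  have "0 \<le> C' * \<mu> 0" using \<Psi>[of 0] by linarith
  then show ?thesis using \<mu>_pos[of 0] by (simp add: zero_le_mult_iff)
qed

text \<open>\<open>conv H\<close> is \<open>\<G>\<^sub>1 H\<close>, \<open>R\<close> is the symbol of \<open>\<G>\<^sub>2\<close>, and \<open>sol H \<phi>\<close> is the right-hand side of the integral
  equation with source \<open>H = F(\<cdot>,u) - k u\<close>, all in coordinates.\<close>

definition K :: "nat \<Rightarrow> real \<Rightarrow> real" where "K j = ml_kernel \<alpha> (\<mu> j)"

definition R :: "nat \<Rightarrow> real \<Rightarrow> real" where "R j t = \<Psi> j * mittag_leffler \<alpha> 1 (- (\<mu> j * t powr \<alpha>))"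

definition conv :: "(nat \<Rightarrow> real \<Rightarrow> real) \<Rightarrow> nat \<Rightarrow> real \<Rightarrow> real" where
  "conv H j t = (\<integral>\<tau>. indicator {0<..<t} \<tau> * (K j (t - \<tau>) * H j \<tau>) \<partial>lborel)"

definition sol :: "(nat \<Rightarrow> real \<Rightarrow> real) \<Rightarrow> (nat \<Rightarrow> real) \<Rightarrow> nat \<Rightarrow> real \<Rightarrow> real" where
  "sol H \<phi> j t = R j t * (\<phi> j - conv H j T) + conv H j t"

text \<open>A ball of radius Y in the weighted source space. The bound is asked only almost
  everywhere, since the source of a mild solution is determined only up to null sets; measurability
  is asked of each coordinate with respect to Borel sets, which keeps Tonelli and Fubini
  applicable.\<close>

definition weighted :: "(nat \<Rightarrow> real \<Rightarrow> real) \<Rightarrow> real \<Rightarrow> real \<Rightarrow> bool" where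
  "weighted H Y a \<longleftrightarrow> (\<forall>j. H j \<in> borel_measurable borel) \<and> 0 \<le> Y \<and>
     (AE \<tau> in lborel. 0 < \<tau> \<longrightarrow> \<tau> < T \<longrightarrow> l2_bound (\<lambda>j. H j \<tau>) (Y * \<tau> powr (- a)))"

lemma borel_K [measurable]: "K j \<in> borel_measurable borel"
  unfolding K_def by (rule borel_ml_kernel[OF \<alpha>])

lemma borel_E1 [measurable]: "mittag_leffler \<alpha> 1 \<in> borel_measurable borel"
  by (rule borel_mittag_leffler[OF \<alpha>]) simp

lemma borel_R [measurable]: "R j \<in> borel_measurable borel"
  unfolding R_def[abs_def] by measurable

lemma weighted_measurable: "weighted H Y a \<Longrightarrow> H j \<in> borel_measurable borel"
  by (simp add: weighted_def)

lemma weighted_nonneg: "weighted H Y a \<Longrightarrow> 0 \<le> Y"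
  by (simp add: weighted_def)

lemma borel_conv [measurable (raw)]:
  assumes [measurable]: "H j \<in> borel_measurable borel"
  shows "conv H j \<in> borel_measurable borel"
proof -
  have eq: "conv H j = (\<lambda>t. \<integral>\<tau>. (if 0 < \<tau> \<and> \<tau> < t then K j (t - \<tau>) * H j \<tau> else 0) \<partial>lborel)"
    unfolding conv_def by (intro ext Bochner_Integration.integral_cong) (auto simp: indicator_def)
  show ?thesis unfolding eq by measurable
qed

text \<open>In terms of z = \<mu>_j t^\<alpha> the weight \<mu>_j^\<theta> is z^\<theta>
  t^(-\<alpha> \<theta>), and z^\<theta> is absorbed by the decay of E_{\<alpha>,\<alpha>}. So each
  power of \<mu> costs that power of t^(-\<alpha>).\<close>

lemma K_bound:
  assumes "0 < t" "0 \<le> \<theta>" "\<theta> \<le> 1"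
  shows "\<mu> j powr \<theta> * \<bar>K j t\<bar> \<le> M2 * t powr (\<alpha> * (1 - \<theta>) - 1)"
proof -
  have m: "0 < \<mu> j" by (rule \<mu>_pos)
  define z where "z = \<mu> j * t powr \<alpha>"
  have z: "0 < z" using m assms by (simp add: z_def)
  have "\<mu> j powr \<theta> * \<bar>K j t\<bar> = \<mu> j powr \<theta> * (t powr (\<alpha> - 1) * \<bar>mittag_leffler \<alpha> \<alpha> (- z)\<bar>)"
    by (simp add: K_def ml_kernel_def abs_mult z_def)
  also have "\<dots> \<le> \<mu> j powr \<theta> * (t powr (\<alpha> - 1) * (M2 / (1 + z)))"
    using z by (intro mult_left_mono Ea_bound) auto
  also have "\<dots> = M2 * t powr (\<alpha> * (1 - \<theta>) - 1) * (z powr \<theta> / (1 + z))"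
  proof -
    have "\<mu> j powr \<theta> * t powr (\<alpha> - 1) = t powr (\<alpha> * (1 - \<theta>) - 1) * z powr \<theta>"
      using m assms by (simp add: z_def powr_mult powr_powr powr_add[symmetric] algebra_simps)
    then show ?thesis by (simp add: field_simps)
  qed
  also have "\<dots> \<le> M2 * t powr (\<alpha> * (1 - \<theta>) - 1) * 1"
    using powr_le_1_plus[of z \<theta>] z assms M2 by (intro mult_left_mono) (auto simp: divide_le_eq)
  finally show ?thesis by simp
qed

lemma K_bound_0: "0 < t \<Longrightarrow> \<bar>K j t\<bar> \<le> M2 * t powr (\<alpha> - 1)"
  using K_bound[of t 0 j] \<mu>_pos[of j] by simp

lemma E1_le: "0 \<le> t \<Longrightarrow> \<bar>mittag_leffler \<alpha> 1 (- (\<mu> j * t powr \<alpha>))\<bar> \<le> M2"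
proof -
  have z: "0 \<le> \<mu> j * t powr \<alpha>" using \<mu>_pos[of j] by simp
  have "\<bar>mittag_leffler \<alpha> 1 (- (\<mu> j * t powr \<alpha>))\<bar> \<le> M2 / (1 + \<mu> j * t powr \<alpha>)" by (rule E1_bound[OF z])
  also have "\<dots> \<le> M2 / 1" using M2 z by (intro divide_left_mono) auto
  finally show ?thesis by simp
qed

lemma E1_bound_powr:
  assumes "0 < t" "0 \<le> \<theta>" "\<theta> \<le> 1"
  shows "\<mu> j powr \<theta> * \<bar>mittag_leffler \<alpha> 1 (- (\<mu> j * t powr \<alpha>))\<bar> \<le> M2 * t powr (- (\<alpha> * \<theta>))"
proof -
  have m: "0 < \<mu> j" by (rule \<mu>_pos)
  define z where "z = \<mu> j * t powr \<alpha>"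
  have z: "0 < z" using m assms by (simp add: z_def)
  have "\<mu> j powr \<theta> * \<bar>mittag_leffler \<alpha> 1 (- z)\<bar> \<le> \<mu> j powr \<theta> * (M2 / (1 + z))"
    using z by (intro mult_left_mono E1_bound) auto
  also have "\<dots> = M2 * t powr (- (\<alpha> * \<theta>)) * (z powr \<theta> / (1 + z))"
  proof -
    have "\<mu> j powr \<theta> = t powr (- (\<alpha> * \<theta>)) * z powr \<theta>"
      using m assms by (simp add: z_def powr_mult powr_powr powr_minus)
    then show ?thesis by (simp add: field_simps)
  qed
  also have "\<dots> \<le> M2 * t powr (- (\<alpha> * \<theta>)) * 1"
    using powr_le_1_plus[of z \<theta>] z assms M2 by (intro mult_left_mono) (auto simp: divide_le_eq)
  finally show ?thesis by (simp add: z_def)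
qed

text \<open>Of the full power of \<mu>_j that \<Psi>_j may contribute, the decay of E_{\<alpha>,1}
  absorbs \<mu>_j^\<theta> at the price t^(-\<alpha> \<theta>). The remaining \<mu>_j^(1-\<theta>)
  has to be supplied by the regularity of the argument of R.\<close>

lemma R_bound:
  assumes "0 < t" "0 \<le> \<theta>" "\<theta> \<le> 1"
  shows "\<bar>R j t\<bar> \<le> C' * M2 * t powr (- (\<alpha> * \<theta>)) * \<mu> j powr (1 - \<theta>)"
proof -
  have m: "0 < \<mu> j" by (rule \<mu>_pos)
  have "\<bar>R j t\<bar> \<le> (C' * \<mu> j) * \<bar>mittag_leffler \<alpha> 1 (- (\<mu> j * t powr \<alpha>))\<bar>"
    unfolding R_def abs_mult by (intro mult_right_mono \<Psi>) simp
  \<comment> \<open>The substitution also rewrites the occurrence inside the Mittag-Leffler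
    argument; the next equation restores that one.\<close>
  also have "\<mu> j = \<mu> j powr (1 - \<theta>) * \<mu> j powr \<theta>" using m by (simp add: powr_add[symmetric])
  also have "C' * (\<mu> j powr (1 - \<theta>) * \<mu> j powr \<theta>) * \<bar>mittag_leffler \<alpha> 1 (- (\<mu> j powr (1 - \<theta>) * \<mu> j powr \<theta> * t powr \<alpha>))\<bar>
     = C' * \<mu> j powr (1 - \<theta>) * (\<mu> j powr \<theta> * \<bar>mittag_leffler \<alpha> 1 (- (\<mu> j * t powr \<alpha>))\<bar>)"
    using m by (simp add: powr_add[symmetric])
  also have "\<dots> \<le> C' * \<mu> j powr (1 - \<theta>) * (M2 * t powr (- (\<alpha> * \<theta>)))"
    using C'_nonneg by (intro mult_left_mono E1_bound_powr assms) auto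
  finally show ?thesis by (simp add: mult_ac)
qed

lemma powr_ratio_ge_1:
  assumes "0 < t" "t < T" "0 \<le> a"
  shows "1 \<le> T powr a * t powr (- a)"
proof -
  have "t powr a * t powr (- a) \<le> T powr a * t powr (- a)" using assms by (intro mult_right_mono powr_mono2) auto
  then show ?thesis using assms by (simp add: powr_add[symmetric])
qed

lemma l2_bound_R:
  assumes "0 < t" "0 \<le> \<theta>" "\<theta> \<le> 1" "l2_bound (\<lambda>j. \<mu> j powr (1 - \<theta>) * x j) B"
  shows "l2_bound (\<lambda>j. R j t * x j) (C' * M2 * B * t powr (- (\<alpha> * \<theta>)))"
proof -
  have "l2_bound (\<lambda>j. (C' * M2 * t powr (- (\<alpha> * \<theta>))) * (\<mu> j powr (1 - \<theta>) * x j)) (\<bar>C' * M2 * t powr (- (\<alpha> * \<theta>))\<bar> * B)"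
    by (rule l2_bound_scale[OF assms(4)])
  then have "l2_bound (\<lambda>j. R j t * x j) (\<bar>C' * M2 * t powr (- (\<alpha> * \<theta>))\<bar> * B)"
  proof (rule l2_bound_abs_le)
    fix j
    have "\<bar>R j t\<bar> * \<bar>x j\<bar> \<le> (C' * M2 * t powr (- (\<alpha> * \<theta>)) * \<mu> j powr (1 - \<theta>)) * \<bar>x j\<bar>"
      using R_bound[OF assms(1-3)] by (rule mult_right_mono) simp
    then show "\<bar>R j t * x j\<bar> \<le> \<bar>C' * M2 * t powr (- (\<alpha> * \<theta>)) * (\<mu> j powr (1 - \<theta>) * x j)\<bar>"
      using C'_nonneg M2 by (simp add: abs_mult mult_ac)
  qed
  then show ?thesis using C'_nonneg M2 by (simp add: abs_mult mult_ac)
qed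

lemma l2_bound_drop_weight:
  assumes x: "l2_bound (\<lambda>j. \<mu> j powr \<theta> * x j) B" and \<theta>: "0 \<le> \<theta>"
  shows "l2_bound x (\<mu> 0 powr (- \<theta>) * B)"
proof (rule l2_bound_abs_le)
  show "l2_bound (\<lambda>j. \<mu> 0 powr (- \<theta>) * (\<mu> j powr \<theta> * x j)) (\<mu> 0 powr (- \<theta>) * B)"
    using l2_bound_scale[OF x, of "\<mu> 0 powr (- \<theta>)"] by simp
  fix j
  have "\<mu> 0 powr (- \<theta>) * \<mu> 0 powr \<theta> \<le> \<mu> 0 powr (- \<theta>) * \<mu> j powr \<theta>"
    using \<mu>(1) \<mu>(2)[of j] \<theta> by (intro mult_left_mono powr_mono2) auto
  then have "1 \<le> \<mu> 0 powr (- \<theta>) * \<mu> j powr \<theta>" using \<mu>(1) by (simp add: powr_add[symmetric])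
  then have "1 * \<bar>x j\<bar> \<le> (\<mu> 0 powr (- \<theta>) * \<mu> j powr \<theta>) * \<bar>x j\<bar>" by (rule mult_right_mono) simp
  then show "\<bar>x j\<bar> \<le> \<bar>\<mu> 0 powr (- \<theta>) * (\<mu> j powr \<theta> * x j)\<bar>" by (simp add: abs_mult)
qed

text \<open>Minkowski's integral inequality together with \<open>K_bound\<close> reduces both claims
  to one Beta integral. Convergence at \<tau> = t requires \<theta> < 1, convergence at \<tau> = 0
  requires a < 1.\<close>

lemma conv_integrable_bound:
  assumes H: "weighted H Y a" and a: "a < 1" and t: "0 < t" "t \<le> T" and \<theta>: "0 \<le> \<theta>" "\<theta> < 1"
  shows "integrable lborel (\<lambda>\<tau>. indicator {0<..<t} \<tau> * (K j (t - \<tau>) * H j \<tau>))"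
    and "l2_bound (\<lambda>j. \<mu> j powr \<theta> * conv H j t) (M2 * Y * Beta (\<alpha> * (1 - \<theta>)) (1 - a) * t powr (\<alpha> * (1 - \<theta>) - a))"
proof -
  note [measurable] = weighted_measurable[OF H]
  let ?g = "\<lambda>\<tau>. M2 * Y * (indicator {0<..<t} \<tau> * ((t - \<tau>) powr (\<alpha> * (1 - \<theta>) - 1) * \<tau> powr ((1 - a) - 1)))"
  let ?f = "\<lambda>j \<tau>. \<mu> j powr \<theta> * (indicator {0<..<t} \<tau> * (K j (t - \<tau>) * H j \<tau>))"
  have g: "has_bochner_integral lborel ?g (M2 * Y * (t powr (\<alpha> * (1 - \<theta>) + (1 - a) - 1) * Beta (\<alpha> * (1 - \<theta>)) (1 - a)))"
    using \<alpha> \<theta> a t by (intro has_bochner_integral_mult_right beta_kernel) auto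
  have bound: "AE \<tau> in lborel. l2_bound (\<lambda>j. ?f j \<tau>) (?g \<tau>)"
    using H[unfolded weighted_def, THEN conjunct2, THEN conjunct2]
  proof eventually_elim
    case (elim \<tau>)
    show ?case
    proof (cases "0 < \<tau> \<and> \<tau> < t")
      case True
      then have "l2_bound (\<lambda>j. H j \<tau>) (Y * \<tau> powr (- a))" using elim t by auto
      then have "l2_bound (\<lambda>j. (\<mu> j powr \<theta> * K j (t - \<tau>)) * H j \<tau>) ((M2 * (t - \<tau>) powr (\<alpha> * (1 - \<theta>) - 1)) * (Y * \<tau> powr (- a)))"
        by (rule l2_bound_mult) (use K_bound[of "t - \<tau>" \<theta>] True \<theta> in \<open>auto simp: abs_mult\<close>)
      then show ?thesis using True by (simp add: mult_ac)
    next
      case False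
      then have "indicator {0<..<t} \<tau> = (0::real)" by auto
      then show ?thesis by (simp add: l2_bound_zero)
    qed
  qed
  have m: "?f j \<in> borel_measurable lborel" for j by measurable
  have 1: "integrable lborel (?f j)" for j
    by (rule l2_bound_integral(1)[OF m bound integrable.intros[OF g]])
  have 2: "l2_bound (\<lambda>j. \<integral>\<tau>. ?f j \<tau> \<partial>lborel) (\<integral>\<tau>. ?g \<tau> \<partial>lborel)"
    by (rule l2_bound_integral(2)[OF m bound integrable.intros[OF g]])
  have "integrable lborel (\<lambda>\<tau>. inverse (\<mu> j powr \<theta>) * ?f j \<tau>)" by (intro integrable_mult_right 1)
  then show "integrable lborel (\<lambda>\<tau>. indicator {0<..<t} \<tau> * (K j (t - \<tau>) * H j \<tau>))"
    using \<mu>_pos[of j] by (simp add: mult.assoc[symmetric])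
  have "(\<lambda>j. \<integral>\<tau>. ?f j \<tau> \<partial>lborel) = (\<lambda>j. \<mu> j powr \<theta> * conv H j t)" by (simp add: conv_def)
  moreover have "(\<integral>\<tau>. ?g \<tau> \<partial>lborel) = M2 * Y * Beta (\<alpha> * (1 - \<theta>)) (1 - a) * t powr (\<alpha> * (1 - \<theta>) - a)"
    using has_bochner_integral_integral_eq[OF g] by (simp add: algebra_simps)
  ultimately show "l2_bound (\<lambda>j. \<mu> j powr \<theta> * conv H j t) (M2 * Y * Beta (\<alpha> * (1 - \<theta>)) (1 - a) * t powr (\<alpha> * (1 - \<theta>) - a))"
    using 2 by (simp only:)
qed

lemma conv_diff:
  assumes "weighted H Y a" "weighted H' Y' a'" "a < 1" "a' < 1" "0 < t" "t \<le> T"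
  shows "conv (\<lambda>j \<tau>. H j \<tau> - H' j \<tau>) j t = conv H j t - conv H' j t"
  using conv_integrable_bound(1)[OF assms(1,3,5,6), of 0 j] conv_integrable_bound(1)[OF assms(2,4,5,6), of 0 j]
  by (simp add: conv_def right_diff_distrib)

end

section \<open>A priori bounds\<close>

lemma beta_kernel_shifted:
  fixes x y \<sigma> t :: real
  assumes "0 < x" "0 < y" "\<sigma> < t"
  shows "(\<integral>\<^sup>+\<tau>. ennreal (indicator {\<sigma><..<t} \<tau> * ((t - \<tau>) powr (x - 1) * (\<tau> - \<sigma>) powr (y - 1))) \<partial>lborel)
    = ennreal (Beta x y * (t - \<sigma>) powr (x + y - 1))"
proof -
  have "has_bochner_integral lborel (\<lambda>\<tau>. indicator {0<..<t - \<sigma>} (- \<sigma> + 1 * \<tau>) * ((t - \<sigma> - (- \<sigma> + 1 * \<tau>)) powr (x - 1) * (- \<sigma> + 1 * \<tau>) powr (y - 1)))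
     (((t - \<sigma>) powr (x + y - 1) * Beta x y) /\<^sub>R \<bar>1\<bar>)"
    using beta_kernel[of x y "t - \<sigma>"] assms by (subst lborel_has_bochner_integral_real_affine_iff[symmetric]) auto
  moreover have "indicator {0<..<t - \<sigma>} (- \<sigma> + 1 * \<tau>) * ((t - \<sigma> - (- \<sigma> + 1 * \<tau>)) powr (x - 1) * (- \<sigma> + 1 * \<tau>) powr (y - 1))
      = indicator {\<sigma><..<t} \<tau> * ((t - \<tau>) powr (x - 1) * (\<tau> - \<sigma>) powr (y - 1))" for \<tau>
    by (simp add: indicator_def)
  ultimately have h: "has_bochner_integral lborel (\<lambda>\<tau>. indicator {\<sigma><..<t} \<tau> * ((t - \<tau>) powr (x - 1) * (\<tau> - \<sigma>) powr (y - 1)))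
     (Beta x y * (t - \<sigma>) powr (x + y - 1))"
    by (simp only: mult.commute[of "Beta x y"]) simp
  show ?thesis
    using nn_integral_eq_integral[OF integrable.intros[OF h]] has_bochner_integral_integral_eq[OF h] by simp
qed

lemma Beta_nonneg: "0 < a \<Longrightarrow> 0 < b \<Longrightarrow> 0 \<le> Beta a (b::real)"
  by (auto simp: Beta_def intro!: divide_nonneg_nonneg mult_nonneg_nonneg Gamma_real_nonneg)

text \<open>The semigroup law of Riemann-Liouville integrals, by Tonelli. It is stated for
  nonnegative extended integrals because Gronwall's lemma uses it before any of these integrals is
  known to be finite.\<close>

lemma iterated_kernel:
  fixes y :: "real \<Rightarrow> real"
  assumes [measurable]: "y \<in> borel_measurable borel" and y: "\<And>\<tau>. 0 \<le> y \<tau>" and ab: "0 < a" "0 < b"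
  shows "(\<integral>\<^sup>+\<tau>. ennreal (indicator {0<..<t} \<tau> * (t - \<tau>) powr (a - 1)) *
      (\<integral>\<^sup>+\<sigma>. ennreal (indicator {0<..<\<tau>} \<sigma> * ((\<tau> - \<sigma>) powr (b - 1) * y \<sigma>)) \<partial>lborel) \<partial>lborel)
    = ennreal (Beta a b) * (\<integral>\<^sup>+\<sigma>. ennreal (indicator {0<..<t} \<sigma> * ((t - \<sigma>) powr (a + b - 1) * y \<sigma>)) \<partial>lborel)"
proof -
  have Beta: "0 \<le> Beta a b" using ab by (rule Beta_nonneg)
  define f where "f \<tau> \<sigma> = ennreal (if 0 < \<sigma> \<and> \<sigma> < \<tau> \<and> \<tau> < t then (t - \<tau>) powr (a - 1) * ((\<tau> - \<sigma>) powr (b - 1) * y \<sigma>) else 0)" for \<tau> \<sigma>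
  have [measurable]: "(\<lambda>(\<tau>, \<sigma>). f \<tau> \<sigma>) \<in> borel_measurable (lborel \<Otimes>\<^sub>M lborel)" unfolding f_def by measurable
  have "(\<integral>\<^sup>+\<tau>. ennreal (indicator {0<..<t} \<tau> * (t - \<tau>) powr (a - 1)) *
      (\<integral>\<^sup>+\<sigma>. ennreal (indicator {0<..<\<tau>} \<sigma> * ((\<tau> - \<sigma>) powr (b - 1) * y \<sigma>)) \<partial>lborel) \<partial>lborel)
     = (\<integral>\<^sup>+\<tau>. (\<integral>\<^sup>+\<sigma>. f \<tau> \<sigma> \<partial>lborel) \<partial>lborel)"
  proof (intro nn_integral_cong)
    fix \<tau> :: real
    have "ennreal (indicator {0<..<t} \<tau> * (t - \<tau>) powr (a - 1)) * ennreal (indicator {0<..<\<tau>} \<sigma> * ((\<tau> - \<sigma>) powr (b - 1) * y \<sigma>)) = f \<tau> \<sigma>" for \<sigma>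
      by (subst ennreal_mult[symmetric]) (auto simp: f_def indicator_def y)
    then show "ennreal (indicator {0<..<t} \<tau> * (t - \<tau>) powr (a - 1)) *
      (\<integral>\<^sup>+\<sigma>. ennreal (indicator {0<..<\<tau>} \<sigma> * ((\<tau> - \<sigma>) powr (b - 1) * y \<sigma>)) \<partial>lborel) = (\<integral>\<^sup>+\<sigma>. f \<tau> \<sigma> \<partial>lborel)"
      by (subst nn_integral_cmult[symmetric]) auto
  qed
  also have "\<dots> = (\<integral>\<^sup>+\<sigma>. (\<integral>\<^sup>+\<tau>. f \<tau> \<sigma> \<partial>lborel) \<partial>lborel)"
    by (rule lborel_pair.Fubini'[symmetric]) measurable
  also have "\<dots> = (\<integral>\<^sup>+\<sigma>. ennreal (Beta a b) * ennreal (indicator {0<..<t} \<sigma> * ((t - \<sigma>) powr (a + b - 1) * y \<sigma>)) \<partial>lborel)"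
  proof (intro nn_integral_cong)
    fix \<sigma> :: real
    show "(\<integral>\<^sup>+\<tau>. f \<tau> \<sigma> \<partial>lborel) = ennreal (Beta a b) * ennreal (indicator {0<..<t} \<sigma> * ((t - \<sigma>) powr (a + b - 1) * y \<sigma>))"
    proof (cases "0 < \<sigma> \<and> \<sigma> < t")
      case True
      have "f \<tau> \<sigma> = ennreal (y \<sigma>) * ennreal (indicator {\<sigma><..<t} \<tau> * ((t - \<tau>) powr (a - 1) * (\<tau> - \<sigma>) powr (b - 1)))" for \<tau>
        using True y[of \<sigma>] by (subst ennreal_mult[symmetric]) (auto simp: f_def indicator_def mult_ac)
      then have "(\<integral>\<^sup>+\<tau>. f \<tau> \<sigma> \<partial>lborel) = ennreal (y \<sigma>) * ennreal (Beta a b * (t - \<sigma>) powr (a + b - 1))"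
        using beta_kernel_shifted[OF ab, of \<sigma> t] True by (simp add: nn_integral_cmult)
      also have "\<dots> = ennreal (Beta a b) * ennreal (indicator {0<..<t} \<sigma> * ((t - \<sigma>) powr (a + b - 1) * y \<sigma>))"
        using True y[of \<sigma>] Beta by (simp add: ennreal_mult[symmetric] mult_ac)
      finally show ?thesis .
    next
      case False
      then have "f \<tau> \<sigma> = 0" for \<tau> by (auto simp: f_def)
      then show ?thesis using False by simp
    qed
  qed
  also have "\<dots> = ennreal (Beta a b) * (\<integral>\<^sup>+\<sigma>. ennreal (indicator {0<..<t} \<sigma> * ((t - \<sigma>) powr (a + b - 1) * y \<sigma>)) \<partial>lborel)"
    by (rule nn_integral_cmult) measurable
  finally show ?thesis .
qed

text \<open>Each insertion of the inequality into itself raises the exponent of the kernel by \<open>\<alpha>\<close>, until the kernel is bounded.\<close>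

lemma weakly_singular_gronwall:
  fixes y :: "real \<Rightarrow> real"
  assumes \<alpha>: "0 < \<alpha>" "\<alpha> < 1" and T: "0 < T"
    and y[measurable]: "y \<in> borel_measurable borel" and ynn: "\<And>\<tau>. 0 \<le> y \<tau>" and ab: "0 \<le> a" "0 \<le> b"
    and fin: "(\<integral>\<^sup>+\<tau>. ennreal (indicator {0<..<T} \<tau> * y \<tau>) \<partial>lborel) < \<infinity>"
    and ineq: "AE t in lborel. 0 < t \<longrightarrow> t < T \<longrightarrow> ennreal (y t) \<le> ennreal (a * t powr (- \<alpha>))
       + ennreal b * (\<integral>\<^sup>+\<tau>. ennreal (indicator {0<..<t} \<tau> * ((t - \<tau>) powr (\<alpha> - 1) * y \<tau>)) \<partial>lborel)"
  shows "\<exists>C\<ge>0. AE t in lborel. 0 < t \<longrightarrow> t < T \<longrightarrow> y t \<le> C * t powr (- \<alpha>)"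
proof -
  \<comment> \<open>The fractional integral of order n \<alpha> without its Gamma factor. It may be
    infinite; inserting the inequality into itself is still legitimate.\<close>
  define J where "J n t = (\<integral>\<^sup>+\<tau>. ennreal (indicator {0<..<t} \<tau> * ((t - \<tau>) powr (real n * \<alpha> - 1) * y \<tau>)) \<partial>lborel)" for n t
  have J_meas[measurable]: "J n \<in> borel_measurable borel" for n
  proof -
    have "J n = (\<lambda>t. \<integral>\<^sup>+\<tau>. (if 0 < \<tau> \<and> \<tau> < t then ennreal ((t - \<tau>) powr (real n * \<alpha> - 1) * y \<tau>) else 0) \<partial>lborel)"
      unfolding J_def by (intro ext nn_integral_cong) (auto simp: indicator_def)
    also have "\<dots> \<in> borel_measurable borel" by measurable
    finally show ?thesis .
  qed
  have step: "\<exists>an bn. 0 \<le> an \<and> 0 \<le> bn \<and> (AE t in lborel. 0 < t \<longrightarrow> t < T \<longrightarrow> ennreal (y t) \<le> ennreal (an * t powr (- \<alpha>)) + ennreal bn * J n t)"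
    if "1 \<le> n" for n
    using that
  proof (induction n rule: dec_induct)
    case base
    then show ?case using ineq ab by (intro exI[of _ a] exI[of _ b]) (simp add: J_def)
  next
    case (step n)
    then obtain an bn where n: "0 \<le> an" "0 \<le> bn" and
      IH: "AE t in lborel. 0 < t \<longrightarrow> t < T \<longrightarrow> ennreal (y t) \<le> ennreal (an * t powr (- \<alpha>)) + ennreal bn * J n t" by auto
    define Ba where "Ba = Beta \<alpha> (1 - \<alpha>)"
    define Bb where "Bb = Beta \<alpha> (real n * \<alpha>)"
    have pos: "0 \<le> Ba" "0 \<le> Bb" unfolding Ba_def Bb_def using \<alpha> step(1) by (auto intro!: Beta_nonneg)
    have "AE t in lborel. 0 < t \<longrightarrow> t < T \<longrightarrow> ennreal (y t) \<le> ennreal ((a + b * an * Ba * T powr \<alpha>) * t powr (- \<alpha>)) + ennreal (b * bn * Bb) * J (Suc n) t"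
      using ineq
    proof eventually_elim
      case (elim t)
      show ?case
      proof (intro impI)
        assume t: "0 < t" "t < T"
        let ?w = "\<lambda>\<tau>. ennreal (indicator {0<..<t} \<tau> * (t - \<tau>) powr (\<alpha> - 1))"
        have "(\<integral>\<^sup>+\<tau>. ennreal (indicator {0<..<t} \<tau> * ((t - \<tau>) powr (\<alpha> - 1) * y \<tau>)) \<partial>lborel)
           \<le> (\<integral>\<^sup>+\<tau>. ennreal an * ennreal (indicator {0<..<t} \<tau> * ((t - \<tau>) powr (\<alpha> - 1) * (\<tau> - 0) powr ((1 - \<alpha>) - 1))) + ennreal bn * (?w \<tau> * J n \<tau>) \<partial>lborel)"
        proof (rule nn_integral_mono_AE)
          show "AE \<tau> in lborel. ennreal (indicator {0<..<t} \<tau> * ((t - \<tau>) powr (\<alpha> - 1) * y \<tau>))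
            \<le> ennreal an * ennreal (indicator {0<..<t} \<tau> * ((t - \<tau>) powr (\<alpha> - 1) * (\<tau> - 0) powr ((1 - \<alpha>) - 1))) + ennreal bn * (?w \<tau> * J n \<tau>)"
            using IH
          proof eventually_elim
            case (elim \<tau>)
            show ?case
            proof (cases "0 < \<tau> \<and> \<tau> < t")
              case True
              then have "ennreal (y \<tau>) \<le> ennreal (an * \<tau> powr (- \<alpha>)) + ennreal bn * J n \<tau>" using elim t by auto
              then have "ennreal ((t - \<tau>) powr (\<alpha> - 1)) * ennreal (y \<tau>)
                 \<le> ennreal ((t - \<tau>) powr (\<alpha> - 1)) * (ennreal (an * \<tau> powr (- \<alpha>)) + ennreal bn * J n \<tau>)" by (rule mult_left_mono) simp
              then show ?thesis using True n ynn by (simp add: ennreal_mult distrib_left mult_ac)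
            qed (auto simp: indicator_def)
          qed
        qed
        also have "\<dots> = ennreal an * (\<integral>\<^sup>+\<tau>. ennreal (indicator {0<..<t} \<tau> * ((t - \<tau>) powr (\<alpha> - 1) * (\<tau> - 0) powr ((1 - \<alpha>) - 1))) \<partial>lborel) + ennreal bn * (\<integral>\<^sup>+\<tau>. ?w \<tau> * J n \<tau> \<partial>lborel)"
          by (subst nn_integral_add) (auto simp: nn_integral_cmult)
        also have "(\<integral>\<^sup>+\<tau>. ennreal (indicator {0<..<t} \<tau> * ((t - \<tau>) powr (\<alpha> - 1) * (\<tau> - 0) powr ((1 - \<alpha>) - 1))) \<partial>lborel) = ennreal Ba"
          using beta_kernel_shifted[of \<alpha> "1 - \<alpha>" 0 t] \<alpha> t by (simp add: Ba_def)
        also have "(\<integral>\<^sup>+\<tau>. ?w \<tau> * J n \<tau> \<partial>lborel) = ennreal Bb * J (Suc n) t"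
          using iterated_kernel[OF y ynn \<alpha>(1), of "real n * \<alpha>" t] \<alpha> step(1) by (simp add: J_def Bb_def algebra_simps)
        finally have I: "(\<integral>\<^sup>+\<tau>. ennreal (indicator {0<..<t} \<tau> * ((t - \<tau>) powr (\<alpha> - 1) * y \<tau>)) \<partial>lborel)
           \<le> ennreal an * ennreal Ba + ennreal bn * (ennreal Bb * J (Suc n) t)" .
        have "1 \<le> T powr \<alpha> * t powr (- \<alpha>)"
        proof -
          have "t powr \<alpha> * t powr (- \<alpha>) \<le> T powr \<alpha> * t powr (- \<alpha>)" using t \<alpha> by (intro mult_right_mono powr_mono2) auto
          then show ?thesis using t by (simp add: powr_add[symmetric])
        qed
        then have c: "b * (an * Ba) * 1 \<le> b * (an * Ba) * (T powr \<alpha> * t powr (- \<alpha>))"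
          using ab n pos by (intro mult_left_mono) auto
        have "ennreal (y t) \<le> ennreal (a * t powr (- \<alpha>)) + ennreal b * (ennreal an * ennreal Ba + ennreal bn * (ennreal Bb * J (Suc n) t))"
          using elim t by (elim impE order_trans) (auto intro!: add_left_mono mult_left_mono I)
        also have "\<dots> = ennreal (a * t powr (- \<alpha>) + b * (an * Ba)) + ennreal (b * bn * Bb) * J (Suc n) t"
          using ab n pos by (simp add: ennreal_mult distrib_left mult_ac add_ac)
        also have "\<dots> \<le> ennreal ((a + b * an * Ba * T powr \<alpha>) * t powr (- \<alpha>)) + ennreal (b * bn * Bb) * J (Suc n) t"
          using c by (intro add_right_mono ennreal_leI) (simp add: algebra_simps)
        finally show "ennreal (y t) \<le> ennreal ((a + b * an * Ba * T powr \<alpha>) * t powr (- \<alpha>)) + ennreal (b * bn * Bb) * J (Suc n) t" .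
      qed
    qed
    then show ?case using ab n pos by (intro exI[of _ "a + b * an * Ba * T powr \<alpha>"] exI[of _ "b * bn * Bb"]) auto
  qed
  \<comment> \<open>From n \<alpha> \<ge> 1 on, the exponent n \<alpha> - 1 is nonnegative, the
    kernel is at most T^(n \<alpha> - 1), and the integrability of y bounds J by a constant, which
    T^\<alpha> t^(-\<alpha>) \<ge> 1 absorbs.\<close>
  obtain n where n: "1 \<le> n" "1 \<le> real n * \<alpha>"
  proof -
    obtain n where "1 / \<alpha> < real n" using reals_Archimedean2 by blast
    then show ?thesis using that[of n] \<alpha> by (cases n) (auto simp: field_simps)
  qed
  obtain an bn where anbn: "0 \<le> an" "0 \<le> bn" and
    final: "AE t in lborel. 0 < t \<longrightarrow> t < T \<longrightarrow> ennreal (y t) \<le> ennreal (an * t powr (- \<alpha>)) + ennreal bn * J n t"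
    using step[OF n(1)] by auto
  obtain I where I: "0 \<le> I" "(\<integral>\<^sup>+\<tau>. ennreal (indicator {0<..<T} \<tau> * y \<tau>) \<partial>lborel) = ennreal I"
    using fin by (cases "(\<integral>\<^sup>+\<tau>. ennreal (indicator {0<..<T} \<tau> * y \<tau>) \<partial>lborel)") auto
  define C where "C = an + bn * (T powr (real n * \<alpha> - 1) * I) * T powr \<alpha>"
  have "AE t in lborel. 0 < t \<longrightarrow> t < T \<longrightarrow> y t \<le> C * t powr (- \<alpha>)"
    using final
  proof eventually_elim
    case (elim t)
    show ?case
    proof (intro impI)
      assume t: "0 < t" "t < T"
      have "J n t \<le> (\<integral>\<^sup>+\<tau>. ennreal (T powr (real n * \<alpha> - 1)) * ennreal (indicator {0<..<T} \<tau> * y \<tau>) \<partial>lborel)"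
        unfolding J_def
      proof (rule nn_integral_mono)
        fix \<tau> :: real
        show "ennreal (indicator {0<..<t} \<tau> * ((t - \<tau>) powr (real n * \<alpha> - 1) * y \<tau>)) \<le> ennreal (T powr (real n * \<alpha> - 1)) * ennreal (indicator {0<..<T} \<tau> * y \<tau>)"
        proof (cases "0 < \<tau> \<and> \<tau> < t")
          case True
          then have "(t - \<tau>) powr (real n * \<alpha> - 1) \<le> T powr (real n * \<alpha> - 1)" using n t by (intro powr_mono2) auto
          then have "(t - \<tau>) powr (real n * \<alpha> - 1) * y \<tau> \<le> T powr (real n * \<alpha> - 1) * y \<tau>" using ynn by (rule mult_right_mono)
          then show ?thesis using True t ynn by (simp add: ennreal_mult[symmetric] ennreal_leI)
        qed (auto simp: indicator_def)
      qed
      also have "\<dots> = ennreal (T powr (real n * \<alpha> - 1) * I)" using I by (simp add: nn_integral_cmult ennreal_mult)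
      finally have "ennreal bn * J n t \<le> ennreal bn * ennreal (T powr (real n * \<alpha> - 1) * I)" by (rule mult_left_mono) simp
      then have "ennreal (y t) \<le> ennreal (an * t powr (- \<alpha>)) + ennreal bn * ennreal (T powr (real n * \<alpha> - 1) * I)"
        using elim t by (meson add_left_mono order_trans)
      then have "ennreal (y t) \<le> ennreal (an * t powr (- \<alpha>) + bn * (T powr (real n * \<alpha> - 1) * I))"
        using anbn I by (simp add: ennreal_mult)
      then have le: "y t \<le> an * t powr (- \<alpha>) + bn * (T powr (real n * \<alpha> - 1) * I)"
        using anbn I by (subst (asm) ennreal_le_iff) auto
      have "1 \<le> T powr \<alpha> * t powr (- \<alpha>)"
      proof -
        have "t powr \<alpha> * t powr (- \<alpha>) \<le> T powr \<alpha> * t powr (- \<alpha>)" using t \<alpha> by (intro mult_right_mono powr_mono2) auto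
        then show ?thesis using t by (simp add: powr_add[symmetric])
      qed
      then have "bn * (T powr (real n * \<alpha> - 1) * I) * 1 \<le> bn * (T powr (real n * \<alpha> - 1) * I) * (T powr \<alpha> * t powr (- \<alpha>))"
        using anbn I by (intro mult_left_mono) auto
      then show "y t \<le> C * t powr (- \<alpha>)" using le by (simp add: C_def algebra_simps)
    qed
  qed
  moreover have "0 \<le> C" using anbn I by (simp add: C_def)
  ultimately show ?thesis by blast
qed

text \<open>Here \<rho> bounds the linear map from sources to solutions in the weight t^(-\<alpha>
  s), and \<Lambda> is the Lipschitz constant of the nonlinear source, so \<rho> \<Lambda> is the
  contraction factor. Assuming \<open>contr\<close> separates the existence and uniqueness arguments
  from the different ways in which the estimate is obtained.\<close>

locale contraction = ml_modes +
  fixes s \<rho> \<Lambda> :: real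
  assumes s: "0 < s" "s < 1" and \<rho>: "0 \<le> \<rho>" and \<Lambda>: "0 < \<Lambda>" "\<rho> * \<Lambda> < 1"
    and contr: "\<And>H Y t. weighted H Y (\<alpha> * s) \<Longrightarrow> 0 < t \<Longrightarrow> t < T \<Longrightarrow>
      l2_bound (\<lambda>j. conv H j t - R j t * conv H j T) (\<rho> * Y * t powr (- (\<alpha> * s)))"
begin

lemma as: "0 < \<alpha> * s" "\<alpha> * s < 1" "\<alpha> * s < \<alpha>"
proof -
  show "0 < \<alpha> * s" using \<alpha> s by simp
  show "\<alpha> * s < \<alpha>" using \<alpha> s by simp
  then show "\<alpha> * s < 1" using \<alpha> by linarith
qed

lemma sol_split: "sol H \<phi> j t = R j t * \<phi> j + (conv H j t - R j t * conv H j T)"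
  by (simp add: sol_def algebra_simps)

lemma sol_bound:
  assumes "weighted H Y (\<alpha> * s)" "l2_bound (\<lambda>j. \<mu> j powr (1 - s) * \<phi> j) \<Phi>" "0 < t" "t < T"
  shows "l2_bound (\<lambda>j. sol H \<phi> j t) ((C' * M2 * \<Phi> + \<rho> * Y) * t powr (- (\<alpha> * s)))"
  unfolding sol_split distrib_right
  using l2_bound_add[OF l2_bound_R[OF assms(3) _ _ assms(2)] contr[OF assms(1,3,4)]] s by simp

text \<open>\<open>N\<close> majorizes the source. Gronwall's lemma bounds an integrable \<open>N\<close> by \<open>t\<^sup>-\<^sup>\<alpha>\<close>; inserting this once into the
  equation improves the rate to \<open>t\<^sup>-\<^sup>\<alpha>\<^sup>s\<close>, and then iterating the contraction gives a constant that depends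
  only on the data.\<close>

lemma a_priori:
  assumes H[measurable]: "\<And>j. H j \<in> borel_measurable borel"
    and N[measurable]: "N \<in> borel_measurable borel" and Nnn: "\<And>\<tau>. 0 \<le> N \<tau>"
    and HN: "AE \<tau> in lborel. 0 < \<tau> \<longrightarrow> \<tau> < T \<longrightarrow> l2_bound (\<lambda>j. H j \<tau>) (N \<tau>)"
    and fin: "(\<integral>\<^sup>+\<tau>. ennreal (indicator {0<..<T} \<tau> * N \<tau>) \<partial>lborel) < \<infinity>"
    and V: "l2_bound (\<lambda>j. conv H j T) V" and \<Phi>: "l2_bound (\<lambda>j. \<mu> j powr (1 - s) * \<phi> j) \<Phi>"
    and rel: "AE t in lborel. 0 < t \<longrightarrow> t < T \<longrightarrow> (\<forall>B. l2_bound (\<lambda>j. sol H \<phi> j t) B \<longrightarrow> N t \<le> \<Lambda> * B)"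
  shows "weighted H (\<Lambda> * (C' * M2 * \<Phi> / (1 - \<rho> * \<Lambda>))) (\<alpha> * s)"
proof -
  define \<Phi>0 where "\<Phi>0 = \<mu> 0 powr (- (1 - s)) * \<Phi>"
  have \<Phi>0: "l2_bound \<phi> \<Phi>0"
    unfolding \<Phi>0_def using s by (intro l2_bound_drop_weight[OF \<Phi>]) simp
  have nn: "0 \<le> \<Phi>0" "0 \<le> V" "0 \<le> \<Phi>" using \<Phi>0 V \<Phi> by (auto dest: l2_bound_nonneg)
  define a where "a = \<Lambda> * (C' * M2 * (\<Phi>0 + V))"
  have ineq: "AE t in lborel. 0 < t \<longrightarrow> t < T \<longrightarrow> ennreal (N t) \<le> ennreal (a * t powr (- \<alpha>))
       + ennreal (\<Lambda> * M2) * (\<integral>\<^sup>+\<tau>. ennreal (indicator {0<..<t} \<tau> * ((t - \<tau>) powr (\<alpha> - 1) * N \<tau>)) \<partial>lborel)"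
    using rel
  proof eventually_elim
    case (elim t)
    show ?case
    proof (intro impI)
      assume t: "0 < t" "t < T"
      define X where "X = (\<integral>\<^sup>+\<tau>. ennreal (indicator {0<..<t} \<tau> * ((t - \<tau>) powr (\<alpha> - 1) * N \<tau>)) \<partial>lborel)"
      show "ennreal (N t) \<le> ennreal (a * t powr (- \<alpha>)) + ennreal (\<Lambda> * M2) * (\<integral>\<^sup>+\<tau>. ennreal (indicator {0<..<t} \<tau> * ((t - \<tau>) powr (\<alpha> - 1) * N \<tau>)) \<partial>lborel)"
      \<comment> \<open>Finiteness of the convolution at time t is not known here; an infinite value
        makes the inequality trivial.\<close>
      proof (cases "X = \<infinity>")
        case True
        then show ?thesis unfolding X_def[symmetric] using \<Lambda> M2 by (simp add: ennreal_mult_top)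
      next
        case False
        let ?h = "\<lambda>\<tau>. indicator {0<..<t} \<tau> * ((t - \<tau>) powr (\<alpha> - 1) * N \<tau>)"
        have h: "integrable lborel ?h"
          using False Nnn by (intro integrableI_nonneg) (auto simp: X_def less_top[symmetric])
        then have g: "integrable lborel (\<lambda>\<tau>. M2 * ?h \<tau>)" by (rule integrable_mult_right)
        have X: "X = ennreal (\<integral>\<tau>. ?h \<tau> \<partial>lborel)" unfolding X_def using Nnn by (intro nn_integral_eq_integral h) auto
        have "AE \<tau> in lborel. l2_bound (\<lambda>j. indicator {0<..<t} \<tau> * (K j (t - \<tau>) * H j \<tau>)) (M2 * ?h \<tau>)"
          using HN
        proof eventually_elim
          case (elim \<tau>)
          show ?case
          proof (cases "0 < \<tau> \<and> \<tau> < t")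
            case True
            then have "l2_bound (\<lambda>j. K j (t - \<tau>) * H j \<tau>) ((M2 * (t - \<tau>) powr (\<alpha> - 1)) * N \<tau>)"
              using elim t by (intro l2_bound_mult K_bound_0) auto
            then show ?thesis using True by (simp add: mult_ac)
          qed (use t l2_bound_zero in \<open>auto simp: indicator_def\<close>)
        qed
        from l2_bound_integral(2)[OF _ this g]
        have c: "l2_bound (\<lambda>j. conv H j t) (M2 * (\<integral>\<tau>. ?h \<tau> \<partial>lborel))" by (simp add: conv_def)
        \<comment> \<open>No spatial weight on the convolution at T is available yet, so R is used
          with \<theta> = 1. This is why the first rate is t^(-\<alpha>).\<close>
        have "l2_bound (\<lambda>j. \<mu> j powr (1 - 1) * (\<phi> j - conv H j T)) (\<Phi>0 + V)"
          using l2_bound_diff[OF \<Phi>0 V] \<mu>_pos by (simp add: less_imp_neq[symmetric])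
        from l2_bound_add[OF l2_bound_R[OF t(1) _ _ this] c]
        have "l2_bound (\<lambda>j. sol H \<phi> j t) (C' * M2 * (\<Phi>0 + V) * t powr (- \<alpha>) + M2 * (\<integral>\<tau>. ?h \<tau> \<partial>lborel))"
          by (simp add: sol_def)
        then have "N t \<le> \<Lambda> * (C' * M2 * (\<Phi>0 + V) * t powr (- \<alpha>) + M2 * (\<integral>\<tau>. ?h \<tau> \<partial>lborel))" using elim t by blast
        also have "\<dots> = a * t powr (- \<alpha>) + (\<Lambda> * M2) * (\<integral>\<tau>. ?h \<tau> \<partial>lborel)" by (simp add: a_def algebra_simps)
        finally have "ennreal (N t) \<le> ennreal (a * t powr (- \<alpha>) + (\<Lambda> * M2) * (\<integral>\<tau>. ?h \<tau> \<partial>lborel))" by (rule ennreal_leI)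
        also have "\<dots> = ennreal (a * t powr (- \<alpha>)) + ennreal (\<Lambda> * M2) * X"
        proof -
          have "0 \<le> (\<integral>\<tau>. ?h \<tau> \<partial>lborel)" using Nnn by (intro Bochner_Integration.integral_nonneg) auto
          then show ?thesis using \<Lambda> M2 nn C'_nonneg by (simp add: X a_def ennreal_mult)
        qed
        finally show ?thesis unfolding X_def .
      qed
    qed
  qed
  have "0 \<le> a" using \<Lambda> M2 nn C'_nonneg by (simp add: a_def)
  from weakly_singular_gronwall[OF \<alpha> T N Nnn this _ fin ineq] \<Lambda> M2
  obtain C where C: "0 \<le> C" "AE t in lborel. 0 < t \<longrightarrow> t < T \<longrightarrow> N t \<le> C * t powr (- \<alpha>)" by auto
  have to_weighted: "weighted H Y b" if "0 \<le> Y" "AE t in lborel. 0 < t \<longrightarrow> t < T \<longrightarrow> N t \<le> Y * t powr (- b)" for Y b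
    unfolding weighted_def using H that(1)
  proof (intro conjI)
    show "AE \<tau> in lborel. 0 < \<tau> \<longrightarrow> \<tau> < T \<longrightarrow> l2_bound (\<lambda>j. H j \<tau>) (Y * \<tau> powr (- b))"
      using that(2) HN by eventually_elim (blast intro: l2_bound_mono)
  qed auto
  have w: "weighted H C \<alpha>" using C by (rule to_weighted)
  define V1 where "V1 = M2 * C * Beta (\<alpha> * s) (1 - \<alpha>) * T powr (\<alpha> * s - \<alpha>)"
  have V1: "l2_bound (\<lambda>j. \<mu> j powr (1 - s) * conv H j T) V1"
    using conv_integrable_bound(2)[OF w \<alpha>(2) T order_refl, of "1 - s"] s by (simp add: V1_def)
  define D where "D = M2 * C * Beta \<alpha> (1 - \<alpha>)"
  have D: "l2_bound (\<lambda>j. conv H j t) D" if "0 < t" "t < T" for t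
    using conv_integrable_bound(2)[OF w \<alpha>(2) that(1), of 0] that \<mu>_pos by (simp add: D_def less_imp_neq[symmetric])
  define Y0 where "Y0 = \<Lambda> * (C' * M2 * (\<Phi> + V1) + D * T powr (\<alpha> * s))"
  have D0: "0 \<le> D" using D[of "T / 2"] T l2_bound_nonneg by auto
  have init: "AE t in lborel. 0 < t \<longrightarrow> t < T \<longrightarrow> N t \<le> Y0 * t powr (- (\<alpha> * s))"
    using rel
  proof eventually_elim
    case (elim t)
    show ?case
    proof (intro impI)
      assume t: "0 < t" "t < T"
      have "l2_bound (\<lambda>j. \<mu> j powr (1 - s) * (\<phi> j - conv H j T)) (\<Phi> + V1)"
        using l2_bound_diff[OF \<Phi> V1] by (simp add: right_diff_distrib)
      from l2_bound_add[OF l2_bound_R[OF t(1) _ _ this] D[OF t]] s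
      have "l2_bound (\<lambda>j. sol H \<phi> j t) (C' * M2 * (\<Phi> + V1) * t powr (- (\<alpha> * s)) + D)" by (simp add: sol_def)
      then have "N t \<le> \<Lambda> * (C' * M2 * (\<Phi> + V1) * t powr (- (\<alpha> * s)) + D * 1)" using elim t by auto
      also have "\<dots> \<le> \<Lambda> * (C' * M2 * (\<Phi> + V1) * t powr (- (\<alpha> * s)) + D * (T powr (\<alpha> * s) * t powr (- (\<alpha> * s))))"
        using powr_ratio_ge_1[OF t, of "\<alpha> * s"] as \<Lambda> D0 by (intro mult_left_mono add_left_mono) auto
      also have "\<dots> = Y0 * t powr (- (\<alpha> * s))" by (simp add: Y0_def algebra_simps)
      finally show "N t \<le> Y0 * t powr (- (\<alpha> * s))" .
    qed
  qed
  define G where "G = C' * M2 * \<Phi>"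
  have G: "0 \<le> G" using C'_nonneg M2 nn by (simp add: G_def)
  \<comment> \<open>The fixed point of Y \<mapsto> \<Lambda> (G + \<rho> Y). The iterates approach
    it from any start, so the initial constant Y0, which depends on the solution through Gronwall's
    lemma, drops out.\<close>
  define Ys where "Ys = \<Lambda> * (G / (1 - \<rho> * \<Lambda>))"
  define Y where "Y n = Ys + (\<rho> * \<Lambda>) ^ n * (Y0 - Ys)" for n
  have Ys: "0 \<le> Ys" "\<Lambda> * G + \<Lambda> * \<rho> * Ys = Ys"
    using \<Lambda> \<rho> G by (auto simp: Ys_def field_simps)
  have Y0: "0 \<le> Y0" using \<Lambda> C'_nonneg M2 nn l2_bound_nonneg[OF V1] D0 by (simp add: Y0_def)
  have Y_Suc: "Y (Suc n) = \<Lambda> * (G + \<rho> * Y n)" for n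
  proof -
    have "\<Lambda> * (G + \<rho> * Y n) = (\<Lambda> * G + \<Lambda> * \<rho> * Ys) + \<rho> * \<Lambda> * ((\<rho> * \<Lambda>) ^ n * (Y0 - Ys))"
      by (simp add: Y_def algebra_simps)
    then show ?thesis by (simp add: Y_def Ys(2))
  qed
  have Y_nn: "0 \<le> Y n" for n
    by (induction n) (use Y0 \<Lambda> \<rho> G in \<open>auto simp: Y_Suc simp: Y_def[of 0]\<close>)
  have iter: "AE t in lborel. 0 < t \<longrightarrow> t < T \<longrightarrow> N t \<le> Y n * t powr (- (\<alpha> * s))" for n
  proof (induction n)
    case 0
    then show ?case using init by (simp add: Y_def)
  next
    case (Suc n)
    have w: "weighted H (Y n) (\<alpha> * s)" using Y_nn Suc by (rule to_weighted)
    show ?case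
      using rel
    proof eventually_elim
      case (elim t)
      then show ?case using sol_bound[OF w \<Phi>] unfolding Y_Suc G_def by (auto simp: mult.assoc)
    qed
  qed
  have "AE t in lborel. \<forall>n. 0 < t \<longrightarrow> t < T \<longrightarrow> N t \<le> Y n * t powr (- (\<alpha> * s))"
    unfolding AE_all_countable using iter by blast
  then have "AE t in lborel. 0 < t \<longrightarrow> t < T \<longrightarrow> N t \<le> Ys * t powr (- (\<alpha> * s))"
  proof eventually_elim
    case (elim t)
    show ?case
    proof (intro impI)
      assume "0 < t" "t < T"
      then have le: "\<forall>n. N t \<le> Y n * t powr (- (\<alpha> * s))" using elim by blast
      have "(\<lambda>n. Y n * t powr (- (\<alpha> * s))) \<longlonglongrightarrow> (Ys + 0 * (Y0 - Ys)) * t powr (- (\<alpha> * s))"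
        unfolding Y_def using \<rho> \<Lambda> by (intro tendsto_intros LIMSEQ_power_zero) auto
      then show "N t \<le> Ys * t powr (- (\<alpha> * s))" using le by (intro LIMSEQ_le_const) auto
    qed
  qed
  with Ys(1) have "weighted H Ys (\<alpha> * s)" by (rule to_weighted)
  then show ?thesis by (simp add: Ys_def G_def)
qed

end

section \<open>Contraction estimates and Picard iteration\<close>

lemma square_le_mult_if_quadratic_nonneg:
  fixes A B C :: real
  assumes q: "\<And>x y. 0 \<le> x\<^sup>2 * A - 2 * x * y * B + y\<^sup>2 * C" and A: "0 < A"
  shows "B\<^sup>2 \<le> A * C"
proof -
  have "0 \<le> B\<^sup>2 * A - 2 * B * A * B + A\<^sup>2 * C" by (rule q)
  also have "\<dots> = A * (A * C - B\<^sup>2)" by (simp add: power2_eq_square algebra_simps)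
  finally show ?thesis using A by (simp add: zero_le_mult_iff)
qed

context ml_modes
begin

text \<open>The smoothing of the kernel is used at \<theta> = p, where the exponent \<alpha> (1 - p)
  - \<alpha> q of time is zero. Discarding the weight again gives \<mu>_0^(-p), and bounded \<Psi>
  lets the value at T be treated like the value at t.\<close>

lemma contraction_bounded_Psi:
  assumes pq: "0 < p" "0 < q" "p + q = 1" and Cb: "0 \<le> Cb" "\<And>j. \<bar>\<Psi> j\<bar> \<le> Cb"
    and H: "weighted H Y (\<alpha> * q)" and t: "0 < t" "t < T"
  shows "l2_bound (\<lambda>j. conv H j t - R j t * conv H j T)
     (M2 / \<mu> 0 powr p * (T powr (\<alpha> * q) + M2 * Cb * T powr (\<alpha> * q)) * Beta (\<alpha> * q) (1 - \<alpha> * q) * Y * t powr (- (\<alpha> * q)))"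
proof -
  have p: "0 \<le> p" "p < 1" "1 - p = q" using pq by auto
  have aq: "0 < \<alpha> * q" "\<alpha> * q < 1" using \<alpha> pq mult_strict_mono[of \<alpha> 1 q 1] by auto
  define B where "B = Beta (\<alpha> * q) (1 - \<alpha> * q)"
  define X where "X = \<mu> 0 powr (- p) * (M2 * Y * B)"
  have "l2_bound (\<lambda>j. conv H j x) X" if "0 < x" "x \<le> T" for x
    using conv_integrable_bound(2)[OF H aq(2) that p(1,2), unfolded p(3)] that p(1)
    unfolding X_def B_def by (intro l2_bound_drop_weight) auto
  note X = this[of t] this[of T]
  have Xnn: "0 \<le> X" using X(1) t l2_bound_nonneg by auto
  have "l2_bound (\<lambda>j. R j t * conv H j T) ((Cb * M2) * X)"
  proof (rule l2_bound_mult[OF X(2)])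
    show "\<bar>R j t\<bar> \<le> Cb * M2" for j
      unfolding R_def abs_mult using Cb E1_le[of t j] t by (intro mult_mono) auto
  qed (use T in auto)
  from l2_bound_diff[OF X(1) this] t
  have b: "l2_bound (\<lambda>j. conv H j t - R j t * conv H j T) (X * (1 + M2 * Cb) * 1)" by (simp add: algebra_simps)
  have le: "X * (1 + M2 * Cb) * 1 \<le> X * (1 + M2 * Cb) * (T powr (\<alpha> * q) * t powr (- (\<alpha> * q)))"
    using Xnn Cb M2 aq powr_ratio_ge_1[OF t, of "\<alpha> * q"] by (intro mult_left_mono) auto
  have eq: "X * (1 + M2 * Cb) * (T powr (\<alpha> * q) * t powr (- (\<alpha> * q)))
     = M2 / \<mu> 0 powr p * (T powr (\<alpha> * q) + M2 * Cb * T powr (\<alpha> * q)) * B * Y * t powr (- (\<alpha> * q))"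
    by (simp add: X_def powr_minus divide_inverse algebra_simps)
  show ?thesis using l2_bound_mono[OF b le] unfolding eq B_def .
qed

text \<open>Here \<Psi> consumes the weight \<mu>^p of the convolution at T, so the factor
  \<mu>_0^(-p) is missing and T^\<alpha> appears instead. The hypothesis on \<mu>_0 T^\<alpha>,
  raised to the power p, says that T^\<alpha> is at most \<mu>_0^(-p) T^(\<alpha> q).\<close>

lemma contraction_short_time:
  assumes pq: "0 < p" "0 < q" "p + q = 1" and C0: "0 \<le> C0" "C' = C0 * T powr \<alpha>" and Z: "\<mu> 0 * T powr \<alpha> \<le> 1"
    and H: "weighted H Y (\<alpha> * q)" and t: "0 < t" "t < T"
  shows "l2_bound (\<lambda>j. conv H j t - R j t * conv H j T)
     (M2 / \<mu> 0 powr p * (T powr (\<alpha> * q) + M2 * C0 * T powr (\<alpha> * q)) * Beta (\<alpha> * q) (1 - \<alpha> * q) * Y * t powr (- (\<alpha> * q)))"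
proof -
  have p: "0 \<le> p" "p < 1" "1 - p = q" "1 - q = p" using pq by auto
  have aq: "0 < \<alpha> * q" "\<alpha> * q < 1" using \<alpha> pq mult_strict_mono[of \<alpha> 1 q 1] by auto
  define B where "B = Beta (\<alpha> * q) (1 - \<alpha> * q)"
  have W: "l2_bound (\<lambda>j. \<mu> j powr p * conv H j x) (M2 * Y * B)" if "0 < x" "x \<le> T" for x
    using conv_integrable_bound(2)[OF H aq(2) that p(1,2), unfolded p(3)] that unfolding B_def by simp
  define X where "X = \<mu> 0 powr (- p) * (M2 * Y * B)"
  have X: "l2_bound (\<lambda>j. conv H j t) X" unfolding X_def using W t p by (intro l2_bound_drop_weight) auto
  have B: "0 \<le> M2 * Y * B" using W[of T] T l2_bound_nonneg by auto
  have Xnn: "0 \<le> X" using X l2_bound_nonneg by auto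
  have r: "l2_bound (\<lambda>j. R j t * conv H j T) (C' * M2 * (M2 * Y * B) * t powr (- (\<alpha> * q)))"
    using l2_bound_R[OF t(1), of q "\<lambda>j. conv H j T"] W[of T] T pq p(4) by auto
  have "T powr \<alpha> \<le> \<mu> 0 powr (- p) * T powr (\<alpha> * q)"
  proof -
    have "(\<mu> 0 * T powr \<alpha>) powr p \<le> 1" using Z \<mu>(1) T p by (intro powr_le1) auto
    then have "\<mu> 0 powr (- p) * (\<mu> 0 powr p * T powr (\<alpha> * p)) \<le> \<mu> 0 powr (- p) * 1"
      using \<mu>(1) T by (intro mult_left_mono) (auto simp: powr_mult powr_powr)
    then have "T powr (\<alpha> * p) \<le> \<mu> 0 powr (- p)" using \<mu>(1) by (simp add: powr_add[symmetric] mult.assoc[symmetric])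
    then have "T powr (\<alpha> * p) * T powr (\<alpha> * q) \<le> \<mu> 0 powr (- p) * T powr (\<alpha> * q)" by (rule mult_right_mono) simp
    moreover have "T powr (\<alpha> * p) * T powr (\<alpha> * q) = T powr \<alpha>" using pq by (simp add: powr_add[symmetric] distrib_left[symmetric])
    ultimately show ?thesis by simp
  qed
  then have "C0 * M2 * (M2 * Y * B) * t powr (- (\<alpha> * q)) * T powr \<alpha> \<le> C0 * M2 * (M2 * Y * B) * t powr (- (\<alpha> * q)) * (\<mu> 0 powr (- p) * T powr (\<alpha> * q))"
    using C0 M2 B by (intro mult_left_mono) auto
  moreover have "X * 1 \<le> X * (T powr (\<alpha> * q) * t powr (- (\<alpha> * q)))"
    using Xnn aq powr_ratio_ge_1[OF t, of "\<alpha> * q"] by (intro mult_left_mono) auto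
  ultimately have "X + C' * M2 * (M2 * Y * B) * t powr (- (\<alpha> * q))
     \<le> M2 / \<mu> 0 powr p * (T powr (\<alpha> * q) + M2 * C0 * T powr (\<alpha> * q)) * B * Y * t powr (- (\<alpha> * q))"
    by (simp add: C0(2) X_def powr_minus divide_inverse algebra_simps)
  with l2_bound_diff[OF X r] show ?thesis unfolding B_def by (rule l2_bound_mono)
qed

lemma K_le_K0: "0 < x \<Longrightarrow> \<bar>K j x\<bar> \<le> K 0 x"
  using ml_kernel_antimono[OF \<alpha>, of "\<mu> 0" "\<mu> j" x x] ml_kernel_pos[OF \<alpha>, of "\<mu> j" x] \<mu>(1) \<mu>(2)[of j] by (simp add: K_def)

lemma K_nonneg: "0 < x \<Longrightarrow> 0 \<le> K j x"
  using ml_kernel_pos[OF \<alpha>, of "\<mu> j" x] \<mu>_pos[of j] by (simp add: K_def)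

lemma K_powr_integral:
  assumes "0 < a" "a < 1" "0 < t"
  shows "integrable lborel (\<lambda>\<tau>. indicator {0<..<t} \<tau> * (K j (t - \<tau>) * \<tau> powr (- a)))"
    and "(\<integral>\<tau>. indicator {0<..<t} \<tau> * (K j (t - \<tau>) * \<tau> powr (- a)) \<partial>lborel) \<le> t powr (- a) / (\<mu> j * (1 - a))"
proof -
  show "integrable lborel (\<lambda>\<tau>. indicator {0<..<t} \<tau> * (K j (t - \<tau>) * \<tau> powr (- a)))"
    using ml_kernel_powr_convolution[OF \<alpha> assms(3), of "1 - a" "\<mu> j"] assms(2) by (simp add: K_def has_bochner_integral_iff)
  show "(\<integral>\<tau>. indicator {0<..<t} \<tau> * (K j (t - \<tau>) * \<tau> powr (- a)) \<partial>lborel) \<le> t powr (- a) / (\<mu> j * (1 - a))"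
    unfolding K_def by (rule ml_kernel_singular_bound[OF \<alpha> \<mu>_pos assms(3,1,2)])
qed

text \<open>For large \<open>\<mu> 0 * T powr \<alpha>\<close> the pointwise bounds on the kernels lose a logarithm; instead
  Cauchy--Schwarz with weight \<open>\<tau> powr (\<alpha> * s)\<close> is applied in each mode, and all kernels are
  dominated by the slowest one.\<close>

lemma contraction_long_time:
  assumes s: "1 / 2 \<le> s" "s < 1" and H: "weighted H Y (\<alpha> * s)" and t: "0 < t" "t < T"
  shows "l2_bound (\<lambda>j. conv H j t - R j t * conv H j T)
     ((1 / \<mu> 0 + C' * M2 * T powr (- (\<alpha> * s)) * \<mu> 0 powr (- s)) / (1 - \<alpha> * s) * Y * t powr (- (\<alpha> * s)))"
proof -
  define a where "a = \<alpha> * s"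
  have a: "0 < a" "a < 1" using \<alpha> s mult_strict_mono[of \<alpha> 1 s 1] by (auto simp: a_def)
  note [measurable] = weighted_measurable[OF H]
  have Y: "0 \<le> Y" using H by (rule weighted_nonneg)
  have HY: "AE \<tau> in lborel. 0 < \<tau> \<longrightarrow> \<tau> < T \<longrightarrow> l2_bound (\<lambda>j. H j \<tau>) (Y * \<tau> powr (- a))"
    using H by (simp add: weighted_def a_def)
  have m0: "0 < \<mu> 0" by (rule \<mu>_pos)
  have c: "l2_bound (\<lambda>j. conv H j t) (Y * (t powr (- a) / (\<mu> 0 * (1 - a))))"
  proof -
    let ?g = "\<lambda>\<tau>. Y * (indicator {0<..<t} \<tau> * (K 0 (t - \<tau>) * \<tau> powr (- a)))"
    have g: "integrable lborel ?g" by (intro integrable_mult_right K_powr_integral a t)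
    have "AE \<tau> in lborel. l2_bound (\<lambda>j. indicator {0<..<t} \<tau> * (K j (t - \<tau>) * H j \<tau>)) (?g \<tau>)"
      using HY
    proof eventually_elim
      case (elim \<tau>)
      show ?case
      proof (cases "0 < \<tau> \<and> \<tau> < t")
        case True
        then have "l2_bound (\<lambda>j. K j (t - \<tau>) * H j \<tau>) (K 0 (t - \<tau>) * (Y * \<tau> powr (- a)))"
          using elim t by (intro l2_bound_mult K_le_K0) auto
        then show ?thesis using True by (simp add: mult_ac)
      qed (use l2_bound_zero in \<open>auto simp: indicator_def\<close>)
    qed
    from l2_bound_integral(2)[OF _ this g]
    have "l2_bound (\<lambda>j. conv H j t) (Y * (\<integral>\<tau>. indicator {0<..<t} \<tau> * (K 0 (t - \<tau>) * \<tau> powr (- a)) \<partial>lborel))" by (simp add: conv_def)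
    then show ?thesis by (rule l2_bound_mono) (intro mult_left_mono K_powr_integral a t Y)
  qed
  define I where "I j = (\<integral>\<tau>. indicator {0<..<T} \<tau> * (K j (T - \<tau>) * \<tau> powr (- a)) \<partial>lborel)" for j
  \<comment> \<open>The second factor of Cauchy-Schwarz. It carries the kernel of the slowest mode
    instead of that of mode j, so that the sum over j acts only on the coordinates of H and can be
    bounded under the integral.\<close>
  define Q where "Q j \<tau> = indicator {0<..<T} \<tau> * (K 0 (T - \<tau>) * (\<tau> powr a * (H j \<tau>)\<^sup>2))" for j \<tau>
  define w where "w \<tau> = indicator {0<..<T} \<tau> * (K 0 (T - \<tau>) * \<tau> powr (- a))" for \<tau>
  have w: "integrable lborel w" unfolding w_def by (intro K_powr_integral a T)
  have [measurable]: "Q j \<in> borel_measurable borel" for j unfolding Q_def by measurable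
  have sumQ: "AE \<tau> in lborel. \<forall>n. (\<Sum>j<n. Q j \<tau>) \<le> Y\<^sup>2 * w \<tau>"
    using HY
  proof eventually_elim
    case (elim \<tau>)
    show ?case
    proof (cases "0 < \<tau> \<and> \<tau> < T")
      case True
      then have b: "l2_bound (\<lambda>j. H j \<tau>) (Y * \<tau> powr (- a))" using elim by auto
      show ?thesis
      proof
        fix n
        have "(\<Sum>j<n. (H j \<tau>)\<^sup>2) \<le> (Y * \<tau> powr (- a))\<^sup>2"
          using b l2_bound_nonneg[OF b] unfolding l2_bound_def L2_set_def by (metis sqrt_le_D)
        then have "K 0 (T - \<tau>) * \<tau> powr a * (\<Sum>j<n. (H j \<tau>)\<^sup>2) \<le> K 0 (T - \<tau>) * \<tau> powr a * (Y * \<tau> powr (- a))\<^sup>2"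
          using True K_nonneg[of "T - \<tau>" 0] by (intro mult_left_mono) auto
        also have "\<dots> = Y\<^sup>2 * (K 0 (T - \<tau>) * ((\<tau> powr a * \<tau> powr (- a)) * \<tau> powr (- a)))" by (simp add: power2_eq_square mult_ac)
        also have "\<tau> powr a * \<tau> powr (- a) = 1" using True by (simp add: powr_add[symmetric])
        finally show "(\<Sum>j<n. Q j \<tau>) \<le> Y\<^sup>2 * w \<tau>"
          using True by (simp add: Q_def w_def sum_distrib_left mult_ac)
      qed
    next
      case False
      then show ?thesis by (auto simp: Q_def w_def indicator_def)
    qed
  qed
  have Qnn: "0 \<le> Q j \<tau>" for j \<tau> using K_nonneg[of "T - \<tau>" 0] by (auto simp: Q_def indicator_def)
  have Qi: "integrable lborel (Q j)" for j
  proof (rule Bochner_Integration.integrable_bound)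
    show "integrable lborel (\<lambda>\<tau>. Y\<^sup>2 * w \<tau>)" using w by (rule integrable_mult_right)
    show "AE \<tau> in lborel. norm (Q j \<tau>) \<le> norm (Y\<^sup>2 * w \<tau>)"
      using sumQ
    proof eventually_elim
      case (elim \<tau>)
      have "Q j \<tau> \<le> (\<Sum>i<Suc j. Q i \<tau>)" using Qnn by (intro member_le_sum) auto
      also have "\<dots> \<le> Y\<^sup>2 * w \<tau>" using elim by blast
      finally show ?case using Qnn[of j \<tau>] by simp
    qed
  qed simp
  define qj where "qj j = (\<integral>\<tau>. Q j \<tau> \<partial>lborel)" for j
  have qnn: "0 \<le> qj j" for j unfolding qj_def using Qnn by (intro Bochner_Integration.integral_nonneg)
  have qsum: "(\<Sum>j<n. qj j) \<le> Y\<^sup>2 * (T powr (- a) / (\<mu> 0 * (1 - a)))" for n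
  proof -
    have "(\<Sum>j<n. qj j) = (\<integral>\<tau>. (\<Sum>j<n. Q j \<tau>) \<partial>lborel)"
      unfolding qj_def using Qi by (subst Bochner_Integration.integral_sum) auto
    also have "\<dots> \<le> (\<integral>\<tau>. Y\<^sup>2 * w \<tau> \<partial>lborel)"
      using sumQ Qi w by (intro integral_mono_AE) auto
    also have "\<dots> = Y\<^sup>2 * I 0" by (simp add: w_def I_def)
    also have "\<dots> \<le> Y\<^sup>2 * (T powr (- a) / (\<mu> 0 * (1 - a)))"
      unfolding I_def by (intro mult_left_mono K_powr_integral a T) simp
    finally show ?thesis .
  qed
  have CS: "(conv H j T)\<^sup>2 \<le> T powr (- a) / (\<mu> j * (1 - a)) * qj j" for j
  proof -
    let ?f = "\<lambda>\<tau>. indicator {0<..<T} \<tau> * (K j (T - \<tau>) * H j \<tau>)"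
    let ?i = "\<lambda>\<tau>. indicator {0<..<T} \<tau> * (K j (T - \<tau>) * \<tau> powr (- a))"
    have fi: "integrable lborel ?f" using conv_integrable_bound(1)[OF H[folded a_def] a(2) T order_refl, of 0 j] by simp
    have ii: "integrable lborel ?i" by (intro K_powr_integral a T)
    have "(conv H j T)\<^sup>2 \<le> (T powr (- a) / (\<mu> j * (1 - a))) * qj j"
    proof (rule square_le_mult_if_quadratic_nonneg)
      show "0 < T powr (- a) / (\<mu> j * (1 - a))" using T \<mu>_pos[of j] a by simp
      fix x y :: real
      \<comment> \<open>Young's inequality with the splitting of each product by u = \<tau>^(a/2).
        Integrated, it makes a quadratic form in x and y nonnegative, whose discriminant is the
        required Cauchy-Schwarz inequality.\<close>
      have pt: "2 * x * y * ?f \<tau> \<le> x\<^sup>2 * ?i \<tau> + y\<^sup>2 * Q j \<tau>" for \<tau>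
      proof (cases "0 < \<tau> \<and> \<tau> < T")
        case True
        define u where "u = \<tau> powr (a / 2)"
        have u: "0 < u" "\<tau> powr a = u\<^sup>2" "\<tau> powr (- a) = 1 / u\<^sup>2"
          using True powr_half_sqrt_powr[of \<tau>] by (auto simp: u_def powr_minus_divide power2_eq_square powr_add[symmetric])
        have k: "0 \<le> K j (T - \<tau>)" "K j (T - \<tau>) \<le> K 0 (T - \<tau>)"
          using K_nonneg[of "T - \<tau>" j] K_le_K0[of "T - \<tau>" j] True by auto
        have "2 * (x / u) * (y * u * H j \<tau>) \<le> (x / u)\<^sup>2 + (y * u * H j \<tau>)\<^sup>2" by (rule sum_squares_bound)
        then have "K j (T - \<tau>) * (2 * (x / u) * (y * u * H j \<tau>)) \<le> K j (T - \<tau>) * ((x / u)\<^sup>2 + (y * u * H j \<tau>)\<^sup>2)"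
          using k(1) by (rule mult_left_mono)
        also have "\<dots> \<le> K j (T - \<tau>) * (x / u)\<^sup>2 + K 0 (T - \<tau>) * (y * u * H j \<tau>)\<^sup>2"
          unfolding distrib_left using k(2) by (intro add_left_mono mult_right_mono) auto
        finally show ?thesis using True u(1)
          by (simp add: Q_def u power_divide power_mult_distrib mult_ac)
      next
        case False
        then have "indicator {0<..<T} \<tau> = (0::real)" by auto
        then show ?thesis by (simp add: Q_def)
      qed
      have "2 * x * y * conv H j T = (\<integral>\<tau>. 2 * x * y * ?f \<tau> \<partial>lborel)" by (simp add: conv_def)
      also have "\<dots> \<le> (\<integral>\<tau>. x\<^sup>2 * ?i \<tau> + y\<^sup>2 * Q j \<tau> \<partial>lborel)"
        using fi ii Qi by (intro integral_mono pt) auto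
      also have "\<dots> = x\<^sup>2 * I j + y\<^sup>2 * qj j" using ii Qi by (simp add: I_def qj_def)
      also have "\<dots> \<le> x\<^sup>2 * (T powr (- a) / (\<mu> j * (1 - a))) + y\<^sup>2 * qj j"
        unfolding I_def by (intro add_right_mono mult_left_mono K_powr_integral a T) simp
      finally show "0 \<le> x\<^sup>2 * (T powr (- a) / (\<mu> j * (1 - a))) - 2 * x * y * conv H j T + y\<^sup>2 * qj j" by simp
    qed
    then show ?thesis .
  qed
  define V where "V = \<mu> 0 powr (- s) * T powr (- a) * Y / (1 - a)"
  have V: "0 \<le> V" using Y a by (simp add: V_def)
  have v: "l2_bound (\<lambda>j. \<mu> j powr (1 - s) * conv H j T) V"
    unfolding l2_bound_def L2_set_def
  proof (intro allI real_le_lsqrt sum_nonneg zero_le_power2 V)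
    fix n
    have "(\<mu> j powr (1 - s) * conv H j T)\<^sup>2 \<le> (\<mu> 0 powr (1 - 2 * s) * T powr (- a) / (1 - a)) * qj j" for j
    proof -
      have mj: "0 < \<mu> j" by (rule \<mu>_pos)
      \<comment> \<open>The weight squared, divided by the \<mu>_j from Chebyshev's bound, leaves
        \<mu>_j^(1-2s). As s \<ge> 1/2 this is largest at the lowest mode.\<close>
      have e: "(\<mu> j powr (1 - s))\<^sup>2 = \<mu> j powr (1 - 2 * s) * \<mu> j"
        using mj powr_add[of "\<mu> j" "1 - 2 * s" 1] by (simp add: power2_eq_square powr_add[symmetric] algebra_simps)
      have "(\<mu> j powr (1 - s) * conv H j T)\<^sup>2 \<le> (\<mu> j powr (1 - s))\<^sup>2 * (T powr (- a) / (\<mu> j * (1 - a)) * qj j)"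
        unfolding power_mult_distrib by (intro mult_left_mono CS) simp
      also have "\<dots> = \<mu> j powr (1 - 2 * s) * (T powr (- a) / (1 - a) * qj j)" using mj by (simp add: e)
      also have "\<dots> \<le> \<mu> 0 powr (1 - 2 * s) * (T powr (- a) / (1 - a) * qj j)"
        using \<mu>(2)[of j] m0 s a qnn[of j] by (intro mult_right_mono powr_mono2') auto
      finally show ?thesis by simp
    qed
    then have "(\<Sum>j<n. (\<mu> j powr (1 - s) * conv H j T)\<^sup>2) \<le> (\<mu> 0 powr (1 - 2 * s) * T powr (- a) / (1 - a)) * (\<Sum>j<n. qj j)"
      unfolding sum_distrib_left by (intro sum_mono)
    also have "\<dots> \<le> (\<mu> 0 powr (1 - 2 * s) * T powr (- a) / (1 - a)) * (Y\<^sup>2 * (T powr (- a) / (\<mu> 0 * (1 - a))))"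
      using a by (intro mult_left_mono qsum) auto
    also have "\<dots> = V\<^sup>2"
    proof -
      have "\<mu> 0 powr (1 - 2 * s) = \<mu> 0 * (\<mu> 0 powr (- s))\<^sup>2"
        using m0 powr_add[of "\<mu> 0" 1 "- 2 * s"] by (simp add: power2_eq_square powr_add[symmetric])
      then show ?thesis using m0 by (simp add: V_def power2_eq_square)
    qed
    finally show "(\<Sum>i<n. (\<mu> i powr (1 - s) * conv H i T)\<^sup>2) \<le> V\<^sup>2" .
  qed
  have "l2_bound (\<lambda>j. R j t * conv H j T) (C' * M2 * V * t powr (- (\<alpha> * s)))"
    using l2_bound_R[OF t(1) _ _ v] s by simp
  from l2_bound_diff[OF c this]
  show ?thesis by (rule l2_bound_mono) (simp add: V_def a_def[symmetric] divide_inverse distrib_right distrib_left mult_ac)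
qed

end

context contraction
begin

text \<open>\<open>f\<close> is the nonlinearity read in coordinates.\<close>

lemma picard:
  fixes f :: "real \<Rightarrow> (nat \<Rightarrow> real) \<Rightarrow> nat \<Rightarrow> real"
  assumes f_meas: "\<And>c j. (\<And>i. c i \<in> borel_measurable borel) \<Longrightarrow>
        (\<And>t. 0 < t \<Longrightarrow> t < T \<Longrightarrow> summable (\<lambda>i. (c i t)\<^sup>2)) \<Longrightarrow>
        (\<lambda>t. indicator {0<..<T} t * f t (\<lambda>i. c i t) j) \<in> borel_measurable borel"
    and f_lip: "\<And>t c d B. 0 < t \<Longrightarrow> t < T \<Longrightarrow> summable (\<lambda>i. (c i)\<^sup>2) \<Longrightarrow> summable (\<lambda>i. (d i)\<^sup>2) \<Longrightarrow>
        l2_bound (\<lambda>i. c i - d i) B \<Longrightarrow> l2_bound (\<lambda>i. f t c i - f t d i) (\<Lambda> * B)"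
    and f_zero: "\<And>t i. 0 < t \<Longrightarrow> t < T \<Longrightarrow> f t (\<lambda>_. 0) i = 0"
    and \<Phi>: "l2_bound (\<lambda>j. \<mu> j powr (1 - s) * \<phi> j) \<Phi>"
  obtains c Y where "\<And>j. c j \<in> borel_measurable borel" "0 \<le> Y"
    "\<And>t. 0 < t \<Longrightarrow> t < T \<Longrightarrow> l2_bound (\<lambda>j. c j t) (Y * t powr (- (\<alpha> * s)))"
    "weighted (\<lambda>j t. indicator {0<..<T} t * f t (\<lambda>i. c i t) j) (\<Lambda> * Y) (\<alpha> * s)"
    "\<And>j t. 0 < t \<Longrightarrow> t < T \<Longrightarrow> c j t = sol (\<lambda>j t. indicator {0<..<T} t * f t (\<lambda>i. c i t) j) \<phi> j t"
proof -
  define Fop where "Fop c j t = indicator {0<..<T} t * f t (\<lambda>i. c i t) j" for c :: "nat \<Rightarrow> real \<Rightarrow> real" and j t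
  define S where "S c = sol (Fop c) \<phi>" for c
  define bd where "bd c Y \<longleftrightarrow> (\<forall>j. c j \<in> borel_measurable borel) \<and> 0 \<le> Y \<and>
     (\<forall>t. 0 < t \<longrightarrow> t < T \<longrightarrow> l2_bound (\<lambda>j. c j t) (Y * t powr (- (\<alpha> * s))))" for c :: "nat \<Rightarrow> real \<Rightarrow> real" and Y
  define dist_le where "dist_le c d Y \<longleftrightarrow> 0 \<le> Y \<and>
     (\<forall>t. 0 < t \<longrightarrow> t < T \<longrightarrow> l2_bound (\<lambda>j. c j t - d j t) (Y * t powr (- (\<alpha> * s))))" for c d :: "nat \<Rightarrow> real \<Rightarrow> real" and Y
  define G where "G = C' * M2 * \<Phi>"
  define \<theta> where "\<theta> = \<rho> * \<Lambda>"
  have \<theta>: "0 \<le> \<theta>" "\<theta> < 1" using \<rho> \<Lambda> by (auto simp: \<theta>_def)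
  have G: "0 \<le> G" using C'_nonneg M2 l2_bound_nonneg[OF \<Phi>] by (simp add: G_def)
  have bd_summable: "summable (\<lambda>j. (c j t)\<^sup>2)" if "bd c Y" "0 < t" "t < T" for c Y t
    using that l2_bound_summable unfolding bd_def by blast
  have Fop_meas: "Fop c j \<in> borel_measurable borel" if "bd c Y" for c Y j
    unfolding Fop_def using that bd_summable[OF that] by (intro f_meas) (auto simp: bd_def)
  have Fop_diff: "weighted (\<lambda>j t. Fop c j t - Fop d j t) (\<Lambda> * Y) (\<alpha> * s)"
    if "bd c Yc" "bd d Yd" "dist_le c d Y" for c d Yc Yd Y
    unfolding weighted_def
  proof (intro conjI allI AE_I2 impI)
    show "(\<lambda>t. Fop c j t - Fop d j t) \<in> borel_measurable borel" for j
      by (intro borel_measurable_diff Fop_meas[OF that(1)] Fop_meas[OF that(2)])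
    show "0 \<le> \<Lambda> * Y" using \<Lambda> that by (simp add: dist_le_def)
    fix t :: real assume t: "0 < t" "t < T"
    have "l2_bound (\<lambda>i. f t (\<lambda>i. c i t) i - f t (\<lambda>i. d i t) i) (\<Lambda> * (Y * t powr (- (\<alpha> * s))))"
      using t that by (intro f_lip bd_summable) (auto simp: dist_le_def)
    then show "l2_bound (\<lambda>j. Fop c j t - Fop d j t) (\<Lambda> * Y * t powr (- (\<alpha> * s)))"
      using t by (simp add: Fop_def mult.assoc)
  qed
  have bd0: "bd (\<lambda>_ _. 0) 0" by (simp add: bd_def l2_bound_zero)
  have Fop0: "Fop (\<lambda>_ _. 0) = (\<lambda>_ _. 0)" by (auto simp: Fop_def fun_eq_iff indicator_def f_zero)
  have Fop_w: "weighted (Fop c) (\<Lambda> * Y) (\<alpha> * s)" if "bd c Y" for c Y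
    using Fop_diff[OF that bd0, of Y] that by (simp add: Fop0 dist_le_def bd_def)
  have S_bd: "bd (S c) (G + \<theta> * Y)" if "bd c Y" for c Y
    unfolding bd_def
  proof (intro conjI allI impI)
    have [measurable]: "Fop c j \<in> borel_measurable borel" for j using Fop_meas[OF that] .
    show "S c j \<in> borel_measurable borel" for j unfolding S_def sol_def[abs_def] by measurable
    show "0 \<le> G + \<theta> * Y" using G \<theta> that by (simp add: bd_def)
    show "l2_bound (\<lambda>j. S c j t) ((G + \<theta> * Y) * t powr (- (\<alpha> * s)))" if "0 < t" "t < T" for t
      using sol_bound[OF Fop_w[OF \<open>bd c Y\<close>] \<Phi> that] by (simp add: S_def G_def \<theta>_def mult.assoc)
  qed
  have S_dist: "dist_le (S c) (S d) (\<theta> * Y)" if "bd c Yc" "bd d Yd" "dist_le c d Y" for c d Yc Yd Y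
    unfolding dist_le_def
  proof (intro conjI allI impI)
    show "0 \<le> \<theta> * Y" using \<theta> that by (simp add: dist_le_def)
    fix t :: real assume t: "0 < t" "t < T"
    have cd: "conv (\<lambda>j \<tau>. Fop c j \<tau> - Fop d j \<tau>) j x = conv (Fop c) j x - conv (Fop d) j x" if "0 < x" "x \<le> T" for j x
      using conv_diff[OF Fop_w[OF \<open>bd c Yc\<close>] Fop_w[OF \<open>bd d Yd\<close>] as(2) as(2) that] .
    have "S c j t - S d j t = conv (\<lambda>j \<tau>. Fop c j \<tau> - Fop d j \<tau>) j t - R j t * conv (\<lambda>j \<tau>. Fop c j \<tau> - Fop d j \<tau>) j T" for j
      using t T by (simp add: S_def sol_def cd algebra_simps)
    then show "l2_bound (\<lambda>j. S c j t - S d j t) (\<theta> * Y * t powr (- (\<alpha> * s)))"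
      using contr[OF Fop_diff[OF that] t] by (simp add: \<theta>_def mult.assoc)
  qed
  define C where "C n = (S ^^ n) (\<lambda>_ _. 0)" for n
  have C_Suc: "C (Suc n) = S (C n)" for n by (simp add: C_def)
  \<comment> \<open>The fixed point of Y \<mapsto> G + \<theta> Y, so \<open>S\<close> maps the ball
    of this radius into itself.\<close>
  define Yb where "Yb = G / (1 - \<theta>)"
  have Yb: "0 \<le> Yb" "G + \<theta> * Yb = Yb" using G \<theta> by (auto simp: Yb_def field_simps)
  have bd_mono: "bd c A \<Longrightarrow> A \<le> B \<Longrightarrow> bd c B" for c A B
    unfolding bd_def by (meson l2_bound_mono mult_right_mono powr_ge_zero order_trans)
  have C_bd: "bd (C n) Yb" for n
  proof (induction n)
    case 0
    show ?case unfolding C_def using bd_mono[OF bd0 Yb(1)] by simp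
  next
    case (Suc n)
    from S_bd[OF this] show ?case by (simp add: C_Suc Yb(2))
  qed
  have dist_mono: "dist_le c d A \<Longrightarrow> A \<le> B \<Longrightarrow> dist_le c d B" for c d A B
    unfolding dist_le_def by (meson l2_bound_mono mult_right_mono powr_ge_zero order_trans)
  \<comment> \<open>The two iterates are the images under n steps of \<open>C k\<close> and of the
    zero start, which differ by at most Yb; no geometric series has to be summed.\<close>
  have dist_C: "dist_le (C (n + k)) (C n) (Yb * \<theta> ^ n)" for n k
  proof (induction n)
    case 0
    then show ?case using C_bd[of k] by (simp add: dist_le_def bd_def C_def)
  next
    case (Suc n)
    from S_dist[OF C_bd C_bd this] show ?case by (simp add: C_Suc mult_ac)
  qed
  have conv_C: "convergent (\<lambda>n. C n j t)" if t: "0 < t" "t < T" for j t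
  proof (rule Cauchy_convergent, rule metric_CauchyI)
    fix e :: real assume e: "0 < e"
    define A where "A = Yb * t powr (- (\<alpha> * s))"
    have "(\<lambda>n. 2 * (A * \<theta> ^ n)) \<longlonglongrightarrow> 2 * (A * 0)" using \<theta> by (intro tendsto_intros LIMSEQ_power_zero) auto
    then have "\<forall>\<^sub>F n in sequentially. 2 * (A * \<theta> ^ n) < e" using e by (intro order_tendstoD) auto
    then obtain M where M: "2 * (A * \<theta> ^ M) < e" by (auto simp: eventually_sequentially)
    have b: "\<bar>C (M + k) j t - C M j t\<bar> \<le> A * \<theta> ^ M" for k
      using l2_bound_component[of "\<lambda>j. C (M + k) j t - C M j t"] dist_C[of M k] t by (auto simp: dist_le_def A_def mult_ac)
    show "\<exists>M. \<forall>m\<ge>M. \<forall>n\<ge>M. dist (C m j t) (C n j t) < e"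
    proof (intro exI allI impI)
      fix m n assume "M \<le> m" "M \<le> n"
      then show "dist (C m j t) (C n j t) < e" using b[of "m - M"] b[of "n - M"] M by (auto simp: dist_real_def)
    qed
  qed
  define c where "c j t = (if 0 < t \<and> t < T then lim (\<lambda>n. C n j t) else 0)" for j t
  have lim_C: "(\<lambda>n. C n j t) \<longlonglongrightarrow> c j t" if "0 < t" "t < T" for j t
    using conv_C[OF that, of j] that by (simp add: c_def convergent_LIMSEQ_iff)
  have c_meas: "c j \<in> borel_measurable borel" for j
  proof -
    have [measurable]: "C n j \<in> borel_measurable borel" for n using C_bd by (simp add: bd_def)
    show ?thesis unfolding c_def by measurable
  qed
  have c_dist: "dist_le c (C n) (Yb * \<theta> ^ n)" for n
    unfolding dist_le_def
  proof (intro conjI allI impI)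
    show "0 \<le> Yb * \<theta> ^ n" using Yb \<theta> by simp
    fix t :: real assume t: "0 < t" "t < T"
    show "l2_bound (\<lambda>j. c j t - C n j t) (Yb * \<theta> ^ n * t powr (- (\<alpha> * s)))"
    proof (rule l2_bound_LIMSEQ)
      show "l2_bound (\<lambda>j. C (n + k) j t - C n j t) (Yb * \<theta> ^ n * t powr (- (\<alpha> * s)))" for k
        using dist_C[of n k] t by (simp add: dist_le_def)
      show "(\<lambda>k. C (n + k) j t - C n j t) \<longlonglongrightarrow> c j t - C n j t" for j
        using LIMSEQ_ignore_initial_segment[OF lim_C[OF t, of j], of n] by (intro tendsto_diff tendsto_const) (simp add: add.commute)
    qed simp
  qed
  have c_bd: "bd c Yb"
    using c_dist[of 0] c_meas Yb by (simp add: bd_def dist_le_def C_def)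
  have fixpt: "c j t = S c j t" if t: "0 < t" "t < T" for j t
  proof -
    have "(\<lambda>n. C (Suc n) j t) \<longlonglongrightarrow> S c j t"
    proof (rule Lim_null[THEN iffD2], rule tendsto_0_le)
      show "(\<lambda>n. \<theta> * (Yb * \<theta> ^ n) * t powr (- (\<alpha> * s))) \<longlonglongrightarrow> 0"
      proof -
        have "(\<lambda>n. \<theta> * (Yb * \<theta> ^ n) * t powr (- (\<alpha> * s))) \<longlonglongrightarrow> \<theta> * (Yb * 0) * t powr (- (\<alpha> * s))"
          using \<theta> by (intro tendsto_intros LIMSEQ_power_zero) auto
        then show ?thesis by simp
      qed
      show "\<forall>\<^sub>F n in sequentially. norm (C (Suc n) j t - S c j t) \<le> norm (\<theta> * (Yb * \<theta> ^ n) * t powr (- (\<alpha> * s))) * 1"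
      proof (intro always_eventually allI)
        fix n
        have "dist_le (S c) (S (C n)) (\<theta> * (Yb * \<theta> ^ n))" by (rule S_dist[OF c_bd C_bd c_dist])
        then have "\<bar>S c j t - S (C n) j t\<bar> \<le> \<theta> * (Yb * \<theta> ^ n) * t powr (- (\<alpha> * s))"
          using t l2_bound_component[of "\<lambda>j. S c j t - S (C n) j t"] by (auto simp: dist_le_def)
        then show "norm (C (Suc n) j t - S c j t) \<le> norm (\<theta> * (Yb * \<theta> ^ n) * t powr (- (\<alpha> * s))) * 1"
          using \<theta> Yb by (simp add: C_Suc abs_mult abs_minus_commute)
      qed
    qed
    with LIMSEQ_Suc[OF lim_C[OF t, of j]] show ?thesis by (rule LIMSEQ_unique)
  qed
  show ?thesis
  proof (rule that[of c Yb])
    show "l2_bound (\<lambda>j. c j t) (Yb * t powr (- (\<alpha> * s)))" if "0 < t" "t < T" for t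
      using c_bd that by (simp add: bd_def)
    show "weighted (\<lambda>j t. indicator {0<..<T} t * f t (\<lambda>i. c i t) j) (\<Lambda> * Yb) (\<alpha> * s)"
      using Fop_w[OF c_bd] by (simp add: Fop_def[abs_def])
    show "c j t = sol (\<lambda>j t. indicator {0<..<T} t * f t (\<lambda>i. c i t) j) \<phi> j t" if "0 < t" "t < T" for j t
      using fixpt[OF that, of j] by (simp add: S_def Fop_def[abs_def])
  qed (use c_meas Yb in auto)
qed

end

section \<open>The Caputo derivative of the modes\<close>

text \<open>The variant of \<open>triangle_fubini\<close> for an unbounded density: sources behave
  like \<tau>^(-a), so boundedness is replaced by integrability of the outer integrand. Positivity
  of the kernel makes that integrand also control the integral of the absolute value.\<close>

lemma triangle_fubini_integrable:
  fixes a :: "real \<Rightarrow> real \<Rightarrow> real" and g W :: "real \<Rightarrow> real"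
  assumes a[measurable]: "(\<lambda>(\<tau>, s). a \<tau> s) \<in> borel_measurable (borel \<Otimes>\<^sub>M borel)"
    and nonneg: "\<And>\<tau> s. 0 < \<tau> \<Longrightarrow> \<tau> < s \<Longrightarrow> s < t \<Longrightarrow> 0 \<le> a \<tau> s"
    and g[measurable]: "g \<in> borel_measurable borel"
    and W: "\<And>\<tau>. 0 < \<tau> \<Longrightarrow> \<tau> < t \<Longrightarrow> has_bochner_integral lborel (\<lambda>s. indicator {\<tau><..<t} s * a \<tau> s) (W \<tau>)"
    and int: "integrable lborel (\<lambda>\<tau>. indicator {0<..<t} \<tau> * (g \<tau> * W \<tau>))"
  shows "has_bochner_integral lborel (\<lambda>s. indicator {0<..<t} s * (\<integral>\<tau>. indicator {0<..<s} \<tau> * (a \<tau> s * g \<tau>) \<partial>lborel))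
    (\<integral>\<tau>. indicator {0<..<t} \<tau> * (g \<tau> * W \<tau>) \<partial>lborel)"
proof -
  define h where "h \<tau> s = (if 0 < \<tau> \<and> \<tau> < s \<and> s < t then a \<tau> s * g \<tau> else 0)" for \<tau> s
  have h_meas[measurable]: "(\<lambda>(\<tau>, s). h \<tau> s) \<in> borel_measurable (lborel \<Otimes>\<^sub>M lborel)"
    unfolding h_def by measurable
  have h_int: "has_bochner_integral lborel (h \<tau>) (indicator {0<..<t} \<tau> * (g \<tau> * W \<tau>))"
    and h_norm: "(\<integral>s. norm (h \<tau> s) \<partial>lborel) = \<bar>indicator {0<..<t} \<tau> * (g \<tau> * W \<tau>)\<bar>" for \<tau>
  proof -
    have "has_bochner_integral lborel (h \<tau>) (indicator {0<..<t} \<tau> * (g \<tau> * W \<tau>)) \<and>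
      (\<integral>s. norm (h \<tau> s) \<partial>lborel) = \<bar>indicator {0<..<t} \<tau> * (g \<tau> * W \<tau>)\<bar>"
    proof (cases "0 < \<tau> \<and> \<tau> < t")
      case True
      have eq: "h \<tau> = (\<lambda>s. g \<tau> * (indicator {\<tau><..<t} s * a \<tau> s))"
        and eqn: "(\<lambda>s. norm (h \<tau> s)) = (\<lambda>s. \<bar>g \<tau>\<bar> * (indicator {\<tau><..<t} s * a \<tau> s))"
        using True nonneg[of \<tau>] by (auto simp: h_def indicator_def fun_eq_iff abs_mult)
      note w = W[of \<tau>]
      have "0 \<le> (\<integral>s. indicator {\<tau><..<t} s * a \<tau> s \<partial>lborel)"
        using True nonneg[of \<tau>] by (intro Bochner_Integration.integral_nonneg) (auto simp: indicator_def)
      then have "0 \<le> W \<tau>" using has_bochner_integral_integral_eq[OF w] True by simp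
      then show ?thesis
        using has_bochner_integral_mult_right[OF w, of "g \<tau>"] has_bochner_integral_integral_eq[OF has_bochner_integral_mult_right[OF w, of "\<bar>g \<tau>\<bar>"]] True
        unfolding eqn by (simp add: eq abs_mult)
    next
      case False
      then have "h \<tau> = (\<lambda>_. 0)" "indicator {0<..<t} \<tau> = (0::real)" by (auto simp: h_def fun_eq_iff)
      then show ?thesis by (simp add: has_bochner_integral_zero)
    qed
    then show "has_bochner_integral lborel (h \<tau>) (indicator {0<..<t} \<tau> * (g \<tau> * W \<tau>))"
      "(\<integral>s. norm (h \<tau> s) \<partial>lborel) = \<bar>indicator {0<..<t} \<tau> * (g \<tau> * W \<tau>)\<bar>" by auto
  qed
  have pair: "integrable (lborel \<Otimes>\<^sub>M lborel) (\<lambda>(\<tau>, s). h \<tau> s)"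
  proof (rule lborel_pair.Fubini_integrable)
    show "integrable lborel (\<lambda>\<tau>. \<integral>s. norm (case (\<tau>, s) of (\<tau>, s) \<Rightarrow> h \<tau> s) \<partial>lborel)"
      using int by (simp add: h_norm[simplified] integrable_abs flip: abs_mult)
    show "AE \<tau> in lborel. integrable lborel (\<lambda>s. case (\<tau>, s) of (\<tau>, s) \<Rightarrow> h \<tau> s)"
      using h_int by (auto simp: has_bochner_integral_iff)
  qed measurable
  have inner: "(\<integral>\<tau>. h \<tau> s \<partial>lborel) = indicator {0<..<t} s * (\<integral>\<tau>. indicator {0<..<s} \<tau> * (a \<tau> s * g \<tau>) \<partial>lborel)" for s
  proof (cases "0 < s \<and> s < t")
    case True
    then show ?thesis by (auto simp: h_def indicator_def intro!: Bochner_Integration.integral_cong)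
  next
    case False
    then have "h \<tau> s = 0" for \<tau> by (auto simp: h_def)
    with False show ?thesis by (auto simp: indicator_def)
  qed
  show ?thesis
    using lborel_pair.integrable_snd[OF pair] lborel_pair.Fubini_integral[OF pair]
    by (simp add: inner has_bochner_integral_integral_eq[OF h_int] has_bochner_integral_iff)
qed

lemma has_bochner_integral_translate:
  fixes f :: "real \<Rightarrow> real"
  assumes "has_bochner_integral lborel (\<lambda>s. indicator {0<..<t - \<tau>} s * f s) I"
  shows "has_bochner_integral lborel (\<lambda>s. indicator {\<tau><..<t} s * f (s - \<tau>)) I"
proof -
  have "has_bochner_integral lborel (\<lambda>s. indicator {0<..<t - \<tau>} (- \<tau> + 1 * s) * f (- \<tau> + 1 * s)) (I /\<^sub>R \<bar>1\<bar>)"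
    using assms by (subst lborel_has_bochner_integral_real_affine_iff[symmetric]) auto
  then show ?thesis
    by (elim has_bochner_integral_cong[THEN iffD1, rotated -1]) (auto simp: indicator_def)
qed

text \<open>The number \<delta> measures the negative order of the space that contains the
  derivative. Since \<Psi>_j is controlled by \<mu>_j, the weight 1 - \<delta> in
  \<open>init\<close> is what puts the initial value into the space of weight -\<delta>; \<delta> <
  1 lets the convolution satisfy it as well.\<close>

locale caputo_modes = ml_modes +
  fixes H :: "nat \<Rightarrow> real \<Rightarrow> real" and Y a :: real and \<phi> :: "nat \<Rightarrow> real" and \<delta> B :: real
  assumes H: "weighted H Y a" and a: "0 < a" "a < \<alpha>" and \<delta>: "0 < \<delta>" "\<delta> < 1"
    and mono_\<mu>: "mono \<mu>" and \<mu>_lim: "filterlim \<mu> at_top sequentially"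
    and init: "l2_bound (\<lambda>j. \<mu> j powr (1 - \<delta>) * (\<phi> j - conv H j T)) B"
begin

lemma a1: "a < 1"
  using a \<alpha> by simp

lemma Y_nonneg: "0 \<le> Y"
  using H by (rule weighted_nonneg)

lemma borel_H [measurable]: "H j \<in> borel_measurable borel"
  using H by (rule weighted_measurable)

text \<open>\<open>U\<close> and \<open>W\<close> are the coordinates of \<open>u\<close> and of \<open>\<partial>\<^sub>t\<^sup>\<alpha> u\<close>, and \<open>b0\<close> those of \<open>u(0)\<close>.\<close>

definition U :: "nat \<Rightarrow> real \<Rightarrow> real" where "U j t = sol H \<phi> j t"

definition W :: "nat \<Rightarrow> real \<Rightarrow> real" where "W j t = - \<mu> j * U j t + H j t"

definition E :: "nat \<Rightarrow> real \<Rightarrow> real" where "E j t = mittag_leffler \<alpha> 1 (- (\<mu> j * t powr \<alpha>))"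

definition b0 :: "nat \<Rightarrow> real" where "b0 j = \<Psi> j * (\<phi> j - conv H j T)"

lemma U_eq: "U j t = b0 j * E j t + conv H j t"
  by (simp add: U_def sol_def R_def E_def b0_def mult_ac)

lemma E_0: "E j 0 = 1"
  using \<alpha> by (simp add: E_def mittag_leffler_0)

lemma conv_0: "conv H j 0 = 0"
  by (simp add: conv_def)

lemma borel_E [measurable]: "E j \<in> borel_measurable borel"
  unfolding E_def[abs_def] by measurable

lemma borel_U [measurable]: "U j \<in> borel_measurable borel"
  unfolding U_eq[abs_def] by measurable

lemma borel_W [measurable]: "W j \<in> borel_measurable borel"
  unfolding W_def[abs_def] by measurable

lemma E_abs_le: "0 \<le> t \<Longrightarrow> \<bar>E j t\<bar> \<le> M2"
  unfolding E_def by (rule E1_le)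

lemma H_abs: "AE \<tau> in lborel. 0 < \<tau> \<longrightarrow> \<tau> < T \<longrightarrow> \<bar>H j \<tau>\<bar> \<le> Y * \<tau> powr (- a)"
  using H[unfolded weighted_def, THEN conjunct2, THEN conjunct2]
  by eventually_elim (auto dest!: l2_bound_component[of _ _ j])

lemma H_integrable:
  assumes "t \<le> T" "g \<in> borel_measurable borel" "\<And>x. 0 < x \<Longrightarrow> x < t \<Longrightarrow> \<bar>g x\<bar> \<le> D"
  shows "integrable lborel (\<lambda>x. indicator {0<..<t} x * (H j x * g x))"
proof (cases "0 < t")
  case True
  note [measurable] = assms(2)
  have D: "0 \<le> D" using assms(3)[of "t / 2"] True by auto
  show ?thesis
  proof (rule Bochner_Integration.integrable_bound)
    have "has_bochner_integral lborel (\<lambda>x. indicator {0<..<t} x * x powr ((1 - a) - 1)) (t powr (1 - a) / (1 - a))"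
      using True a1 by (intro powr_kernel_aux) auto
    then show "integrable lborel (\<lambda>x. (Y * D) * (indicator {0<..<t} x * x powr (- a)))"
      by (intro integrable_mult_right) (auto simp: has_bochner_integral_iff)
    show "AE x in lborel. norm (indicator {0<..<t} x * (H j x * g x)) \<le> norm ((Y * D) * (indicator {0<..<t} x * x powr (- a)))"
      using H_abs[of j]
    proof eventually_elim
      case (elim x)
      show ?case
      proof (cases "0 < x \<and> x < t")
        case True
        then have "\<bar>H j x\<bar> * \<bar>g x\<bar> \<le> (Y * x powr (- a)) * D"
          using elim assms(1,3) Y_nonneg by (intro mult_mono) auto
        then show ?thesis using True Y_nonneg D by (simp add: abs_mult mult_ac)
      qed (auto simp: indicator_def)
    qed
  qed measurable
qed simp

text \<open>Both sides of the Caputo identity reduce to \<open>\<integral> H(x) E(t - x) dx\<close>: the fractional integral of the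
  kernel is \<open>E\<close>, and \<open>1 - \<mu> \<integral> K = E\<close>.\<close>

lemma caputo_mode:
  assumes t: "0 < t" "t \<le> T"
  shows "has_bochner_integral lborel (\<lambda>\<tau>. indicator {0<..<t} \<tau> * ((t - \<tau>) powr (- \<alpha>) * (U j \<tau> - U j 0)))
      (Gamma (1 - \<alpha>) * (\<integral>\<tau>. indicator {0<..<t} \<tau> * W j \<tau> \<partial>lborel))"
    and "integrable lborel (\<lambda>\<tau>. indicator {0<..<t} \<tau> * W j \<tau>)"
proof -
  let ?E = "\<lambda>\<sigma>. mittag_leffler \<alpha> \<sigma> (- (\<mu> j * t powr \<alpha>))"
  define X where "X = (\<integral>x. indicator {0<..<t} x * (H j x * E j (t - x)) \<partial>lborel)"
  have G0: "0 < Gamma (1 - \<alpha>)" using \<alpha> by (intro Gamma_real_pos) simp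
  have frac_E: "has_bochner_integral lborel (\<lambda>\<tau>. indicator {0<..<t} \<tau> * ((t - \<tau>) powr (- \<alpha>) * E j \<tau>)) (Gamma (1 - \<alpha>) * t powr (1 - \<alpha>) * ?E (2 - \<alpha>))"
  proof -
    have "has_bochner_integral lborel (\<lambda>\<tau>. indicator {0<..<t} \<tau> * ((t - \<tau>) powr ((1 - \<alpha>) - 1) * (\<tau> powr (1 - 1) * E j \<tau>)))
      (Gamma (1 - \<alpha>) * t powr (1 + (1 - \<alpha>) - 1) * ?E (1 + (1 - \<alpha>)))"
      unfolding E_def using \<alpha> t by (intro mittag_leffler_convolution) auto
    then have "has_bochner_integral lborel (\<lambda>\<tau>. indicator {0<..<t} \<tau> * ((t - \<tau>) powr (- \<alpha>) * E j \<tau>)) (Gamma (1 - \<alpha>) * t powr (1 + (1 - \<alpha>) - 1) * ?E (1 + (1 - \<alpha>)))"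
      by (elim has_bochner_integral_cong[THEN iffD1, rotated -1]) (auto simp: indicator_def)
    then show ?thesis by (simp add: algebra_simps)
  qed
  have int_E: "has_bochner_integral lborel (\<lambda>\<tau>. indicator {0<..<t} \<tau> * E j \<tau>) (t * ?E 2)"
  proof -
    have "has_bochner_integral lborel (\<lambda>\<tau>. indicator {0<..<t} \<tau> * ((t - \<tau>) powr (1 - 1) * (\<tau> powr (1 - 1) * E j \<tau>)))
      (Gamma 1 * t powr (1 + 1 - 1) * ?E (1 + 1))"
      unfolding E_def using \<alpha> t by (intro mittag_leffler_convolution) auto
    then have "has_bochner_integral lborel (\<lambda>\<tau>. indicator {0<..<t} \<tau> * E j \<tau>) (Gamma 1 * t powr (1 + 1 - 1) * ?E (1 + 1))"
      by (elim has_bochner_integral_cong[THEN iffD1, rotated -1]) (auto simp: indicator_def)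
    then show ?thesis using t by simp
  qed
  have frac_1: "has_bochner_integral lborel (\<lambda>\<tau>. indicator {0<..<t} \<tau> * (t - \<tau>) powr (- \<alpha>)) (t powr (1 - \<alpha>) / (1 - \<alpha>))"
    using powr_kernel(2)[of "1 - \<alpha>" 0 t] \<alpha> t by simp
  have Kj: "0 \<le> K j (s - \<tau>)" if "\<tau> < s" for s \<tau> using that by (intro K_nonneg) simp
  have frac_conv: "has_bochner_integral lborel (\<lambda>s. indicator {0<..<t} s * ((t - s) powr (- \<alpha>) * conv H j s)) (Gamma (1 - \<alpha>) * X)"
  proof -
    have "has_bochner_integral lborel
       (\<lambda>s. indicator {0<..<t} s * (\<integral>\<tau>. indicator {0<..<s} \<tau> * (((t - s) powr (- \<alpha>) * K j (s - \<tau>)) * H j \<tau>) \<partial>lborel))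
       (\<integral>\<tau>. indicator {0<..<t} \<tau> * (H j \<tau> * (Gamma (1 - \<alpha>) * E j (t - \<tau>))) \<partial>lborel)"
    proof (rule triangle_fubini_integrable)
      show "has_bochner_integral lborel (\<lambda>s. indicator {\<tau><..<t} s * ((t - s) powr (- \<alpha>) * K j (s - \<tau>))) (Gamma (1 - \<alpha>) * E j (t - \<tau>))"
        if "0 < \<tau>" "\<tau> < t" for \<tau>
      proof -
        have "has_bochner_integral lborel (\<lambda>s. indicator {0<..<t - \<tau>} s * ((t - \<tau> - s) powr (- \<alpha>) * K j s)) (Gamma (1 - \<alpha>) * E j (t - \<tau>))"
          unfolding K_def E_def using that by (intro ml_kernel_fractional_integral \<alpha>) simp
        from has_bochner_integral_translate[OF this] show ?thesis by simp
      qed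
      show "integrable lborel (\<lambda>\<tau>. indicator {0<..<t} \<tau> * (H j \<tau> * (Gamma (1 - \<alpha>) * E j (t - \<tau>))))"
        using t G0 E_abs_le by (intro H_integrable[where D = "Gamma (1 - \<alpha>) * M2"]) (auto simp: abs_mult)
    qed (use Kj in auto)
    moreover have "(\<integral>\<tau>. indicator {0<..<t} \<tau> * (H j \<tau> * (Gamma (1 - \<alpha>) * E j (t - \<tau>))) \<partial>lborel) = Gamma (1 - \<alpha>) * X"
      unfolding X_def by (subst integral_mult_right_zero[symmetric]) (simp add: mult_ac)
    moreover have "(\<integral>\<tau>. indicator {0<..<s} \<tau> * (((t - s) powr (- \<alpha>) * K j (s - \<tau>)) * H j \<tau>) \<partial>lborel) = (t - s) powr (- \<alpha>) * conv H j s" for s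
      unfolding conv_def by (subst integral_mult_right_zero[symmetric]) (simp add: mult_ac)
    ultimately show ?thesis by simp
  qed
  have HE: "integrable lborel (\<lambda>x. indicator {0<..<t} x * (H j x * E j (t - x)))"
    using t E_abs_le by (intro H_integrable[where D = M2]) auto
  have HH: "integrable lborel (\<lambda>x. indicator {0<..<t} x * (H j x * 1))"
    using t by (intro H_integrable[where D = 1]) auto
  have int_conv: "has_bochner_integral lborel (\<lambda>s. indicator {0<..<t} s * conv H j s) (((\<integral>x. indicator {0<..<t} x * H j x \<partial>lborel) - X) / \<mu> j)"
  proof -
    have "has_bochner_integral lborel
       (\<lambda>s. indicator {0<..<t} s * (\<integral>\<tau>. indicator {0<..<s} \<tau> * (K j (s - \<tau>) * H j \<tau>) \<partial>lborel))
       (\<integral>\<tau>. indicator {0<..<t} \<tau> * (H j \<tau> * ((1 - E j (t - \<tau>)) / \<mu> j)) \<partial>lborel)"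
    proof (rule triangle_fubini_integrable)
      show "has_bochner_integral lborel (\<lambda>s. indicator {\<tau><..<t} s * K j (s - \<tau>)) ((1 - E j (t - \<tau>)) / \<mu> j)"
        if "0 < \<tau>" "\<tau> < t" for \<tau>
      proof -
        have "has_bochner_integral lborel (\<lambda>s. indicator {0<..<t - \<tau>} s * K j (t - \<tau> - s)) ((1 - E j (t - \<tau>)) / \<mu> j)"
          unfolding K_def E_def using that \<mu>_pos[of j] by (intro ml_kernel_integral \<alpha>) auto
        from has_bochner_integral_reflect[OF this] have "has_bochner_integral lborel (\<lambda>s. indicator {0<..<t - \<tau>} s * K j s) ((1 - E j (t - \<tau>)) / \<mu> j)" by simp
        from has_bochner_integral_translate[OF this] show ?thesis .
      qed
      have "integrable lborel (\<lambda>\<tau>. (indicator {0<..<t} \<tau> * (H j \<tau> * 1) - indicator {0<..<t} \<tau> * (H j \<tau> * E j (t - \<tau>))) / \<mu> j)"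
        using HE HH by (intro integrable_divide Bochner_Integration.integrable_diff)
      then show "integrable lborel (\<lambda>\<tau>. indicator {0<..<t} \<tau> * (H j \<tau> * ((1 - E j (t - \<tau>)) / \<mu> j)))"
        by (simp add: algebra_simps diff_divide_distrib)
    qed (use Kj in auto)
    moreover have "(\<integral>\<tau>. indicator {0<..<t} \<tau> * (H j \<tau> * ((1 - E j (t - \<tau>)) / \<mu> j)) \<partial>lborel)
       = (\<integral>\<tau>. (indicator {0<..<t} \<tau> * (H j \<tau> * 1) - indicator {0<..<t} \<tau> * (H j \<tau> * E j (t - \<tau>))) / \<mu> j \<partial>lborel)"
      by (intro Bochner_Integration.integral_cong) (auto simp: algebra_simps diff_divide_distrib)
    moreover have "\<dots> = ((\<integral>x. indicator {0<..<t} x * H j x \<partial>lborel) - X) / \<mu> j"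
      using HE HH by (simp add: X_def)
    ultimately show ?thesis unfolding conv_def by (simp only:)
  qed
  \<comment> \<open>The identity for the homogeneous mode: the recursion in the second index
    isolates a leading term that is the fractional integral of E(0) = 1, and what remains is -\<mu>
    times the ordinary integral of E.\<close>
  have shift: "Gamma (1 - \<alpha>) * t powr (1 - \<alpha>) * ?E (2 - \<alpha>) - t powr (1 - \<alpha>) / (1 - \<alpha>) = Gamma (1 - \<alpha>) * (- \<mu> j * (t * ?E 2))"
  proof -
    have "Gamma (1 - \<alpha> + 1) = (1 - \<alpha>) * Gamma (1 - \<alpha>)"
      using \<alpha> by (intro Gamma_plus1) (auto elim!: nonpos_Ints_cases)
    then have G2: "Gamma (2 - \<alpha>) = (1 - \<alpha>) * Gamma (1 - \<alpha>)" by simp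
    have G: "Gamma (1 - \<alpha>) * inverse (Gamma (2 - \<alpha>)) = 1 / (1 - \<alpha>)"
      unfolding G2 using less_imp_neq[OF G0, symmetric] \<alpha> by (simp add: field_simps)
    have e: "?E (2 - \<alpha>) = inverse (Gamma (2 - \<alpha>)) + - (\<mu> j * t powr \<alpha>) * ?E 2"
      using mittag_leffler_shift[OF \<alpha>, of "2 - \<alpha>" "- (\<mu> j * t powr \<alpha>)"] \<alpha> by simp
    have "Gamma (1 - \<alpha>) * t powr (1 - \<alpha>) * ?E (2 - \<alpha>)
       = t powr (1 - \<alpha>) * (Gamma (1 - \<alpha>) * inverse (Gamma (2 - \<alpha>))) + Gamma (1 - \<alpha>) * (- \<mu> j * ((t powr (1 - \<alpha>) * t powr \<alpha>) * ?E 2))"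
      unfolding e by (simp add: algebra_simps)
    also have "t powr (1 - \<alpha>) * t powr \<alpha> = t" using t by (simp add: powr_add[symmetric])
    finally show ?thesis unfolding G by simp
  qed
  have intW: "has_bochner_integral lborel (\<lambda>\<tau>. - \<mu> j * (b0 j * (indicator {0<..<t} \<tau> * E j \<tau>) + indicator {0<..<t} \<tau> * conv H j \<tau>) + indicator {0<..<t} \<tau> * (H j \<tau> * 1))
     (- \<mu> j * (b0 j * (t * ?E 2) + ((\<integral>x. indicator {0<..<t} x * H j x \<partial>lborel) - X) / \<mu> j) + (\<integral>x. indicator {0<..<t} x * (H j x * 1) \<partial>lborel))"
    by (intro has_bochner_integral_add has_bochner_integral_mult_right int_E int_conv has_bochner_integral_integrable HH)
  have eqW: "- \<mu> j * (b0 j * (indicator {0<..<t} \<tau> * E j \<tau>) + indicator {0<..<t} \<tau> * conv H j \<tau>) + indicator {0<..<t} \<tau> * (H j \<tau> * 1)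
     = indicator {0<..<t} \<tau> * W j \<tau>" for \<tau>
    by (simp add: W_def U_eq algebra_simps)
  \<comment> \<open>The integral of H enters once through -\<mu> times the convolution and once
    directly, with opposite signs; only the term X survives.\<close>
  have valW: "- \<mu> j * (b0 j * (t * ?E 2) + ((\<integral>x. indicator {0<..<t} x * H j x \<partial>lborel) - X) / \<mu> j) + (\<integral>x. indicator {0<..<t} x * (H j x * 1) \<partial>lborel)
     = b0 j * (- \<mu> j * (t * ?E 2)) + X"
    using \<mu>_pos[of j] by (simp add: field_simps)
  note intW' = intW[unfolded eqW valW]
  show "integrable lborel (\<lambda>\<tau>. indicator {0<..<t} \<tau> * W j \<tau>)" using intW' by (simp add: has_bochner_integral_iff)
  have "has_bochner_integral lborel
     (\<lambda>\<tau>. b0 j * (indicator {0<..<t} \<tau> * ((t - \<tau>) powr (- \<alpha>) * E j \<tau>) - indicator {0<..<t} \<tau> * (t - \<tau>) powr (- \<alpha>)) + indicator {0<..<t} \<tau> * ((t - \<tau>) powr (- \<alpha>) * conv H j \<tau>))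
     (b0 j * (Gamma (1 - \<alpha>) * t powr (1 - \<alpha>) * ?E (2 - \<alpha>) - t powr (1 - \<alpha>) / (1 - \<alpha>)) + Gamma (1 - \<alpha>) * X)"
    by (intro has_bochner_integral_add has_bochner_integral_diff has_bochner_integral_mult_right frac_E frac_1 frac_conv)
  moreover have "b0 j * (indicator {0<..<t} \<tau> * ((t - \<tau>) powr (- \<alpha>) * E j \<tau>) - indicator {0<..<t} \<tau> * (t - \<tau>) powr (- \<alpha>)) + indicator {0<..<t} \<tau> * ((t - \<tau>) powr (- \<alpha>) * conv H j \<tau>)
     = indicator {0<..<t} \<tau> * ((t - \<tau>) powr (- \<alpha>) * (U j \<tau> - U j 0))" for \<tau>
    by (simp add: U_eq E_0 conv_0 algebra_simps)
  moreover have "b0 j * (Gamma (1 - \<alpha>) * t powr (1 - \<alpha>) * ?E (2 - \<alpha>) - t powr (1 - \<alpha>) / (1 - \<alpha>)) + Gamma (1 - \<alpha>) * X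
     = Gamma (1 - \<alpha>) * (\<integral>\<tau>. indicator {0<..<t} \<tau> * W j \<tau> \<partial>lborel)"
    unfolding shift has_bochner_integral_integral_eq[OF intW'] by (simp add: algebra_simps)
  ultimately show "has_bochner_integral lborel (\<lambda>\<tau>. indicator {0<..<t} \<tau> * ((t - \<tau>) powr (- \<alpha>) * (U j \<tau> - U j 0)))
      (Gamma (1 - \<alpha>) * (\<integral>\<tau>. indicator {0<..<t} \<tau> * W j \<tau> \<partial>lborel))"
    by simp
qed

text \<open>The weighted derivative splits into three parts, one for each summand of the constant: R
  at \<theta> = 1 applied to the data of \<open>init\<close>, the convolution with weight 1 -
  \<delta>, and the source. The last two are less singular than t^(-\<alpha>) and are raised to that
  rate by powers of T.\<close>

lemma W_bound:
  "AE t in lborel. 0 < t \<longrightarrow> t < T \<longrightarrow> l2_bound (\<lambda>j. \<mu> j powr (- \<delta>) * W j t)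
     ((C' * M2 * B + M2 * Y * Beta (\<alpha> * \<delta>) (1 - a) * T powr (\<alpha> * \<delta> - a + \<alpha>) + \<mu> 0 powr (- \<delta>) * Y * T powr (\<alpha> - a)) * t powr (- \<alpha>))"
  using H[unfolded weighted_def, THEN conjunct2, THEN conjunct2]
proof eventually_elim
  case (elim t)
  show ?case
  proof (intro impI)
    assume t: "0 < t" "t < T"
    have drop: "t powr (x - \<alpha>) \<le> T powr x * t powr (- \<alpha>)" if "0 \<le> x" for x
    proof -
      have "t powr (x - \<alpha>) = t powr x * t powr (- \<alpha>)" using t by (simp add: powr_add[symmetric])
      also have "\<dots> \<le> T powr x * t powr (- \<alpha>)" using t that by (intro mult_right_mono powr_mono2) auto
      finally show ?thesis .
    qed
    have 1: "l2_bound (\<lambda>j. R j t * (\<mu> j powr (1 - \<delta>) * (\<phi> j - conv H j T))) (C' * M2 * B * t powr (- \<alpha>))"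
    proof -
      have "l2_bound (\<lambda>j. \<mu> j powr (1 - 1) * (\<mu> j powr (1 - \<delta>) * (\<phi> j - conv H j T))) B"
        using init \<mu>_pos by (simp add: less_imp_neq[symmetric])
      from l2_bound_R[OF t(1) _ _ this] show ?thesis by simp
    qed
    have 2: "l2_bound (\<lambda>j. \<mu> j powr (1 - \<delta>) * conv H j t) (M2 * Y * Beta (\<alpha> * \<delta>) (1 - a) * T powr (\<alpha> * \<delta> - a + \<alpha>) * t powr (- \<alpha>))"
    proof (rule l2_bound_mono)
      show "l2_bound (\<lambda>j. \<mu> j powr (1 - \<delta>) * conv H j t) (M2 * Y * Beta (\<alpha> * \<delta>) (1 - a) * t powr (\<alpha> * \<delta> - a))"
        using conv_integrable_bound(2)[OF H a1 t(1), of "1 - \<delta>"] t \<delta> by simp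
      have "t powr (\<alpha> * \<delta> - a) \<le> T powr (\<alpha> * \<delta> - a + \<alpha>) * t powr (- \<alpha>)"
      proof -
        have "0 \<le> \<alpha> * \<delta>" using \<alpha> \<delta> by simp
        then show ?thesis using drop[of "\<alpha> * \<delta> - a + \<alpha>"] a by simp
      qed
      moreover have "0 \<le> Beta (\<alpha> * \<delta>) (1 - a)" using \<alpha> \<delta> a1 by (intro Beta_nonneg) auto
      ultimately show "M2 * Y * Beta (\<alpha> * \<delta>) (1 - a) * t powr (\<alpha> * \<delta> - a) \<le> M2 * Y * Beta (\<alpha> * \<delta>) (1 - a) * T powr (\<alpha> * \<delta> - a + \<alpha>) * t powr (- \<alpha>)"
        unfolding mult.assoc using M2 Y_nonneg by (intro mult_left_mono) auto
    qed
    have 3: "l2_bound (\<lambda>j. \<mu> j powr (- \<delta>) * H j t) (\<mu> 0 powr (- \<delta>) * Y * T powr (\<alpha> - a) * t powr (- \<alpha>))"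
    proof (rule l2_bound_mono)
      show "l2_bound (\<lambda>j. \<mu> j powr (- \<delta>) * H j t) (\<mu> 0 powr (- \<delta>) * (Y * t powr (- a)))"
        using elim t \<delta> \<mu> by (intro l2_bound_mult) (auto intro!: powr_mono2')
      show "\<mu> 0 powr (- \<delta>) * (Y * t powr (- a)) \<le> \<mu> 0 powr (- \<delta>) * Y * T powr (\<alpha> - a) * t powr (- \<alpha>)"
        unfolding mult.assoc using drop[of "\<alpha> - a"] a Y_nonneg by (intro mult_left_mono) auto
    qed
    have "\<mu> j powr (- \<delta>) * W j t = - (R j t * (\<mu> j powr (1 - \<delta>) * (\<phi> j - conv H j T)) + \<mu> j powr (1 - \<delta>) * conv H j t) + \<mu> j powr (- \<delta>) * H j t" for j
    proof -
      have "\<mu> j powr (1 - \<delta>) = \<mu> j powr (- \<delta>) * \<mu> j" using \<mu>_pos[of j] powr_add[of "\<mu> j" "- \<delta>" 1] by simp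
      then show ?thesis by (simp add: W_def U_def sol_def algebra_simps)
    qed
    then show "l2_bound (\<lambda>j. \<mu> j powr (- \<delta>) * W j t)
     ((C' * M2 * B + M2 * Y * Beta (\<alpha> * \<delta>) (1 - a) * T powr (\<alpha> * \<delta> - a + \<alpha>) + \<mu> 0 powr (- \<delta>) * Y * T powr (\<alpha> - a)) * t powr (- \<alpha>))"
      using l2_bound_add[OF l2_bound_uminus[OF l2_bound_add[OF 1 2]] 3] by (simp add: distrib_right)
  qed
qed

section \<open>Uniform bounds, tails and continuity in time\<close>

definition Dc :: real where "Dc = M2 * Y * Beta \<alpha> (1 - a) * T powr (\<alpha> - a)"

lemma conv_uniform: "0 \<le> t \<Longrightarrow> t \<le> T \<Longrightarrow> l2_bound (\<lambda>j. conv H j t) Dc"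
proof -
  assume t: "0 \<le> t" "t \<le> T"
  have Beta: "0 \<le> Beta \<alpha> (1 - a)" using \<alpha> a1 by (intro Beta_nonneg) auto
  show ?thesis
  proof (cases "t = 0")
    case True
    then show ?thesis using M2 Y_nonneg Beta by (simp add: conv_0 l2_bound_zero Dc_def)
  next
    case False
    have "l2_bound (\<lambda>j. conv H j t) (M2 * Y * Beta \<alpha> (1 - a) * t powr (\<alpha> - a))"
      using conv_integrable_bound(2)[OF H a1 _ t(2), of 0] False t \<mu>_pos by (simp add: less_imp_neq[symmetric])
    moreover have "M2 * Y * Beta \<alpha> (1 - a) * t powr (\<alpha> - a) \<le> Dc"
      unfolding Dc_def using t a M2 Y_nonneg Beta by (intro mult_left_mono powr_mono2) auto
    ultimately show ?thesis by (rule l2_bound_mono)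
  qed
qed

lemma b0_bound: "l2_bound (\<lambda>j. \<mu> j powr (- \<delta>) * b0 j) (C' * B)"
proof -
  have "l2_bound (\<lambda>j. C' * (\<mu> j powr (1 - \<delta>) * (\<phi> j - conv H j T))) (C' * B)"
    using l2_bound_scale[OF init, of C'] C'_nonneg by simp
  then show ?thesis
  proof (rule l2_bound_abs_le)
    fix j
    have e: "\<mu> j powr (1 - \<delta>) = \<mu> j powr (- \<delta>) * \<mu> j" using \<mu>_pos[of j] powr_add[of "\<mu> j" "- \<delta>" 1] by simp
    have "\<mu> j powr (- \<delta>) * \<bar>\<phi> j - conv H j T\<bar> * \<bar>\<Psi> j\<bar> \<le> \<mu> j powr (- \<delta>) * \<bar>\<phi> j - conv H j T\<bar> * (C' * \<mu> j)"
      by (intro mult_left_mono \<Psi>) auto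
    then show "\<bar>\<mu> j powr (- \<delta>) * b0 j\<bar> \<le> \<bar>C' * (\<mu> j powr (1 - \<delta>) * (\<phi> j - conv H j T))\<bar>"
      using C'_nonneg \<mu>_pos[of j] by (simp add: b0_def abs_mult e mult_ac)
  qed
qed

lemma U_uniform:
  assumes "0 \<le> t" "t \<le> T"
  shows "l2_bound (\<lambda>j. \<mu> j powr (- \<delta>) * U j t) (M2 * (C' * B) + \<mu> 0 powr (- \<delta>) * Dc)"
proof -
  have "l2_bound (\<lambda>j. E j t * (\<mu> j powr (- \<delta>) * b0 j)) (M2 * (C' * B))"
    by (rule l2_bound_mult[OF b0_bound E_abs_le[OF assms(1)]])
  moreover have "l2_bound (\<lambda>j. \<mu> j powr (- \<delta>) * conv H j t) (\<mu> 0 powr (- \<delta>) * Dc)"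
    using \<delta> \<mu> by (intro l2_bound_mult conv_uniform assms) (auto intro!: powr_mono2')
  ultimately have "l2_bound (\<lambda>j. E j t * (\<mu> j powr (- \<delta>) * b0 j) + \<mu> j powr (- \<delta>) * conv H j t) (M2 * (C' * B) + \<mu> 0 powr (- \<delta>) * Dc)"
    by (rule l2_bound_add)
  then show ?thesis by (simp add: U_eq algebra_simps)
qed

text \<open>Here \<open>\<delta> > 0\<close> is essential: it makes the tails of the modes small uniformly in time.\<close>

lemma U_tail:
  assumes "0 < \<epsilon>"
  obtains n where "\<And>t. 0 \<le> t \<Longrightarrow> t \<le> T \<Longrightarrow> l2_bound (\<lambda>j. if j < n then 0 else \<mu> j powr (- \<delta>) * U j t) \<epsilon>"
proof -
  have Dc: "0 \<le> Dc" using conv_uniform[of 0] T l2_bound_nonneg by auto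
  let ?b = "\<lambda>j. \<mu> j powr (- \<delta>) * b0 j"
  define e1 where "e1 = \<epsilon> / (2 * M2)"
  have e1: "0 < e1" using assms M2 by (simp add: e1_def)
  have sb: "summable (\<lambda>j. (?b j)\<^sup>2)" using b0_bound by (rule l2_bound_summable)
  obtain n1 where "\<forall>n\<ge>n1. norm (\<Sum>i. (?b (i + n))\<^sup>2) < e1\<^sup>2"
    using suminf_exist_split[of "e1\<^sup>2", OF _ sb] e1 by auto
  then have n1: "n1 \<le> n \<Longrightarrow> (\<Sum>i. (?b (i + n))\<^sup>2) < e1\<^sup>2" for n
    unfolding real_norm_def abs_less_iff by blast
  have "(\<lambda>j. \<mu> j powr (- \<delta>) * Dc) \<longlonglongrightarrow> 0 * Dc"
    using \<delta> by (intro tendsto_intros tendsto_neg_powr \<mu>_lim) auto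
  then have "\<forall>\<^sub>F j in sequentially. \<mu> j powr (- \<delta>) * Dc < \<epsilon> / 2" using assms by (intro order_tendstoD(2)) auto
  then obtain n2 where n2: "\<And>j. n2 \<le> j \<Longrightarrow> \<mu> j powr (- \<delta>) * Dc < \<epsilon> / 2" by (auto simp: eventually_sequentially)
  \<comment> \<open>Beyond n1 the weighted initial value has a small tail, by summability; beyond n2
    the weight \<mu>_j^(-\<delta>) alone makes the uniformly bounded convolution small.\<close>
  define n where "n = max n1 n2"
  have tail_b: "l2_bound (\<lambda>j. if j < n then 0 else ?b j) e1"
  proof -
    let ?c = "\<lambda>j. (if j < n then 0 else ?b j)\<^sup>2"
    have "summable ?c" by (rule summable_comparison_test'[OF sb, of 0]) auto
    moreover have "(\<Sum>j. ?c j) = (\<Sum>i. (?b (i + n))\<^sup>2)"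
      using suminf_split_initial_segment[OF \<open>summable ?c\<close>, of n] by simp
    ultimately show ?thesis using n1[of n] e1 by (subst l2_bound_iff) (auto simp: n_def)
  qed
  show ?thesis
  proof (rule that[of n])
    fix t assume t: "0 \<le> t" "t \<le> T"
    have 1: "l2_bound (\<lambda>j. E j t * (if j < n then 0 else ?b j)) (M2 * e1)"
      using tail_b E_abs_le[OF t(1)] by (rule l2_bound_mult)
    have 2: "l2_bound (\<lambda>j. (if j < n then 0 else \<mu> j powr (- \<delta>)) * conv H j t) (\<mu> n powr (- \<delta>) * Dc)"
      using \<delta> \<mu>_pos mono_\<mu> by (intro l2_bound_mult conv_uniform t) (auto intro!: powr_mono2' monoD[OF mono_\<mu>])
    have "M2 * e1 + \<mu> n powr (- \<delta>) * Dc \<le> \<epsilon>" using n2[of n] M2 by (simp add: e1_def n_def)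
    moreover have "l2_bound (\<lambda>j. if j < n then 0 else \<mu> j powr (- \<delta>) * U j t) (M2 * e1 + \<mu> n powr (- \<delta>) * Dc)"
      using l2_bound_add[OF 1 2] by (rule l2_bound_abs_le) (simp add: U_eq algebra_simps)
    ultimately show "l2_bound (\<lambda>j. if j < n then 0 else \<mu> j powr (- \<delta>) * U j t) \<epsilon>" by (rule l2_bound_mono[rotated])
  qed
qed

definition Q :: "nat \<Rightarrow> real \<Rightarrow> real" where
  "Q j t = Gamma (1 - a) * t powr (\<alpha> + (1 - a) - 1) * mittag_leffler \<alpha> (\<alpha> + (1 - a)) (- (\<mu> j * t powr \<alpha>))"

lemma Q: "0 < t \<Longrightarrow> has_bochner_integral lborel (\<lambda>\<tau>. indicator {0<..<t} \<tau> * (K j (t - \<tau>) * \<tau> powr (- a))) (Q j t)"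
  using ml_kernel_powr_convolution[OF \<alpha>, of t "1 - a" "\<mu> j"] a1 by (simp add: K_def Q_def)

lemma Q_continuous: "continuous_on {0..} (Q j)"
  unfolding Q_def using \<alpha> a a1
  by (intro continuous_intros continuous_on_powr' continuous_on_compose2[OF continuous_mittag_leffler[of \<alpha> "\<alpha> + (1 - a)" UNIV]]) auto

lemma conv_le_Q:
  assumes "0 \<le> t" "t \<le> T"
  shows "\<bar>conv H j t\<bar> \<le> Y * Q j t"
proof (cases "t = 0")
  case True
  then show ?thesis using a by (simp add: conv_0 Q_def)
next
  case False
  then have t: "0 < t" using assms by simp
  have i: "integrable lborel (\<lambda>\<tau>. indicator {0<..<t} \<tau> * (K j (t - \<tau>) * H j \<tau>))"
    using conv_integrable_bound(1)[OF H a1 t assms(2), of 0] by simp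
  have "\<bar>conv H j t\<bar> \<le> (\<integral>\<tau>. \<bar>indicator {0<..<t} \<tau> * (K j (t - \<tau>) * H j \<tau>)\<bar> \<partial>lborel)"
    unfolding conv_def by (rule integral_abs_bound)
  also have "\<dots> \<le> (\<integral>\<tau>. Y * (indicator {0<..<t} \<tau> * (K j (t - \<tau>) * \<tau> powr (- a))) \<partial>lborel)"
  proof (rule integral_mono_AE)
    show "integrable lborel (\<lambda>\<tau>. \<bar>indicator {0<..<t} \<tau> * (K j (t - \<tau>) * H j \<tau>)\<bar>)" using i by (rule integrable_abs)
    show "integrable lborel (\<lambda>\<tau>. Y * (indicator {0<..<t} \<tau> * (K j (t - \<tau>) * \<tau> powr (- a))))"
      using Q[OF t] by (intro integrable_mult_right) (auto simp: has_bochner_integral_iff)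
    show "AE \<tau> in lborel. \<bar>indicator {0<..<t} \<tau> * (K j (t - \<tau>) * H j \<tau>)\<bar> \<le> Y * (indicator {0<..<t} \<tau> * (K j (t - \<tau>) * \<tau> powr (- a)))"
      using H_abs[of j]
    proof eventually_elim
      case (elim \<tau>)
      show ?case
      proof (cases "0 < \<tau> \<and> \<tau> < t")
        case True
        then have "K j (t - \<tau>) * \<bar>H j \<tau>\<bar> \<le> K j (t - \<tau>) * (Y * \<tau> powr (- a))"
          using elim assms by (intro mult_left_mono K_nonneg) auto
        then show ?thesis using True K_nonneg[of "t - \<tau>" j] by (simp add: abs_mult mult_ac)
      qed (auto simp: indicator_def)
    qed
  qed
  also have "\<dots> = Y * Q j t" using has_bochner_integral_integral_eq[OF Q[OF t]] by simp
  finally show ?thesis .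
qed

text \<open>Since \<open>K\<close> is decreasing, the modulus of continuity of the convolution is controlled by that of the
  explicit function \<open>Q\<close>, the convolution of \<open>K\<close> with the majorant of \<open>H\<close>.\<close>

lemma conv_modulus:
  assumes st: "0 < c" "c \<le> s" "s < t" "t \<le> T"
  shows "\<bar>conv H j t - conv H j s\<bar> \<le> Y * (\<bar>Q j s - Q j t\<bar> + 2 * (c powr (- a) * (M2 * ((t - s) powr \<alpha> / \<alpha>))))"
proof -
  let ?k = "\<lambda>x \<tau>. indicator {0<..<x} \<tau> * (K j (x - \<tau>) * \<tau> powr (- a))"
  let ?f = "\<lambda>x \<tau>. indicator {0<..<x} \<tau> * (K j (x - \<tau>) * H j \<tau>)"
  let ?r = "\<lambda>\<tau>. c powr (- a) * (M2 * (indicator {s<..<t} \<tau> * (t - \<tau>) powr (\<alpha> - 1)))"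
  have fi: "integrable lborel (?f x)" if "0 < x" "x \<le> T" for x
    using conv_integrable_bound(1)[OF H a1 that, of 0] by simp
  have r: "has_bochner_integral lborel ?r (c powr (- a) * (M2 * ((t - s) powr \<alpha> / \<alpha>)))"
    using st \<alpha> by (intro has_bochner_integral_mult_right powr_kernel(2)) auto
  have k: "has_bochner_integral lborel (?k s) (Q j s)" "has_bochner_integral lborel (?k t) (Q j t)"
    using Q st by auto
  \<comment> \<open>The factor 2: on (s, t) one copy of \<open>?r\<close> cancels the negative term
    coming from \<open>?k t\<close>, and the other bounds the new part of the convolution. On (0, s)
    the difference of the kernels is already nonnegative.\<close>
  have g: "has_bochner_integral lborel (\<lambda>\<tau>. Y * (?k s \<tau> - ?k t \<tau> + 2 * ?r \<tau>))
     (Y * (Q j s - Q j t + 2 * (c powr (- a) * (M2 * ((t - s) powr \<alpha> / \<alpha>)))))"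
    by (intro has_bochner_integral_mult_right has_bochner_integral_add has_bochner_integral_diff k r)
  have "\<bar>conv H j t - conv H j s\<bar> = \<bar>\<integral>\<tau>. ?f t \<tau> - ?f s \<tau> \<partial>lborel\<bar>"
    unfolding conv_def using fi st by simp
  also have "\<dots> \<le> (\<integral>\<tau>. \<bar>?f t \<tau> - ?f s \<tau>\<bar> \<partial>lborel)" by (rule integral_abs_bound)
  also have "\<dots> \<le> (\<integral>\<tau>. Y * (?k s \<tau> - ?k t \<tau> + 2 * ?r \<tau>) \<partial>lborel)"
  proof (rule integral_mono_AE)
    show "integrable lborel (\<lambda>\<tau>. \<bar>?f t \<tau> - ?f s \<tau>\<bar>)" using fi st by (intro integrable_abs Bochner_Integration.integrable_diff) auto
    show "integrable lborel (\<lambda>\<tau>. Y * (?k s \<tau> - ?k t \<tau> + 2 * ?r \<tau>))" using g by (simp add: has_bochner_integral_iff)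
    have "AE \<tau> in lborel. \<tau> \<noteq> s" by (rule AE_lborel_singleton)
    then show "AE \<tau> in lborel. \<bar>?f t \<tau> - ?f s \<tau>\<bar> \<le> Y * (?k s \<tau> - ?k t \<tau> + 2 * ?r \<tau>)"
      using H_abs[of j]
    proof eventually_elim
      case (elim \<tau>)
      consider "\<tau> \<le> 0 \<or> t \<le> \<tau>" | "0 < \<tau>" "\<tau> < s" | "s < \<tau>" "\<tau> < t" using elim(1) by linarith
      then show ?case
      proof cases
        case 1
        then show ?thesis using st by (auto simp: indicator_def)
      next
        case 2
        have d: "0 \<le> K j (s - \<tau>) - K j (t - \<tau>)"
          using 2 st \<mu>_pos[of j] ml_kernel_antimono[OF \<alpha>, of "\<mu> j" "\<mu> j" "s - \<tau>" "t - \<tau>"] by (simp add: K_def)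
        have "\<bar>?f t \<tau> - ?f s \<tau>\<bar> = \<bar>(K j (t - \<tau>) - K j (s - \<tau>)) * H j \<tau>\<bar>" using 2 st by (simp add: left_diff_distrib)
        also have "\<dots> = (K j (s - \<tau>) - K j (t - \<tau>)) * \<bar>H j \<tau>\<bar>" using d by (simp add: abs_mult)
        also have "\<dots> \<le> (K j (s - \<tau>) - K j (t - \<tau>)) * (Y * \<tau> powr (- a))"
          using elim(2) 2 st d by (intro mult_left_mono) auto
        finally show ?thesis using 2 st by (simp add: algebra_simps)
      next
        case 3
        have K1: "0 \<le> K j (t - \<tau>)" "K j (t - \<tau>) \<le> M2 * (t - \<tau>) powr (\<alpha> - 1)"
          using K_nonneg[of "t - \<tau>" j] K_bound_0[of "t - \<tau>" j] 3 by auto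
        have p: "\<tau> powr (- a) \<le> c powr (- a)" using 3 st a by (intro powr_mono2') auto
        have Hb: "\<bar>H j \<tau>\<bar> \<le> Y * \<tau> powr (- a)" using elim(2) 3 st by auto
        have le: "K j (t - \<tau>) * \<tau> powr (- a) \<le> ?r \<tau>"
        proof -
          have "K j (t - \<tau>) * \<tau> powr (- a) \<le> (M2 * (t - \<tau>) powr (\<alpha> - 1)) * c powr (- a)"
            using K1 p M2 by (intro mult_mono) auto
          then show ?thesis using 3 by (simp add: mult_ac)
        qed
        have "\<bar>?f t \<tau> - ?f s \<tau>\<bar> = K j (t - \<tau>) * \<bar>H j \<tau>\<bar>" using 3 st K1 by (simp add: abs_mult)
        also have "\<dots> \<le> K j (t - \<tau>) * (Y * \<tau> powr (- a))" using K1 Hb by (intro mult_left_mono)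
        also have "\<dots> = Y * (K j (t - \<tau>) * \<tau> powr (- a))" by simp
        also have "\<dots> \<le> Y * (?k s \<tau> - ?k t \<tau> + 2 * ?r \<tau>)"
          by (rule mult_left_mono[OF _ Y_nonneg]) (use le 3 st in \<open>auto simp: mult_ac\<close>)
        finally show ?thesis .
      qed
    qed
  qed
  also have "\<dots> = Y * (Q j s - Q j t + 2 * (c powr (- a) * (M2 * ((t - s) powr \<alpha> / \<alpha>))))"
    by (rule has_bochner_integral_integral_eq[OF g])
  also have "\<dots> \<le> Y * (\<bar>Q j s - Q j t\<bar> + 2 * (c powr (- a) * (M2 * ((t - s) powr \<alpha> / \<alpha>))))"
    using Y_nonneg by (intro mult_left_mono) auto
  finally show ?thesis .
qed

text \<open>At 0 the bound by \<open>Q\<close> suffices, because \<open>Q\<close> vanishes there.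
  Elsewhere \<open>conv_modulus\<close> applies with a constant c that stays below both times, which
  keeps it away from the singularity of the source.\<close>

lemma conv_continuous: "continuous_on {0..T} (conv H j)"
  unfolding continuous_on
proof
  fix s assume s: "s \<in> {0..T}"
  have Qc: "(Q j \<longlongrightarrow> Q j x) (at x within {0..T})" if "0 \<le> x" for x
    using Q_continuous[of j] that unfolding continuous_on by (auto intro: tendsto_within_subset)
  show "(conv H j \<longlongrightarrow> conv H j s) (at s within {0..T})"
  proof (cases "s = 0")
    case True
    have "((\<lambda>t. Y * Q j t) \<longlongrightarrow> Y * Q j 0) (at 0 within {0..T})" by (intro tendsto_intros Qc) simp
    then have lim: "((\<lambda>t. Y * Q j t) \<longlongrightarrow> 0) (at 0 within {0..T})" using a by (simp add: Q_def)
    have "(conv H j \<longlongrightarrow> 0) (at 0 within {0..T})"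
      by (rule Lim_null_comparison[OF _ lim]) (auto simp: eventually_at_filter conv_le_Q)
    then show ?thesis using True by (simp add: conv_0)
  next
    case False
    define c where "c = s / 2"
    have c: "0 < c" "c < s" using False s by (auto simp: c_def)
    let ?g = "\<lambda>t. Y * (\<bar>Q j s - Q j t\<bar> + 2 * (c powr (- a) * (M2 * (\<bar>t - s\<bar> powr \<alpha> / \<alpha>))))"
    have "((\<lambda>t. \<bar>t - s\<bar> powr \<alpha>) \<longlongrightarrow> \<bar>s - s\<bar> powr \<alpha>) (at s within {0..T})"
      using \<alpha> by (intro tendsto_powr2 tendsto_intros) auto
    then have "(?g \<longlongrightarrow> Y * (\<bar>Q j s - Q j s\<bar> + 2 * (c powr (- a) * (M2 * (\<bar>s - s\<bar> powr \<alpha> / \<alpha>))))) (at s within {0..T})"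
      using \<alpha> s by (intro tendsto_intros Qc) auto
    then have lim: "(?g \<longlongrightarrow> 0) (at s within {0..T})" using \<alpha> by simp
    have "\<forall>\<^sub>F t in at s within {0..T}. norm (conv H j t - conv H j s) \<le> ?g t"
    proof -
      have "\<forall>\<^sub>F t in at s within {0..T}. c < t" using c by (intro order_tendstoD(1)[OF tendsto_ident_at]) auto
      moreover have "\<forall>\<^sub>F t in at s within {0..T}. t \<in> {0..T} \<and> t \<noteq> s" by (simp add: eventually_at_filter)
      ultimately show ?thesis
      proof eventually_elim
        case (elim t)
        show ?case
        proof (cases "s < t")
          case True
          then show ?thesis using conv_modulus[of c s t j] c elim by simp
        next
          case False
          then show ?thesis using conv_modulus[of c t s j] c elim s by (simp add: abs_minus_commute)
        qed
      qed
    qed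
    from Lim_null_comparison[OF this lim] show ?thesis by (simp add: LIM_zero_iff)
  qed
qed

lemma U_continuous: "continuous_on {0..T} (U j)"
proof -
  have "continuous_on {0..T} (E j)"
    unfolding E_def[abs_def] using \<alpha>
    by (intro continuous_on_compose2[OF continuous_mittag_leffler[of \<alpha> 1 UNIV]] continuous_intros continuous_on_powr') auto
  then show ?thesis unfolding U_eq[abs_def] by (intro continuous_intros conv_continuous)
qed

text \<open>Finitely many continuous modes account for half of \<epsilon>, and the tails at the two
  times, small uniformly in time, for a quarter each.\<close>

lemma U_l2_continuous:
  assumes s: "s \<in> {0..T}" and \<epsilon>: "0 < \<epsilon>"
  shows "\<forall>\<^sub>F t in at s within {0..T}. l2_bound (\<lambda>j. \<mu> j powr (- \<delta>) * (U j t - U j s)) \<epsilon>"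
proof -
  obtain n where n: "\<And>t. 0 \<le> t \<Longrightarrow> t \<le> T \<Longrightarrow> l2_bound (\<lambda>j. if j < n then 0 else \<mu> j powr (- \<delta>) * U j t) (\<epsilon> / 4)"
    using U_tail[of "\<epsilon> / 4"] \<epsilon> by auto
  let ?d = "\<lambda>t j. \<mu> j powr (- \<delta>) * (U j t - U j s)"
  have "((\<lambda>t. L2_set (?d t) {..<n}) \<longlongrightarrow> L2_set (?d s) {..<n}) (at s within {0..T})"
    unfolding L2_set_def using U_continuous s by (intro tendsto_intros) (auto simp: continuous_on)
  moreover have "L2_set (?d s) {..<n} = 0" by (simp add: L2_set_def)
  ultimately have "\<forall>\<^sub>F t in at s within {0..T}. L2_set (?d t) {..<n} < \<epsilon> / 2" using \<epsilon> by (intro order_tendstoD(2)) auto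
  moreover have "\<forall>\<^sub>F t in at s within {0..T}. t \<in> {0..T}" by (simp add: eventually_at_filter)
  ultimately show ?thesis
  proof eventually_elim
    case (elim t)
    have 1: "l2_bound (\<lambda>j. if j < n then ?d t j else 0) (\<epsilon> / 2)"
      unfolding l2_bound_def
    proof
      fix m
      have "(\<Sum>j<m. (if j < n then ?d t j else 0)\<^sup>2) \<le> (\<Sum>j<n. (?d t j)\<^sup>2)"
      proof -
        have "(\<Sum>j<m. (if j < n then ?d t j else 0)\<^sup>2) = (\<Sum>j\<in>{..<m} \<inter> {..<n}. (?d t j)\<^sup>2)"
          by (rule sum.mono_neutral_cong_right) auto
        also have "\<dots> \<le> (\<Sum>j<n. (?d t j)\<^sup>2)" by (rule sum_mono2) auto
        finally show ?thesis .
      qed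
      then have "L2_set (\<lambda>j. if j < n then ?d t j else 0) {..<m} \<le> L2_set (?d t) {..<n}" unfolding L2_set_def by simp
      then show "L2_set (\<lambda>j. if j < n then ?d t j else 0) {..<m} \<le> \<epsilon> / 2" using elim by simp
    qed
    have 2: "l2_bound (\<lambda>j. (if j < n then 0 else \<mu> j powr (- \<delta>) * U j t) - (if j < n then 0 else \<mu> j powr (- \<delta>) * U j s)) (\<epsilon> / 4 + \<epsilon> / 4)"
      using n elim s by (intro l2_bound_diff) auto
    show ?case using l2_bound_add[OF 1 2] by (rule l2_bound_mono[OF l2_bound_abs_le]) (auto simp: right_diff_distrib)
  qed
qed

end

section \<open>Duality and measurability\<close>

lemma AE_lebesgue_on_Ioo_iff:
  "(AE t in lebesgue_on {0<..<T::real}. P t) \<longleftrightarrow> (AE t in lborel. 0 < t \<longrightarrow> t < T \<longrightarrow> P t)"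
proof -
  have "(AE t in lebesgue_on {0<..<T}. P t) \<longleftrightarrow> (AE t in lebesgue. t \<in> {0<..<T} \<longrightarrow> P t)"
    by (rule AE_restrict_space_iff) simp
  also have "\<dots> \<longleftrightarrow> (AE t in lborel. t \<in> {0<..<T} \<longrightarrow> P t)" by (rule AE_completion_iff)
  finally show ?thesis unfolding greaterThanLessThan_iff imp_conjL .
qed

lemma nn_integral_lebesgue_on_Ioo:
  assumes [measurable]: "f \<in> borel_measurable borel"
  shows "(\<integral>\<^sup>+t. f t \<partial>lebesgue_on {0<..<T::real}) = (\<integral>\<^sup>+t. f t * indicator {0<..<T} t \<partial>lborel)"
  by (simp add: nn_integral_restrict_space nn_integral_completion)

text \<open>Cauchy-Schwarz for sequences. The bound on partial sums provides the dominating function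
  when such series are integrated term by term.\<close>

lemma l2_pairing:
  assumes x: "l2_bound x A" and y: "l2_bound y B"
  shows "summable (\<lambda>j. \<bar>x j * y j\<bar>)" and "summable (\<lambda>j. x j * y j)"
    and "\<bar>\<Sum>j. x j * y j\<bar> \<le> A * B" and "\<bar>\<Sum>j<n. x j * y j\<bar> \<le> A * B"
proof -
  have le: "(\<Sum>j<n. \<bar>x j * y j\<bar>) \<le> A * B" for n
  proof -
    have "(\<Sum>j<n. \<bar>x j * y j\<bar>) \<le> L2_set x {..<n} * L2_set y {..<n}"
      unfolding abs_mult by (rule L2_set_mult_ineq)
    also have "\<dots> \<le> A * B"
      using x y by (intro mult_mono) (auto simp: l2_bound_def l2_bound_nonneg[OF x] intro: order_trans[OF L2_set_nonneg])
    finally show ?thesis .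
  qed
  show s: "summable (\<lambda>j. \<bar>x j * y j\<bar>)" by (rule summableI_nonneg_bounded[OF _ le]) simp
  then show "summable (\<lambda>j. x j * y j)" by (rule summable_rabs_cancel)
  have "\<bar>\<Sum>j. x j * y j\<bar> \<le> (\<Sum>j. \<bar>x j * y j\<bar>)" by (rule summable_rabs[OF s])
  also have "\<dots> \<le> A * B" by (rule suminf_le_const[OF s le])
  finally show "\<bar>\<Sum>j. x j * y j\<bar> \<le> A * B" .
  show "\<bar>\<Sum>j<n. x j * y j\<bar> \<le> A * B" using le[of n] sum_abs[of "\<lambda>j. x j * y j" "{..<n}"] by linarith
qed

context caputo_modes
begin

definition CW :: real where
  "CW = C' * M2 * B + M2 * Y * Beta (\<alpha> * \<delta>) (1 - a) * T powr (\<alpha> * \<delta> - a + \<alpha>) + \<mu> 0 powr (- \<delta>) * Y * T powr (\<alpha> - a)"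

lemma W_bound': "AE t in lborel. 0 < t \<longrightarrow> t < T \<longrightarrow> l2_bound (\<lambda>j. \<mu> j powr (- \<delta>) * W j t) (CW * t powr (- \<alpha>))"
  using W_bound by (simp add: CW_def)

lemma weight_cancel: "(\<mu> j powr (- \<delta>) * x) * (\<mu> j powr \<delta> * y) = x * y"
  using \<mu>_pos[of j] by (simp add: powr_minus field_simps)

text \<open>Finite sums inherit the identity from \<open>caputo_mode\<close>, and dominated
  convergence passes to the series on both sides. The majorants are a constant times (t -
  \<tau>)^(-\<alpha>) for U and a constant times \<tau>^(-\<alpha>) for W, both integrable because
  \<alpha> < 1.\<close>

lemma has_caputo_deriv_paired:
  assumes \<psi>: "l2_bound (\<lambda>j. \<mu> j powr \<delta> * \<psi> j) P"
  shows "has_caputo_deriv \<alpha> T (\<lambda>t. \<Sum>j. U j t * \<psi> j) (\<lambda>t. \<Sum>j. W j t * \<psi> j)"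
  unfolding has_caputo_deriv_def
proof (intro conjI ballI)
  define D where "D = M2 * (C' * B) + \<mu> 0 powr (- \<delta>) * Dc"
  have D: "l2_bound (\<lambda>j. \<mu> j powr (- \<delta>) * U j t) D" if "0 \<le> t" "t \<le> T" for t
    unfolding D_def using that by (rule U_uniform)
  have D0: "0 \<le> D" using D[of 0] T l2_bound_nonneg by auto
  have P0: "0 \<le> P" using \<psi> by (rule l2_bound_nonneg)
  have [measurable]: "(\<lambda>t. \<Sum>j. W j t * \<psi> j) \<in> borel_measurable borel" by measurable
  have W_pair: "AE t in lborel. 0 < t \<longrightarrow> t < T \<longrightarrow> summable (\<lambda>j. W j t * \<psi> j) \<and>
      \<bar>\<Sum>j. W j t * \<psi> j\<bar> \<le> CW * t powr (- \<alpha>) * P \<and> (\<forall>n. \<bar>\<Sum>j<n. W j t * \<psi> j\<bar> \<le> CW * t powr (- \<alpha>) * P)"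
    using W_bound'
  proof eventually_elim
    case (elim t)
    show ?case
    proof (intro impI)
      assume "0 < t" "t < T"
      then have "l2_bound (\<lambda>j. \<mu> j powr (- \<delta>) * W j t) (CW * t powr (- \<alpha>))" using elim by blast
      from l2_pairing[OF this \<psi>]
      show "summable (\<lambda>j. W j t * \<psi> j) \<and>
      \<bar>\<Sum>j. W j t * \<psi> j\<bar> \<le> CW * t powr (- \<alpha>) * P \<and> (\<forall>n. \<bar>\<Sum>j<n. W j t * \<psi> j\<bar> \<le> CW * t powr (- \<alpha>) * P)"
        by (simp add: weight_cancel)
    qed
  qed
  have dom: "integrable lborel (\<lambda>\<tau>. indicator {0<..<t} \<tau> * (CW * \<tau> powr (- \<alpha>) * P))" if "0 < t" for t
  proof -
    have "integrable lborel (\<lambda>\<tau>. (CW * P) * (indicator {0<..<t} \<tau> * \<tau> powr ((1 - \<alpha>) - 1)))"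
      using powr_kernel_aux[of "1 - \<alpha>" t] that \<alpha> by (intro integrable_mult_right) (auto simp: has_bochner_integral_iff)
    then show ?thesis by (simp add: mult_ac)
  qed
  have W_int: "integrable lborel (\<lambda>\<tau>. indicator {0<..<t} \<tau> * (\<Sum>j. W j \<tau> * \<psi> j))"
    and W_lim: "(\<lambda>n. \<integral>\<tau>. indicator {0<..<t} \<tau> * (\<Sum>j<n. W j \<tau> * \<psi> j) \<partial>lborel) \<longlonglongrightarrow> (\<integral>\<tau>. indicator {0<..<t} \<tau> * (\<Sum>j. W j \<tau> * \<psi> j) \<partial>lborel)"
    if t: "0 < t" "t \<le> T" for t
  proof -
    have lim: "AE \<tau> in lborel. (\<lambda>n. indicator {0<..<t} \<tau> * (\<Sum>j<n. W j \<tau> * \<psi> j)) \<longlonglongrightarrow> indicator {0<..<t} \<tau> * (\<Sum>j. W j \<tau> * \<psi> j)"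
      using W_pair
    proof eventually_elim
      case (elim \<tau>)
      show ?case
      proof (cases "\<tau> \<in> {0<..<t}")
        case True
        then have "summable (\<lambda>j. W j \<tau> * \<psi> j)" using elim t by auto
        then show ?thesis using True by (intro tendsto_mult tendsto_const summable_LIMSEQ)
      qed simp
    qed
    have bound: "AE \<tau> in lborel. norm (indicator {0<..<t} \<tau> * (\<Sum>j<n. W j \<tau> * \<psi> j)) \<le> indicator {0<..<t} \<tau> * (CW * \<tau> powr (- \<alpha>) * P)" for n
      using W_pair by eventually_elim (use t in \<open>auto simp: indicator_def\<close>)
    show "integrable lborel (\<lambda>\<tau>. indicator {0<..<t} \<tau> * (\<Sum>j. W j \<tau> * \<psi> j))"
      by (rule integrable_dominated_convergence[OF _ _ dom[OF t(1)] lim bound]) measurable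
    show "(\<lambda>n. \<integral>\<tau>. indicator {0<..<t} \<tau> * (\<Sum>j<n. W j \<tau> * \<psi> j) \<partial>lborel) \<longlonglongrightarrow> (\<integral>\<tau>. indicator {0<..<t} \<tau> * (\<Sum>j. W j \<tau> * \<psi> j) \<partial>lborel)"
      by (rule integral_dominated_convergence[OF _ _ dom[OF t(1)] lim bound]) measurable
  qed
  show "integrable (lebesgue_on {0<..<T}) (\<lambda>t. \<Sum>j. W j t * \<psi> j)"
    using W_int[OF T order_refl] by (subst integral_lebesgue_on_lborel(2)) auto
  fix t assume "t \<in> {0<..<T}"
  then have t: "0 < t" "t < T" "t \<le> T" by auto
  define V where "V \<tau> = (\<Sum>j. U j \<tau> * \<psi> j) - (\<Sum>j. U j 0 * \<psi> j)" for \<tau>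
  have [measurable]: "V \<in> borel_measurable borel" unfolding V_def[abs_def] by measurable
  have U_pair: "(\<lambda>n. \<Sum>j<n. (U j \<tau> - U j 0) * \<psi> j) \<longlonglongrightarrow> V \<tau>" "\<bar>\<Sum>j<n. (U j \<tau> - U j 0) * \<psi> j\<bar> \<le> (D + D) * P"
    if "0 \<le> \<tau>" "\<tau> \<le> T" for \<tau> n
  proof -
    note 1 = l2_pairing(2)[OF D[OF that] \<psi>, unfolded weight_cancel]
    note 2 = l2_pairing(2)[OF D[of 0] \<psi>, unfolded weight_cancel]
    have "(\<lambda>n. (\<Sum>j<n. U j \<tau> * \<psi> j) - (\<Sum>j<n. U j 0 * \<psi> j)) \<longlonglongrightarrow> V \<tau>"
      unfolding V_def using 1 2 T by (intro tendsto_diff summable_LIMSEQ) auto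
    then show "(\<lambda>n. \<Sum>j<n. (U j \<tau> - U j 0) * \<psi> j) \<longlonglongrightarrow> V \<tau>" by (simp add: left_diff_distrib sum_subtractf)
    have "l2_bound (\<lambda>j. \<mu> j powr (- \<delta>) * (U j \<tau> - U j 0)) (D + D)"
      using l2_bound_diff[OF D[OF that] D[of 0]] T by (simp add: right_diff_distrib)
    from l2_pairing(4)[OF this \<psi>] show "\<bar>\<Sum>j<n. (U j \<tau> - U j 0) * \<psi> j\<bar> \<le> (D + D) * P" by (simp add: weight_cancel)
  qed
  have "0 < Gamma (1 - \<alpha>)" using \<alpha> by (intro Gamma_real_pos) simp
  then have G0: "Gamma (1 - \<alpha>) \<noteq> 0" by simp
  have "(\<lambda>n. \<integral>\<tau>. indicator {0<..<t} \<tau> * ((t - \<tau>) powr (- \<alpha>) * (\<Sum>j<n. (U j \<tau> - U j 0) * \<psi> j)) \<partial>lborel)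
     \<longlonglongrightarrow> (\<integral>\<tau>. indicator {0<..<t} \<tau> * ((t - \<tau>) powr (- \<alpha>) * V \<tau>) \<partial>lborel)"
  proof (rule integral_dominated_convergence)
    have "integrable lborel (\<lambda>\<tau>. ((D + D) * P) * (indicator {0<..<t} \<tau> * (t - \<tau>) powr ((1 - \<alpha>) - 1)))"
      using powr_kernel(2)[of "1 - \<alpha>" 0 t] t \<alpha> by (intro integrable_mult_right) (auto simp: has_bochner_integral_iff)
    then show "integrable lborel (\<lambda>\<tau>. indicator {0<..<t} \<tau> * ((t - \<tau>) powr (- \<alpha>) * ((D + D) * P)))" by (simp add: mult_ac)
    show "AE \<tau> in lborel. (\<lambda>n. indicator {0<..<t} \<tau> * ((t - \<tau>) powr (- \<alpha>) * (\<Sum>j<n. (U j \<tau> - U j 0) * \<psi> j))) \<longlonglongrightarrow> indicator {0<..<t} \<tau> * ((t - \<tau>) powr (- \<alpha>) * V \<tau>)"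
    proof (rule AE_I2)
      fix \<tau> :: real
      show "(\<lambda>n. indicator {0<..<t} \<tau> * ((t - \<tau>) powr (- \<alpha>) * (\<Sum>j<n. (U j \<tau> - U j 0) * \<psi> j))) \<longlonglongrightarrow> indicator {0<..<t} \<tau> * ((t - \<tau>) powr (- \<alpha>) * V \<tau>)"
        by (cases "\<tau> \<in> {0<..<t}") (use t in \<open>auto intro!: tendsto_mult U_pair(1)\<close>)
    qed
    show "AE \<tau> in lborel. norm (indicator {0<..<t} \<tau> * ((t - \<tau>) powr (- \<alpha>) * (\<Sum>j<n. (U j \<tau> - U j 0) * \<psi> j))) \<le> indicator {0<..<t} \<tau> * ((t - \<tau>) powr (- \<alpha>) * ((D + D) * P))" for n
    proof (rule AE_I2)
      fix \<tau> :: real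
      show "norm (indicator {0<..<t} \<tau> * ((t - \<tau>) powr (- \<alpha>) * (\<Sum>j<n. (U j \<tau> - U j 0) * \<psi> j))) \<le> indicator {0<..<t} \<tau> * ((t - \<tau>) powr (- \<alpha>) * ((D + D) * P))"
      proof (cases "\<tau> \<in> {0<..<t}")
        case True
        then show ?thesis using U_pair(2)[of \<tau> n] t by (simp add: abs_mult mult_left_mono)
      qed simp
    qed
  qed measurable
  moreover have "(\<integral>\<tau>. indicator {0<..<t} \<tau> * ((t - \<tau>) powr (- \<alpha>) * (\<Sum>j<n. (U j \<tau> - U j 0) * \<psi> j)) \<partial>lborel)
     = Gamma (1 - \<alpha>) * (\<integral>\<tau>. indicator {0<..<t} \<tau> * (\<Sum>j<n. W j \<tau> * \<psi> j) \<partial>lborel)" for n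
  proof -
    note m = caputo_mode[OF t(1) t(3)]
    have "(\<integral>\<tau>. indicator {0<..<t} \<tau> * ((t - \<tau>) powr (- \<alpha>) * (\<Sum>j<n. (U j \<tau> - U j 0) * \<psi> j)) \<partial>lborel)
      = (\<integral>\<tau>. (\<Sum>j<n. \<psi> j * (indicator {0<..<t} \<tau> * ((t - \<tau>) powr (- \<alpha>) * (U j \<tau> - U j 0)))) \<partial>lborel)"
      by (simp add: sum_distrib_left mult_ac)
    also have "\<dots> = (\<Sum>j<n. \<psi> j * (Gamma (1 - \<alpha>) * (\<integral>\<tau>. indicator {0<..<t} \<tau> * W j \<tau> \<partial>lborel)))"
      using m(1) has_bochner_integral_integral_eq[OF m(1)]
      by (subst Bochner_Integration.integral_sum) (auto simp: has_bochner_integral_iff)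
    also have "\<dots> = Gamma (1 - \<alpha>) * (\<integral>\<tau>. (\<Sum>j<n. \<psi> j * (indicator {0<..<t} \<tau> * W j \<tau>)) \<partial>lborel)"
      using m(2) by (subst Bochner_Integration.integral_sum) (auto simp: sum_distrib_left mult_ac)
    also have "(\<integral>\<tau>. (\<Sum>j<n. \<psi> j * (indicator {0<..<t} \<tau> * W j \<tau>)) \<partial>lborel) = (\<integral>\<tau>. indicator {0<..<t} \<tau> * (\<Sum>j<n. W j \<tau> * \<psi> j) \<partial>lborel)"
      by (simp add: sum_distrib_left mult_ac)
    finally show ?thesis .
  qed
  moreover have "(\<lambda>n. Gamma (1 - \<alpha>) * (\<integral>\<tau>. indicator {0<..<t} \<tau> * (\<Sum>j<n. W j \<tau> * \<psi> j) \<partial>lborel))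
     \<longlonglongrightarrow> Gamma (1 - \<alpha>) * (\<integral>\<tau>. indicator {0<..<t} \<tau> * (\<Sum>j. W j \<tau> * \<psi> j) \<partial>lborel)"
    by (intro tendsto_intros W_lim t)
  ultimately have eq: "(\<integral>\<tau>. indicator {0<..<t} \<tau> * ((t - \<tau>) powr (- \<alpha>) * V \<tau>) \<partial>lborel)
     = Gamma (1 - \<alpha>) * (\<integral>\<tau>. indicator {0<..<t} \<tau> * (\<Sum>j. W j \<tau> * \<psi> j) \<partial>lborel)"
    using LIMSEQ_unique by simp
  show "RL_integral (1 - \<alpha>) (\<lambda>\<tau>. (\<Sum>j. U j \<tau> * \<psi> j) - (\<Sum>j. U j 0 * \<psi> j)) t = (\<integral>\<tau>. (\<Sum>j. W j \<tau> * \<psi> j) \<partial>lebesgue_on {0<..<t})"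
    unfolding RL_integral_def V_def[symmetric]
    by (subst (1 2) integral_lebesgue_on_lborel(1)) (use eq G0 in auto)
qed

end

text \<open>Measurability of \<open>t \<mapsto> F(t,u(t))\<close> follows from Lipschitz continuity alone: \<open>u\<close> is rounded in
  finitely many coordinates by \<open>quant\<close> and time is rounded by \<open>time_step\<close>, which leaves finitely many arguments.\<close>

definition quant :: "nat \<Rightarrow> (nat \<Rightarrow> real) \<Rightarrow> nat \<Rightarrow> real" where
  "quant m y j = (if j < m then max (- real m) (min (real m) (of_int \<lfloor>real m * y j\<rfloor> / real m)) else 0)"

text \<open>Once m exceeds the norm of the sequence, clipping to [-m, m] cannot increase the
  rounding error of a coordinate.\<close>

lemma quant_bound:
  assumes y: "l2_bound y B" and m: "0 < m" "B \<le> real m"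
  shows "\<bar>quant m y j - y j\<bar> \<le> (if j < m then 1 / real m else \<bar>y j\<bar>)"
proof (cases "j < m")
  case True
  define z where "z = of_int \<lfloor>real m * y j\<rfloor> / real m"
  have z1: "z \<le> y j" using m by (simp add: z_def divide_le_eq mult.commute)
  have "real m * y j < of_int \<lfloor>real m * y j\<rfloor> + 1" by linarith
  then have z2: "y j \<le> z + 1 / real m" using m by (simp add: z_def field_simps)
  have yj: "- real m \<le> y j" "y j \<le> real m" using l2_bound_component[OF y, of j] m by auto
  have "quant m y j = max (- real m) (min (real m) z)" using True by (simp add: quant_def z_def)
  then show ?thesis using True z1 z2 yj by (simp add: max_def min_def)
qed (simp add: quant_def)

text \<open>The error has two parts: m coordinates, each off by at most 1/m, contribute m^(-1/2) in
  norm, and the discarded coordinates contribute the tail.\<close>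

lemma quant_tendsto:
  assumes y: "summable (\<lambda>j. (y j)\<^sup>2)"
  obtains b where "b \<longlonglongrightarrow> 0" "\<forall>\<^sub>F m in sequentially. l2_bound (\<lambda>j. quant m y j - y j) (b m)"
proof -
  define B where "B = sqrt (\<Sum>j. (y j)\<^sup>2)"
  have B: "l2_bound y B" unfolding B_def by (rule l2_bound_sqrt[OF y])
  define tail where "tail m = (\<Sum>j. (y (j + m))\<^sup>2)" for m
  have tail: "tail \<longlonglongrightarrow> 0" unfolding tail_def using suminf_exist_split2[OF y] by simp
  define b where "b m = 1 / sqrt (real m) + sqrt (tail m)" for m
  show ?thesis
  proof (rule that)
    have "(\<lambda>m. 1 / sqrt (real m)) \<longlonglongrightarrow> 0"
      using tendsto_divide_0[OF tendsto_const filterlim_at_top_imp_at_infinity[OF filterlim_compose[OF sqrt_at_top filterlim_real_sequentially]]] .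
    moreover have "(\<lambda>m. sqrt (tail m)) \<longlonglongrightarrow> sqrt 0" by (intro tendsto_intros tail)
    ultimately show "b \<longlonglongrightarrow> 0" unfolding b_def using tendsto_add[of "\<lambda>m. 1 / sqrt (real m)" 0 _ "\<lambda>m. sqrt (tail m)" 0] by simp
    obtain M :: nat where M: "B \<le> real M" using real_arch_simple by blast
    have "l2_bound (\<lambda>j. quant m y j - y j) (b m)" if m: "max 1 M \<le> m" for m
    proof -
      have m': "0 < m" "B \<le> real m" using m M by auto
      have 1: "l2_bound (\<lambda>j. if j < m then 1 / real m else 0) (1 / sqrt (real m))"
        unfolding l2_bound_def
      proof
        fix n
        have "(\<Sum>j<n. (if j < m then 1 / real m else 0)\<^sup>2) \<le> (\<Sum>j<m. (1 / real m)\<^sup>2)"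
        proof -
          have "(\<Sum>j<n. (if j < m then 1 / real m else 0)\<^sup>2) = (\<Sum>j\<in>{..<n} \<inter> {..<m}. (1 / real m)\<^sup>2)"
            by (rule sum.mono_neutral_cong_right) auto
          also have "\<dots> \<le> (\<Sum>j<m. (1 / real m)\<^sup>2)" by (rule sum_mono2) auto
          finally show ?thesis .
        qed
        also have "\<dots> = 1 / real m" using m' by (simp add: power2_eq_square)
        finally show "L2_set (\<lambda>j. if j < m then 1 / real m else 0) {..<n} \<le> 1 / sqrt (real m)"
          unfolding L2_set_def using real_sqrt_le_mono by (fastforce simp: real_sqrt_divide)
      qed
      have 2: "l2_bound (\<lambda>j. if j < m then 0 else y j) (sqrt (tail m))"
      proof -
        let ?c = "\<lambda>j. (if j < m then 0 else y j)\<^sup>2"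
        have s: "summable ?c" by (rule summable_comparison_test'[OF y, of 0]) auto
        moreover have "(\<Sum>j. ?c j) = tail m"
          using suminf_split_initial_segment[OF s, of m] by (simp add: tail_def)
        ultimately show ?thesis using l2_bound_sqrt[OF s] by simp
      qed
      show ?thesis
        unfolding b_def
      proof (rule l2_bound_abs_le[OF l2_bound_add[OF 1 2]])
        show "\<bar>quant m y j - y j\<bar> \<le> \<bar>(if j < m then 1 / real m else 0) + (if j < m then 0 else y j)\<bar>" for j
          using quant_bound[OF B m', of j] by (auto split: if_splits)
      qed
    qed
    then show "\<forall>\<^sub>F m in sequentially. l2_bound (\<lambda>j. quant m y j - y j) (b m)"
      unfolding eventually_sequentially by blast
  qed
qed

text \<open>Simple functions with values in an arbitrary type. Since only the preimages of single
  values have to be measurable, the notion is stable under composition with any function at all, in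
  particular with the nonlinearity.\<close>

definition finite_valued :: "real \<Rightarrow> (real \<Rightarrow> 'c) \<Rightarrow> bool" where
  "finite_valued T x \<longleftrightarrow> finite (x ` {0<..<T}) \<and> (\<forall>v. {t \<in> {0<..<T}. x t = v} \<in> sets borel)"

lemma finite_valued_compose:
  assumes "finite_valued T x"
  shows "finite_valued T (\<lambda>t. g (x t))"
proof -
  have "finite ((\<lambda>t. g (x t)) ` {0<..<T})"
    using assms finite_imageI[of "x ` {0<..<T}" g] by (simp add: finite_valued_def image_image)
  moreover have "{t \<in> {0<..<T}. g (x t) = v} \<in> sets borel" for v
  proof -
    have "{t \<in> {0<..<T}. g (x t) = v} = (\<Union>c\<in>{c \<in> x ` {0<..<T}. g c = v}. {t \<in> {0<..<T}. x t = c})" by auto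
    also have "\<dots> \<in> sets borel" using assms by (intro sets.finite_UN) (auto simp: finite_valued_def)
    finally show ?thesis .
  qed
  ultimately show ?thesis by (simp add: finite_valued_def)
qed

lemma finite_valued_Pair:
  assumes x: "finite_valued T x" and y: "finite_valued T y"
  shows "finite_valued T (\<lambda>t. (x t, y t))"
proof -
  have "finite ((\<lambda>t. (x t, y t)) ` {0<..<T})"
    by (rule finite_subset[of _ "x ` {0<..<T} \<times> y ` {0<..<T}"]) (use x y in \<open>auto simp: finite_valued_def\<close>)
  moreover have "{t \<in> {0<..<T}. (x t, y t) = v} \<in> sets borel" for v
  proof -
    have "{t \<in> {0<..<T}. (x t, y t) = v} = {t \<in> {0<..<T}. x t = fst v} \<inter> {t \<in> {0<..<T}. y t = snd v}" by (cases v) auto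
    also have "\<dots> \<in> sets borel" using x y by (intro sets.Int) (auto simp: finite_valued_def)
    finally show ?thesis .
  qed
  ultimately show ?thesis by (simp add: finite_valued_def)
qed

lemma finite_valued_measurable:
  fixes x :: "real \<Rightarrow> real"
  assumes x: "finite_valued T x"
  shows "(\<lambda>t. indicator {0<..<T} t * x t) \<in> borel_measurable borel"
proof -
  have fin: "finite (x ` {0<..<T})" using x by (simp add: finite_valued_def)
  have "(\<lambda>t. indicator {0<..<T} t * x t) = (\<lambda>t. \<Sum>v\<in>x ` {0<..<T}. v * indicator {t \<in> {0<..<T}. x t = v} t)"
  proof
    fix t
    show "indicator {0<..<T} t * x t = (\<Sum>v\<in>x ` {0<..<T}. v * indicator {t \<in> {0<..<T}. x t = v} t)"
    proof (cases "t \<in> {0<..<T}")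
      case True
      then have "(\<Sum>v\<in>x ` {0<..<T}. v * indicator {t \<in> {0<..<T}. x t = v} t) = (\<Sum>v\<in>x ` {0<..<T}. if v = x t then v else 0)"
        by (intro sum.cong) (auto simp: indicator_def)
      also have "\<dots> = x t" using fin True by (simp add: sum.delta)
      finally show ?thesis using True by simp
    qed (auto simp: indicator_def)
  qed
  also have "\<dots> \<in> borel_measurable borel"
    using x by (intro borel_measurable_sum borel_measurable_times borel_measurable_const borel_measurable_indicator) (auto simp: finite_valued_def)
  finally show ?thesis .
qed

lemma finite_valued_quant:
  assumes y[measurable]: "\<And>j. y j \<in> borel_measurable borel"
  shows "finite_valued T (\<lambda>t. quant m (\<lambda>j. y j t))"
proof -
  define V where "V = (\<lambda>i. max (- real m) (min (real m) (of_int i / real m))) ` (UNIV :: int set)"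
  have V: "finite V"
  proof (rule finite_subset)
    \<comment> \<open>A value strictly inside the clipping interval is a grid point i/m with
      \<bar>i\<bar> at most m squared.\<close>
    show "V \<subseteq> (\<lambda>i. of_int i / real m) ` {- (int m * int m)..int m * int m} \<union> {- real m, real m}"
    proof
      fix v assume "v \<in> V"
      then obtain i :: int where v: "v = max (- real m) (min (real m) (of_int i / real m))" by (auto simp: V_def)
      show "v \<in> (\<lambda>i. of_int i / real m) ` {- (int m * int m)..int m * int m} \<union> {- real m, real m}"
      proof (cases "v = - real m \<or> v = real m")
        case False
        then have e: "v = of_int i / real m" "- real m < v" "v < real m" using v by (auto simp: max_def min_def split: if_splits)
        then have m: "0 < real m" by linarith
        have "of_int i = v * real m" using e m by simp
        moreover have "v * real m \<le> real m * real m" "- real m * real m \<le> v * real m"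
          using e m by (intro mult_right_mono; simp)+
        ultimately have "of_int i \<le> (of_int (int m * int m) :: real)" "of_int (- (int m * int m)) \<le> (of_int i :: real)" by simp_all
        then have "i \<in> {- (int m * int m)..int m * int m}" unfolding of_int_le_iff by simp
        then show ?thesis using e by blast
      qed auto
    qed
  qed auto
  have fin: "finite {f :: nat \<Rightarrow> real. \<forall>j. (j \<in> {..<m} \<longrightarrow> f j \<in> V) \<and> (j \<notin> {..<m} \<longrightarrow> f j = 0)}"
    using V by (intro finite_set_of_finite_funs) auto
  have "finite ((\<lambda>t. quant m (\<lambda>j. y j t)) ` {0<..<T})"
    by (rule finite_subset[OF _ fin]) (auto simp: quant_def V_def)
  moreover have "{t \<in> {0<..<T}. quant m (\<lambda>j. y j t) = v} \<in> sets borel" for v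
  proof (cases "\<forall>j\<ge>m. v j = 0")
    case True
    then have "{t \<in> {0<..<T}. quant m (\<lambda>j. y j t) = v} = {0<..<T} \<inter> {t. \<forall>j\<in>{..<m}. quant m (\<lambda>j. y j t) j = v j}"
      by (auto simp: fun_eq_iff quant_def not_less)
    also have "\<dots> \<in> sets borel"
    proof (intro sets.Int)
      have [measurable]: "(\<lambda>t. quant m (\<lambda>j. y j t) j) \<in> borel_measurable borel" for j unfolding quant_def by measurable
      show "{t. \<forall>j\<in>{..<m}. quant m (\<lambda>j. y j t) j = v j} \<in> sets borel"
        by measurable
    qed simp
    finally show ?thesis .
  next
    case False
    then obtain i where "m \<le> i" "v i \<noteq> 0" by auto
    then have "quant m f \<noteq> v" for f by (auto simp: quant_def fun_eq_iff intro!: exI[of _ i])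
    then have "{t \<in> {0<..<T}. quant m (\<lambda>j. y j t) = v} = {}" by simp
    then show ?thesis by (simp only: sets.empty_sets)
  qed
  ultimately show ?thesis by (simp add: finite_valued_def)
qed

text \<open>The summand 1/2 selects the midpoint of a cell, so the rounded time stays in the open
  interval where the hypotheses on F apply.\<close>

definition time_step :: "real \<Rightarrow> nat \<Rightarrow> real \<Rightarrow> real" where
  "time_step T m t = T * (of_int \<lfloor>real m * t / T\<rfloor> + 1 / 2) / real m"

lemma time_step:
  assumes T: "0 < T" and m: "0 < m" and t: "t \<in> {0<..<T}"
  shows "time_step T m t \<in> {0<..<T}" and "\<bar>time_step T m t - t\<bar> \<le> T / real m"
    and "\<lfloor>real m * t / T\<rfloor> \<in> {0..<int m}"
proof -
  define i where "i = \<lfloor>real m * t / T\<rfloor>"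
  have x: "0 \<le> real m * t / T" "real m * t / T < real m" using T m t by (auto simp: divide_less_eq)
  have i: "0 \<le> i" "i < int m" using x by (auto simp: i_def floor_less_iff)
  then show "\<lfloor>real m * t / T\<rfloor> \<in> {0..<int m}" by (simp add: i_def)
  have i': "0 \<le> (of_int i :: real)" "(of_int i :: real) + 1 \<le> real m" using i by linarith+
  have ts: "time_step T m t = T * (of_int i + 1 / 2) / real m" by (simp add: time_step_def i_def)
  have "T * (of_int i + 1 / 2) < T * real m" using i' T by (intro mult_strict_left_mono) auto
  then show "time_step T m t \<in> {0<..<T}" unfolding ts using T m i' by (auto simp: divide_less_eq)
  have fl: "of_int i \<le> real m * t / T" "real m * t / T < of_int i + 1" unfolding i_def by linarith+
  have "time_step T m t - t = T / real m * ((of_int i + 1 / 2) - real m * t / T)"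
    unfolding ts using T m by (simp add: field_simps)
  also have "\<bar>\<dots>\<bar> = T / real m * \<bar>(of_int i + 1 / 2) - real m * t / T\<bar>" using T by (simp add: abs_mult)
  also have "\<dots> \<le> T / real m * 1" using fl T by (intro mult_left_mono) auto
  finally show "\<bar>time_step T m t - t\<bar> \<le> T / real m" by simp
qed

lemma finite_valued_time_step:
  assumes T: "0 < T" and m: "0 < m"
  shows "finite_valued T (time_step T m)"
proof -
  have "finite_valued T (\<lambda>t. \<lfloor>real m * t / T\<rfloor>)"
    unfolding finite_valued_def
  proof (intro conjI allI)
    show "finite ((\<lambda>t. \<lfloor>real m * t / T\<rfloor>) ` {0<..<T})"
      by (rule finite_subset[of _ "{0..<int m}"]) (use time_step(3)[OF T m] in auto)
    show "{t \<in> {0<..<T}. \<lfloor>real m * t / T\<rfloor> = v} \<in> sets borel" for v by measurable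
  qed
  from finite_valued_compose[OF this, of "\<lambda>i. T * (of_int i + 1 / 2) / real m"]
  show ?thesis by (simp add: time_step_def[abs_def])
qed

section \<open>Fractional power spaces\<close>

locale spectral = L2_basis \<Omega> e for \<Omega> :: "(real^'n) set" and e +
  fixes lam :: "nat \<Rightarrow> real"
  assumes lam: "0 < lam 0" "mono lam"
begin

lemma lam_pos: "0 < lam j"
  using lam monoD[OF lam(2), of 0 j] by simp

lemma L2_norm_le_if_l2_bound:
  assumes "f \<in> L2 \<Omega>" "l2_bound (cf f) B"
  shows "L2_norm \<Omega> f \<le> B"
proof (rule power2_le_imp_le)
  show "0 \<le> B" using assms(2) by (rule l2_bound_nonneg)
  then show "(L2_norm \<Omega> f)\<^sup>2 \<le> B\<^sup>2"
    using parseval[OF assms(1)] assms(2) by (simp add: l2_bound_iff sums_iff)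
qed

lemma l2_bound_cf: "f \<in> L2 \<Omega> \<Longrightarrow> l2_bound (cf f) (L2_norm \<Omega> f)"
  using parseval[of f] by (subst l2_bound_iff) (auto simp: L2_norm_nonneg sums_iff)

lemma frac_pow_terms_eq: "frac_pow_terms \<Omega> lam e \<gamma> v = (\<lambda>j x. (lam j powr \<gamma> * cf v j) * e j x)"
  by (simp add: frac_pow_terms_def cf_def fun_eq_iff)

lemma dom_pow_iff: "v \<in> dom_pow \<Omega> lam e \<gamma> \<longleftrightarrow> v \<in> L2 \<Omega> \<and> summable (\<lambda>j. (lam j powr \<gamma> * cf v j)\<^sup>2)"
  by (simp add: dom_pow_def frac_pow_terms_eq L2_summable_iff)

lemma dom_pow_norm_eq:
  assumes "v \<in> dom_pow \<Omega> lam e \<gamma>"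
  shows "dom_pow_norm \<Omega> lam e \<gamma> v = sqrt (\<Sum>j. (lam j powr \<gamma> * cf v j)\<^sup>2)"
proof -
  have "summable (\<lambda>j. (lam j powr \<gamma> * cf v j)\<^sup>2)" using assms by (simp add: dom_pow_iff)
  from norm_synth[OF this] have "(dom_pow_norm \<Omega> lam e \<gamma> v)\<^sup>2 = (\<Sum>j. (lam j powr \<gamma> * cf v j)\<^sup>2)"
    by (simp add: dom_pow_norm_def frac_pow_def frac_pow_terms_eq synth_def)
  then show ?thesis by (metis L2_norm_nonneg dom_pow_norm_def real_sqrt_unique)
qed

lemma dom_pow_bound:
  assumes "v \<in> dom_pow \<Omega> lam e \<gamma>"
  shows "l2_bound (\<lambda>j. lam j powr \<gamma> * cf v j) (dom_pow_norm \<Omega> lam e \<gamma> v)"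
  using assms by (simp add: dom_pow_norm_eq dom_pow_iff l2_bound_sqrt)

lemma dom_pow_norm_nonneg: "0 \<le> dom_pow_norm \<Omega> lam e \<gamma> v"
  by (simp add: dom_pow_norm_def L2_norm_nonneg)

lemma dom_pow_L2: "v \<in> dom_pow \<Omega> lam e \<gamma> \<Longrightarrow> v \<in> L2 \<Omega>"
  by (simp add: dom_pow_iff)

text \<open>Realizes a coordinate sequence as an element of a dual space, the sequence being
  recovered by evaluation at the basis functions. For coordinates of an L2 function it is the inner
  product with that function, by Parseval.\<close>

definition functional :: "(nat \<Rightarrow> real) \<Rightarrow> (real^'n \<Rightarrow> real) \<Rightarrow> real" where
  "functional x \<psi> = (\<Sum>j. x j * cf \<psi> j)"

lemma functional_e: "functional x (e i) = x i"
proof -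
  have "(\<lambda>j. x j * cf (e i) j) = (\<lambda>j. if j = i then x i else 0)" by (auto simp: cf_e)
  then show ?thesis using sums_single[of i "\<lambda>_. x i"] by (simp add: functional_def sums_iff)
qed

lemma weight_cancel: "(lam j powr (- \<gamma>) * x) * (lam j powr \<gamma> * y) = x * y"
  using lam_pos[of j] by (simp add: powr_minus field_simps)

lemma functional_dual:
  assumes x: "l2_bound (\<lambda>j. lam j powr (- \<gamma>) * x j) X"
  shows "functional x \<in> dual_pow \<Omega> lam e \<gamma>"
proof -
  have s: "summable (\<lambda>j. x j * cf f j)" "\<bar>functional x f\<bar> \<le> X * dom_pow_norm \<Omega> lam e \<gamma> f" if "f \<in> dom_pow \<Omega> lam e \<gamma>" for f
    using l2_pairing(2,3)[OF x dom_pow_bound[OF that], unfolded weight_cancel] by (auto simp: functional_def)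
  have "functional x (\<lambda>z. a * f z + b * g z) = a * functional x f + b * functional x g"
    if f: "f \<in> dom_pow \<Omega> lam e \<gamma>" and g: "g \<in> dom_pow \<Omega> lam e \<gamma>" for f g a b
  proof -
    have "functional x (\<lambda>z. a * f z + b * g z) = (\<Sum>j. a * (x j * cf f j) + b * (x j * cf g j))"
      unfolding functional_def by (simp add: cf_lincomb[OF dom_pow_L2[OF f] dom_pow_L2[OF g]] algebra_simps)
    also have "\<dots> = a * functional x f + b * functional x g"
      unfolding functional_def using s(1)[OF f] s(1)[OF g]
      by (subst suminf_add[symmetric]) (auto simp: summable_mult suminf_mult)
    finally show ?thesis .
  qed
  then show ?thesis using s(2) unfolding dual_pow_def by blast
qed

lemma dual_pow_norm_eq: "dual_pow_norm lam e \<gamma> v = sqrt (\<Sum>j. (lam j powr (- \<gamma>) * v (e j))\<^sup>2)"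
proof -
  have "(v (e j))\<^sup>2 * lam j powr (- 2 * \<gamma>) = (lam j powr (- \<gamma>) * v (e j))\<^sup>2" for j
    by (simp add: power2_eq_square powr_add[symmetric])
  then show ?thesis by (simp add: dual_pow_norm_def)
qed

lemma dual_pow_norm_bounds:
  assumes "l2_bound (\<lambda>j. lam j powr (- \<gamma>) * v (e j)) X"
  shows "dual_pow_norm lam e \<gamma> v \<le> X" "0 \<le> dual_pow_norm lam e \<gamma> v"
proof -
  have X: "0 \<le> X" using assms by (rule l2_bound_nonneg)
  have "summable (\<lambda>j. (lam j powr (- \<gamma>) * v (e j))\<^sup>2)" "(\<Sum>j. (lam j powr (- \<gamma>) * v (e j))\<^sup>2) \<le> X\<^sup>2"
    using assms X by (auto simp: l2_bound_iff)
  then show "dual_pow_norm lam e \<gamma> v \<le> X" "0 \<le> dual_pow_norm lam e \<gamma> v"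
    using X unfolding dual_pow_norm_eq by (auto intro!: real_le_lsqrt suminf_nonneg)
qed

lemma finite_valued_lebesgue: "finite_valued T x \<Longrightarrow> {t \<in> {0<..<T}. x t = v} \<in> sets lebesgue"
  unfolding finite_valued_def using sets_completionI_sets[of _ lborel] by simp

lemma strongly_measurable_L2:
  assumes y: "\<And>j. y j \<in> borel_measurable borel"
    and u: "\<And>t. t \<in> {0<..<T} \<Longrightarrow> u t \<in> L2 \<Omega>" "\<And>t j. t \<in> {0<..<T} \<Longrightarrow> cf (u t) j = y j t"
  shows "strongly_measurable T (L2 \<Omega>) (L2_norm \<Omega>) u"
  unfolding strongly_measurable_def
proof (intro exI conjI allI)
  have q: "summable (\<lambda>j. (quant m z j)\<^sup>2)" for m z
    by (rule summable_finite[of "{..<m}"]) (auto simp: quant_def)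
  define s where "s m t = synth (quant m (\<lambda>j. y j t))" for m t
  have fv: "finite_valued T (s m)" for m
    unfolding s_def by (rule finite_valued_compose[OF finite_valued_quant[of y T m, OF y], where g = synth])
  show "finite (s m ` {0<..<T})" for m using fv by (simp add: finite_valued_def)
  show "s m ` {0<..<T} \<subseteq> L2 \<Omega>" for m using synth_L2[OF q] by (auto simp: s_def)
  show "{t \<in> {0<..<T}. s m t = v} \<in> sets lebesgue" for m v using fv by (rule finite_valued_lebesgue)
  show "AE t in lebesgue_on {0<..<T}. (\<lambda>m. L2_norm \<Omega> (\<lambda>x. s m t x - u t x)) \<longlonglongrightarrow> 0"
  proof (rule AE_I2)
    fix t assume "t \<in> space (lebesgue_on {0<..<T})"
    then have t: "t \<in> {0<..<T}" by simp
    have "summable (\<lambda>j. (y j t)\<^sup>2)" using summable_cf[OF u(1)[OF t]] by (simp add: u(2)[OF t])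
    then obtain b where b: "b \<longlonglongrightarrow> 0" "\<forall>\<^sub>F m in sequentially. l2_bound (\<lambda>j. quant m (\<lambda>j. y j t) j - y j t) (b m)"
      by (rule quant_tendsto)
    show "(\<lambda>m. L2_norm \<Omega> (\<lambda>x. s m t x - u t x)) \<longlonglongrightarrow> 0"
    proof (rule tendsto_sandwich[OF _ _ tendsto_const b(1)])
      show "\<forall>\<^sub>F m in sequentially. L2_norm \<Omega> (\<lambda>x. s m t x - u t x) \<le> b m"
        using b(2)
      proof eventually_elim
        case (elim m)
        have "cf (\<lambda>x. s m t x - u t x) = (\<lambda>j. quant m (\<lambda>j. y j t) j - y j t)"
          by (rule ext, subst cf_diff) (auto simp: s_def synth_L2[OF q] cf_synth[OF q] u(1)[OF t] u(2)[OF t])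
        then show ?case using elim u(1)[OF t]
          by (intro L2_norm_le_if_l2_bound L2_diff) (auto simp: s_def synth_L2[OF q])
      qed
    qed (simp add: L2_norm_nonneg)
  qed
qed

text \<open>The quantization acts on the weighted coordinates, which are square summable, and the
  weight is removed afterwards; errors in l2 then coincide with errors in the dual norm.\<close>

lemma strongly_measurable_dual:
  assumes [measurable]: "\<And>j. x j \<in> borel_measurable borel"
    and sm: "AE t in lborel. 0 < t \<longrightarrow> t < T \<longrightarrow> summable (\<lambda>j. (lam j powr (- \<gamma>) * x j t)\<^sup>2)"
  shows "strongly_measurable T (dual_pow \<Omega> lam e \<gamma>) (dual_pow_norm lam e \<gamma>) (\<lambda>t. functional (\<lambda>j. x j t))"
  unfolding strongly_measurable_def
proof (intro exI conjI allI)
  define y where "y j t = lam j powr (- \<gamma>) * x j t" for j t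
  have y: "y j \<in> borel_measurable borel" for j unfolding y_def by measurable
  define s where "s m t = functional (\<lambda>j. lam j powr \<gamma> * quant m (\<lambda>j. y j t) j)" for m t
  have fv: "finite_valued T (s m)" for m
    unfolding s_def by (rule finite_valued_compose[OF finite_valued_quant[of y T m, OF y], where g = "\<lambda>q. functional (\<lambda>j. lam j powr \<gamma> * q j)"])
  have pw: "lam j powr (- \<gamma>) * (lam j powr \<gamma> * z) = z" for j z using lam_pos[of j] by (simp add: powr_minus)
  show "finite (s m ` {0<..<T})" for m using fv by (simp add: finite_valued_def)
  show "{t \<in> {0<..<T}. s m t = v} \<in> sets lebesgue" for m v using fv by (rule finite_valued_lebesgue)
  show "s m ` {0<..<T} \<subseteq> dual_pow \<Omega> lam e \<gamma>" for m
  proof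
    fix v assume "v \<in> s m ` {0<..<T}"
    then obtain t where v: "v = s m t" by auto
    have "summable (\<lambda>j. (quant m (\<lambda>j. y j t) j)\<^sup>2)"
      by (rule summable_finite[of "{..<m}"]) (auto simp: quant_def)
    from l2_bound_sqrt[OF this] show "v \<in> dual_pow \<Omega> lam e \<gamma>"
      unfolding v s_def by (intro functional_dual) (simp add: pw)
  qed
  show "AE t in lebesgue_on {0<..<T}. (\<lambda>m. dual_pow_norm lam e \<gamma> (\<lambda>\<psi>. s m t \<psi> - functional (\<lambda>j. x j t) \<psi>)) \<longlonglongrightarrow> 0"
    unfolding AE_lebesgue_on_Ioo_iff using sm
  proof eventually_elim
    case (elim t)
    show ?case
    proof (intro impI)
      assume "0 < t" "t < T"
      then have "summable (\<lambda>j. (y j t)\<^sup>2)" using elim by (simp add: y_def)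
      then obtain b where b: "b \<longlonglongrightarrow> 0" "\<forall>\<^sub>F m in sequentially. l2_bound (\<lambda>j. quant m (\<lambda>j. y j t) j - y j t) (b m)"
        by (rule quant_tendsto)
      have c: "lam j powr (- \<gamma>) * (s m t (e j) - functional (\<lambda>j. x j t) (e j)) = quant m (\<lambda>j. y j t) j - y j t" for m j
        by (simp add: s_def functional_e right_diff_distrib pw y_def)
      have e: "\<forall>\<^sub>F m in sequentially. dual_pow_norm lam e \<gamma> (\<lambda>\<psi>. s m t \<psi> - functional (\<lambda>j. x j t) \<psi>) \<le> b m \<and>
          0 \<le> dual_pow_norm lam e \<gamma> (\<lambda>\<psi>. s m t \<psi> - functional (\<lambda>j. x j t) \<psi>)"
        using b(2) by eventually_elim (auto intro!: dual_pow_norm_bounds simp: c)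
      show "(\<lambda>m. dual_pow_norm lam e \<gamma> (\<lambda>\<psi>. s m t \<psi> - functional (\<lambda>j. x j t) \<psi>)) \<longlonglongrightarrow> 0"
        by (rule tendsto_sandwich[OF _ _ tendsto_const b(1)]) (use e in \<open>auto elim: eventually_mono\<close>)
    qed
  qed
qed

text \<open>Coordinates of simple functions are measurable and converge to those of h, because a
  coordinate is bounded by the norm.\<close>

lemma strongly_measurable_cf:
  assumes sm: "strongly_measurable T (L2 \<Omega>) (L2_norm \<Omega>) h" and L2: "AE t in lebesgue_on {0<..<T}. h t \<in> L2 \<Omega>"
  obtains g where "g \<in> borel_measurable borel" "AE t in lborel. 0 < t \<longrightarrow> t < T \<longrightarrow> g t = cf (h t) j"
proof -
  obtain s where fin: "\<And>n. finite (s n ` {0<..<T})" and sL2: "\<And>n. s n ` {0<..<T} \<subseteq> L2 \<Omega>"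
    and sets: "\<And>n v. {t \<in> {0<..<T}. s n t = v} \<in> sets lebesgue"
    and lim: "AE t in lebesgue_on {0<..<T}. (\<lambda>n. L2_norm \<Omega> (\<lambda>x. s n t x - h t x)) \<longlonglongrightarrow> 0"
    using sm unfolding strongly_measurable_def by blast
  have meas: "(\<lambda>t. cf (s n t) j) \<in> borel_measurable (lebesgue_on {0<..<T})" for n
  proof -
    have "(\<lambda>t. \<Sum>v\<in>s n ` {0<..<T}. cf v j * indicator {t \<in> {0<..<T}. s n t = v} t) \<in> borel_measurable (lebesgue_on {0<..<T})"
    proof (intro borel_measurable_sum borel_measurable_times borel_measurable_const borel_measurable_indicator)
      show "{t \<in> {0<..<T}. s n t = v} \<in> sets (lebesgue_on {0<..<T})" for v
        using sets[of n v] by (subst sets_restrict_space_iff) auto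
    qed
    moreover have "(\<Sum>v\<in>s n ` {0<..<T}. cf v j * indicator {t \<in> {0<..<T}. s n t = v} t) = cf (s n t) j" if t: "t \<in> {0<..<T}" for t
    proof -
      have "(\<Sum>v\<in>s n ` {0<..<T}. cf v j * indicator {t \<in> {0<..<T}. s n t = v} t) = (\<Sum>v\<in>s n ` {0<..<T}. if v = s n t then cf v j else 0)"
        using t by (intro sum.cong) (auto simp: indicator_def)
      also have "\<dots> = cf (s n t) j" using fin t by (simp add: sum.delta)
      finally show ?thesis .
    qed
    ultimately show ?thesis by (subst measurable_cong[where g = "\<lambda>t. \<Sum>v\<in>s n ` {0<..<T}. cf v j * indicator {t \<in> {0<..<T}. s n t = v} t"]) auto
  qed
  define g0 where "g0 t = lim (\<lambda>n. cf (s n t) j)" for t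
  have "g0 \<in> borel_measurable (lebesgue_on {0<..<T})"
    unfolding g0_def by (rule borel_measurable_lim_metric[OF meas])
  \<comment> \<open>The limit is only Lebesgue measurable. Passing to a Borel function that agrees
    almost everywhere makes the product measurability arguments for \<open>conv\<close>
    available.\<close>
  then have "(\<lambda>t. indicator {0<..<T} t *\<^sub>R g0 t) \<in> borel_measurable lebesgue"
    by (subst (asm) borel_measurable_restrict_space_iff) auto
  from completion_ex_borel_measurable_real[OF this]
  obtain g where g: "g \<in> borel_measurable lborel" "AE t in lborel. indicator {0<..<T} t *\<^sub>R g0 t = g t" by auto
  have g0: "AE t in lebesgue_on {0<..<T}. g0 t = cf (h t) j"
    using lim L2 AE_space
  proof eventually_elim
    case (elim t)
    have t: "t \<in> {0<..<T}" using elim(3) by simp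
    have "(\<lambda>n. cf (s n t) j - cf (h t) j) \<longlonglongrightarrow> 0"
    proof (rule tendsto_0_le[OF elim(1), of _ 1], intro always_eventually allI)
      fix n
      have st: "s n t \<in> L2 \<Omega>" using sL2[of n] t by blast
      have "\<bar>cf (\<lambda>x. s n t x - h t x) j\<bar> \<le> L2_norm \<Omega> (\<lambda>x. s n t x - h t x)"
        by (rule l2_bound_component[OF l2_bound_cf[OF L2_diff[OF st elim(2)]]])
      then show "norm (cf (s n t) j - cf (h t) j) \<le> norm (L2_norm \<Omega> (\<lambda>x. s n t x - h t x)) * 1"
        by (simp add: cf_diff[OF st elim(2)] L2_norm_nonneg)
    qed
    then have "(\<lambda>n. cf (s n t) j) \<longlonglongrightarrow> cf (h t) j" by (simp add: LIM_zero_iff)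
    then show ?case unfolding g0_def by (rule limI)
  qed
  have "AE t in lborel. 0 < t \<longrightarrow> t < T \<longrightarrow> g t = cf (h t) j"
    using g(2) g0[unfolded AE_lebesgue_on_Ioo_iff] by eventually_elim auto
  then show ?thesis using g(1) that by simp
qed

end

section \<open>Mild solutions\<close>

lemma AE_Ioo_ex:
  assumes "AE t in lborel. 0 < t \<longrightarrow> t < T \<longrightarrow> P t" "0 < (T::real)"
  shows "\<exists>t. 0 < t \<and> t < T \<and> P t"
proof (rule ccontr)
  assume "\<not> ?thesis"
  then have "AE t in lborel. t \<notin> {0<..<T}" using assms(1) by (auto elim!: eventually_mono)
  then have "emeasure lborel {0<..<T} = 0"
    by (subst (asm) AE_iff_measurable[of "{0<..<T}"]) auto
  then show False using assms(2) by simp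
qed

lemma integrable_powr_Ioo:
  assumes "0 \<le> b" "b < 1" "0 < (t::real)"
  shows "integrable lborel (\<lambda>\<tau>. indicator {0<..<t} \<tau> * \<tau> powr (- b))"
  using powr_kernel_aux[of "1 - b" t] assms by (simp add: has_bochner_integral_iff)

text \<open>The constant \<Upsilon> + kn is the Lipschitz constant of the combined source F(t, v) -
  k(t) v, which is why it serves as \<Lambda>.\<close>

locale mild_problem =
  spectral \<Omega> e lam + contraction \<alpha> T M2 C' "\<lambda>j. lam j powr \<beta>" "Psi lam \<alpha> \<beta> \<kappa> T" s \<rho> \<Lambda>
  for \<Omega> :: "(real^'n) set" and e and lam and \<alpha> T M2 C' \<beta> \<kappa> s \<rho> \<Lambda> :: real +
  fixes k :: "real \<Rightarrow> real" and F :: "real \<Rightarrow> real^'n \<Rightarrow> (real^'n \<Rightarrow> real) \<Rightarrow> real" and \<Upsilon> kn :: real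
  assumes \<beta>: "0 < \<beta>" and lam_lim: "filterlim lam at_top sequentially"
    and k: "continuous_on {0..T} k" and kn: "\<And>t. t \<in> {0..T} \<Longrightarrow> \<bar>k t\<bar> \<le> kn"
    and \<Upsilon>: "0 < \<Upsilon>" and \<Lambda>_eq: "\<Lambda> = \<Upsilon> + kn"
    and F_L2: "\<And>t v. t \<in> {0<..<T} \<Longrightarrow> v \<in> L2 \<Omega> \<Longrightarrow> (\<lambda>x. F t x v) \<in> L2 \<Omega>"
    and F_zero: "\<And>t. t \<in> {0<..<T} \<Longrightarrow> AE x in lebesgue_on \<Omega>. F t x (\<lambda>_. 0) = 0"
    and F_lipschitz: "\<And>t1 t2 v1 v2. t1 \<in> {0<..<T} \<Longrightarrow> t2 \<in> {0<..<T} \<Longrightarrow> v1 \<in> L2 \<Omega> \<Longrightarrow> v2 \<in> L2 \<Omega> \<Longrightarrow>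
         L2_norm \<Omega> (\<lambda>x. F t1 x v1 - F t2 x v2) \<le> \<Upsilon> * (\<bar>t1 - t2\<bar> + L2_norm \<Omega> (\<lambda>x. v1 x - v2 x))"
begin

abbreviation \<mu> :: "nat \<Rightarrow> real" where "\<mu> j \<equiv> lam j powr \<beta>"

lemma kn_nonneg: "0 \<le> kn"
  using kn[of 0] T by force

section \<open>The nonlinearity in coordinates\<close>

lemma F_lip_cf:
  assumes "t1 \<in> {0<..<T}" "t2 \<in> {0<..<T}" "v1 \<in> L2 \<Omega>" "v2 \<in> L2 \<Omega>" "L2_norm \<Omega> (\<lambda>x. v1 x - v2 x) \<le> B"
  shows "l2_bound (\<lambda>j. cf (\<lambda>x. F t1 x v1) j - cf (\<lambda>x. F t2 x v2) j) (\<Upsilon> * (\<bar>t1 - t2\<bar> + B))"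
proof (rule l2_bound_mono)
  have "l2_bound (cf (\<lambda>x. F t1 x v1 - F t2 x v2)) (L2_norm \<Omega> (\<lambda>x. F t1 x v1 - F t2 x v2))"
    using assms by (intro l2_bound_cf L2_diff F_L2)
  moreover have "cf (\<lambda>x. F t1 x v1 - F t2 x v2) = (\<lambda>j. cf (\<lambda>x. F t1 x v1) j - cf (\<lambda>x. F t2 x v2) j)"
    by (rule ext, rule cf_diff) (use assms F_L2 in auto)
  ultimately show "l2_bound (\<lambda>j. cf (\<lambda>x. F t1 x v1) j - cf (\<lambda>x. F t2 x v2) j) (L2_norm \<Omega> (\<lambda>x. F t1 x v1 - F t2 x v2))" by simp
  have "\<Upsilon> * (\<bar>t1 - t2\<bar> + L2_norm \<Omega> (\<lambda>x. v1 x - v2 x)) \<le> \<Upsilon> * (\<bar>t1 - t2\<bar> + B)"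
    using assms \<Upsilon> by (intro mult_left_mono) auto
  then show "L2_norm \<Omega> (\<lambda>x. F t1 x v1 - F t2 x v2) \<le> \<Upsilon> * (\<bar>t1 - t2\<bar> + B)"
    using F_lipschitz[OF assms(1-4)] by linarith
qed

lemma cf_F_zero: "t \<in> {0<..<T} \<Longrightarrow> cf (\<lambda>x. F t x (\<lambda>_. 0)) j = 0"
  using L2_inner_cong_AE[OF F_L2[OF _ L2_zero] L2_zero e_L2 F_zero, of t j] by (simp add: cf_def L2_inner_zero_left)

definition f :: "real \<Rightarrow> (nat \<Rightarrow> real) \<Rightarrow> nat \<Rightarrow> real" where
  "f t c j = cf (\<lambda>x. F t x (synth c)) j - k t * c j"

lemma synth_diff_bound:
  assumes "summable (\<lambda>i. (c i)\<^sup>2)" "summable (\<lambda>i. (d i)\<^sup>2)" "l2_bound (\<lambda>i. c i - d i) B"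
  shows "L2_norm \<Omega> (\<lambda>x. synth c x - synth d x) \<le> B"
proof (rule L2_norm_le_if_l2_bound)
  show "(\<lambda>x. synth c x - synth d x) \<in> L2 \<Omega>" using assms by (intro L2_diff synth_L2)
  have "cf (\<lambda>x. synth c x - synth d x) = (\<lambda>i. c i - d i)"
    by (rule ext, subst cf_diff) (use assms in \<open>auto simp: synth_L2 cf_synth\<close>)
  then show "l2_bound (cf (\<lambda>x. synth c x - synth d x)) B" using assms by simp
qed

lemma f_lipschitz:
  assumes "0 < t" "t < T" "summable (\<lambda>i. (c i)\<^sup>2)" "summable (\<lambda>i. (d i)\<^sup>2)" "l2_bound (\<lambda>i. c i - d i) B"
  shows "l2_bound (\<lambda>i. f t c i - f t d i) (\<Lambda> * B)"
proof -
  have t: "t \<in> {0<..<T}" using assms by simp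
  have 1: "l2_bound (\<lambda>j. cf (\<lambda>x. F t x (synth c)) j - cf (\<lambda>x. F t x (synth d)) j) (\<Upsilon> * B)"
    using F_lip_cf[OF t t synth_L2 synth_L2 synth_diff_bound] assms by simp
  have "\<bar>k t\<bar> \<le> kn" using kn[of t] assms by simp
  then have 2: "l2_bound (\<lambda>i. k t * (c i - d i)) (kn * B)" using l2_bound_mult[OF assms(5), of "\<lambda>_. k t" kn] by simp
  show ?thesis using l2_bound_diff[OF 1 2] by (simp add: f_def \<Lambda>_eq algebra_simps)
qed

text \<open>Not immediate, because synthesizing the zero sequence yields a chosen function that
  vanishes only almost everywhere. The Lipschitz bound at distance 0 compares F at this function
  with F at the zero function.\<close>

lemma f_zero:
  assumes "0 < t" "t < T"
  shows "f t (\<lambda>_. 0) i = 0"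
proof -
  have t: "t \<in> {0<..<T}" using assms by simp
  have z: "summable (\<lambda>i::nat. (0::real)\<^sup>2)" by simp
  have "L2_norm \<Omega> (\<lambda>x. synth (\<lambda>_. 0) x - 0) \<le> 0"
  proof (rule L2_norm_le_if_l2_bound)
    show "(\<lambda>x. synth (\<lambda>_. 0) x - 0) \<in> L2 \<Omega>" using synth_L2[OF z] by simp
    have "cf (\<lambda>x. synth (\<lambda>_. 0) x - 0) = (\<lambda>_. 0)" using cf_synth[OF z] by (simp add: fun_eq_iff)
    then show "l2_bound (cf (\<lambda>x. synth (\<lambda>_. 0) x - 0)) 0" by (simp add: l2_bound_zero)
  qed
  from F_lip_cf[OF t t synth_L2[OF z] L2_zero this]
  have "l2_bound (\<lambda>j. cf (\<lambda>x. F t x (synth (\<lambda>_. 0))) j - cf (\<lambda>x. F t x (\<lambda>_. 0)) j) 0" by simp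
  from l2_bound_component[OF this, of i] show ?thesis by (simp add: f_def cf_F_zero[OF t])
qed

lemma borel_k: "(\<lambda>t. indicator {0<..<T} t * k t) \<in> borel_measurable borel"
proof -
  have [measurable]: "(\<lambda>t. indicator {0..T} t *\<^sub>R k t) \<in> borel_measurable borel"
    using k by (intro borel_measurable_continuous_on_indicator) auto
  have "(\<lambda>t. indicator {0<..<T} t * k t) = (\<lambda>t. indicator {0<..<T} t * (indicator {0..T} t *\<^sub>R k t))"
    by (auto simp: indicator_def fun_eq_iff)
  also have "\<dots> \<in> borel_measurable borel" by measurable
  finally show ?thesis .
qed

lemma borel_cf_F:
  assumes c: "\<And>i. c i \<in> borel_measurable borel" and sm: "\<And>t. 0 < t \<Longrightarrow> t < T \<Longrightarrow> summable (\<lambda>i. (c i t)\<^sup>2)"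
  shows "(\<lambda>t. indicator {0<..<T} t * cf (\<lambda>x. F t x (synth (\<lambda>i. c i t))) j) \<in> borel_measurable borel"
proof -
  \<comment> \<open>\<open>Suc m\<close> keeps the number of time cells positive.\<close>
  define q where "q m t = quant (Suc m) (\<lambda>i. c i t)" for m t
  have qs: "summable (\<lambda>i. (q m t i)\<^sup>2)" for m t
    by (rule summable_finite[of "{..<Suc m}"]) (auto simp: q_def quant_def)
  define G where "G m t = cf (\<lambda>x. F (time_step T (Suc m) t) x (synth (q m t))) j" for m t
  have "finite_valued T (G m)" for m
  proof -
    have "finite_valued T (\<lambda>t. (time_step T (Suc m) t, q m t))"
      unfolding q_def by (intro finite_valued_Pair finite_valued_time_step T finite_valued_quant[of c, OF c]) simp
    from finite_valued_compose[OF this, of "\<lambda>p. cf (\<lambda>x. F (fst p) x (synth (snd p))) j"]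
    show ?thesis by (simp add: G_def[abs_def])
  qed
  then have meas: "(\<lambda>t. indicator {0<..<T} t * G m t) \<in> borel_measurable borel" for m by (rule finite_valued_measurable)
  have lim: "(\<lambda>m. indicator {0<..<T} t * G m t) \<longlonglongrightarrow> indicator {0<..<T} t * cf (\<lambda>x. F t x (synth (\<lambda>i. c i t))) j" for t
  proof (cases "t \<in> {0<..<T}")
    case True
    have st: "summable (\<lambda>i. (c i t)\<^sup>2)" using sm True by simp
    obtain b where b: "b \<longlonglongrightarrow> 0" "\<forall>\<^sub>F m in sequentially. l2_bound (\<lambda>j. quant m (\<lambda>i. c i t) j - c j t) (b m)"
      using st by (rule quant_tendsto)
    have b': "(\<lambda>m. b (Suc m)) \<longlonglongrightarrow> 0" using b(1) by (rule LIMSEQ_Suc)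
    have ev: "\<forall>\<^sub>F m in sequentially. l2_bound (\<lambda>j. q m t j - c j t) (b (Suc m))"
      using b(2) unfolding q_def by (subst (asm) eventually_sequentially_Suc[symmetric])
    have "(\<lambda>m. \<Upsilon> * (T / real (Suc m) + b (Suc m))) \<longlonglongrightarrow> \<Upsilon> * (0 + 0)"
      by (intro tendsto_intros b' LIMSEQ_Suc[OF lim_const_over_n])
    then have z: "(\<lambda>m. \<Upsilon> * (T / real (Suc m) + b (Suc m))) \<longlonglongrightarrow> 0" by simp
    have "\<forall>\<^sub>F m in sequentially. norm (G m t - cf (\<lambda>x. F t x (synth (\<lambda>i. c i t))) j) \<le> \<Upsilon> * (T / real (Suc m) + b (Suc m))"
      using ev
    proof eventually_elim
      case (elim m)
      note ts = time_step[OF T, of "Suc m" t, OF _ True]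
      have "l2_bound (\<lambda>j. cf (\<lambda>x. F (time_step T (Suc m) t) x (synth (q m t))) j - cf (\<lambda>x. F t x (synth (\<lambda>i. c i t))) j)
         (\<Upsilon> * (\<bar>time_step T (Suc m) t - t\<bar> + b (Suc m)))"
        using ts(1) True by (intro F_lip_cf synth_L2 synth_diff_bound qs st elim) auto
      from l2_bound_component[OF this, of j]
      have "\<bar>G m t - cf (\<lambda>x. F t x (synth (\<lambda>i. c i t))) j\<bar> \<le> \<Upsilon> * (\<bar>time_step T (Suc m) t - t\<bar> + b (Suc m))" by (simp add: G_def)
      also have "\<dots> \<le> \<Upsilon> * (T / real (Suc m) + b (Suc m))"
        using ts(2) \<Upsilon> by (intro mult_left_mono add_right_mono) auto
      finally show ?case by simp
    qed
    from Lim_null_comparison[OF this z] have "(\<lambda>m. G m t) \<longlonglongrightarrow> cf (\<lambda>x. F t x (synth (\<lambda>i. c i t))) j" by (simp add: LIM_zero_iff)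
    then show ?thesis by (intro tendsto_mult tendsto_const)
  qed simp
  show ?thesis by (rule borel_measurable_LIMSEQ_real[OF lim meas])
qed

lemma borel_f:
  assumes c[measurable]: "\<And>i. c i \<in> borel_measurable borel" and sm: "\<And>t. 0 < t \<Longrightarrow> t < T \<Longrightarrow> summable (\<lambda>i. (c i t)\<^sup>2)"
  shows "(\<lambda>t. indicator {0<..<T} t * f t (\<lambda>i. c i t) j) \<in> borel_measurable borel"
proof -
  note [measurable] = borel_cf_F[of c, OF c sm] borel_k
  have "(\<lambda>t. indicator {0<..<T} t * f t (\<lambda>i. c i t) j)
     = (\<lambda>t. indicator {0<..<T} t * cf (\<lambda>x. F t x (synth (\<lambda>i. c i t))) j - (indicator {0<..<T} t * k t) * c j t)"
    by (simp add: f_def fun_eq_iff algebra_simps)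
  also have "\<dots> \<in> borel_measurable borel" by measurable
  finally show ?thesis .
qed

section \<open>The solution operators and the integral equation in coordinates\<close>

lemma G1_integrand_eq: "G1_integrand \<Omega> lam e \<alpha> \<beta> t h j \<tau> = K j (t - \<tau>) * cf (h \<tau>) j"
  by (simp add: G1_integrand_def K_def ml_kernel_def cf_def mult_ac)

lemma G1_terms_eq: "G1_terms \<Omega> lam e \<alpha> \<beta> t h = (\<lambda>j x. (\<integral>\<tau>. G1_integrand \<Omega> lam e \<alpha> \<beta> t h j \<tau> \<partial>lebesgue_on {0<..<t}) * e j x)"
  by (simp add: G1_terms_def fun_eq_iff)

text \<open>The assumed convergence is essential for reading off coordinates: without it the
  integrals and the chosen sum would carry no information. The coordinates g are Borel versions that
  agree with those of h only almost everywhere.\<close>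

lemma G1_coords:
  assumes g[measurable]: "\<And>j. g j \<in> borel_measurable borel"
    and eq: "AE \<tau> in lborel. 0 < \<tau> \<longrightarrow> \<tau> < T \<longrightarrow> (\<forall>j. g j \<tau> = cf (h \<tau>) j)"
    and t: "0 < t" "t \<le> T" and c: "G1_converges \<Omega> lam e \<alpha> \<beta> t h"
  shows "G1 \<Omega> lam e \<alpha> \<beta> t h \<in> L2 \<Omega>" "cf (G1 \<Omega> lam e \<alpha> \<beta> t h) j = conv g j t"
    "integrable lborel (\<lambda>\<tau>. indicator {0<..<t} \<tau> * (K j (t - \<tau>) * g j \<tau>))" "summable (\<lambda>j. (conv g j t)\<^sup>2)"
proof -
  have ae: "AE \<tau> in lebesgue_on {0<..<t}. G1_integrand \<Omega> lam e \<alpha> \<beta> t h j \<tau> = K j (t - \<tau>) * g j \<tau>" for j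
    unfolding AE_lebesgue_on_Ioo_iff using eq by eventually_elim (use t in \<open>auto simp: G1_integrand_eq\<close>)
  have int: "integrable (lebesgue_on {0<..<t}) (G1_integrand \<Omega> lam e \<alpha> \<beta> t h j)" for j
    using c by (simp add: G1_converges_def)
  have m: "(\<lambda>\<tau>. K j (t - \<tau>) * g j \<tau>) \<in> borel_measurable (lebesgue_on {0<..<t})" for j
    by (rule measurable_restrict_space1, rule measurable_completion) measurable
  have int2: "integrable (lebesgue_on {0<..<t}) (\<lambda>\<tau>. K j (t - \<tau>) * g j \<tau>)" for j
    using integrable_cong_AE[OF borel_measurable_integrable[OF int] m ae] int by simp
  then show "integrable lborel (\<lambda>\<tau>. indicator {0<..<t} \<tau> * (K j (t - \<tau>) * g j \<tau>))"
    by (subst (asm) integral_lebesgue_on_lborel(2)) auto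
  have a: "(\<integral>\<tau>. G1_integrand \<Omega> lam e \<alpha> \<beta> t h j \<tau> \<partial>lebesgue_on {0<..<t}) = conv g j t" for j
    using integral_cong_AE[OF borel_measurable_integrable[OF int] m ae]
    by (simp add: conv_def integral_lebesgue_on_lborel(1))
  have sm: "L2_summable \<Omega> (\<lambda>j x. conv g j t * e j x)" using c by (simp add: G1_converges_def G1_terms_eq a)
  then show s: "summable (\<lambda>j. (conv g j t)\<^sup>2)" by (simp add: L2_summable_iff)
  have "G1 \<Omega> lam e \<alpha> \<beta> t h = synth (\<lambda>j. conv g j t)" by (simp add: G1_def G1_terms_eq a synth_def)
  then show "G1 \<Omega> lam e \<alpha> \<beta> t h \<in> L2 \<Omega>" "cf (G1 \<Omega> lam e \<alpha> \<beta> t h) j = conv g j t"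
    using synth_L2[OF s] cf_synth[OF s] by auto
qed

lemma G1_convergesI:
  assumes g: "weighted g Y a" "a < 1"
    and eq: "\<And>\<tau> j. 0 < \<tau> \<Longrightarrow> \<tau> < T \<Longrightarrow> g j \<tau> = cf (h \<tau>) j" and t: "0 < t" "t \<le> T"
  shows "G1_converges \<Omega> lam e \<alpha> \<beta> t h"
proof -
  note [measurable] = weighted_measurable[OF g(1)]
  have sp: "G1_integrand \<Omega> lam e \<alpha> \<beta> t h j \<tau> = K j (t - \<tau>) * g j \<tau>" if "\<tau> \<in> space (lebesgue_on {0<..<t})" for j \<tau>
    using that eq[of \<tau> j] t by (simp add: G1_integrand_eq)
  have i: "integrable lborel (\<lambda>\<tau>. indicator {0<..<t} \<tau> * (K j (t - \<tau>) * g j \<tau>))" for j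
    using conv_integrable_bound(1)[OF g t, of 0] by simp
  have a: "(\<integral>\<tau>. G1_integrand \<Omega> lam e \<alpha> \<beta> t h j \<tau> \<partial>lebesgue_on {0<..<t}) = conv g j t" for j
    by (subst Bochner_Integration.integral_cong[OF refl sp]) (simp_all add: conv_def integral_lebesgue_on_lborel(1))
  have "integrable (lebesgue_on {0<..<t}) (G1_integrand \<Omega> lam e \<alpha> \<beta> t h j)" for j
    using i[of j] by (subst Bochner_Integration.integrable_cong[OF refl sp]) (simp_all add: integral_lebesgue_on_lborel(2))
  moreover have "l2_bound (\<lambda>j. conv g j t) (M2 * Y * Beta \<alpha> (1 - a) * t powr (\<alpha> - a))"
    using conv_integrable_bound(2)[OF g t, of 0] lam_pos by (simp add: less_imp_neq[symmetric])
  then have "L2_summable \<Omega> (G1_terms \<Omega> lam e \<alpha> \<beta> t h)"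
    by (simp add: G1_terms_eq a L2_summable_iff l2_bound_summable)
  ultimately show ?thesis by (simp add: G1_converges_def)
qed

lemma G2_terms_eq: "G2_terms \<Omega> lam e \<alpha> \<beta> \<kappa> T t v = (\<lambda>j x. (R j t * cf v j) * e j x)"
  by (simp add: G2_terms_def R_def cf_def fun_eq_iff mult_ac)

lemma G2_converges_iff: "G2_converges \<Omega> lam e \<alpha> \<beta> \<kappa> T t v \<longleftrightarrow> summable (\<lambda>j. (R j t * cf v j)\<^sup>2)"
  by (simp add: G2_converges_def G2_terms_eq L2_summable_iff)

lemma G2_coords:
  assumes "G2_converges \<Omega> lam e \<alpha> \<beta> \<kappa> T t v"
  shows "G2 \<Omega> lam e \<alpha> \<beta> \<kappa> T t v \<in> L2 \<Omega>" "cf (G2 \<Omega> lam e \<alpha> \<beta> \<kappa> T t v) j = R j t * cf v j"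
proof -
  have "G2 \<Omega> lam e \<alpha> \<beta> \<kappa> T t v = synth (\<lambda>j. R j t * cf v j)" by (simp add: G2_def G2_terms_eq synth_def)
  then show "G2 \<Omega> lam e \<alpha> \<beta> \<kappa> T t v \<in> L2 \<Omega>" "cf (G2 \<Omega> lam e \<alpha> \<beta> \<kappa> T t v) j = R j t * cf v j"
    using assms by (auto simp: G2_converges_iff synth_L2 cf_synth)
qed

lemma G3_coords:
  assumes "\<And>j. g j \<in> borel_measurable borel" "AE \<tau> in lborel. 0 < \<tau> \<longrightarrow> \<tau> < T \<longrightarrow> (\<forall>j. g j \<tau> = cf (h \<tau>) j)"
    and "G3_converges \<Omega> lam e \<alpha> \<beta> \<kappa> T t h"
  shows "G3 \<Omega> lam e \<alpha> \<beta> \<kappa> T t h \<in> L2 \<Omega>" "cf (G3 \<Omega> lam e \<alpha> \<beta> \<kappa> T t h) j = - (R j t * conv g j T)"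
proof -
  have c: "G1_converges \<Omega> lam e \<alpha> \<beta> T h" "G2_converges \<Omega> lam e \<alpha> \<beta> \<kappa> T t (G1 \<Omega> lam e \<alpha> \<beta> T h)"
    using assms(3) by (auto simp: G3_converges_def)
  have eq: "G3 \<Omega> lam e \<alpha> \<beta> \<kappa> T t h = (\<lambda>x. (-1) * G2 \<Omega> lam e \<alpha> \<beta> \<kappa> T t (G1 \<Omega> lam e \<alpha> \<beta> T h) x)"
    by (simp add: G3_def fun_eq_iff)
  show "G3 \<Omega> lam e \<alpha> \<beta> \<kappa> T t h \<in> L2 \<Omega>" unfolding eq by (intro L2_scale G2_coords(1) c)
  show "cf (G3 \<Omega> lam e \<alpha> \<beta> \<kappa> T t h) j = - (R j t * conv g j T)"
    unfolding eq cf_scale G2_coords(2)[OF c(2)] G1_coords(2)[OF assms(1,2) T order_refl c(1)] by simp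
qed

definition rhs :: "(real^'n \<Rightarrow> real) \<Rightarrow> (real \<Rightarrow> real^'n \<Rightarrow> real) \<Rightarrow> (real \<Rightarrow> real^'n \<Rightarrow> real) \<Rightarrow> real \<Rightarrow> real^'n \<Rightarrow> real" where
  "rhs \<phi> h1 h2 t x = G2 \<Omega> lam e \<alpha> \<beta> \<kappa> T t \<phi> x + G1 \<Omega> lam e \<alpha> \<beta> t h1 x + G3 \<Omega> lam e \<alpha> \<beta> \<kappa> T t h1 x
     - G3 \<Omega> lam e \<alpha> \<beta> \<kappa> T t h2 x - G1 \<Omega> lam e \<alpha> \<beta> t h2 x"

definition rhs_converges :: "(real^'n \<Rightarrow> real) \<Rightarrow> (real \<Rightarrow> real^'n \<Rightarrow> real) \<Rightarrow> (real \<Rightarrow> real^'n \<Rightarrow> real) \<Rightarrow> real \<Rightarrow> bool" where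
  "rhs_converges \<phi> h1 h2 t \<longleftrightarrow> G2_converges \<Omega> lam e \<alpha> \<beta> \<kappa> T t \<phi> \<and>
     G1_converges \<Omega> lam e \<alpha> \<beta> t h1 \<and> G1_converges \<Omega> lam e \<alpha> \<beta> t h2 \<and>
     G3_converges \<Omega> lam e \<alpha> \<beta> \<kappa> T t h1 \<and> G3_converges \<Omega> lam e \<alpha> \<beta> \<kappa> T t h2"

text \<open>By linearity the two sources F(u) and k u enter only through their difference, which is
  the single source in \<open>sol\<close>. The integrability claims justify splitting the
  convolution, at time t and at time T.\<close>

lemma rhs_coords:
  assumes g1[measurable]: "\<And>j. g1 j \<in> borel_measurable borel" and g2[measurable]: "\<And>j. g2 j \<in> borel_measurable borel"
    and e1: "AE \<tau> in lborel. 0 < \<tau> \<longrightarrow> \<tau> < T \<longrightarrow> (\<forall>j. g1 j \<tau> = cf (h1 \<tau>) j)"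
    and e2: "AE \<tau> in lborel. 0 < \<tau> \<longrightarrow> \<tau> < T \<longrightarrow> (\<forall>j. g2 j \<tau> = cf (h2 \<tau>) j)"
    and t: "0 < t" "t < T" and c: "rhs_converges \<phi> h1 h2 t"
  shows "rhs \<phi> h1 h2 t \<in> L2 \<Omega>" "cf (rhs \<phi> h1 h2 t) j = sol (\<lambda>j \<tau>. g1 j \<tau> - g2 j \<tau>) (cf \<phi>) j t"
    "integrable lborel (\<lambda>\<tau>. indicator {0<..<t} \<tau> * (K j (t - \<tau>) * (g1 j \<tau> - g2 j \<tau>)))"
    "integrable lborel (\<lambda>\<tau>. indicator {0<..<T} \<tau> * (K j (T - \<tau>) * (g1 j \<tau> - g2 j \<tau>)))"
    "summable (\<lambda>j. (conv (\<lambda>j \<tau>. g1 j \<tau> - g2 j \<tau>) j T)\<^sup>2)"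
proof -
  have cs: "G2_converges \<Omega> lam e \<alpha> \<beta> \<kappa> T t \<phi>" "G1_converges \<Omega> lam e \<alpha> \<beta> t h1" "G1_converges \<Omega> lam e \<alpha> \<beta> t h2"
    "G3_converges \<Omega> lam e \<alpha> \<beta> \<kappa> T t h1" "G3_converges \<Omega> lam e \<alpha> \<beta> \<kappa> T t h2"
    "G1_converges \<Omega> lam e \<alpha> \<beta> T h1" "G1_converges \<Omega> lam e \<alpha> \<beta> T h2"
    using c by (auto simp: rhs_converges_def G3_converges_def)
  have tT: "t \<le> T" using t by simp
  note a1 = G1_coords[OF g1 e1 t(1) tT cs(2)] and a2 = G1_coords[OF g2 e2 t(1) tT cs(3)]
  note b1 = G1_coords[OF g1 e1 T order_refl cs(6)] and b2 = G1_coords[OF g2 e2 T order_refl cs(7)]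
  note d1 = G3_coords[OF g1 e1 cs(4)] and d2 = G3_coords[OF g2 e2 cs(5)]
  note d0 = G2_coords[OF cs(1)]
  have cd: "conv (\<lambda>j \<tau>. g1 j \<tau> - g2 j \<tau>) j t = conv g1 j t - conv g2 j t" "conv (\<lambda>j \<tau>. g1 j \<tau> - g2 j \<tau>) j T = conv g1 j T - conv g2 j T" for j
    using a1(3)[of j] a2(3)[of j] b1(3)[of j] b2(3)[of j] by (simp_all add: conv_def right_diff_distrib)
  let ?s1 = "\<lambda>x. G2 \<Omega> lam e \<alpha> \<beta> \<kappa> T t \<phi> x + G1 \<Omega> lam e \<alpha> \<beta> t h1 x"
  let ?s2 = "\<lambda>x. ?s1 x + G3 \<Omega> lam e \<alpha> \<beta> \<kappa> T t h1 x"
  let ?s3 = "\<lambda>x. ?s2 x - G3 \<Omega> lam e \<alpha> \<beta> \<kappa> T t h2 x"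
  have add: "cf (\<lambda>x. u x + v x) j = cf u j + cf v j" if "u \<in> L2 \<Omega>" "v \<in> L2 \<Omega>" for u v
    using cf_lincomb[OF that, of 1 1] by simp
  have s1: "?s1 \<in> L2 \<Omega>" by (rule L2_add[OF d0(1) a1(1)])
  have s2: "?s2 \<in> L2 \<Omega>" by (rule L2_add[OF s1 d1(1)])
  have s3: "?s3 \<in> L2 \<Omega>" by (rule L2_diff[OF s2 d2(1)])
  have r: "rhs \<phi> h1 h2 t = (\<lambda>x. ?s3 x - G1 \<Omega> lam e \<alpha> \<beta> t h2 x)" by (simp add: rhs_def fun_eq_iff)
  show "rhs \<phi> h1 h2 t \<in> L2 \<Omega>" unfolding r by (rule L2_diff[OF s3 a2(1)])
  show "cf (rhs \<phi> h1 h2 t) j = sol (\<lambda>j \<tau>. g1 j \<tau> - g2 j \<tau>) (cf \<phi>) j t"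
    unfolding r cf_diff[OF s3 a2(1)] cf_diff[OF s2 d2(1)] add[OF s1 d1(1)] add[OF d0(1) a1(1)] d0(2) a1(2) a2(2) d1(2) d2(2)
    by (simp add: sol_def cd algebra_simps)
  show "integrable lborel (\<lambda>\<tau>. indicator {0<..<t} \<tau> * (K j (t - \<tau>) * (g1 j \<tau> - g2 j \<tau>)))"
    using Bochner_Integration.integrable_diff[OF a1(3) a2(3)] by (simp add: right_diff_distrib)
  show "integrable lborel (\<lambda>\<tau>. indicator {0<..<T} \<tau> * (K j (T - \<tau>) * (g1 j \<tau> - g2 j \<tau>)))"
    using Bochner_Integration.integrable_diff[OF b1(3) b2(3)] by (simp add: right_diff_distrib)
  show "summable (\<lambda>j. (conv (\<lambda>j \<tau>. g1 j \<tau> - g2 j \<tau>) j T)\<^sup>2)"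
    unfolding cd by (rule l2_bound_summable[OF l2_bound_diff[OF l2_bound_sqrt[OF b1(4)] l2_bound_sqrt[OF b2(4)]]])
qed

lemma Bochner_Lp_from_coords:
  assumes y[measurable]: "\<And>j. y j \<in> borel_measurable borel" and a: "0 \<le> a" "a < 1"
    and h: "\<And>t. t \<in> {0<..<T} \<Longrightarrow> h t \<in> L2 \<Omega>" "\<And>t j. t \<in> {0<..<T} \<Longrightarrow> cf (h t) j = y j t"
    and bound: "\<And>t. t \<in> {0<..<T} \<Longrightarrow> l2_bound (\<lambda>j. y j t) (A * t powr (- a))"
  shows "h \<in> Bochner_Lp 1 T (L2 \<Omega>) (L2_norm \<Omega>)"
proof -
  define N where "N t = sqrt (\<Sum>j. (y j t)\<^sup>2)" for t
  have [measurable]: "N \<in> borel_measurable borel" unfolding N_def by measurable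
  have N: "L2_norm \<Omega> (h t) = N t" "N t \<le> A * t powr (- a)" "0 \<le> N t" if t: "t \<in> {0<..<T}" for t
  proof -
    have "(L2_norm \<Omega> (h t))\<^sup>2 = (\<Sum>j. (y j t)\<^sup>2)" using parseval[OF h(1)[OF t]] by (simp add: h(2)[OF t] sums_iff)
    then show n: "L2_norm \<Omega> (h t) = N t" unfolding N_def by (metis L2_norm_nonneg real_sqrt_unique)
    show "0 \<le> N t" using n L2_norm_nonneg[of \<Omega> "h t"] by simp
    have "cf (h t) = (\<lambda>j. y j t)" using h(2)[OF t] by auto
    then show "N t \<le> A * t powr (- a)" unfolding n[symmetric] using bound[OF t] h(1)[OF t] by (intro L2_norm_le_if_l2_bound) auto
  qed
  have "integrable lborel (\<lambda>t. indicator {0<..<T} t * N t)"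
  proof (rule Bochner_Integration.integrable_bound)
    show "integrable lborel (\<lambda>t. A * (indicator {0<..<T} t * t powr (- a)))"
      using a T by (intro integrable_mult_right integrable_powr_Ioo)
    show "AE t in lborel. norm (indicator {0<..<T} t * N t) \<le> norm (A * (indicator {0<..<T} t * t powr (- a)))"
    proof (rule AE_I2)
      fix t :: real
      show "norm (indicator {0<..<T} t * N t) \<le> norm (A * (indicator {0<..<T} t * t powr (- a)))"
        using N(2,3)[of t] by (cases "t \<in> {0<..<T}") auto
    qed
  qed measurable
  then have "integrable (lebesgue_on {0<..<T}) N" by (subst integral_lebesgue_on_lborel(2)) auto
  moreover have "integrable (lebesgue_on {0<..<T}) N \<longleftrightarrow> integrable (lebesgue_on {0<..<T}) (\<lambda>t. L2_norm \<Omega> (h t) powr 1)"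
    by (rule Bochner_Integration.integrable_cong) (auto simp: N L2_norm_nonneg)
  ultimately have "integrable (lebesgue_on {0<..<T}) (\<lambda>t. L2_norm \<Omega> (h t) powr 1)" by simp
  moreover have "AE t in lebesgue_on {0<..<T}. h t \<in> L2 \<Omega>" by (rule AE_I2) (use h in auto)
  moreover have "strongly_measurable T (L2 \<Omega>) (L2_norm \<Omega>) h" by (rule strongly_measurable_L2[OF y h])
  ultimately show ?thesis unfolding Bochner_Lp_def by blast
qed

lemma mild_solution_iff:
  "mild_solution \<Omega> lam e \<alpha> \<beta> \<kappa> T k F \<phi> u \<longleftrightarrow>
     (\<exists>m\<ge>1. \<exists>l\<ge>1. u \<in> Bochner_Lp m T (Lp (lebesgue_on \<Omega>) l) (Lp_norm (lebesgue_on \<Omega>) l)) \<and>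
     (AE t in lebesgue_on {0<..<T}. u t \<in> L2 \<Omega>) \<and>
     (\<lambda>t x. F t x (u t)) \<in> Bochner_Lp 1 T (L2 \<Omega>) (L2_norm \<Omega>) \<and>
     (\<lambda>t x. k t * u t x) \<in> Bochner_Lp 1 T (L2 \<Omega>) (L2_norm \<Omega>) \<and>
     (AE t in lebesgue_on {0<..<T}. rhs_converges \<phi> (\<lambda>t x. F t x (u t)) (\<lambda>t x. k t * u t x) t \<and>
        (AE x in lebesgue_on \<Omega>. u t x = rhs \<phi> (\<lambda>t x. F t x (u t)) (\<lambda>t x. k t * u t x) t x))"
  unfolding mild_solution_def Let_def rhs_converges_def rhs_def by (simp add: conj_assoc)

lemma powr_\<mu>: "\<mu> j powr x = lam j powr (\<beta> * x)"
  by (simp add: powr_powr)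

text \<open>The fixed point from \<open>picard\<close> is synthesized into a function. The remaining
  work is to check the convergence requirements, which concern F(u) and k u separately, so each
  source receives its own weighted bound.\<close>

theorem mild_solution_exists:
  assumes \<phi>: "\<phi> \<in> L2 \<Omega>" "l2_bound (\<lambda>j. \<mu> j powr (1 - s) * cf \<phi> j) \<Phi>"
  shows "\<exists>u. mild_solution \<Omega> lam e \<alpha> \<beta> \<kappa> T k F \<phi> u"
proof -
  obtain c Y where c[measurable]: "\<And>j. c j \<in> borel_measurable borel" and Y: "0 \<le> Y"
    and cb: "\<And>t. 0 < t \<Longrightarrow> t < T \<Longrightarrow> l2_bound (\<lambda>j. c j t) (Y * t powr (- (\<alpha> * s)))"
    and H: "weighted (\<lambda>j t. indicator {0<..<T} t * f t (\<lambda>i. c i t) j) (\<Lambda> * Y) (\<alpha> * s)"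
    and fixp: "\<And>j t. 0 < t \<Longrightarrow> t < T \<Longrightarrow> c j t = sol (\<lambda>j t. indicator {0<..<T} t * f t (\<lambda>i. c i t) j) (cf \<phi>) j t"
  proof (rule picard[of f "cf \<phi>" \<Phi>])
    show "(\<lambda>t. indicator {0<..<T} t * f t (\<lambda>i. c i t) j) \<in> borel_measurable borel"
      if "\<And>i. c i \<in> borel_measurable borel" "\<And>t. 0 < t \<Longrightarrow> t < T \<Longrightarrow> summable (\<lambda>i. (c i t)\<^sup>2)" for c j
      using that by (rule borel_f)
    show "l2_bound (\<lambda>i. f t c i - f t d i) (\<Lambda> * B)"
      if "0 < t" "t < T" "summable (\<lambda>i. (c i)\<^sup>2)" "summable (\<lambda>i. (d i)\<^sup>2)" "l2_bound (\<lambda>i. c i - d i) B" for t c d B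
      using that by (rule f_lipschitz)
    show "f t (\<lambda>_. 0) i = 0" if "0 < t" "t < T" for t i using that by (rule f_zero)
  qed (rule \<phi>(2), rule that)
  have cs: "summable (\<lambda>j. (c j t)\<^sup>2)" if "0 < t" "t < T" for t using cb[OF that] by (rule l2_bound_summable)
  define u where "u t = synth (\<lambda>j. c j t)" for t
  have u: "u t \<in> L2 \<Omega>" "cf (u t) j = c j t" if "t \<in> {0<..<T}" for t j
    using that cs[of t] by (auto simp: u_def synth_L2 cf_synth)
  let ?Fu = "\<lambda>t x. F t x (u t)" and ?ku = "\<lambda>t x. k t * u t x"
  define gF where "gF j t = indicator {0<..<T} t * cf (\<lambda>x. F t x (synth (\<lambda>i. c i t))) j" for j t
  define gk where "gk j t = (indicator {0<..<T} t * k t) * c j t" for j t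
  have [measurable]: "gF j \<in> borel_measurable borel" for j unfolding gF_def by (rule borel_cf_F[of c, OF c cs])
  have [measurable]: "gk j \<in> borel_measurable borel" for j unfolding gk_def by (rule borel_measurable_times[OF borel_k c])
  have gF: "gF j t = cf (?Fu t) j" and gk: "gk j t = cf (?ku t) j" if "0 < t" "t < T" for j t
    using that by (simp_all add: gF_def gk_def u_def[symmetric] cf_scale u)
  have ub: "L2_norm \<Omega> (u t) \<le> Y * t powr (- (\<alpha> * s))" if "0 < t" "t < T" for t
  proof (rule L2_norm_le_if_l2_bound)
    show "u t \<in> L2 \<Omega>" using u that by simp
    have "cf (u t) = (\<lambda>j. c j t)" using u that by auto
    then show "l2_bound (cf (u t)) (Y * t powr (- (\<alpha> * s)))" using cb[OF that] by simp
  qed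
  have gFb: "l2_bound (\<lambda>j. gF j t) (\<Upsilon> * Y * t powr (- (\<alpha> * s)))" if t: "0 < t" "t < T" for t
  proof -
    have tt: "t \<in> {0<..<T}" using t by simp
    have "L2_norm \<Omega> (\<lambda>x. u t x - 0) \<le> Y * t powr (- (\<alpha> * s))" using ub[OF t] by simp
    from F_lip_cf[OF tt tt u(1)[OF tt] L2_zero this]
    show ?thesis by (simp add: gF[OF t] cf_F_zero[OF tt] mult.assoc)
  qed
  have gkb: "l2_bound (\<lambda>j. gk j t) (kn * Y * t powr (- (\<alpha> * s)))" if t: "0 < t" "t < T" for t
    using l2_bound_mult[OF cb[OF t], of "\<lambda>_. k t" kn] kn[of t] t by (simp add: gk_def mult.assoc)
  have wF: "weighted gF (\<Upsilon> * Y) (\<alpha> * s)" and wk: "weighted gk (kn * Y) (\<alpha> * s)"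
    using gFb gkb Y \<Upsilon> kn_nonneg by (auto simp: weighted_def)
  have Heq: "(\<lambda>j t. indicator {0<..<T} t * f t (\<lambda>i. c i t) j) = (\<lambda>j t. gF j t - gk j t)"
    by (simp add: f_def gF_def gk_def fun_eq_iff algebra_simps)
  have conv: "rhs_converges \<phi> ?Fu ?ku t" if t: "0 < t" "t < T" for t
  proof -
    have tT: "t \<le> T" using t by simp
    have R1: "summable (\<lambda>j. (R j t * cf \<phi> j)\<^sup>2)"
      using l2_bound_R[OF t(1) _ _ \<phi>(2)] s by (intro l2_bound_summable) auto
    have R2: "summable (\<lambda>j. (R j t * conv g j T)\<^sup>2)" if "weighted g Z (\<alpha> * s)" for g Z
    proof -
      have "l2_bound (\<lambda>j. \<mu> j powr (1 - s) * conv g j T) (M2 * Z * Beta (\<alpha> * (1 - (1 - s))) (1 - \<alpha> * s) * T powr (\<alpha> * (1 - (1 - s)) - \<alpha> * s))"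
        using s by (intro conv_integrable_bound(2)[OF that as(2) T order_refl]) auto
      from l2_bound_R[OF t(1) _ _ this] s show ?thesis by (intro l2_bound_summable) auto
    qed
    have c1: "G1_converges \<Omega> lam e \<alpha> \<beta> x ?Fu" "G1_converges \<Omega> lam e \<alpha> \<beta> x ?ku" if "0 < x" "x \<le> T" for x
      using G1_convergesI[OF wF as(2) gF that] G1_convergesI[OF wk as(2) gk that] by auto
    have g1: "cf (G1 \<Omega> lam e \<alpha> \<beta> T ?Fu) j = conv gF j T" "cf (G1 \<Omega> lam e \<alpha> \<beta> T ?ku) j = conv gk j T" for j
      using G1_coords(2)[of gF ?Fu T, OF _ _ T order_refl c1(1)[OF T order_refl]] G1_coords(2)[of gk ?ku T, OF _ _ T order_refl c1(2)[OF T order_refl]] gF gk by auto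
    show ?thesis
      unfolding rhs_converges_def G3_converges_def G2_converges_iff g1
      using R1 R2[OF wF] R2[OF wk] c1[OF t(1) tT] c1[OF T order_refl] by blast
  qed
  have eq: "AE x in lebesgue_on \<Omega>. u t x = rhs \<phi> ?Fu ?ku t x" if t: "0 < t" "t < T" for t
  proof (rule AE_eq_if_cf_eq)
    have e: "AE \<tau> in lborel. 0 < \<tau> \<longrightarrow> \<tau> < T \<longrightarrow> (\<forall>j. gF j \<tau> = cf (?Fu \<tau>) j)" "AE \<tau> in lborel. 0 < \<tau> \<longrightarrow> \<tau> < T \<longrightarrow> (\<forall>j. gk j \<tau> = cf (?ku \<tau>) j)"
      using gF gk by auto
    show "u t \<in> L2 \<Omega>" using u t by simp
    show "rhs \<phi> ?Fu ?ku t \<in> L2 \<Omega>" by (rule rhs_coords(1)[OF _ _ e t conv[OF t]]) measurable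
    have "cf (rhs \<phi> ?Fu ?ku t) j = sol (\<lambda>j \<tau>. gF j \<tau> - gk j \<tau>) (cf \<phi>) j t" for j
      by (rule rhs_coords(2)[OF _ _ e t conv[OF t]]) measurable
    then show "cf (u t) j = cf (rhs \<phi> ?Fu ?ku t) j" for j
      using fixp[OF t, of j] t by (simp add: u Heq)
  qed
  have kuL2: "?ku t \<in> L2 \<Omega>" if "t \<in> {0<..<T}" for t by (rule L2_scale[OF u(1)[OF that]])
  have "mild_solution \<Omega> lam e \<alpha> \<beta> \<kappa> T k F \<phi> u"
    unfolding mild_solution_iff
  proof (intro conjI)
    have "u \<in> Bochner_Lp 1 T (L2 \<Omega>) (L2_norm \<Omega>)"
      by (rule Bochner_Lp_from_coords[OF c _ as(2) u]) (use as cb in auto)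
    then show "\<exists>m\<ge>1. \<exists>l\<ge>1. u \<in> Bochner_Lp m T (Lp (lebesgue_on \<Omega>) l) (Lp_norm (lebesgue_on \<Omega>) l)"
      by (intro exI[of _ "1::real"] conjI order_refl exI[of _ "2::real"]) simp_all
    show "AE t in lebesgue_on {0<..<T}. u t \<in> L2 \<Omega>" by (rule AE_I2) (use u in simp)
    show "?Fu \<in> Bochner_Lp 1 T (L2 \<Omega>) (L2_norm \<Omega>)"
      by (rule Bochner_Lp_from_coords[of gF "\<alpha> * s"]) (use as gFb gF u F_L2 in auto)
    show "?ku \<in> Bochner_Lp 1 T (L2 \<Omega>) (L2_norm \<Omega>)"
      by (rule Bochner_Lp_from_coords[of gk "\<alpha> * s"]) (use as gkb gk kuL2 in auto)
    show "AE t in lebesgue_on {0<..<T}. rhs_converges \<phi> ?Fu ?ku t \<and> (AE x in lebesgue_on \<Omega>. u t x = rhs \<phi> ?Fu ?ku t x)"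
      by (rule AE_I2) (use conv eq in simp)
  qed
  then show ?thesis by blast
qed

section \<open>From a mild solution back to its coordinates\<close>

definition l2n :: "(nat \<Rightarrow> real) \<Rightarrow> real" where "l2n x = sqrt (\<Sum>j. (x j)\<^sup>2)"

lemma l2n_nonneg: "summable (\<lambda>j. (x j)\<^sup>2) \<Longrightarrow> 0 \<le> l2n x"
  by (simp add: l2n_def suminf_nonneg)

lemma l2n_le: "l2_bound x B \<Longrightarrow> l2n x \<le> B"
  using l2_bound_nonneg[of x B] by (auto simp: l2n_def l2_bound_iff intro!: real_le_lsqrt)

lemma l2_bound_l2n: "l2_bound x B \<Longrightarrow> l2_bound x (l2n x)"
  unfolding l2n_def by (intro l2_bound_sqrt l2_bound_summable)

text \<open>The counterpart of \<open>f\<close> for a given function: F is applied to v itself and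
  not to the function synthesized from its coordinates, which agrees with v only almost
  everywhere.\<close>

definition hc :: "real \<Rightarrow> (real^'n \<Rightarrow> real) \<Rightarrow> nat \<Rightarrow> real" where
  "hc t v j = cf (\<lambda>x. F t x v) j - cf (\<lambda>x. k t * v x) j"

lemma hc_lipschitz:
  assumes t: "0 < t" "t < T" and vw: "v \<in> L2 \<Omega>" "w \<in> L2 \<Omega>" and B: "l2_bound (\<lambda>j. cf v j - cf w j) B"
  shows "l2_bound (\<lambda>j. hc t v j - hc t w j) (\<Lambda> * B)"
proof -
  have tt: "t \<in> {0<..<T}" using t by simp
  have "L2_norm \<Omega> (\<lambda>x. v x - w x) \<le> B"
  proof (rule L2_norm_le_if_l2_bound)
    show "(\<lambda>x. v x - w x) \<in> L2 \<Omega>" using vw by (rule L2_diff)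
    have "cf (\<lambda>x. v x - w x) = (\<lambda>j. cf v j - cf w j)" by (rule ext, rule cf_diff[OF vw])
    then show "l2_bound (cf (\<lambda>x. v x - w x)) B" using B by simp
  qed
  from F_lip_cf[OF tt tt vw this]
  have 1: "l2_bound (\<lambda>j. cf (\<lambda>x. F t x v) j - cf (\<lambda>x. F t x w) j) (\<Upsilon> * B)" by simp
  have 2: "l2_bound (\<lambda>j. k t * (cf v j - cf w j)) (kn * B)"
    using kn[of t] t by (intro l2_bound_mult[OF B]) auto
  show ?thesis using l2_bound_diff[OF 1 2] by (simp add: hc_def cf_scale \<Lambda>_eq algebra_simps)
qed

lemma hc_bound:
  assumes t: "0 < t" "t < T" and v: "v \<in> L2 \<Omega>" and B: "l2_bound (cf v) B"
  shows "l2_bound (hc t v) (\<Lambda> * B)"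
proof -
  have tt: "t \<in> {0<..<T}" using t by simp
  have z: "cf (\<lambda>_. 0) j = 0" for j by (simp add: cf_def L2_inner_zero_left)
  have "hc t (\<lambda>_. 0) j = 0" for j by (simp add: hc_def cf_F_zero[OF tt] z)
  then show ?thesis using hc_lipschitz[OF t v L2_zero, of B] B by (simp add: z)
qed

text \<open>There are countably many coordinates, so their exceptional null sets merge into one. The
  integrability of the source norm, part of the notion of a mild solution, is the starting point for
  Gronwall's lemma.\<close>

lemma mild_coords:
  assumes "mild_solution \<Omega> lam e \<alpha> \<beta> \<kappa> T k F \<phi> u"
  obtains H where "\<And>j. H j \<in> borel_measurable borel"
    "AE t in lborel. 0 < t \<longrightarrow> t < T \<longrightarrow> u t \<in> L2 \<Omega> \<and> (\<forall>j. H j t = hc t (u t) j)"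
    "(\<integral>\<^sup>+t. ennreal (indicator {0<..<T} t * l2n (\<lambda>j. H j t)) \<partial>lborel) < \<infinity>"
    "summable (\<lambda>j. (conv H j T)\<^sup>2)"
    "\<And>j. integrable lborel (\<lambda>\<tau>. indicator {0<..<T} \<tau> * (K j (T - \<tau>) * H j \<tau>))"
    "AE t in lborel. 0 < t \<longrightarrow> t < T \<longrightarrow> (\<forall>j. cf (u t) j = sol H (cf \<phi>) j t \<and>
        integrable lborel (\<lambda>\<tau>. indicator {0<..<t} \<tau> * (K j (t - \<tau>) * H j \<tau>)))"
proof -
  let ?Fu = "\<lambda>t x. F t x (u t)" and ?ku = "\<lambda>t x. k t * u t x"
  have uL2: "AE t in lebesgue_on {0<..<T}. u t \<in> L2 \<Omega>"
    and FuB: "?Fu \<in> Bochner_Lp 1 T (L2 \<Omega>) (L2_norm \<Omega>)" and kuB: "?ku \<in> Bochner_Lp 1 T (L2 \<Omega>) (L2_norm \<Omega>)"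
    and eqn: "AE t in lebesgue_on {0<..<T}. rhs_converges \<phi> ?Fu ?ku t \<and> (AE x in lebesgue_on \<Omega>. u t x = rhs \<phi> ?Fu ?ku t x)"
    using assms unfolding mild_solution_iff by blast+
  have FL2: "AE t in lebesgue_on {0<..<T}. ?Fu t \<in> L2 \<Omega>" and kL2: "AE t in lebesgue_on {0<..<T}. ?ku t \<in> L2 \<Omega>"
    and Fsm: "strongly_measurable T (L2 \<Omega>) (L2_norm \<Omega>) ?Fu" and ksm: "strongly_measurable T (L2 \<Omega>) (L2_norm \<Omega>) ?ku"
    and Fi: "integrable (lebesgue_on {0<..<T}) (\<lambda>t. L2_norm \<Omega> (?Fu t) powr 1)" and ki: "integrable (lebesgue_on {0<..<T}) (\<lambda>t. L2_norm \<Omega> (?ku t) powr 1)"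
    using FuB kuB unfolding Bochner_Lp_def by blast+
  have "\<exists>g. g \<in> borel_measurable borel \<and> (AE t in lborel. 0 < t \<longrightarrow> t < T \<longrightarrow> g t = cf (?Fu t) j)" for j
    by (rule strongly_measurable_cf[OF Fsm FL2, of j]) blast
  then have "\<exists>g. \<forall>j. g j \<in> borel_measurable borel \<and> (AE t in lborel. 0 < t \<longrightarrow> t < T \<longrightarrow> g j t = cf (?Fu t) j)"
    by (intro choice allI)
  then obtain gF where gF: "\<And>j. gF j \<in> borel_measurable borel" "\<And>j. AE t in lborel. 0 < t \<longrightarrow> t < T \<longrightarrow> gF j t = cf (?Fu t) j"
    by blast
  have "\<exists>g. g \<in> borel_measurable borel \<and> (AE t in lborel. 0 < t \<longrightarrow> t < T \<longrightarrow> g t = cf (?ku t) j)" for j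
    by (rule strongly_measurable_cf[OF ksm kL2, of j]) blast
  then have "\<exists>g. \<forall>j. g j \<in> borel_measurable borel \<and> (AE t in lborel. 0 < t \<longrightarrow> t < T \<longrightarrow> g j t = cf (?ku t) j)"
    by (intro choice allI)
  then obtain gk where gk: "\<And>j. gk j \<in> borel_measurable borel" "\<And>j. AE t in lborel. 0 < t \<longrightarrow> t < T \<longrightarrow> gk j t = cf (?ku t) j"
    by blast
  have eF: "AE t in lborel. 0 < t \<longrightarrow> t < T \<longrightarrow> (\<forall>j. gF j t = cf (?Fu t) j)"
  proof -
    have "AE t in lborel. \<forall>j. 0 < t \<longrightarrow> t < T \<longrightarrow> gF j t = cf (?Fu t) j" unfolding AE_all_countable using gF(2) by blast
    then show ?thesis by eventually_elim blast
  qed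
  have ek: "AE t in lborel. 0 < t \<longrightarrow> t < T \<longrightarrow> (\<forall>j. gk j t = cf (?ku t) j)"
  proof -
    have "AE t in lborel. \<forall>j. 0 < t \<longrightarrow> t < T \<longrightarrow> gk j t = cf (?ku t) j" unfolding AE_all_countable using gk(2) by blast
    then show ?thesis by eventually_elim blast
  qed
  define H where "H j \<tau> = gF j \<tau> - gk j \<tau>" for j \<tau>
  have H[measurable]: "H j \<in> borel_measurable borel" for j
    unfolding H_def using gF(1) gk(1) by (intro borel_measurable_diff)
  have H_hc: "AE t in lborel. 0 < t \<longrightarrow> t < T \<longrightarrow> u t \<in> L2 \<Omega> \<and> (\<forall>j. H j t = hc t (u t) j)"
    using eF ek uL2[unfolded AE_lebesgue_on_Ioo_iff] by eventually_elim (auto simp: H_def hc_def)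
  have fin: "(\<integral>\<^sup>+t. ennreal (indicator {0<..<T} t * l2n (\<lambda>j. H j t)) \<partial>lborel) < \<infinity>"
  proof -
    have [measurable]: "(\<lambda>t. l2n (\<lambda>j. H j t)) \<in> borel_measurable borel" unfolding l2n_def by measurable
    have i: "integrable (lebesgue_on {0<..<T}) (\<lambda>t. L2_norm \<Omega> (?Fu t) + L2_norm \<Omega> (?ku t))"
      using Bochner_Integration.integrable_add[OF Fi ki] by (simp add: L2_norm_nonneg)
    have "(\<integral>\<^sup>+t. ennreal (indicator {0<..<T} t * l2n (\<lambda>j. H j t)) \<partial>lborel) = (\<integral>\<^sup>+t. ennreal (l2n (\<lambda>j. H j t)) * indicator {0<..<T} t \<partial>lborel)"
      by (intro nn_integral_cong) (auto simp: indicator_def)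
    also have "\<dots> = (\<integral>\<^sup>+t. ennreal (l2n (\<lambda>j. H j t)) \<partial>lebesgue_on {0<..<T})"
      by (rule nn_integral_lebesgue_on_Ioo[symmetric]) measurable
    also have "\<dots> \<le> (\<integral>\<^sup>+t. ennreal (L2_norm \<Omega> (?Fu t) + L2_norm \<Omega> (?ku t)) \<partial>lebesgue_on {0<..<T})"
    proof (rule nn_integral_mono_AE)
      have "AE t in lebesgue_on {0<..<T}. \<forall>j. gF j t = cf (?Fu t) j" "AE t in lebesgue_on {0<..<T}. \<forall>j. gk j t = cf (?ku t) j"
        unfolding AE_lebesgue_on_Ioo_iff by (rule eF ek)+
      then show "AE t in lebesgue_on {0<..<T}. ennreal (l2n (\<lambda>j. H j t)) \<le> ennreal (L2_norm \<Omega> (?Fu t) + L2_norm \<Omega> (?ku t))"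
        using FL2 kL2
      proof eventually_elim
        case (elim t)
        have "l2_bound (\<lambda>j. cf (?Fu t) j - cf (?ku t) j) (L2_norm \<Omega> (?Fu t) + L2_norm \<Omega> (?ku t))"
          using elim by (intro l2_bound_diff l2_bound_cf) auto
        then show ?case using elim by (intro ennreal_leI l2n_le) (simp add: H_def)
      qed
    qed
    also have "\<dots> < \<infinity>"
      using i by (subst nn_integral_eq_integral) (auto simp: L2_norm_nonneg)
    finally show ?thesis .
  qed
  have rc: "AE t in lborel. 0 < t \<longrightarrow> t < T \<longrightarrow> rhs_converges \<phi> ?Fu ?ku t"
    using eqn unfolding AE_lebesgue_on_Ioo_iff by eventually_elim blast
  \<comment> \<open>Convergence of the third operator at any time contains convergence of the first
    one at the final time T, so a single admissible t0 yields all facts about T.\<close>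
  then obtain t0 where t0: "0 < t0" "t0 < T" "rhs_converges \<phi> ?Fu ?ku t0" using AE_Ioo_ex[OF _ T] by blast
  note r0 = rhs_coords[OF gF(1) gk(1) eF ek t0, folded H_def[abs_def]]
  have sol: "AE t in lborel. 0 < t \<longrightarrow> t < T \<longrightarrow> (\<forall>j. cf (u t) j = sol H (cf \<phi>) j t \<and>
        integrable lborel (\<lambda>\<tau>. indicator {0<..<t} \<tau> * (K j (t - \<tau>) * H j \<tau>)))"
    using eqn[unfolded AE_lebesgue_on_Ioo_iff] uL2[unfolded AE_lebesgue_on_Ioo_iff]
  proof eventually_elim
    case (elim t)
    show ?case
    proof (intro impI allI)
      fix j assume t: "0 < t" "t < T"
      then have c: "rhs_converges \<phi> ?Fu ?ku t" and ae: "AE x in lebesgue_on \<Omega>. u t x = rhs \<phi> ?Fu ?ku t x" and ut: "u t \<in> L2 \<Omega>"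
        using elim by auto
      note r = rhs_coords[OF gF(1) gk(1) eF ek t c, folded H_def[abs_def]]
      have "cf (u t) j = cf (rhs \<phi> ?Fu ?ku t) j"
        unfolding cf_def by (rule L2_inner_cong_AE[OF ut r(1) e_L2 ae])
      then show "cf (u t) j = sol H (cf \<phi>) j t \<and> integrable lborel (\<lambda>\<tau>. indicator {0<..<t} \<tau> * (K j (t - \<tau>) * H j \<tau>))"
        using r(2)[of j] r(3)[of j] by (simp add: H_def[abs_def])
    qed
  qed
  show ?thesis
    by (rule that[OF H H_hc fin _ _ sol]) (use r0(4,5) in \<open>simp_all add: H_def[abs_def]\<close>)
qed

text \<open>The difference of the two sources drives a problem with zero data, for which
  \<open>a_priori\<close> returns a zero constant. No assumption on the growth of either solution
  near t = 0 enters beyond the integrability of its source.\<close>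

theorem mild_solution_unique:
  assumes u: "mild_solution \<Omega> lam e \<alpha> \<beta> \<kappa> T k F \<phi> u" and v: "mild_solution \<Omega> lam e \<alpha> \<beta> \<kappa> T k F \<phi> v"
  shows "AE t in lebesgue_on {0<..<T}. AE x in lebesgue_on \<Omega>. v t x = u t x"
proof -
  obtain G where G[measurable]: "\<And>j. G j \<in> borel_measurable borel"
    and Gh: "AE t in lborel. 0 < t \<longrightarrow> t < T \<longrightarrow> u t \<in> L2 \<Omega> \<and> (\<forall>j. G j t = hc t (u t) j)"
    and Gf: "(\<integral>\<^sup>+t. ennreal (indicator {0<..<T} t * l2n (\<lambda>j. G j t)) \<partial>lborel) < \<infinity>"
    and GT: "summable (\<lambda>j. (conv G j T)\<^sup>2)"
    and GiT: "\<And>j. integrable lborel (\<lambda>\<tau>. indicator {0<..<T} \<tau> * (K j (T - \<tau>) * G j \<tau>))"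
    and Gs: "AE t in lborel. 0 < t \<longrightarrow> t < T \<longrightarrow> (\<forall>j. cf (u t) j = sol G (cf \<phi>) j t \<and>
        integrable lborel (\<lambda>\<tau>. indicator {0<..<t} \<tau> * (K j (t - \<tau>) * G j \<tau>)))"
    proof (rule mild_coords[OF u]) qed (rule that)
  obtain H where H[measurable]: "\<And>j. H j \<in> borel_measurable borel"
    and Hh: "AE t in lborel. 0 < t \<longrightarrow> t < T \<longrightarrow> v t \<in> L2 \<Omega> \<and> (\<forall>j. H j t = hc t (v t) j)"
    and Hf: "(\<integral>\<^sup>+t. ennreal (indicator {0<..<T} t * l2n (\<lambda>j. H j t)) \<partial>lborel) < \<infinity>"
    and HT: "summable (\<lambda>j. (conv H j T)\<^sup>2)"
    and HiT: "\<And>j. integrable lborel (\<lambda>\<tau>. indicator {0<..<T} \<tau> * (K j (T - \<tau>) * H j \<tau>))"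
    and Hs: "AE t in lborel. 0 < t \<longrightarrow> t < T \<longrightarrow> (\<forall>j. cf (v t) j = sol H (cf \<phi>) j t \<and>
        integrable lborel (\<lambda>\<tau>. indicator {0<..<t} \<tau> * (K j (t - \<tau>) * H j \<tau>)))"
    proof (rule mild_coords[OF v]) qed (rule that)
  define D where "D j \<tau> = H j \<tau> - G j \<tau>" for j \<tau>
  have D[measurable]: "D j \<in> borel_measurable borel" for j unfolding D_def by measurable
  \<comment> \<open>The absolute value secures nonnegativity at every time: for a sequence that is
    not square summable, \<open>l2n\<close> need not be a norm.\<close>
  define N where "N t = \<bar>l2n (\<lambda>j. D j t)\<bar>" for t
  have N[measurable]: "N \<in> borel_measurable borel" unfolding N_def l2n_def by measurable
  have bounds: "AE t in lborel. 0 < t \<longrightarrow> t < T \<longrightarrow> l2_bound (\<lambda>j. G j t) (l2n (\<lambda>j. G j t)) \<and> l2_bound (\<lambda>j. H j t) (l2n (\<lambda>j. H j t))"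
    using Gh Hh
  proof eventually_elim
    case (elim t)
    show ?case
    proof (intro impI)
      assume t: "0 < t" "t < T"
      have "l2_bound (\<lambda>j. G j t) (\<Lambda> * L2_norm \<Omega> (u t))" "l2_bound (\<lambda>j. H j t) (\<Lambda> * L2_norm \<Omega> (v t))"
        using elim t hc_bound[OF t _ l2_bound_cf, of "u t"] hc_bound[OF t _ l2_bound_cf, of "v t"] by auto
      then show "l2_bound (\<lambda>j. G j t) (l2n (\<lambda>j. G j t)) \<and> l2_bound (\<lambda>j. H j t) (l2n (\<lambda>j. H j t))"
        by (auto intro: l2_bound_l2n)
    qed
  qed
  have DN: "AE t in lborel. 0 < t \<longrightarrow> t < T \<longrightarrow> l2_bound (\<lambda>j. D j t) (N t) \<and> N t \<le> l2n (\<lambda>j. H j t) + l2n (\<lambda>j. G j t)"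
    using bounds
  proof eventually_elim
    case (elim t)
    show ?case
    proof (intro impI)
      assume "0 < t" "t < T"
      then have d: "l2_bound (\<lambda>j. D j t) (l2n (\<lambda>j. H j t) + l2n (\<lambda>j. G j t))"
        unfolding D_def using elim by (intro l2_bound_diff) auto
      have "N t = l2n (\<lambda>j. D j t)" using l2n_nonneg[OF l2_bound_summable[OF d]] by (simp add: N_def)
      then show "l2_bound (\<lambda>j. D j t) (N t) \<and> N t \<le> l2n (\<lambda>j. H j t) + l2n (\<lambda>j. G j t)"
        using l2_bound_l2n[OF d] l2n_le[OF d] by simp
    qed
  qed
  have fin: "(\<integral>\<^sup>+t. ennreal (indicator {0<..<T} t * N t) \<partial>lborel) < \<infinity>"
  proof -
    have [measurable]: "(\<lambda>t. l2n (\<lambda>j. H j t)) \<in> borel_measurable borel" "(\<lambda>t. l2n (\<lambda>j. G j t)) \<in> borel_measurable borel"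
      unfolding l2n_def by measurable
    have "(\<integral>\<^sup>+t. ennreal (indicator {0<..<T} t * N t) \<partial>lborel)
       \<le> (\<integral>\<^sup>+t. ennreal (indicator {0<..<T} t * l2n (\<lambda>j. H j t)) + ennreal (indicator {0<..<T} t * l2n (\<lambda>j. G j t)) \<partial>lborel)"
    proof (rule nn_integral_mono_AE)
      show "AE t in lborel. ennreal (indicator {0<..<T} t * N t) \<le> ennreal (indicator {0<..<T} t * l2n (\<lambda>j. H j t)) + ennreal (indicator {0<..<T} t * l2n (\<lambda>j. G j t))"
        using DN bounds
      proof eventually_elim
        case (elim t)
        show ?case
        proof (cases "t \<in> {0<..<T}")
          case True
          then have "N t \<le> l2n (\<lambda>j. H j t) + l2n (\<lambda>j. G j t)" "0 \<le> l2n (\<lambda>j. H j t)" "0 \<le> l2n (\<lambda>j. G j t)"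
            using elim l2_bound_nonneg by auto
          then show ?thesis using True by (simp add: ennreal_plus[symmetric] ennreal_leI del: ennreal_plus)
        qed simp
      qed
    qed
    also have "\<dots> = (\<integral>\<^sup>+t. ennreal (indicator {0<..<T} t * l2n (\<lambda>j. H j t)) \<partial>lborel) + (\<integral>\<^sup>+t. ennreal (indicator {0<..<T} t * l2n (\<lambda>j. G j t)) \<partial>lborel)"
      by (rule nn_integral_add) measurable
    also have "\<dots> < \<infinity>" using Gf Hf by simp
    finally show ?thesis .
  qed
  have cT: "conv D j T = conv H j T - conv G j T" for j
    using HiT[of j] GiT[of j] by (simp add: conv_def D_def right_diff_distrib)
  have sol_D: "AE t in lborel. 0 < t \<longrightarrow> t < T \<longrightarrow> (\<forall>j. sol D (\<lambda>_. 0) j t = cf (v t) j - cf (u t) j)"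
    using Gs Hs
  proof eventually_elim
    case (elim t)
    show ?case
    proof (intro impI allI)
      fix j assume t: "0 < t" "t < T"
      then have i: "integrable lborel (\<lambda>\<tau>. indicator {0<..<t} \<tau> * (K j (t - \<tau>) * H j \<tau>))"
        "integrable lborel (\<lambda>\<tau>. indicator {0<..<t} \<tau> * (K j (t - \<tau>) * G j \<tau>))" using elim by auto
      then have "conv D j t = conv H j t - conv G j t" by (simp add: conv_def D_def right_diff_distrib)
      moreover have "cf (u t) j = sol G (cf \<phi>) j t" "cf (v t) j = sol H (cf \<phi>) j t" using elim t by auto
      ultimately show "sol D (\<lambda>_. 0) j t = cf (v t) j - cf (u t) j" by (simp add: sol_def cT algebra_simps)
    qed
  qed
  \<comment> \<open>With zero data the bound \<Phi> is 0, so the constant of the weighted class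
    vanishes and the difference of the sources is zero almost everywhere.\<close>
  have "weighted D (\<Lambda> * (C' * M2 * 0 / (1 - \<rho> * \<Lambda>))) (\<alpha> * s)"
  proof (rule a_priori[OF D N])
    show "0 \<le> N \<tau>" for \<tau> by (simp add: N_def)
    show "AE \<tau> in lborel. 0 < \<tau> \<longrightarrow> \<tau> < T \<longrightarrow> l2_bound (\<lambda>j. D j \<tau>) (N \<tau>)" using DN by eventually_elim blast
    show "(\<integral>\<^sup>+t. ennreal (indicator {0<..<T} t * N t) \<partial>lborel) < \<infinity>" by (rule fin)
    show "l2_bound (\<lambda>j. conv D j T) (sqrt (\<Sum>j. (conv H j T)\<^sup>2) + sqrt (\<Sum>j. (conv G j T)\<^sup>2))"
      unfolding cT by (intro l2_bound_diff l2_bound_sqrt HT GT)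
    show "l2_bound (\<lambda>j. \<mu> j powr (1 - s) * 0) 0" by (simp add: l2_bound_zero)
    show "AE t in lborel. 0 < t \<longrightarrow> t < T \<longrightarrow> (\<forall>B. l2_bound (\<lambda>j. sol D (\<lambda>_. 0) j t) B \<longrightarrow> N t \<le> \<Lambda> * B)"
      using Gh Hh sol_D DN
    proof eventually_elim
      case (elim t)
      show ?case
      proof (intro impI allI)
        fix B assume t: "0 < t" "t < T" and "l2_bound (\<lambda>j. sol D (\<lambda>_. 0) j t) B"
        then have "l2_bound (\<lambda>j. cf (v t) j - cf (u t) j) B" using elim by simp
        then have "l2_bound (\<lambda>j. hc t (v t) j - hc t (u t) j) (\<Lambda> * B)" using elim t by (intro hc_lipschitz) auto
        moreover have "(\<lambda>j. hc t (v t) j - hc t (u t) j) = (\<lambda>j. D j t)" using elim t by (simp add: D_def)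
        ultimately have d: "l2_bound (\<lambda>j. D j t) (\<Lambda> * B)" by simp
        have "N t = l2n (\<lambda>j. D j t)" using l2n_nonneg[OF l2_bound_summable[OF d]] by (simp add: N_def)
        then show "N t \<le> \<Lambda> * B" using l2n_le[OF d] by simp
      qed
    qed
  qed
  then have w: "weighted D 0 (\<alpha> * s)" by simp
  have z: "sol D (\<lambda>_. 0) j t = 0" if "0 < t" "t < T" for j t
    using l2_bound_component[OF sol_bound[OF w _ that], of "\<lambda>_. 0" 0 j] by (simp add: l2_bound_zero)
  show ?thesis
    unfolding AE_lebesgue_on_Ioo_iff using sol_D Gh Hh
  proof eventually_elim
    case (elim t)
    show ?case
    proof (intro impI)
      assume t: "0 < t" "t < T"
      show "AE x in lebesgue_on \<Omega>. v t x = u t x"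
      proof (rule AE_eq_if_cf_eq)
        show "v t \<in> L2 \<Omega>" "u t \<in> L2 \<Omega>" using elim t by auto
        show "cf (v t) j = cf (u t) j" for j using elim t z[OF t, of j] by simp
      qed
    qed
  qed
qed

text \<open>The source bound from \<open>a_priori\<close> is linear in the norm of the data, and so
  are the bounds for the modes; hence one constant serves every \<phi>. The condition \<delta> \<le>
  s makes the weight 1 - \<delta> of the data dominate the weight 1 - s of the contraction.\<close>

theorem caputo_regularity:
  fixes \<delta> m :: real
  assumes \<delta>: "0 < \<delta>" "\<delta> < 1" "\<delta> \<le> s" and m: "0 < m" "\<alpha> * m < 1"
  shows "\<exists>C7>0. \<forall>\<phi>\<in>dom_pow \<Omega> lam e (\<beta> * (1 - \<delta>)). \<forall>u. mild_solution \<Omega> lam e \<alpha> \<beta> \<kappa> T k F \<phi> u \<longrightarrow>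
     (\<exists>w. has_caputo_deriv_dual \<Omega> lam e (\<beta> * \<delta>) \<alpha> T u w \<and>
          w \<in> Bochner_Lp m T (dual_pow \<Omega> lam e (\<beta> * \<delta>)) (dual_pow_norm lam e (\<beta> * \<delta>)) \<and>
          Bochner_Lp_norm m T (dual_pow_norm lam e (\<beta> * \<delta>)) w
            \<le> C7 * Lp_norm (lebesgue_on {0<..<T}) m (\<lambda>t. t powr (- \<alpha>)) * dom_pow_norm \<Omega> lam e (\<beta> * (1 - \<delta>)) \<phi>)"
proof -
  \<comment> \<open>These are the constants for data of norm one: Y1 bounds the source, B1 the
    weighted data minus the convolution at T, and C is the corresponding value of
    \<open>CW\<close>.\<close>
  define Y1 where "Y1 = \<Lambda> * (C' * M2 * \<mu> 0 powr (- (s - \<delta>)) / (1 - \<rho> * \<Lambda>))"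
  define B1 where "B1 = 1 + M2 * Y1 * Beta (\<alpha> * \<delta>) (1 - \<alpha> * s) * T powr (\<alpha> * \<delta> - \<alpha> * s)"
  define C where "C = C' * M2 * B1 + M2 * Y1 * Beta (\<alpha> * \<delta>) (1 - \<alpha> * s) * T powr (\<alpha> * \<delta> - \<alpha> * s + \<alpha>) + \<mu> 0 powr (- \<delta>) * Y1 * T powr (\<alpha> - \<alpha> * s)"
  have Y1: "0 \<le> Y1" using \<Lambda> C'_nonneg M2 by (simp add: Y1_def)
  have Beta: "0 \<le> Beta (\<alpha> * \<delta>) (1 - \<alpha> * s)" using \<alpha> \<delta> as by (intro Beta_nonneg) auto
  have C: "0 \<le> C" using Y1 Beta C'_nonneg M2 by (simp add: C_def B1_def)
  show ?thesis
  \<comment> \<open>C is only known to be nonnegative, while a positive constant is claimed.\<close>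
  proof (intro exI[of _ "C + 1"] conjI ballI allI impI)
    show "0 < C + 1" using C by simp
    fix \<phi> u assume \<phi>: "\<phi> \<in> dom_pow \<Omega> lam e (\<beta> * (1 - \<delta>))" and u: "mild_solution \<Omega> lam e \<alpha> \<beta> \<kappa> T k F \<phi> u"
    define n\<phi> where "n\<phi> = dom_pow_norm \<Omega> lam e (\<beta> * (1 - \<delta>)) \<phi>"
    have n\<phi>: "0 \<le> n\<phi>" by (simp add: n\<phi>_def dom_pow_norm_nonneg)
    have \<phi>b: "l2_bound (\<lambda>j. \<mu> j powr (1 - \<delta>) * cf \<phi> j) n\<phi>"
      using dom_pow_bound[OF \<phi>] by (simp add: powr_\<mu> n\<phi>_def)
    have \<phi>s: "l2_bound (\<lambda>j. \<mu> j powr (1 - s) * cf \<phi> j) (\<mu> 0 powr (- (s - \<delta>)) * n\<phi>)"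
    proof (rule l2_bound_drop_weight)
      have "\<mu> j powr (s - \<delta>) * (\<mu> j powr (1 - s) * cf \<phi> j) = \<mu> j powr (1 - \<delta>) * cf \<phi> j" for j
        using lam_pos[of j] by (simp add: mult.assoc[symmetric] powr_add[symmetric])
      then show "l2_bound (\<lambda>j. \<mu> j powr (s - \<delta>) * (\<mu> j powr (1 - s) * cf \<phi> j)) n\<phi>" using \<phi>b by (simp only:)
    qed (use \<delta> in simp)
    obtain H where H[measurable]: "\<And>j. H j \<in> borel_measurable borel"
      and Hh: "AE t in lborel. 0 < t \<longrightarrow> t < T \<longrightarrow> u t \<in> L2 \<Omega> \<and> (\<forall>j. H j t = hc t (u t) j)"
      and Hf: "(\<integral>\<^sup>+t. ennreal (indicator {0<..<T} t * l2n (\<lambda>j. H j t)) \<partial>lborel) < \<infinity>"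
      and HT: "summable (\<lambda>j. (conv H j T)\<^sup>2)"
      and Hs: "AE t in lborel. 0 < t \<longrightarrow> t < T \<longrightarrow> (\<forall>j. cf (u t) j = sol H (cf \<phi>) j t \<and>
          integrable lborel (\<lambda>\<tau>. indicator {0<..<t} \<tau> * (K j (t - \<tau>) * H j \<tau>)))"
      proof (rule mild_coords[OF u]) qed (rule that)
    define N where "N t = \<bar>l2n (\<lambda>j. H j t)\<bar>" for t
    have N[measurable]: "N \<in> borel_measurable borel" unfolding N_def l2n_def by measurable
    have HN: "AE t in lborel. 0 < t \<longrightarrow> t < T \<longrightarrow> l2_bound (\<lambda>j. H j t) (N t) \<and> N t = l2n (\<lambda>j. H j t)"
      using Hh
    proof eventually_elim
      case (elim t)
      show ?case
      proof (intro impI)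
        assume t: "0 < t" "t < T"
        have d: "l2_bound (\<lambda>j. H j t) (\<Lambda> * L2_norm \<Omega> (u t))"
          using elim t hc_bound[OF t _ l2_bound_cf, of "u t"] by auto
        have "N t = l2n (\<lambda>j. H j t)" using l2n_nonneg[OF l2_bound_summable[OF d]] by (simp add: N_def)
        then show "l2_bound (\<lambda>j. H j t) (N t) \<and> N t = l2n (\<lambda>j. H j t)" using l2_bound_l2n[OF d] by simp
      qed
    qed
    have "weighted H (\<Lambda> * (C' * M2 * (\<mu> 0 powr (- (s - \<delta>)) * n\<phi>) / (1 - \<rho> * \<Lambda>))) (\<alpha> * s)"
    proof (rule a_priori[OF H N])
      show "0 \<le> N \<tau>" for \<tau> by (simp add: N_def)
      show "AE \<tau> in lborel. 0 < \<tau> \<longrightarrow> \<tau> < T \<longrightarrow> l2_bound (\<lambda>j. H j \<tau>) (N \<tau>)" using HN by eventually_elim blast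
      have "(\<integral>\<^sup>+t. ennreal (indicator {0<..<T} t * N t) \<partial>lborel) = (\<integral>\<^sup>+t. ennreal (indicator {0<..<T} t * l2n (\<lambda>j. H j t)) \<partial>lborel)"
        by (rule nn_integral_cong_AE) (use HN in eventually_elim, auto simp: indicator_def)
      then show "(\<integral>\<^sup>+t. ennreal (indicator {0<..<T} t * N t) \<partial>lborel) < \<infinity>" using Hf by simp
      show "l2_bound (\<lambda>j. conv H j T) (sqrt (\<Sum>j. (conv H j T)\<^sup>2))" by (rule l2_bound_sqrt[OF HT])
      show "l2_bound (\<lambda>j. \<mu> j powr (1 - s) * cf \<phi> j) (\<mu> 0 powr (- (s - \<delta>)) * n\<phi>)" by (rule \<phi>s)
      show "AE t in lborel. 0 < t \<longrightarrow> t < T \<longrightarrow> (\<forall>B. l2_bound (\<lambda>j. sol H (cf \<phi>) j t) B \<longrightarrow> N t \<le> \<Lambda> * B)"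
        using Hh Hs HN
      proof eventually_elim
        case (elim t)
        show ?case
        proof (intro impI allI)
          fix B assume t: "0 < t" "t < T" and B: "l2_bound (\<lambda>j. sol H (cf \<phi>) j t) B"
          have "cf (u t) = (\<lambda>j. sol H (cf \<phi>) j t)" using elim t by auto
          then have "l2_bound (hc t (u t)) (\<Lambda> * B)" using elim t B by (intro hc_bound) auto
          moreover have "hc t (u t) = (\<lambda>j. H j t)" using elim t by auto
          ultimately have "l2n (\<lambda>j. H j t) \<le> \<Lambda> * B" by (simp only: l2n_le)
          then show "N t \<le> \<Lambda> * B" using elim(3) t by simp
        qed
      qed
    qed
    then have w: "weighted H (Y1 * n\<phi>) (\<alpha> * s)" by (simp add: Y1_def mult_ac)
    have init: "l2_bound (\<lambda>j. \<mu> j powr (1 - \<delta>) * (cf \<phi> j - conv H j T)) (B1 * n\<phi>)"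
    proof -
      have "l2_bound (\<lambda>j. \<mu> j powr (1 - \<delta>) * conv H j T) (M2 * (Y1 * n\<phi>) * Beta (\<alpha> * \<delta>) (1 - \<alpha> * s) * T powr (\<alpha> * \<delta> - \<alpha> * s))"
        using conv_integrable_bound(2)[OF w as(2) T order_refl, of "1 - \<delta>"] \<delta> by simp
      from l2_bound_diff[OF \<phi>b this] show ?thesis by (simp add: B1_def algebra_simps)
    qed
    interpret cm: caputo_modes \<alpha> T M2 C' \<mu> "Psi lam \<alpha> \<beta> \<kappa> T" H "Y1 * n\<phi>" "\<alpha> * s" "cf \<phi>" \<delta> "B1 * n\<phi>"
    proof
      show "mono \<mu>" using lam(2) lam_pos \<beta> by (auto simp: mono_def less_imp_le intro!: powr_mono2)
      show "filterlim \<mu> at_top sequentially"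
        unfolding filterlim_at_top
      proof
        fix Z :: real
        have "\<forall>\<^sub>F j in sequentially. \<bar>Z\<bar> powr (1 / \<beta>) \<le> lam j" using lam_lim by (simp add: filterlim_at_top)
        then show "\<forall>\<^sub>F j in sequentially. Z \<le> \<mu> j"
        proof eventually_elim
          case (elim j)
          then have "(\<bar>Z\<bar> powr (1 / \<beta>)) powr \<beta> \<le> \<mu> j" using \<beta> by (intro powr_mono2) auto
          then show ?case using \<beta> by (simp add: powr_powr)
        qed
      qed
    qed (use w as \<delta> init in auto)
    have CW: "cm.CW = C * n\<phi>"
      by (simp add: cm.CW_def C_def algebra_simps)
    have \<gamma>: "\<mu> j powr (- \<delta>) = lam j powr (- (\<beta> * \<delta>))" "\<mu> j powr \<delta> = lam j powr (\<beta> * \<delta>)" for j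
      by (simp_all add: powr_\<mu>)
    let ?\<gamma> = "\<beta> * \<delta>"
    define w where "w t = functional (\<lambda>j. cm.W j t)" for t
    define U where "U t = functional (\<lambda>j. cm.U j t)" for t
    have "has_caputo_deriv_dual \<Omega> lam e ?\<gamma> \<alpha> T u w"
      unfolding has_caputo_deriv_dual_def
    proof (intro exI[of _ U] conjI ballI)
      show "U t \<in> dual_pow \<Omega> lam e ?\<gamma>" if "t \<in> {0..T}" for t
        unfolding U_def using cm.U_uniform[of t] that by (intro functional_dual) (simp add: \<gamma>)
      fix x assume x: "x \<in> {0..T}"
      show "((\<lambda>t. dual_pow_norm lam e ?\<gamma> (\<lambda>\<psi>. U t \<psi> - U x \<psi>)) \<longlongrightarrow> 0) (at x within {0..T})"
      proof (rule tendstoI)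
        fix \<epsilon> :: real assume "0 < \<epsilon>"
        then have "\<forall>\<^sub>F t in at x within {0..T}. l2_bound (\<lambda>j. \<mu> j powr (- \<delta>) * (cm.U j t - cm.U j x)) (\<epsilon> / 2)"
          by (intro cm.U_l2_continuous x) simp
        then show "\<forall>\<^sub>F t in at x within {0..T}. dist (dual_pow_norm lam e ?\<gamma> (\<lambda>\<psi>. U t \<psi> - U x \<psi>)) 0 < \<epsilon>"
        proof eventually_elim
          case (elim t)
          then have "l2_bound (\<lambda>j. lam j powr (- ?\<gamma>) * (U t (e j) - U x (e j))) (\<epsilon> / 2)" by (simp add: U_def functional_e \<gamma>)
          from dual_pow_norm_bounds[OF this] show ?case using \<open>0 < \<epsilon>\<close> by (simp add: dist_real_def)
        qed
      qed
    next
      show "AE t in lebesgue_on {0<..<T}. \<forall>\<psi>\<in>dom_pow \<Omega> lam e ?\<gamma>. U t \<psi> = L2_inner \<Omega> (u t) \<psi>"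
        unfolding AE_lebesgue_on_Ioo_iff using Hh Hs
      proof eventually_elim
        case (elim t)
        show ?case
        proof (intro impI ballI)
          fix \<psi> assume t: "0 < t" "t < T" and \<psi>: "\<psi> \<in> dom_pow \<Omega> lam e ?\<gamma>"
          have "(\<lambda>j. cf (u t) j * cf \<psi> j) sums L2_inner \<Omega> (u t) \<psi>"
            using elim t dom_pow_L2[OF \<psi>] by (intro parseval_inner) auto
          moreover have "cf (u t) j = cm.U j t" for j using elim t by (simp add: cm.U_def)
          ultimately show "U t \<psi> = L2_inner \<Omega> (u t) \<psi>" by (simp add: U_def functional_def sums_iff)
        qed
      qed
      fix \<psi> assume \<psi>: "\<psi> \<in> dom_pow \<Omega> lam e ?\<gamma>"
      have "l2_bound (\<lambda>j. \<mu> j powr \<delta> * cf \<psi> j) (dom_pow_norm \<Omega> lam e ?\<gamma> \<psi>)"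
        using dom_pow_bound[OF \<psi>] by (simp add: \<gamma>)
      from cm.has_caputo_deriv_paired[OF this]
      show "has_caputo_deriv \<alpha> T (\<lambda>t. U t \<psi>) (\<lambda>t. w t \<psi>)" by (simp add: U_def w_def functional_def)
    qed
    moreover
    have wb: "AE t in lebesgue_on {0<..<T}. l2_bound (\<lambda>j. lam j powr (- ?\<gamma>) * w t (e j)) (C * n\<phi> * t powr (- \<alpha>))"
      unfolding AE_lebesgue_on_Ioo_iff using cm.W_bound' by eventually_elim (simp add: w_def functional_e \<gamma> CW)
    define Nw where "Nw t = dual_pow_norm lam e ?\<gamma> (w t)" for t
    have Nw_meas: "Nw \<in> borel_measurable borel"
      unfolding Nw_def dual_pow_norm_eq w_def functional_e by measurable
    have Nw: "AE t in lebesgue_on {0<..<T}. 0 \<le> Nw t \<and> Nw t \<le> C * n\<phi> * t powr (- \<alpha>)"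
      using wb by eventually_elim (auto simp: Nw_def intro: dual_pow_norm_bounds)
    define g where "g t = (C * n\<phi>) powr m * \<bar>t powr (- \<alpha>)\<bar> powr m" for t :: real
    have g_int0: "integrable (lebesgue_on {0<..<T}) (\<lambda>t. \<bar>t powr (- \<alpha>)\<bar> powr m)"
    proof -
      have "integrable lborel (\<lambda>t. indicator {0<..<T} t * t powr (- (\<alpha> * m)))"
        using \<alpha> m T by (intro integrable_powr_Ioo) auto
      then show ?thesis by (subst integral_lebesgue_on_lborel(2)) (auto simp: powr_powr)
    qed
    then have g_int: "integrable (lebesgue_on {0<..<T}) g" unfolding g_def by (rule integrable_mult_right)
    have Cn: "0 \<le> C * n\<phi>" using C n\<phi> by simp
    have le: "AE t in lebesgue_on {0<..<T}. Nw t powr m \<le> g t"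
      using Nw
    proof eventually_elim
      case (elim t)
      then have "Nw t powr m \<le> (C * n\<phi> * t powr (- \<alpha>)) powr m" using m by (intro powr_mono2) auto
      then show ?case using Cn by (simp add: g_def powr_mult)
    qed
    have Nw_m: "(\<lambda>t. Nw t powr m) \<in> borel_measurable (lebesgue_on {0<..<T})"
    proof -
      note [measurable] = Nw_meas
      show ?thesis by (rule measurable_restrict_space1, rule measurable_completion) measurable
    qed
    have Nw_int: "integrable (lebesgue_on {0<..<T}) (\<lambda>t. Nw t powr m)"
    proof (rule Bochner_Integration.integrable_bound[OF g_int Nw_m])
      show "AE t in lebesgue_on {0<..<T}. norm (Nw t powr m) \<le> norm (g t)"
        using le by eventually_elim auto
    qed
    have "w \<in> Bochner_Lp m T (dual_pow \<Omega> lam e ?\<gamma>) (dual_pow_norm lam e ?\<gamma>)"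
      unfolding Bochner_Lp_def
    proof (intro CollectI conjI)
      show "AE t in lebesgue_on {0<..<T}. w t \<in> dual_pow \<Omega> lam e ?\<gamma>"
        using wb by eventually_elim (auto simp: w_def functional_e intro: functional_dual)
      have "AE t in lborel. 0 < t \<longrightarrow> t < T \<longrightarrow> summable (\<lambda>j. (lam j powr (- ?\<gamma>) * cm.W j t)\<^sup>2)"
        using wb[unfolded AE_lebesgue_on_Ioo_iff] by eventually_elim (auto simp: w_def functional_e intro: l2_bound_summable)
      from strongly_measurable_dual[OF cm.borel_W this]
      show "strongly_measurable T (dual_pow \<Omega> lam e ?\<gamma>) (dual_pow_norm lam e ?\<gamma>) w" by (simp add: w_def[abs_def])
      show "integrable (lebesgue_on {0<..<T}) (\<lambda>t. dual_pow_norm lam e ?\<gamma> (w t) powr m)"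
        using Nw_int by (simp add: Nw_def)
    qed
    moreover
    have "Bochner_Lp_norm m T (dual_pow_norm lam e ?\<gamma>) w \<le> (C + 1) * Lp_norm (lebesgue_on {0<..<T}) m (\<lambda>t. t powr (- \<alpha>)) * n\<phi>"
    proof -
      let ?I = "\<integral>t. \<bar>t powr (- \<alpha>)\<bar> powr m \<partial>lebesgue_on {0<..<T}"
      have I: "0 \<le> ?I" by (intro Bochner_Integration.integral_nonneg) auto
      have "(\<integral>t. Nw t powr m \<partial>lebesgue_on {0<..<T}) \<le> (\<integral>t. g t \<partial>lebesgue_on {0<..<T})"
        by (rule integral_mono_AE[OF Nw_int g_int le])
      also have "\<dots> = (C * n\<phi>) powr m * ?I" unfolding g_def by simp
      finally have "(\<integral>t. Nw t powr m \<partial>lebesgue_on {0<..<T}) powr (1 / m) \<le> ((C * n\<phi>) powr m * ?I) powr (1 / m)"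
        using m by (intro powr_mono2 Bochner_Integration.integral_nonneg) auto
      also have "\<dots> = C * n\<phi> * ?I powr (1 / m)" using m C n\<phi> I by (simp add: powr_mult powr_powr)
      also have "\<dots> \<le> (C + 1) * n\<phi> * ?I powr (1 / m)" using n\<phi> by (intro mult_right_mono) auto
      finally show ?thesis by (simp add: Bochner_Lp_norm_def Lp_norm_def Nw_def mult_ac)
    qed
    ultimately show "\<exists>w. has_caputo_deriv_dual \<Omega> lam e ?\<gamma> \<alpha> T u w \<and>
          w \<in> Bochner_Lp m T (dual_pow \<Omega> lam e ?\<gamma>) (dual_pow_norm lam e ?\<gamma>) \<and>
          Bochner_Lp_norm m T (dual_pow_norm lam e ?\<gamma>) w
            \<le> (C + 1) * Lp_norm (lebesgue_on {0<..<T}) m (\<lambda>t. t powr (- \<alpha>)) * dom_pow_norm \<Omega> lam e (\<beta> * (1 - \<delta>)) \<phi>"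
      unfolding n\<phi>_def by blast
  qed
qed

end

section \<open>The smallness condition\<close>

lemma (in ml_modes) M2_ge_1: "1 \<le> M2"
  using E1_bound[of 0] by (simp add: mittag_leffler_0)

text \<open>For \<open>\<kappa> \<noteq> 0\<close> the paper's contraction works with \<open>s = q\<close>. For \<open>\<kappa> = 0\<close> the bound on \<open>\<Psi>\<close> grows with \<open>\<mu>\<close>, and
  \<open>\<mu> 0 * T powr \<alpha>\<close> decides between \<open>s = q\<close> and \<open>s = max p q\<close>.\<close>

lemma (in ml_modes) contraction_factor:
  fixes p q Cb :: real
  defines "\<Theta> \<equiv> M2 / \<mu> 0 powr p * (T powr (\<alpha> * q) + M2 * Cb * T powr (\<alpha> * q)) * Beta (\<alpha> * q) (1 - \<alpha> * q)"
  assumes pq: "0 < p" "0 < q" "p + q = 1" and Cb: "0 < Cb" "(\<forall>j. \<bar>\<Psi> j\<bar> \<le> Cb) \<or> C' = Cb * T powr \<alpha>"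
  obtains s \<rho> where "q \<le> s" "s < 1" "0 \<le> \<rho>" "\<rho> \<le> \<Theta>"
    "\<And>H Y t. weighted H Y (\<alpha> * s) \<Longrightarrow> 0 < t \<Longrightarrow> t < T \<Longrightarrow>
      l2_bound (\<lambda>j. conv H j t - R j t * conv H j T) (\<rho> * Y * t powr (- (\<alpha> * s)))"
proof -
  define B where "B = Beta (\<alpha> * q) (1 - \<alpha> * q)"
  have aq: "0 < \<alpha> * q" "\<alpha> * q < 1" using \<alpha> pq mult_strict_mono[of \<alpha> 1 q 1] by auto
  have B: "0 \<le> B" unfolding B_def using aq by (intro Beta_nonneg) auto
  have \<Theta>: "0 \<le> \<Theta>" using M2 Cb B by (auto simp: \<Theta>_def B_def intro!: mult_nonneg_nonneg add_nonneg_nonneg)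
  consider "\<forall>j. \<bar>\<Psi> j\<bar> \<le> Cb" | "C' = Cb * T powr \<alpha>" "\<mu> 0 * T powr \<alpha> \<le> 1" | "C' = Cb * T powr \<alpha>" "1 \<le> \<mu> 0 * T powr \<alpha>"
    using Cb(2) linear by blast
  then show ?thesis
  proof cases
    case 1
    show ?thesis
      by (rule that[of q \<Theta>]) (use contraction_bounded_Psi[OF pq, of Cb] 1 Cb pq \<Theta> in \<open>auto simp: \<Theta>_def\<close>)
  next
    case 2
    show ?thesis
      by (rule that[of q \<Theta>]) (use contraction_short_time[OF pq _ 2] Cb pq \<Theta> in \<open>auto simp: \<Theta>_def\<close>)
  next
    case 3
    define s where "s = max p q"
    define \<rho> where "\<rho> = (1 / \<mu> 0 + C' * M2 * T powr (- (\<alpha> * s)) * \<mu> 0 powr (- s)) / (1 - \<alpha> * s)"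
    define Z where "Z = \<mu> 0 * T powr \<alpha>"
    have s: "1 / 2 \<le> s" "s < 1" "p \<le> s" "q \<le> s" using pq by (auto simp: s_def)
    have as: "\<alpha> * s < 1" using \<alpha> s mult_strict_mono[of \<alpha> 1 s 1] by auto
    \<comment> \<open>For s = q this is \<open>Beta_ge_inverse\<close>. For s = p the relation
      \<alpha> p + \<alpha> q = \<alpha> \<le> 1 gives 1/(1 - \<alpha> p) \<le> 1/(\<alpha> q),
      which the same lemma bounds after exchanging the arguments of Beta.\<close>
    have inv: "1 / (1 - \<alpha> * s) \<le> B"
    proof (cases "p \<le> q")
      case True
      then show ?thesis unfolding B_def s_def using aq by (simp add: Beta_ge_inverse max_absorb2)
    next
      case False
      have "\<alpha> * p + \<alpha> * q \<le> 1" using \<alpha> pq by (simp add: distrib_left[symmetric])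
      then have "1 / (1 - \<alpha> * p) \<le> 1 / (\<alpha> * q)" using aq by (intro divide_left_mono) auto
      also have "\<dots> \<le> B" unfolding B_def by (subst Beta_commute, rule Beta_ge_inverse) (use aq in auto)
      finally show ?thesis using False by (simp add: s_def)
    qed
    have Zp: "Z powr x = \<mu> 0 powr x * T powr (\<alpha> * x)" for x
      unfolding Z_def using \<mu>(1) T by (simp add: powr_mult powr_powr)
    have Z: "1 \<le> Z" using 3 by (simp add: Z_def)
    \<comment> \<open>Both summands of \<rho> are compared with \<mu>_0^(-p) T^(\<alpha> q) through
      powers of Z \<ge> 1: the first equals it times Z^(-q), the second, apart from M2 and Cb,
      equals it times Z^(p-s), and p \<le> s.\<close>
    have le1: "1 / \<mu> 0 \<le> \<mu> 0 powr (- p) * T powr (\<alpha> * q)"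
    proof -
      have "1 / \<mu> 0 * 1 \<le> 1 / \<mu> 0 * Z powr q" using Z pq \<mu>(1) by (intro mult_left_mono ge_one_powr_ge_zero) auto
      also have "\<dots> = \<mu> 0 powr (- 1) * \<mu> 0 powr q * T powr (\<alpha> * q)" using \<mu>(1) by (simp add: Zp powr_minus_divide)
      also have "\<dots> = \<mu> 0 powr (- 1 + q) * T powr (\<alpha> * q)" by (simp only: powr_add)
      also have "- 1 + q = - p" using pq by simp
      finally show ?thesis by simp
    qed
    have le2: "T powr \<alpha> * T powr (- (\<alpha> * s)) * \<mu> 0 powr (- s) \<le> \<mu> 0 powr (- p) * T powr (\<alpha> * q)"
    proof -
      have "Z powr (p - s) \<le> Z powr 0" using Z s by (intro powr_mono) auto
      then have "\<mu> 0 powr (- p) * T powr (\<alpha> * q) * Z powr (p - s) \<le> \<mu> 0 powr (- p) * T powr (\<alpha> * q) * 1"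
        using Z by (intro mult_left_mono) auto
      also have "\<mu> 0 powr (- p) * T powr (\<alpha> * q) * Z powr (p - s) = T powr (\<alpha> * q + \<alpha> * (p - s)) * \<mu> 0 powr (- p + (p - s))"
        unfolding Zp powr_add by (simp only: mult_ac)
      also have "\<alpha> * q + \<alpha> * (p - s) = \<alpha> * (p + q) + - (\<alpha> * s)" by (simp add: algebra_simps)
      also have "T powr (\<alpha> * (p + q) + - (\<alpha> * s)) = T powr \<alpha> * T powr (- (\<alpha> * s))"
        unfolding pq(3) by (simp only: powr_add mult_1_right)
      finally show ?thesis by simp
    qed
    have "C' * M2 * T powr (- (\<alpha> * s)) * \<mu> 0 powr (- s) = M2 * Cb * (T powr \<alpha> * T powr (- (\<alpha> * s)) * \<mu> 0 powr (- s))"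
      by (simp add: 3(1) mult_ac)
    also have "\<dots> \<le> M2 * Cb * (\<mu> 0 powr (- p) * T powr (\<alpha> * q))" using M2 Cb le2 by (intro mult_left_mono) auto
    finally have "1 / \<mu> 0 + C' * M2 * T powr (- (\<alpha> * s)) * \<mu> 0 powr (- s)
        \<le> \<mu> 0 powr (- p) * T powr (\<alpha> * q) + M2 * Cb * (\<mu> 0 powr (- p) * T powr (\<alpha> * q))" (is "?x \<le> ?y") using le1 by linarith
    moreover have y: "0 \<le> ?y" using M2 Cb by (intro add_nonneg_nonneg mult_nonneg_nonneg) auto
    ultimately have "\<rho> \<le> ?y * B"
      unfolding \<rho>_def using mult_mono[OF _ inv, of ?x ?y] as by simp
    \<comment> \<open>The long-time estimate has one factor M2 fewer than \<Theta>; as M2 is at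
      least E_{\<alpha>,1}(0) = 1, it can be inserted.\<close>
    also have "\<dots> \<le> M2 * (?y * B)" using mult_right_mono[OF M2_ge_1, of "?y * B"] y B by simp
    also have "\<dots> = \<Theta>" by (simp add: \<Theta>_def B_def powr_minus_divide algebra_simps)
    finally have "\<rho> \<le> \<Theta>" .
    moreover have "0 \<le> \<rho>" using \<mu>(1) M2 C'_nonneg as by (auto simp: \<rho>_def)
    ultimately show ?thesis
      using contraction_long_time[OF s(1,2)] s by (intro that[of s \<rho>]) (auto simp: \<rho>_def)
  qed
qed

theorem theorem7:
  fixes \<Omega> :: "(real^'n) set"
    and A :: "real^'n \<Rightarrow> real^'n^'n" and b :: "real^'n \<Rightarrow> real" and L0 :: real
    and bc :: boundary_operator
    and lam :: "nat \<Rightarrow> real" and e :: "nat \<Rightarrow> real^'n \<Rightarrow> real"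
    and \<alpha> \<beta> \<kappa> T M2 C\<kappa> \<Upsilon> :: real
    and p q p' q' r qh ph rh :: real
    and k :: "real \<Rightarrow> real"
    and F :: "real \<Rightarrow> real^'n \<Rightarrow> (real^'n \<Rightarrow> real) \<Rightarrow> real"
  assumes \<alpha>: "0 < \<alpha>" "\<alpha> < 1" and \<beta>: "0 < \<beta>" "\<beta> \<le> 1" and T: "0 < T"
    and \<Omega>: "open \<Omega>" "bounded \<Omega>"
    and A_C1: "\<And>i j. C1_closure \<Omega> (\<lambda>x. A x $ i $ j)"
    and A_sym: "\<And>x i j. x \<in> closure \<Omega> \<Longrightarrow> A x $ i $ j = A x $ j $ i"
    and A_elliptic: "0 < L0" "\<And>x \<xi>. x \<in> closure \<Omega> \<Longrightarrow> \<xi> \<bullet> (A x *v \<xi>) \<ge> L0 * (norm \<xi>)\<^sup>2"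
    and b: "continuous_on (closure \<Omega>) b" "\<And>x. x \<in> closure \<Omega> \<Longrightarrow> 0 \<le> b x"
    and lam: "0 < lam 0" "mono lam" "filterlim lam at_top sequentially"
    and eigen: "\<And>j. e j \<in> H2 \<Omega>" "\<And>j. boundary_zero bc \<Omega> A (e j)"
      "\<And>j. AE x in lebesgue_on \<Omega>. elliptic_op \<Omega> A b (e j) x = lam j * e j x"
    and basis: "orthonormal_basis \<Omega> e"
    and M2: "0 < M2"
      "\<And>\<sigma> z. \<sigma> \<in> {\<alpha> - 1, \<alpha>, 1} \<Longrightarrow> 0 \<le> z \<Longrightarrow> \<bar>mittag_leffler \<alpha> \<sigma> (- z)\<bar> \<le> M2 / (1 + z)"
    and \<kappa>: "\<kappa> \<notin> {0<..<1} \<or>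
      \<kappa> \<in> {0<..<1} \<and> (\<forall>j. lam j \<noteq> (THE l. 0 < l \<and> mittag_leffler \<alpha> 1 (- (l powr \<beta> * T powr \<alpha>)) = \<kappa>))"
    and C\<kappa>: "0 < C\<kappa>"
      "\<And>j. \<bar>Psi lam \<alpha> \<beta> \<kappa> T j\<bar> \<le> (if \<kappa> = 0 then C\<kappa> * lam j powr \<beta> * T powr \<alpha> else C\<kappa>)"
    and pq: "0 < p" "p < 1" "0 < q" "q < 1" "p + q = 1"
    and pq': "0 < p'" "p' < p" "q' = 1 - p'"
    and r: "0 < r" "r \<le> (1 - \<alpha> * q') / (\<alpha> * q')"
    and qh: "0 \<le> qh" "qh < q" "ph = 1 - qh"
    and rh: "0 < rh" "rh \<le> (1 - \<alpha>) / \<alpha>"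
    and k: "continuous_on {0..T} k"
    and F_L2: "\<And>t v. t \<in> {0<..<T} \<Longrightarrow> v \<in> L2 \<Omega> \<Longrightarrow> (\<lambda>x. F t x v) \<in> L2 \<Omega>"
    and F_zero: "\<And>t. t \<in> {0<..<T} \<Longrightarrow> AE x in lebesgue_on \<Omega>. F t x (\<lambda>_. 0) = 0"
    and F_lipschitz: "0 < \<Upsilon>"
      "\<And>t1 t2 v1 v2. t1 \<in> {0<..<T} \<Longrightarrow> t2 \<in> {0<..<T} \<Longrightarrow> v1 \<in> L2 \<Omega> \<Longrightarrow> v2 \<in> L2 \<Omega> \<Longrightarrow>
         L2_norm \<Omega> (\<lambda>x. F t1 x v1 - F t2 x v2)
           \<le> \<Upsilon> * (\<bar>t1 - t2\<bar> + L2_norm \<Omega> (\<lambda>x. v1 x - v2 x))"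
    and Theta: "Theta \<alpha> \<beta> p q (lam 0) M2 C\<kappa> \<Upsilon> T k < 1"
  shows "(\<forall>\<phi>\<in>dom_pow \<Omega> lam e (\<beta> * (p + qh)).
            \<exists>u. mild_solution \<Omega> lam e \<alpha> \<beta> \<kappa> T k F \<phi> u \<and>
                (\<forall>v. mild_solution \<Omega> lam e \<alpha> \<beta> \<kappa> T k F \<phi> v \<longrightarrow>
                   (AE t in lebesgue_on {0<..<T}. AE x in lebesgue_on \<Omega>. v t x = u t x)))
       \<and> (\<exists>C7>0. \<forall>\<phi>\<in>dom_pow \<Omega> lam e (\<beta> * (p + qh)).
            \<forall>u. mild_solution \<Omega> lam e \<alpha> \<beta> \<kappa> T k F \<phi> u \<longrightarrow>
              (\<exists>w. has_caputo_deriv_dual \<Omega> lam e (\<beta> * (q - qh)) \<alpha> T u w \<and>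
                   w \<in> Bochner_Lp (1 / \<alpha> - rh) T
                         (dual_pow \<Omega> lam e (\<beta> * (q - qh))) (dual_pow_norm lam e (\<beta> * (q - qh))) \<and>
                   Bochner_Lp_norm (1 / \<alpha> - rh) T (dual_pow_norm lam e (\<beta> * (q - qh))) w
                     \<le> C7 * Lp_norm (lebesgue_on {0<..<T}) (1 / \<alpha> - rh) (\<lambda>t. t powr (- \<alpha>))
                          * dom_pow_norm \<Omega> lam e (\<beta> * (p + qh)) \<phi>))"
proof -
  define kn where "kn = (SUP t\<in>{0..T}. \<bar>k t\<bar>)"
  have kn: "\<bar>k t\<bar> \<le> kn" if "t \<in> {0..T}" for t
  proof -
    have "compact ((\<lambda>t. \<bar>k t\<bar>) ` {0..T})" using k by (intro compact_continuous_image continuous_intros) auto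
    then have "bdd_above ((\<lambda>t. \<bar>k t\<bar>) ` {0..T})" by (intro bounded_imp_bdd_above compact_imp_bounded)
    then show ?thesis unfolding kn_def by (rule cSUP_upper[OF that])
  qed
  have kn0: "0 \<le> kn" using kn[of 0] T by force
  have lam_ge: "lam 0 \<le> lam j" "0 < lam j" for j using lam(1) monoD[OF lam(2), of 0 j] by auto
  let ?\<mu> = "\<lambda>j. lam j powr \<beta>"
  have \<mu>_ge: "?\<mu> 0 \<le> ?\<mu> j" for j using lam_ge lam(1) \<beta> by (intro powr_mono2) (auto intro: less_imp_le)
  \<comment> \<open>For \<kappa> different from 0 the constant bound is rewritten as a multiple of
    \<mu>_j, using \<mu>_0 \<le> \<mu>_j, so that both cases satisfy the growth condition of
    \<open>ml_modes\<close>.\<close>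
  define C' where "C' = (if \<kappa> = 0 then C\<kappa> * T powr \<alpha> else C\<kappa> / ?\<mu> 0)"
  interpret ml_modes \<alpha> T M2 C' ?\<mu> "Psi lam \<alpha> \<beta> \<kappa> T"
  proof
    show "\<bar>Psi lam \<alpha> \<beta> \<kappa> T j\<bar> \<le> C' * ?\<mu> j" for j
    proof (cases "\<kappa> = 0")
      case True
      then show ?thesis using C\<kappa>(2)[of j] by (simp add: C'_def mult_ac)
    next
      case False
      have "C\<kappa> * 1 \<le> C\<kappa> * (?\<mu> j / ?\<mu> 0)" using C\<kappa>(1) lam(1) \<mu>_ge[of j] by (intro mult_left_mono) auto
      then show ?thesis using False C\<kappa>(2)[of j] by (simp add: C'_def)
    qed
  qed (use \<alpha> T M2 lam \<mu>_ge in auto)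
  define \<Lambda> where "\<Lambda> = \<Upsilon> + kn"
  have \<Lambda>: "0 < \<Lambda>" using F_lipschitz(1) kn0 by (simp add: \<Lambda>_def)
  let ?B = "Beta (\<alpha> * q) (1 - \<alpha> * q)"
  let ?\<Theta> = "M2 / ?\<mu> 0 powr p * (T powr (\<alpha> * q) + M2 * C\<kappa> * T powr (\<alpha> * q)) * ?B"
  have "(\<forall>j. \<bar>Psi lam \<alpha> \<beta> \<kappa> T j\<bar> \<le> C\<kappa>) \<or> C' = C\<kappa> * T powr \<alpha>" using C\<kappa>(2) by (auto simp: C'_def split: if_splits)
  from contraction_factor[OF pq(1,3,5) C\<kappa>(1) this]
  obtain s \<rho> where qs: "q \<le> s" "s < 1" and \<rho>: "0 \<le> \<rho>" "\<rho> \<le> ?\<Theta>"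
    and contr: "\<And>H Y t. weighted H Y (\<alpha> * s) \<Longrightarrow> 0 < t \<Longrightarrow> t < T \<Longrightarrow>
      l2_bound (\<lambda>j. conv H j t - R j t * conv H j T) (\<rho> * Y * t powr (- (\<alpha> * s)))" by blast
  have \<rho>\<Lambda>: "\<rho> * \<Lambda> < 1"
  proof -
    have aq: "0 < \<alpha> * q" "\<alpha> * q < 1" using \<alpha> pq mult_strict_mono[of \<alpha> 1 q 1] by auto
    have "0 \<le> M2 / lam 0 powr (\<beta> * p) * C\<kappa> * ?B"
      using M2(1) C\<kappa>(1) Beta_nonneg[of "\<alpha> * q" "1 - \<alpha> * q"] aq by (intro mult_nonneg_nonneg) auto
    \<comment> \<open>\<Theta>(T) consists of the contraction factor and the term with the bare
      C_\<kappa>; the latter is nonnegative, so \<Theta>(T) < 1 forces the contraction factor below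
      1.\<close>
    moreover have "Theta \<alpha> \<beta> p q (lam 0) M2 C\<kappa> \<Upsilon> T k = ?\<Theta> * \<Lambda> + M2 / lam 0 powr (\<beta> * p) * C\<kappa> * ?B"
      by (simp add: Theta_def Let_def kn_def[symmetric] \<Lambda>_def powr_powr algebra_simps add_divide_distrib)
    moreover have "\<rho> * \<Lambda> \<le> ?\<Theta> * \<Lambda>" using \<rho> \<Lambda> by (intro mult_right_mono) auto
    ultimately show ?thesis using Theta by linarith
  qed
  interpret mild_problem \<Omega> e lam \<alpha> T M2 C' \<beta> \<kappa> s \<rho> \<Lambda> k F \<Upsilon> kn
  proof (intro mild_problem.intro spectral.intro L2_basis.intro contraction.intro)
    show "finite_measure (lebesgue_on \<Omega>)" using \<Omega> by (rule finite_measure_lebesgue_on_bounded)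
    show "spectral_axioms lam" using lam by unfold_locales
    show "ml_modes \<alpha> T M2 C' ?\<mu> (Psi lam \<alpha> \<beta> \<kappa> T)" by unfold_locales
    show "contraction_axioms \<alpha> T ?\<mu> (Psi lam \<alpha> \<beta> \<kappa> T) s \<rho> \<Lambda>"
      by unfold_locales (use qs pq \<rho>(1) \<rho>\<Lambda> \<Lambda> contr in auto)
    show "mild_problem_axioms \<Omega> lam T \<beta> \<Lambda> k F \<Upsilon> kn"
      by unfold_locales (use lam \<beta> k kn F_lipschitz \<Lambda>_def F_L2 F_zero in auto)
  qed (rule basis)
  have \<delta>: "0 < q - qh" "q - qh < 1" "q - qh \<le> s" "1 - (q - qh) = p + qh" using qh pq qs by auto
  \<comment> \<open>The condition on rh keeps the exponent at least 1, and rh > 0 makes \<alpha>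
    times the exponent less than 1, so that power of t^(-\<alpha>) is integrable at 0.\<close>
  have m: "0 < 1 / \<alpha> - rh" "\<alpha> * (1 / \<alpha> - rh) < 1"
  proof -
    have "rh \<le> 1 / \<alpha> - 1" using rh(2) \<alpha> by (simp add: diff_divide_distrib)
    then show "0 < 1 / \<alpha> - rh" by simp
    have "\<alpha> * (1 / \<alpha> - rh) = 1 - \<alpha> * rh" using \<alpha> by (simp add: right_diff_distrib)
    then show "\<alpha> * (1 / \<alpha> - rh) < 1" using \<alpha> rh(1) by simp
  qed
  have ex: "\<exists>u. mild_solution \<Omega> lam e \<alpha> \<beta> \<kappa> T k F \<phi> u" if \<phi>: "\<phi> \<in> dom_pow \<Omega> lam e (\<beta> * (p + qh))" for \<phi>
  proof (rule mild_solution_exists)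
    show "\<phi> \<in> L2 \<Omega>" using \<phi> by (rule dom_pow_L2)
    let ?w = "s - (q - qh)"
    have "l2_bound (\<lambda>j. ?\<mu> j powr (p + qh) * cf \<phi> j) (dom_pow_norm \<Omega> lam e (\<beta> * (p + qh)) \<phi>)"
      using dom_pow_bound[OF \<phi>] by (simp add: powr_\<mu>)
    moreover have "?\<mu> j powr (p + qh) * cf \<phi> j = ?\<mu> j powr ?w * (?\<mu> j powr (1 - s) * cf \<phi> j)" for j
    proof -
      have "?w + (1 - s) = p + qh" using pq by simp
      then show ?thesis by (metis mult.assoc powr_add)
    qed
    ultimately have "l2_bound (\<lambda>j. ?\<mu> j powr ?w * (?\<mu> j powr (1 - s) * cf \<phi> j)) (dom_pow_norm \<Omega> lam e (\<beta> * (p + qh)) \<phi>)"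
      by (simp only:)
    then show "l2_bound (\<lambda>j. ?\<mu> j powr (1 - s) * cf \<phi> j) (?\<mu> 0 powr (- ?w) * dom_pow_norm \<Omega> lam e (\<beta> * (p + qh)) \<phi>)"
      by (rule l2_bound_drop_weight) (use \<delta> in simp)
  qed
  show ?thesis
    using ex mild_solution_unique caputo_regularity[OF \<delta>(1-3) m, unfolded \<delta>(4)] by blast
qed

end
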